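(* Let $\mathbb{K}$ be a field of characteristic zero with algebraic closure $\mathbb{F}$, $V$ a $\mathbb{K}$-vector space of finite dimension $n\ge2$, $\mathfrak{L}$ a Lie subalgebra of $\mathfrak{gl}_{\mathbb{K}}(V)$, and $\mathcal{K}$ a $\mathbb{Z}$-graded ideal of $\mathfrak{f}(V)$ with $\mathfrak{f}_{[\mu+1]}(V)\subseteq\mathcal{K}\subseteq\mathfrak{f}_{[2]}(V)$ for some integer $\mu\ge1$. Let $\mathfrak{m}=\mathfrak{f}(V)/\mathcal{K}$ and $$W(\mathcal{K})=\{v\in V\mid[v,\mathfrak{f}_{[2]}(V)]\subseteq\mathcal{K}\}.$$ Fix a basis $e_1,\dots,e_n$ of $V$ in such a way that the first $m$ vectors $e_1,\dots,e_m$ form a basis of $W(\mathcal{K})$. Then a necessary and sufficient condition in order that the maximal effective $\mathfrak{L}$-prolongation of $\mathfrak{m}$ be finite dimensional is that the matrix $$(M_1(\mathfrak{L},z),\,M_2(\mathcal{K},z))$$ has rank $n$ for all $z\in W_{(\mathbb{F})}\setminus\{0\}=\{z\in\mathbb{F}^n\setminus\{0\}\mid z_i=0\ \ \forall i>m\}$.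
   Context: $\mathfrak{f}(V)=\sum_{p\ge1}\mathfrak{f}_{-p}(V)$ is the free Lie $\mathbb{K}$-algebra generated by $V$, graded so that $\mathfrak{f}_{-1}(V)=V$; $\mathfrak{f}_{-2}(V)=\Lambda^2(V)$ and $\mathfrak{f}_{[q]}(V)=\sum_{p\ge q}\mathfrak{f}_{-p}(V)$. Write $\mathcal{K}=\sum_{p\ge2}\mathcal{K}_{-p}$ with $\mathcal{K}_{-p}\subseteq\mathfrak{f}_{-p}(V)$. $W_{(\mathbb{F})}=\mathbb{F}\otimes_{\mathbb{K}}W(\mathcal{K})$. Using the chosen basis, identify $V\simeq\mathbb{K}^n$, $\mathbb{F}\otimes_{\mathbb{K}}V\simeq\mathbb{F}^n$ and $\mathfrak{gl}_{\mathbb{K}}(V)$ with $n\times n$ matrices. Matrix $M_1(\mathfrak{L},z)$: let $A_1,\dots,A_k$ be generators of the vector space $\mathfrak{L}^{\perp}=\{A\in\mathfrak{gl}_{\mathbb{K}}(V)\mid\operatorname{trace}(AX)=0\ \forall X\in\mathfrak{L}\}$; $M_1(\mathfrak{L},z)=(A_1z,\dots,A_kz)$. Matrix $M_2(\mathcal{K},z)$: let $\mathfrak{o}(V)$ be the space of antisymmetric $n\times n$ matrices, with generators $X_1,\dots,X_N$ as a vector space. Identify $\Lambda^2(V)$ with $\mathfrak{o}(V)$ by $v\wedge w\mapsto vw^{\intercal}-wv^{\intercal}$, put $\mathcal{K}_{-2}^{\perp}=\{X\in\mathfrak{o}(V)\mid\operatorname{trace}(XK)=0\ \forall K\in\mathcal{K}_{-2}\}$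 and let $Y_1,\dots,Y_r$ be generators of $\mathcal{K}_{-2}^{\perp}$. Then $M_2(\mathcal{K},z)$ is the matrix whose columns are all the vectors $X_jY_iz$, $1\le j\le N$, $1\le i\le r$. A $\mathbb{Z}$-graded Lie algebra $\mathfrak{g}=\sum_{p\in\mathbb{Z}}\mathfrak{g}_p$ is an effective $\mathfrak{L}$-prolongation of $\mathfrak{m}$ if $\sum_{p<0}\mathfrak{g}_p=\mathfrak{m}$, $\{X\in\sum_{p\ge0}\mathfrak{g}_p\mid[X,\mathfrak{g}_{-1}]=\{0\}\}=\{0\}$, and for each $A\in\mathfrak{g}_0$ the map $v\mapsto[A,v]$ on $\mathfrak{g}_{-1}=V$ belongs to $\mathfrak{L}$. The maximal one (which exists and is unique up to isomorphism) is the one into which every effective $\mathfrak{L}$-prolongation of $\mathfrak{m}$ embeds by an injective graded Lie algebra homomorphism that is the identity on $\mathfrak{m}$. *)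

theory Defs
  imports "Jordan_Normal_Form.DL_Rank" "HOL-Algebra.Algebraic_Closure_Type"
begin

hide_const (open) Polynomial.smult Modules.module Modules.module_hom Multiset.mult
no_notation fps_nth (infixl "$" 75)
no_notation Polynomials.var ("X\<index>")

section \<open>Lie algebras\<close>

text \<open>
  The ground field is a type \<open>'k\<close>; as a HOL-Algebra ring it is \<^term>\<open>class_ring\<close>.
  The fields \<open>mult\<close> and \<open>one\<close> that a module record inherits play no role.
\<close>

record ('k, 'a) lie = "('k, 'a) module" +
  bracket :: "'a \<Rightarrow> 'a \<Rightarrow> 'a"

abbreviation vspan :: "('k::field, 'a, 'm) module_scheme \<Rightarrow> 'a set \<Rightarrow> 'a set" where
  "vspan \<equiv> LinearCombinations.module.span class_ring"

abbreviation vsubspace :: "'a set \<Rightarrow> ('k::field, 'a, 'm) module_scheme \<Rightarrow> bool" where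
  "vsubspace \<equiv> VectorSpace.subspace class_ring"

locale lie_algebra = vectorspace class_ring G
  for G :: "('k::field, 'a, 'm) lie_scheme" +
  assumes bracket_closed: "\<lbrakk>x \<in> carrier G; y \<in> carrier G\<rbrakk> \<Longrightarrow> bracket G x y \<in> carrier G"
    and bracket_add_left: "\<lbrakk>x \<in> carrier G; y \<in> carrier G; z \<in> carrier G\<rbrakk>
      \<Longrightarrow> bracket G (x \<oplus>\<^bsub>G\<^esub> y) z = bracket G x z \<oplus>\<^bsub>G\<^esub> bracket G y z"
    and bracket_add_right: "\<lbrakk>x \<in> carrier G; y \<in> carrier G; z \<in> carrier G\<rbrakk>
      \<Longrightarrow> bracket G x (y \<oplus>\<^bsub>G\<^esub> z) = bracket G x y \<oplus>\<^bsub>G\<^esub> bracket G x z"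
    and bracket_smult_left: "\<lbrakk>x \<in> carrier G; y \<in> carrier G\<rbrakk>
      \<Longrightarrow> bracket G (c \<odot>\<^bsub>G\<^esub> x) y = c \<odot>\<^bsub>G\<^esub> bracket G x y"
    and bracket_smult_right: "\<lbrakk>x \<in> carrier G; y \<in> carrier G\<rbrakk>
      \<Longrightarrow> bracket G x (c \<odot>\<^bsub>G\<^esub> y) = c \<odot>\<^bsub>G\<^esub> bracket G x y"
    and bracket_self: "x \<in> carrier G \<Longrightarrow> bracket G x x = \<zero>\<^bsub>G\<^esub>"
    and jacobi: "\<lbrakk>x \<in> carrier G; y \<in> carrier G; z \<in> carrier G\<rbrakk>
      \<Longrightarrow> bracket G x (bracket G y z) \<oplus>\<^bsub>G\<^esub> bracket G y (bracket G z x)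
          \<oplus>\<^bsub>G\<^esub> bracket G z (bracket G x y) = \<zero>\<^bsub>G\<^esub>"

definition lie_subalgebra :: "'a set \<Rightarrow> ('k::field, 'a, 'm) lie_scheme \<Rightarrow> bool" where
  "lie_subalgebra S G \<longleftrightarrow> vsubspace S G \<and> (\<forall>x\<in>S. \<forall>y\<in>S. bracket G x y \<in> S)"

definition lie_ideal :: "'a set \<Rightarrow> ('k::field, 'a, 'm) lie_scheme \<Rightarrow> bool" where
  "lie_ideal I G \<longleftrightarrow> vsubspace I G \<and> (\<forall>x\<in>carrier G. \<forall>y\<in>I. bracket G x y \<in> I)"

definition lie_hom ::
  "('k::field, 'a, 'm) lie_scheme \<Rightarrow> ('k, 'b, 'l) lie_scheme \<Rightarrow> ('a \<Rightarrow> 'b) \<Rightarrow> bool" where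
  "lie_hom G H f \<longleftrightarrow> f \<in> module_hom class_ring G H \<and>
     (\<forall>x\<in>carrier G. \<forall>y\<in>carrier G. f (bracket G x y) = bracket H (f x) (f y))"

definition lie_quotient :: "('k::field, 'a, 'm) lie_scheme \<Rightarrow> 'a set \<Rightarrow> ('k, 'a set) lie" where
  "lie_quotient G I =
     \<lparr>carrier = a_rcosets\<^bsub>G\<^esub> I, mult = undefined, one = undefined,
      zero = I, add = set_add G,
      smult = (\<lambda>c X. \<Union>x\<in>X. I +>\<^bsub>G\<^esub> (c \<odot>\<^bsub>G\<^esub> x)),
      bracket = (\<lambda>X Y. \<Union>x\<in>X. \<Union>y\<in>Y. I +>\<^bsub>G\<^esub> bracket G x y)\<rparr>"

text \<open>Endomorphisms are extensional, so that equality of maps on \<open>V\<close> is equality in HOL.\<close>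

definition gl :: "('k::field, 'v, 'm) module_scheme \<Rightarrow> ('k, 'v \<Rightarrow> 'v) lie" where
  "gl V =
     \<lparr>carrier = module_hom class_ring V V \<inter> extensional (carrier V),
      mult = undefined, one = undefined,
      zero = (\<lambda>v\<in>carrier V. \<zero>\<^bsub>V\<^esub>),
      add = (\<lambda>f g. \<lambda>v\<in>carrier V. f v \<oplus>\<^bsub>V\<^esub> g v),
      smult = (\<lambda>c f. \<lambda>v\<in>carrier V. c \<odot>\<^bsub>V\<^esub> f v),
      bracket = (\<lambda>f g. \<lambda>v\<in>carrier V. f (g v) \<ominus>\<^bsub>V\<^esub> g (f v))\<rparr>"

section \<open>Gradings\<close>

definition graded_lie_algebra ::
  "('k::field, 'a, 'm) lie_scheme \<Rightarrow> (int \<Rightarrow> 'a set) \<Rightarrow> bool" where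
  "graded_lie_algebra G gr \<longleftrightarrow> lie_algebra G \<and> (\<forall>p. vsubspace (gr p) G) \<and>
     (\<forall>x\<in>carrier G. \<exists>!c. (\<forall>p. c p \<in> gr p) \<and> finite {p. c p \<noteq> \<zero>\<^bsub>G\<^esub>} \<and>
        x = (\<Oplus>\<^bsub>G\<^esub>p\<in>{p. c p \<noteq> \<zero>\<^bsub>G\<^esub>}. c p)) \<and>
     (\<forall>p q. \<forall>x\<in>gr p. \<forall>y\<in>gr q. bracket G x y \<in> gr (p + q))"

definition graded_lie_ideal ::
  "'a set \<Rightarrow> ('k::field, 'a, 'm) lie_scheme \<Rightarrow> (int \<Rightarrow> 'a set) \<Rightarrow> bool" where
  "graded_lie_ideal I G gr \<longleftrightarrow> lie_ideal I G \<and> I = vspan G (\<Union>p. I \<inter> gr p)"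

section \<open>The free Lie algebra generated by a vector space\<close>

text \<open>
  Formal Lie expressions in the vectors of \<open>V\<close>, modulo the smallest congruence that makes
  them a Lie algebra in which \<open>Gen\<close> is linear on \<open>V\<close>; see \<open>free_lie_universal\<close>.
\<close>

datatype ('k, gens: 'v) lie_term =
    Gen 'v
  | Zero
  | Plus "('k, 'v) lie_term" "('k, 'v) lie_term"
  | Scale 'k "('k, 'v) lie_term"
  | Br "('k, 'v) lie_term" "('k, 'v) lie_term"

inductive lie_eq ::
  "('k::field, 'v, 'm) module_scheme \<Rightarrow> ('k, 'v) lie_term \<Rightarrow> ('k, 'v) lie_term \<Rightarrow> bool"
  for V where
  refl: "lie_eq V t t"
| sym: "lie_eq V s t \<Longrightarrow> lie_eq V t s"
| trans: "\<lbrakk>lie_eq V r s; lie_eq V s t\<rbrakk> \<Longrightarrow> lie_eq V r t"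
| plus_cong: "\<lbrakk>lie_eq V s s'; lie_eq V t t'\<rbrakk> \<Longrightarrow> lie_eq V (Plus s t) (Plus s' t')"
| scale_cong: "lie_eq V s s' \<Longrightarrow> lie_eq V (Scale a s) (Scale a s')"
| br_cong: "\<lbrakk>lie_eq V s s'; lie_eq V t t'\<rbrakk> \<Longrightarrow> lie_eq V (Br s t) (Br s' t')"
| plus_assoc: "lie_eq V (Plus (Plus r s) t) (Plus r (Plus s t))"
| plus_comm: "lie_eq V (Plus s t) (Plus t s)"
| plus_zero: "lie_eq V (Plus Zero t) t"
| scale_0: "lie_eq V (Scale 0 t) Zero"
| scale_1: "lie_eq V (Scale 1 t) t"
| scale_scale: "lie_eq V (Scale a (Scale b t)) (Scale (a * b) t)"
| scale_add: "lie_eq V (Scale (a + b) t) (Plus (Scale a t) (Scale b t))"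
| scale_plus: "lie_eq V (Scale a (Plus s t)) (Plus (Scale a s) (Scale a t))"
| br_plus_left: "lie_eq V (Br (Plus r s) t) (Plus (Br r t) (Br s t))"
| br_plus_right: "lie_eq V (Br r (Plus s t)) (Plus (Br r s) (Br r t))"
| br_scale_left: "lie_eq V (Br (Scale a s) t) (Scale a (Br s t))"
| br_scale_right: "lie_eq V (Br s (Scale a t)) (Scale a (Br s t))"
| br_self: "lie_eq V (Br t t) Zero"
| br_jacobi: "lie_eq V (Plus (Plus (Br r (Br s t)) (Br s (Br t r))) (Br t (Br r s))) Zero"
| gen_add: "\<lbrakk>v \<in> carrier V; w \<in> carrier V\<rbrakk>
    \<Longrightarrow> lie_eq V (Gen (v \<oplus>\<^bsub>V\<^esub> w)) (Plus (Gen v) (Gen w))"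
| gen_smult: "v \<in> carrier V \<Longrightarrow> lie_eq V (Gen (a \<odot>\<^bsub>V\<^esub> v)) (Scale a (Gen v))"

definition lie_terms :: "('k::field, 'v, 'm) module_scheme \<Rightarrow> ('k, 'v) lie_term set" where
  "lie_terms V = {t. gens t \<subseteq> carrier V}"

definition lie_class ::
  "('k::field, 'v, 'm) module_scheme \<Rightarrow> ('k, 'v) lie_term \<Rightarrow> ('k, 'v) lie_term set" where
  "lie_class V t = {s \<in> lie_terms V. lie_eq V t s}"

definition free_lie ::
  "('k::field, 'v, 'm) module_scheme \<Rightarrow> ('k, ('k, 'v) lie_term set) lie" where
  "free_lie V =
     \<lparr>carrier = lie_class V ` lie_terms V, mult = undefined, one = undefined,
      zero = lie_class V Zero,
      add = (\<lambda>X Y. \<Union>s\<in>X. \<Union>t\<in>Y. lie_class V (Plus s t)),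
      smult = (\<lambda>a X. \<Union>s\<in>X. lie_class V (Scale a s)),
      bracket = (\<lambda>X Y. \<Union>s\<in>X. \<Union>t\<in>Y. lie_class V (Br s t))\<rparr>"

definition free_gen ::
  "('k::field, 'v, 'm) module_scheme \<Rightarrow> 'v \<Rightarrow> ('k, 'v) lie_term set" where
  "free_gen V v = lie_class V (Gen v)"

inductive lie_monomial ::
  "('k::field, 'v, 'm) module_scheme \<Rightarrow> nat \<Rightarrow> ('k, 'v) lie_term \<Rightarrow> bool"
  for V where
  "v \<in> carrier V \<Longrightarrow> lie_monomial V 1 (Gen v)"
| "\<lbrakk>lie_monomial V p s; lie_monomial V q t\<rbrakk> \<Longrightarrow> lie_monomial V (p + q) (Br s t)"

text \<open>
  The component of degree \<open>-p\<close> is spanned by the brackets of \<open>p\<close> vectors of \<open>V\<close>.  As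
  there are no monomials with \<open>0\<close> factors, the components of degree \<open>\<ge> 0\<close> are zero.
\<close>

definition free_lie_gr ::
  "('k::field, 'v, 'm) module_scheme \<Rightarrow> int \<Rightarrow> ('k, 'v) lie_term set set" where
  "free_lie_gr V d = vspan (free_lie V) (lie_class V ` {t. lie_monomial V (nat (- d)) t})"

definition free_lie_from ::
  "('k::field, 'v, 'm) module_scheme \<Rightarrow> nat \<Rightarrow> ('k, 'v) lie_term set set" where
  "free_lie_from V q = vspan (free_lie V) (\<Union>p\<in>{q..}. free_lie_gr V (- int p))"

lemma lie_terms_simps [simp]:
  "Gen v \<in> lie_terms V \<longleftrightarrow> v \<in> carrier V"
  "Zero \<in> lie_terms V"
  "Plus s t \<in> lie_terms V \<longleftrightarrow> s \<in> lie_terms V \<and> t \<in> lie_terms V"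
  "Scale a t \<in> lie_terms V \<longleftrightarrow> t \<in> lie_terms V"
  "Br s t \<in> lie_terms V \<longleftrightarrow> s \<in> lie_terms V \<and> t \<in> lie_terms V"
  by (auto simp: lie_terms_def)

lemma lie_class_eq:
  assumes "s \<in> lie_terms V"
  shows "lie_class V s = lie_class V t \<longleftrightarrow> lie_eq V s t"
proof
  assume "lie_class V s = lie_class V t"
  with assms have "s \<in> lie_class V t"
    by (auto simp: lie_class_def intro: lie_eq.refl)
  thus "lie_eq V s t" by (auto simp: lie_class_def intro: lie_eq.sym)
next
  assume "lie_eq V s t"
  thus "lie_class V s = lie_class V t"
    unfolding lie_class_def by (blast intro: lie_eq.sym lie_eq.trans)
qed

lemma lie_class_self: "s \<in> lie_terms V \<Longrightarrow> s \<in> lie_class V s"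
  by (auto simp: lie_class_def intro: lie_eq.refl)

lemma lie_class_memD: "s' \<in> lie_class V s \<Longrightarrow> s' \<in> lie_terms V \<and> lie_eq V s' s"
  by (auto simp: lie_class_def intro: lie_eq.sym)

lemma free_lie_simps:
  "carrier (free_lie V) = lie_class V ` lie_terms V"
  "\<zero>\<^bsub>free_lie V\<^esub> = lie_class V Zero"
  by (simp_all add: free_lie_def)

lemma free_lie_class_ops:
  assumes "s \<in> lie_terms V"
  shows "a \<odot>\<^bsub>free_lie V\<^esub> lie_class V s = lie_class V (Scale a s)"
    and "t \<in> lie_terms V \<Longrightarrow>
      lie_class V s \<oplus>\<^bsub>free_lie V\<^esub> lie_class V t = lie_class V (Plus s t)"
    and "t \<in> lie_terms V \<Longrightarrow>
      bracket (free_lie V) (lie_class V s) (lie_class V t) = lie_class V (Br s t)"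
proof -
  have 1: "lie_class V (Scale a s') = lie_class V (Scale a s)" if "s' \<in> lie_class V s" for s'
    using lie_class_memD[OF that] by (subst lie_class_eq) (auto intro: lie_eq.scale_cong)
  show "a \<odot>\<^bsub>free_lie V\<^esub> lie_class V s = lie_class V (Scale a s)"
    unfolding free_lie_def lie.simps module.simps
    by (intro UN_constant_eq[OF lie_class_self[OF assms]] ballI 1)
  assume t: "t \<in> lie_terms V"
  have 2: "lie_class V (Plus s' t') = lie_class V (Plus s t)"
    if "s' \<in> lie_class V s" "t' \<in> lie_class V t" for s' t'
    using lie_class_memD[OF that(1)] lie_class_memD[OF that(2)]
    by (subst lie_class_eq) (auto intro: lie_eq.plus_cong)
  show "lie_class V s \<oplus>\<^bsub>free_lie V\<^esub> lie_class V t = lie_class V (Plus s t)"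
    unfolding free_lie_def lie.simps module.simps ring.simps
    by (intro UN_constant_eq[OF lie_class_self[OF assms]] UN_constant_eq[OF lie_class_self[OF t]] ballI 2)
  have 3: "lie_class V (Br s' t') = lie_class V (Br s t)"
    if "s' \<in> lie_class V s" "t' \<in> lie_class V t" for s' t'
    using lie_class_memD[OF that(1)] lie_class_memD[OF that(2)]
    by (subst lie_class_eq) (auto intro: lie_eq.br_cong)
  show "bracket (free_lie V) (lie_class V s) (lie_class V t) = lie_class V (Br s t)"
    unfolding free_lie_def lie.simps module.simps ring.simps
    by (intro UN_constant_eq[OF lie_class_self[OF assms]] UN_constant_eq[OF lie_class_self[OF t]] ballI 3)
qed

lemma free_lie_neg: "lie_eq V (Plus t (Scale (- 1) t)) Zero"
proof -
  have "lie_eq V (Plus t (Scale (- 1) t)) (Plus (Scale 1 t) (Scale (- 1) t))"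
    by (intro lie_eq.plus_cong lie_eq.refl lie_eq.sym[OF lie_eq.scale_1])
  moreover have "lie_eq V (Plus (Scale 1 t) (Scale (- 1) t)) Zero"
    using lie_eq.trans[OF lie_eq.sym[OF lie_eq.scale_add[of V 1 "- 1" t]]]
      lie_eq.scale_0[of V t] by simp
  ultimately show ?thesis by (rule lie_eq.trans)
qed

lemma lie_algebra_free_lie: "lie_algebra (free_lie V)"
proof -
  have eq: "lie_class V s = lie_class V t" if "lie_eq V s t" "s \<in> lie_terms V" for s t
    using that by (simp add: lie_class_eq)
  note [simp] = free_lie_simps free_lie_class_ops
  have "vectorspace class_ring (free_lie V)"
  proof (rule vs_criteria)
    show "field (class_ring :: 'a ring)" by (rule class_field.field_axioms)
    show "\<zero>\<^bsub>free_lie V\<^esub> \<in> carrier (free_lie V)" by simp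
    show "\<forall>v w. v \<in> carrier (free_lie V) \<and> w \<in> carrier (free_lie V)
        \<longrightarrow> v \<oplus>\<^bsub>free_lie V\<^esub> w \<in> carrier (free_lie V)" by auto
    show "\<forall>v\<in>carrier (free_lie V). \<exists>neg_v\<in>carrier (free_lie V).
        v \<oplus>\<^bsub>free_lie V\<^esub> neg_v = \<zero>\<^bsub>free_lie V\<^esub>"
    proof
      fix v assume "v \<in> carrier (free_lie V)"
      then obtain t where t: "t \<in> lie_terms V" "v = lie_class V t" by auto
      thus "\<exists>neg_v\<in>carrier (free_lie V). v \<oplus>\<^bsub>free_lie V\<^esub> neg_v = \<zero>\<^bsub>free_lie V\<^esub>"
        by (intro bexI[of _ "lie_class V (Scale (- 1) t)"]) (simp_all add: eq[OF free_lie_neg])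
    qed
    show "\<forall>c v. c \<in> carrier (class_ring :: 'a ring) \<and> v \<in> carrier (free_lie V)
        \<longrightarrow> c \<odot>\<^bsub>free_lie V\<^esub> v \<in> carrier (free_lie V)" by auto
    show "\<forall>v w. v \<in> carrier (free_lie V) \<and> w \<in> carrier (free_lie V)
        \<longrightarrow> v \<oplus>\<^bsub>free_lie V\<^esub> w = w \<oplus>\<^bsub>free_lie V\<^esub> v"
      by (clarsimp, rule eq, rule lie_eq.plus_comm, simp)
    show "\<forall>v w x. v \<in> carrier (free_lie V) \<and> w \<in> carrier (free_lie V) \<and> x \<in> carrier (free_lie V)
        \<longrightarrow> v \<oplus>\<^bsub>free_lie V\<^esub> w \<oplus>\<^bsub>free_lie V\<^esub> x = v \<oplus>\<^bsub>free_lie V\<^esub> (w \<oplus>\<^bsub>free_lie V\<^esub> x)"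
      by (clarsimp, rule eq, rule lie_eq.plus_assoc, simp)
    show "\<forall>v\<in>carrier (free_lie V). v \<oplus>\<^bsub>free_lie V\<^esub> \<zero>\<^bsub>free_lie V\<^esub> = v"
      by (clarsimp, rule eq, rule lie_eq.trans[OF lie_eq.plus_comm lie_eq.plus_zero], simp)
    show "\<forall>a b v. a \<in> carrier (class_ring :: 'a ring) \<and> b \<in> carrier (class_ring :: 'a ring)
        \<and> v \<in> carrier (free_lie V)
        \<longrightarrow> (a \<otimes>\<^bsub>class_ring\<^esub> b) \<odot>\<^bsub>free_lie V\<^esub> v = a \<odot>\<^bsub>free_lie V\<^esub> (b \<odot>\<^bsub>free_lie V\<^esub> v)"
      by (clarsimp, rule eq, rule lie_eq.sym[OF lie_eq.scale_scale], simp)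
    show "\<forall>v\<in>carrier (free_lie V). \<one>\<^bsub>class_ring\<^esub> \<odot>\<^bsub>free_lie V\<^esub> v = v"
      by (clarsimp, rule eq, rule lie_eq.scale_1, simp)
    show "\<forall>a b v. a \<in> carrier (class_ring :: 'a ring) \<and> b \<in> carrier (class_ring :: 'a ring)
        \<and> v \<in> carrier (free_lie V)
        \<longrightarrow> (a \<oplus>\<^bsub>class_ring\<^esub> b) \<odot>\<^bsub>free_lie V\<^esub> v
          = a \<odot>\<^bsub>free_lie V\<^esub> v \<oplus>\<^bsub>free_lie V\<^esub> b \<odot>\<^bsub>free_lie V\<^esub> v"
      by (clarsimp, rule eq, rule lie_eq.scale_add, simp)
    show "\<forall>a v w. a \<in> carrier (class_ring :: 'a ring) \<and> v \<in> carrier (free_lie V)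
        \<and> w \<in> carrier (free_lie V)
        \<longrightarrow> a \<odot>\<^bsub>free_lie V\<^esub> (v \<oplus>\<^bsub>free_lie V\<^esub> w)
          = a \<odot>\<^bsub>free_lie V\<^esub> v \<oplus>\<^bsub>free_lie V\<^esub> a \<odot>\<^bsub>free_lie V\<^esub> w"
      by (clarsimp, rule eq, rule lie_eq.scale_plus, simp)
  qed
  moreover have "lie_algebra_axioms (free_lie V)"
  proof (unfold lie_algebra_axioms_def free_lie_simps, intro conjI allI impI, goal_cases)
    case 1 thus ?case by (elim imageE) simp
  next
    case 2 thus ?case by (elim imageE, simp, intro eq lie_eq.br_plus_left, simp)
  next
    case 3 thus ?case by (elim imageE, simp, intro eq lie_eq.br_plus_right, simp)
  next
    case 4 thus ?case by (elim imageE, simp, intro eq lie_eq.br_scale_left, simp)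
  next
    case 5 thus ?case by (elim imageE, simp, intro eq lie_eq.br_scale_right, simp)
  next
    case 6 thus ?case by (elim imageE, simp, intro eq lie_eq.br_self, simp)
  next
    case 7 thus ?case by (elim imageE, simp, intro eq lie_eq.br_jacobi, simp)
  qed
  ultimately show ?thesis by (rule lie_algebra.intro)
qed

lemma free_gen_hom: "free_gen V \<in> module_hom class_ring V (free_lie V)"
  if "vectorspace class_ring V"
proof -
  interpret vectorspace class_ring V by fact
  show ?thesis
    by (auto simp: LinearCombinations.module_hom_def free_gen_def free_lie_simps free_lie_class_ops lie_class_eq
        intro: lie_eq.gen_add lie_eq.gen_smult)
qed

primrec lie_eval ::
  "('k::field, 'v, 'm) module_scheme \<Rightarrow> ('k, 'a, 'n) lie_scheme \<Rightarrow> ('v \<Rightarrow> 'a)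
    \<Rightarrow> ('k, 'v) lie_term \<Rightarrow> 'a" where
  "lie_eval V H f (Gen v) = (if v \<in> carrier V then f v else \<zero>\<^bsub>H\<^esub>)"
| "lie_eval V H f Zero = \<zero>\<^bsub>H\<^esub>"
| "lie_eval V H f (Plus s t) = lie_eval V H f s \<oplus>\<^bsub>H\<^esub> lie_eval V H f t"
| "lie_eval V H f (Scale a t) = a \<odot>\<^bsub>H\<^esub> lie_eval V H f t"
| "lie_eval V H f (Br s t) = bracket H (lie_eval V H f s) (lie_eval V H f t)"

theorem free_lie_universal:
  assumes V: "vectorspace class_ring V" and H: "lie_algebra H"
    and f: "f \<in> module_hom class_ring V H"
  shows "\<exists>!\<phi>. \<phi> \<in> extensional (carrier (free_lie V)) \<and> lie_hom (free_lie V) H \<phi> \<and>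
    (\<forall>v\<in>carrier V. \<phi> (free_gen V v) = f v)"
proof -
  interpret V: vectorspace class_ring V by fact
  interpret H: lie_algebra H by fact
  note hom = f[unfolded LinearCombinations.module_hom_def, simplified]
  let ?ev = "lie_eval V H f"
  have cl [simp, intro]: "?ev t \<in> carrier H" for t
    using hom by (induction t) (auto simp: H.bracket_closed Pi_iff)
  have ev: "?ev s = ?ev t" if "lie_eq V s t" for s t
    using that
  proof (induction rule: lie_eq.induct)
    case (plus_assoc r s t) thus ?case by (simp add: H.a_assoc)
  next
    case (plus_comm s t) thus ?case by (simp add: H.a_comm)
  next
    case (scale_0 t) thus ?case using H.lmult_0[of "?ev t"] by simp
  next
    case (scale_1 t) thus ?case using H.smult_one[of "?ev t"] by simp
  next
    case (scale_scale a b t) thus ?case using H.smult_assoc1[of a b "?ev t"] by simp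
  next
    case (scale_add a b t) thus ?case using H.smult_l_distr[of a b "?ev t"] by simp
  next
    case (scale_plus a s t) thus ?case using H.smult_r_distr[of a "?ev s" "?ev t"] by simp
  qed (use hom in \<open>auto simp: H.bracket_add_left H.bracket_add_right H.bracket_smult_left
        H.bracket_smult_right H.bracket_self H.jacobi\<close>)
  define \<phi> where "\<phi> = (\<lambda>c\<in>carrier (free_lie V). ?ev (SOME t. t \<in> lie_terms V \<and> c = lie_class V t))"
  have \<phi>: "\<phi> (lie_class V t) = ?ev t" if "t \<in> lie_terms V" for t
  proof -
    define u where "u = (SOME u. u \<in> lie_terms V \<and> lie_class V t = lie_class V u)"
    have "u \<in> lie_terms V \<and> lie_class V t = lie_class V u"
      unfolding u_def by (rule someI[of _ t]) (use that in simp)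
    hence "lie_eq V t u" using that by (simp add: lie_class_eq)
    thus ?thesis using that ev[of t u] by (simp add: \<phi>_def u_def free_lie_simps)
  qed
  have "\<phi> \<in> extensional (carrier (free_lie V))" by (simp add: \<phi>_def)
  moreover have "lie_hom (free_lie V) H \<phi>"
    by (auto simp: lie_hom_def LinearCombinations.module_hom_def free_lie_simps free_lie_class_ops \<phi>)
  moreover have "\<forall>v\<in>carrier V. \<phi> (free_gen V v) = f v"
    by (simp add: free_gen_def \<phi>)
  moreover have "\<psi> = \<phi>" if ext: "\<psi> \<in> extensional (carrier (free_lie V))"
    and hom\<psi>: "lie_hom (free_lie V) H \<psi>" and gen: "\<forall>v\<in>carrier V. \<psi> (free_gen V v) = f v" for \<psi>
  proof (rule extensionalityI[OF ext])
    show "\<phi> \<in> extensional (carrier (free_lie V))" by fact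
    have cls: "lie_class V t \<in> carrier (free_lie V)" if "t \<in> lie_terms V" for t
      using that by (simp add: free_lie_simps)
    note h = hom\<psi>[unfolded lie_hom_def LinearCombinations.module_hom_def, simplified]
    have "\<psi> (lie_class V t) = ?ev t" if "t \<in> lie_terms V" for t
      using that
    proof (induction t)
      case (Gen v) thus ?case using gen by (simp add: free_gen_def)
    next
      case Zero
      have z: "lie_class V Zero = 0 \<odot>\<^bsub>free_lie V\<^esub> lie_class V Zero"
        by (simp add: free_lie_class_ops lie_class_eq lie_eq.sym[OF lie_eq.scale_0])
      have "\<psi> (lie_class V Zero) = 0 \<odot>\<^bsub>H\<^esub> \<psi> (lie_class V Zero)"
        using h cls[of Zero] z by (metis lie_terms_simps(2))
      moreover have "\<psi> (lie_class V Zero) \<in> carrier H" using h cls[of Zero] by auto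
      ultimately show ?case using H.lmult_0 by simp
    next
      case (Plus s t)
      hence "\<psi> (lie_class V s \<oplus>\<^bsub>free_lie V\<^esub> lie_class V t) = ?ev (Plus s t)"
        using h cls by simp
      thus ?case using Plus.prems by (simp add: free_lie_class_ops)
    next
      case (Scale a t)
      hence "\<psi> (a \<odot>\<^bsub>free_lie V\<^esub> lie_class V t) = ?ev (Scale a t)"
        using h cls by simp
      thus ?case using Scale.prems by (simp add: free_lie_class_ops)
    next
      case (Br s t)
      hence "\<psi> (bracket (free_lie V) (lie_class V s) (lie_class V t)) = ?ev (Br s t)"
        using h cls by simp
      thus ?case using Br.prems by (simp add: free_lie_class_ops)
    qed
    thus "\<And>x. x \<in> carrier (free_lie V) \<Longrightarrow> \<psi> x = \<phi> x" by (auto simp: free_lie_simps \<phi>)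
  qed
  ultimately show ?thesis by blast
qed

section \<open>Effective prolongations\<close>

text \<open>The algebra \<open>\<mm> = \<ff>(V)/\<K>\<close>, its grading, and the inclusion of \<open>V\<close> as the component
  of degree \<open>-1\<close>.\<close>

type_synonym ('k, 'v) fundamental = "('k, 'v) lie_term set set"

definition fund :: "('k::field, 'v, 'm) module_scheme \<Rightarrow> ('k, 'v) lie_term set set
    \<Rightarrow> ('k, ('k, 'v) fundamental) lie" where
  "fund V \<K> = lie_quotient (free_lie V) \<K>"

definition fund_gr :: "('k::field, 'v, 'm) module_scheme \<Rightarrow> ('k, 'v) lie_term set set
    \<Rightarrow> int \<Rightarrow> ('k, 'v) fundamental set" where
  "fund_gr V \<K> p = (\<lambda>x. \<K> +>\<^bsub>free_lie V\<^esub> x) ` free_lie_gr V p"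

definition fund_gen :: "('k::field, 'v, 'm) module_scheme \<Rightarrow> ('k, 'v) lie_term set set
    \<Rightarrow> 'v \<Rightarrow> ('k, 'v) fundamental" where
  "fund_gen V \<K> v = \<K> +>\<^bsub>free_lie V\<^esub> free_gen V v"

text \<open>
  A prolongation of \<open>\<mm>\<close> is given as a graded Lie algebra \<open>G\<close> together with the injection
  \<open>\<iota>\<close> that identifies \<open>\<mm>\<close> with the part of negative degree of \<open>G\<close>.  The element
  \<open>T v\<close> is \<open>[A, v]\<close> under the identification of \<open>V\<close> with the component of degree \<open>-1\<close>.
\<close>

definition effective_prolongation :: "('k::field, 'v, 'm) module_scheme \<Rightarrow> ('v \<Rightarrow> 'v) set
    \<Rightarrow> ('k, 'v) lie_term set set \<Rightarrow> ('k, 'g) lie \<Rightarrow> (int \<Rightarrow> 'g set)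
    \<Rightarrow> (('k, 'v) fundamental \<Rightarrow> 'g) \<Rightarrow> bool" where
  "effective_prolongation V \<LL> \<K> G gr \<iota> \<longleftrightarrow>
     graded_lie_algebra G gr \<and>
     lie_hom (fund V \<K>) G \<iota> \<and> inj_on \<iota> (carrier (fund V \<K>)) \<and>
     (\<forall>p<0. \<iota> ` fund_gr V \<K> p = gr p) \<and>
     {X \<in> vspan G (\<Union>p\<in>{0..}. gr p). \<forall>Y\<in>gr (- 1). bracket G X Y = \<zero>\<^bsub>G\<^esub>} = {\<zero>\<^bsub>G\<^esub>} \<and>
     (\<forall>A\<in>gr 0. \<exists>T\<in>\<LL>. \<forall>v\<in>carrier V.
        bracket G A (\<iota> (fund_gen V \<K> v)) = \<iota> (fund_gen V \<K> (T v)))"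

text \<open>
  Every effective prolongation, of whatever type, is isomorphic to one carried by a set of
  functions \<open>\<mm>\<close>-\<open>list \<Rightarrow> int \<Rightarrow> \<mm>\<close>: an element \<open>x\<close> of \<open>G\<close> is determined by the components of
  negative degree of all the \<open>[\<dots>[[x, v\<^sub>1], v\<^sub>2], \<dots>, v\<^sub>r]\<close> with \<open>v\<^sub>1, \<dots>, v\<^sub>r\<close> of degree \<open>-1\<close>.
\<close>

lemma lie_hom_mod_hom:
  assumes "lie_algebra G" "lie_algebra H" "lie_hom G H \<phi>"
  shows "mod_hom class_ring G H \<phi>"
  using assms unfolding lie_algebra_def vectorspace_def lie_hom_def mod_hom_def mod_hom_axioms_def
  by blast

lemma lie_algebra_transport:
  fixes G :: "('k::field, 'a) lie" and \<phi> :: "'a \<Rightarrow> 'b"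
  assumes "lie_algebra G" and inj: "inj_on \<phi> (carrier G)"
  shows "\<exists>H :: ('k, 'b) lie. lie_algebra H \<and> lie_hom G H \<phi> \<and> carrier H = \<phi> ` carrier G"
proof -
  interpret G: lie_algebra G by fact
  define \<psi> where "\<psi> = inv_into (carrier G) \<phi>"
  have \<psi>: "\<psi> (\<phi> x) = x" if "x \<in> carrier G" for x
    using inj that by (simp add: \<psi>_def)
  define H :: "('k, 'b) lie" where
    "H = \<lparr>carrier = \<phi> ` carrier G, mult = undefined, one = undefined,
       zero = \<phi> \<zero>\<^bsub>G\<^esub>, add = (\<lambda>x y. \<phi> (\<psi> x \<oplus>\<^bsub>G\<^esub> \<psi> y)), smult = (\<lambda>a x. \<phi> (a \<odot>\<^bsub>G\<^esub> \<psi> x)),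
       bracket = (\<lambda>x y. \<phi> (bracket G (\<psi> x) (\<psi> y)))\<rparr>"
  have C: "carrier H = \<phi> ` carrier G" and Z: "\<zero>\<^bsub>H\<^esub> = \<phi> \<zero>\<^bsub>G\<^esub>"
    by (simp_all add: H_def)
  have A: "\<phi> x \<oplus>\<^bsub>H\<^esub> \<phi> y = \<phi> (x \<oplus>\<^bsub>G\<^esub> y)" if "x \<in> carrier G" "y \<in> carrier G" for x y
    using that by (simp add: H_def \<psi>)
  have S: "a \<odot>\<^bsub>H\<^esub> \<phi> x = \<phi> (a \<odot>\<^bsub>G\<^esub> x)" if "x \<in> carrier G" for a x
    using that by (simp add: H_def \<psi>)
  have B: "bracket H (\<phi> x) (\<phi> y) = \<phi> (bracket G x y)" if "x \<in> carrier G" "y \<in> carrier G" for x y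
    using that by (simp add: H_def \<psi>)
  have sm: "a \<odot>\<^bsub>G\<^esub> x \<in> carrier G" if "x \<in> carrier G" for a x
    using that by simp
  have "vectorspace class_ring H"
  proof (rule vs_criteria)
    show "field (class_ring :: 'k ring)" by (rule class_field.field_axioms)
    show "\<zero>\<^bsub>H\<^esub> \<in> carrier H" by (simp add: C Z)
    show "\<forall>v w. v \<in> carrier H \<and> w \<in> carrier H \<longrightarrow> v \<oplus>\<^bsub>H\<^esub> w \<in> carrier H"
      by (auto simp: C A)
    show "\<forall>v\<in>carrier H. \<exists>neg_v\<in>carrier H. v \<oplus>\<^bsub>H\<^esub> neg_v = \<zero>\<^bsub>H\<^esub>"
    proof
      fix v assume "v \<in> carrier H"
      then obtain x where "x \<in> carrier G" "v = \<phi> x" by (auto simp: C)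
      thus "\<exists>neg_v\<in>carrier H. v \<oplus>\<^bsub>H\<^esub> neg_v = \<zero>\<^bsub>H\<^esub>"
        by (intro bexI[of _ "\<phi> (\<ominus>\<^bsub>G\<^esub> x)"]) (auto simp: C A Z G.r_neg)
    qed
    show "\<forall>c v. c \<in> carrier (class_ring :: 'k ring) \<and> v \<in> carrier H \<longrightarrow> c \<odot>\<^bsub>H\<^esub> v \<in> carrier H"
      by (auto simp: C S)
    show "\<forall>v w. v \<in> carrier H \<and> w \<in> carrier H \<longrightarrow> v \<oplus>\<^bsub>H\<^esub> w = w \<oplus>\<^bsub>H\<^esub> v"
      by (auto simp: C A G.a_comm)
    show "\<forall>v w x. v \<in> carrier H \<and> w \<in> carrier H \<and> x \<in> carrier H
        \<longrightarrow> v \<oplus>\<^bsub>H\<^esub> w \<oplus>\<^bsub>H\<^esub> x = v \<oplus>\<^bsub>H\<^esub> (w \<oplus>\<^bsub>H\<^esub> x)"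
      by (auto simp: C A G.a_assoc)
    show "\<forall>v\<in>carrier H. v \<oplus>\<^bsub>H\<^esub> \<zero>\<^bsub>H\<^esub> = v" by (auto simp: C A Z)
    show "\<forall>a b v. a \<in> carrier (class_ring :: 'k ring) \<and> b \<in> carrier (class_ring :: 'k ring) \<and> v \<in> carrier H
        \<longrightarrow> (a \<otimes>\<^bsub>class_ring\<^esub> b) \<odot>\<^bsub>H\<^esub> v = a \<odot>\<^bsub>H\<^esub> (b \<odot>\<^bsub>H\<^esub> v)"
      using G.smult_assoc1 by (auto simp: C S sm)
    show "\<forall>v\<in>carrier H. \<one>\<^bsub>class_ring\<^esub> \<odot>\<^bsub>H\<^esub> v = v"
      using G.smult_one by (auto simp: C S)
    show "\<forall>a b v. a \<in> carrier (class_ring :: 'k ring) \<and> b \<in> carrier (class_ring :: 'k ring) \<and> v \<in> carrier H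
        \<longrightarrow> (a \<oplus>\<^bsub>class_ring\<^esub> b) \<odot>\<^bsub>H\<^esub> v = a \<odot>\<^bsub>H\<^esub> v \<oplus>\<^bsub>H\<^esub> b \<odot>\<^bsub>H\<^esub> v"
      using G.smult_l_distr by (auto simp: C S A sm)
    show "\<forall>a v w. a \<in> carrier (class_ring :: 'k ring) \<and> v \<in> carrier H \<and> w \<in> carrier H
        \<longrightarrow> a \<odot>\<^bsub>H\<^esub> (v \<oplus>\<^bsub>H\<^esub> w) = a \<odot>\<^bsub>H\<^esub> v \<oplus>\<^bsub>H\<^esub> a \<odot>\<^bsub>H\<^esub> w"
      using G.smult_r_distr by (auto simp: C S A sm)
  qed
  moreover have "lie_algebra_axioms H"
    unfolding lie_algebra_axioms_def C
    by (intro conjI allI impI; elim imageE)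
       (simp_all add: A B S Z sm G.bracket_closed G.bracket_add_left G.bracket_add_right
          G.bracket_smult_left G.bracket_smult_right G.bracket_self G.jacobi)
  ultimately have "lie_algebra H" by (rule lie_algebra.intro)
  moreover have "lie_hom G H \<phi>"
    by (auto simp: lie_hom_def LinearCombinations.module_hom_def C A B S)
  ultimately show ?thesis using C by blast
qed

lemma free_lie_gr_subset: "free_lie_gr V p \<subseteq> carrier (free_lie V)"
proof -
  interpret lie_algebra "free_lie V" by (rule lie_algebra_free_lie)
  have "t \<in> lie_terms V" if "lie_monomial V q t" for q t
    using that by induction auto
  thus ?thesis
    unfolding free_lie_gr_def by (intro span_is_subset2) (auto simp: free_lie_simps)
qed

lemma fund_carrier: "x \<in> carrier (free_lie V) \<Longrightarrow> \<K> +>\<^bsub>free_lie V\<^esub> x \<in> carrier (fund V \<K>)"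
  by (auto simp: fund_def lie_quotient_def A_RCOSETS_def')

lemma fund_gr_subset: "fund_gr V \<K> p \<subseteq> carrier (fund V \<K>)"
  using free_lie_gr_subset[of V p] by (auto simp: fund_gr_def intro: fund_carrier)

lemma fund_gen_closed: "v \<in> carrier V \<Longrightarrow> fund_gen V \<K> v \<in> carrier (fund V \<K>)"
  by (simp add: fund_gen_def free_gen_def fund_carrier free_lie_simps)

lemma effective_prolongationD:
  assumes "effective_prolongation V \<LL> \<K> G gr \<iota>"
  shows "lie_algebra G" and "\<forall>p. vsubspace (gr p) G"
    and "\<forall>x\<in>carrier G. \<exists>!c. (\<forall>p. c p \<in> gr p) \<and> finite {p. c p \<noteq> \<zero>\<^bsub>G\<^esub>} \<and>
        x = (\<Oplus>\<^bsub>G\<^esub>p\<in>{p. c p \<noteq> \<zero>\<^bsub>G\<^esub>}. c p)"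
    and "\<forall>p q. \<forall>x\<in>gr p. \<forall>y\<in>gr q. bracket G x y \<in> gr (p + q)"
    and "lie_hom (fund V \<K>) G \<iota>" and "inj_on \<iota> (carrier (fund V \<K>))"
    and "\<forall>p<0. \<iota> ` fund_gr V \<K> p = gr p"
    and "{X \<in> vspan G (\<Union>p\<in>{0..}. gr p). \<forall>Y\<in>gr (- 1). bracket G X Y = \<zero>\<^bsub>G\<^esub>} = {\<zero>\<^bsub>G\<^esub>}"
    and "\<forall>A\<in>gr 0. \<exists>T\<in>\<LL>. \<forall>v\<in>carrier V.
        bracket G A (\<iota> (fund_gen V \<K> v)) = \<iota> (fund_gen V \<K> (T v))"
  using assms[unfolded effective_prolongation_def graded_lie_algebra_def]
  by - (elim conjE, assumption)+

lemma effective_prolongation_iso: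
  assumes G: "effective_prolongation V \<LL> \<K> G gr \<iota>"
    and H: "lie_algebra H" and \<phi>: "lie_hom G H \<phi>" "inj_on \<phi> (carrier G)" "carrier H = \<phi> ` carrier G"
  shows "effective_prolongation V \<LL> \<K> H (\<lambda>p. \<phi> ` gr p) (\<phi> \<circ> \<iota>)"
proof -
  note G_lie = effective_prolongationD(1)[OF G] and G_sub = effective_prolongationD(2)[OF G]
    and G_dec = effective_prolongationD(3)[OF G] and G_br = effective_prolongationD(4)[OF G]
    and G_hom = effective_prolongationD(5)[OF G] and G_inj = effective_prolongationD(6)[OF G]
    and G_neg = effective_prolongationD(7)[OF G] and G_eff = effective_prolongationD(8)[OF G]
    and G_der = effective_prolongationD(9)[OF G]
  interpret G: lie_algebra G by (rule G_lie)
  interpret H: lie_algebra H by fact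
  interpret \<phi>: mod_hom class_ring G H \<phi>
    using lie_hom_mod_hom G.lie_algebra_axioms H \<phi>(1) by blast
  have gr: "submodule class_ring (gr p) G" for p
    using G_sub by (auto simp: VectorSpace.subspace_def)
  have grC: "gr p \<subseteq> carrier G" for p using submodule.subset[OF gr] .
  have grD: "x \<in> carrier G" if "x \<in> gr p" for x p using that grC by blast
  have br: "bracket H (\<phi> x) (\<phi> y) = \<phi> (bracket G x y)" if "x \<in> carrier G" "y \<in> carrier G" for x y
    using that \<phi>(1) by (simp add: lie_hom_def)
  have zero: "\<phi> x = \<zero>\<^bsub>H\<^esub> \<longleftrightarrow> x = \<zero>\<^bsub>G\<^esub>" if "x \<in> carrier G" for x
    using that inj_onD[OF \<phi>(2), of x "\<zero>\<^bsub>G\<^esub>"] by auto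
  have \<iota>C: "\<iota> x \<in> carrier G" if "x \<in> carrier (fund V \<K>)" for x
    using that G_hom by (auto simp: lie_hom_def LinearCombinations.module_hom_def)
  have "vsubspace (\<phi> ` gr p) H" for p
  proof -
    interpret s: submodule class_ring "gr p" G by (rule gr)
    have "submodule class_ring (\<phi> ` gr p) H"
    proof (rule submodule.intro)
      show "module class_ring H" by (rule H.module_axioms)
      show "\<phi> ` gr p \<subseteq> carrier H" using grC \<phi>(3) by blast
      show "\<zero>\<^bsub>H\<^esub> \<in> \<phi> ` gr p" using s.zero_closed \<phi>.f0_is_0 by (metis image_eqI)
    next
      fix v w assume "v \<in> \<phi> ` gr p" "w \<in> \<phi> ` gr p"
      then obtain x y where "x \<in> gr p" "y \<in> gr p" "v = \<phi> x" "w = \<phi> y" by blast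
      moreover have "\<phi> (x \<oplus>\<^bsub>G\<^esub> y) = v \<oplus>\<^bsub>H\<^esub> w" using calculation grD[of x p] grD[of y p] by simp
      ultimately show "v \<oplus>\<^bsub>H\<^esub> w \<in> \<phi> ` gr p" using s.m_closed by (metis image_eqI)
    next
      fix c v assume "v \<in> \<phi> ` gr p"
      then obtain x where x: "x \<in> gr p" "v = \<phi> x" by blast
      have "\<phi> (c \<odot>\<^bsub>G\<^esub> x) = c \<odot>\<^bsub>H\<^esub> v" using x grD[of x p] \<phi>.f_smult[of c x] by simp
      thus "c \<odot>\<^bsub>H\<^esub> v \<in> \<phi> ` gr p" using s.smult_closed[of c x] x by (metis UNIV_I image_eqI partial_object.select_convs(1))
    qed
    thus ?thesis by (simp add: VectorSpace.subspace_def H.vectorspace_axioms)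
  qed
  moreover have "\<exists>!c. (\<forall>p. c p \<in> \<phi> ` gr p) \<and> finite {p. c p \<noteq> \<zero>\<^bsub>H\<^esub>} \<and>
        y = (\<Oplus>\<^bsub>H\<^esub>p\<in>{p. c p \<noteq> \<zero>\<^bsub>H\<^esub>}. c p)" (is "\<exists>!c. ?P c") if yH: "y \<in> carrier H" for y
  proof -
    obtain x where x: "x \<in> carrier G" "y = \<phi> x" using yH unfolding \<phi>(3) by blast
    define Q where "Q = (\<lambda>c. (\<forall>p. c p \<in> gr p) \<and> finite {p. c p \<noteq> \<zero>\<^bsub>G\<^esub>} \<and>
        x = (\<Oplus>\<^bsub>G\<^esub>p\<in>{p. c p \<noteq> \<zero>\<^bsub>G\<^esub>}. c p))"
    have Q: "\<exists>!c. Q c" unfolding Q_def by (rule bspec[OF G_dec x(1)])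
    have PQ: "?P (\<lambda>p. \<phi> (c p)) \<longleftrightarrow> Q c" if c: "\<forall>p. c p \<in> gr p" for c
    proof -
      have cC: "c p \<in> carrier G" for p using c grC by blast
      have eq: "{p. \<phi> (c p) \<noteq> \<zero>\<^bsub>H\<^esub>} = {p. c p \<noteq> \<zero>\<^bsub>G\<^esub>}" using zero cC by blast
      have s: "\<phi> (\<Oplus>\<^bsub>G\<^esub>p\<in>A. c p) = (\<Oplus>\<^bsub>H\<^esub>p\<in>A. \<phi> (c p))" for A :: "int set"
      proof (induction A rule: infinite_finite_induct)
        case (insert a A) thus ?case using cC by (simp add: Pi_iff)
      qed simp_all
      have "(\<Oplus>\<^bsub>G\<^esub>p\<in>A. c p) \<in> carrier G" for A :: "int set" using cC by (simp add: Pi_iff)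
      hence "y = (\<Oplus>\<^bsub>H\<^esub>p\<in>A. \<phi> (c p)) \<longleftrightarrow> x = (\<Oplus>\<^bsub>G\<^esub>p\<in>A. c p)" for A :: "int set"
        using x \<phi>(2) by (auto simp: s[symmetric] inj_on_eq_iff)
      thus ?thesis using c by (simp add: eq Q_def)
    qed
    show ?thesis
    proof (rule ex_ex1I)
      obtain c where c: "Q c" using Q by (rule ex1E)
      hence "?P (\<lambda>p. \<phi> (c p))" using PQ[of c] by (simp add: Q_def)
      thus "\<exists>c. ?P c" by (rule exI[of ?P])
    next
      fix c d assume c: "?P c" and d: "?P d"
      obtain c' where c': "\<And>p. c' p \<in> gr p" "\<And>p. c p = \<phi> (c' p)" using c unfolding image_iff by metis
      obtain d' where d': "\<And>p. d' p \<in> gr p" "\<And>p. d p = \<phi> (d' p)" using d unfolding image_iff by metis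
      have "c = (\<lambda>p. \<phi> (c' p))" "d = (\<lambda>p. \<phi> (d' p))" using c' d' by auto
      hence Qc: "Q c'" and Qd: "Q d'" using PQ[of c'] PQ[of d'] c d c'(1) d'(1) by metis+
      have "c' = d'" using the1_equality[OF Q, OF Qc] the1_equality[OF Q, OF Qd] by simp
      thus "c = d" using c' d' by auto
    qed
  qed
  moreover have "bracket H x y \<in> \<phi> ` gr (p + q)" if xy: "x \<in> \<phi> ` gr p" "y \<in> \<phi> ` gr q" for p q x y
  proof -
    obtain a b where "a \<in> gr p" "b \<in> gr q" "x = \<phi> a" "y = \<phi> b" using xy by blast
    moreover have "bracket G a b \<in> gr (p + q)" using G_br calculation by blast
    ultimately show ?thesis using br[of a b] grD[of a p] grD[of b q] by simp
  qed
  ultimately have "graded_lie_algebra H (\<lambda>p. \<phi> ` gr p)"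
    unfolding graded_lie_algebra_def using H by blast
  moreover have "lie_hom (fund V \<K>) H (\<phi> \<circ> \<iota>)"
    using G_hom \<phi>(1) unfolding lie_hom_def LinearCombinations.module_hom_def by (auto simp: Pi_iff)
  moreover have "inj_on (\<phi> \<circ> \<iota>) (carrier (fund V \<K>))"
    using G_inj \<phi>(2) \<iota>C by (intro comp_inj_on) (auto intro: inj_on_subset)
  moreover have "(\<phi> \<circ> \<iota>) ` fund_gr V \<K> p = \<phi> ` gr p" if "p < 0" for p
    using G_neg that by (metis image_comp)
  moreover have "{X \<in> vspan H (\<Union>p\<in>{0..}. \<phi> ` gr p). \<forall>Y\<in>\<phi> ` gr (- 1). bracket H X Y = \<zero>\<^bsub>H\<^esub>} = {\<zero>\<^bsub>H\<^esub>}"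
  proof -
    let ?S = "\<Union>p\<in>{0..}. gr p"
    have SC: "?S \<subseteq> carrier G" using grC by blast
    have span: "vspan H (\<phi> ` ?S) \<subseteq> \<phi> ` vspan G ?S"
    proof
      fix y assume "y \<in> vspan H (\<phi> ` ?S)"
      then obtain a A where A: "y = H.lincomb a A" "finite A" "A \<subseteq> \<phi> ` ?S"
        unfolding H.span_def by blast
      from A(3) obtain B where B: "B \<subseteq> ?S" "A = \<phi> ` B" by (meson subset_imageE)
      have BC: "B \<subseteq> carrier G" using B SC by blast
      have injB: "inj_on \<phi> B" using \<phi>(2) BC by (rule inj_on_subset)
      have "y = (\<Oplus>\<^bsub>H\<^esub>v\<in>B. a (\<phi> v) \<odot>\<^bsub>H\<^esub> \<phi> v)"
        unfolding A(1) H.lincomb_def B(2) using BC injB by (subst H.add.finprod_reindex) auto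
      also have "\<dots> = (\<Oplus>\<^bsub>H\<^esub>v\<in>B. \<phi> (a (\<phi> v) \<odot>\<^bsub>G\<^esub> v))"
        using BC by (intro H.finsum_cong') auto
      also have "\<dots> = \<phi> (\<Oplus>\<^bsub>G\<^esub>v\<in>B. a (\<phi> v) \<odot>\<^bsub>G\<^esub> v)"
        using BC by (subst \<phi>.hom_sum) auto
      also have "(\<Oplus>\<^bsub>G\<^esub>v\<in>B. a (\<phi> v) \<odot>\<^bsub>G\<^esub> v) = G.lincomb (a \<circ> \<phi>) B"
        by (simp add: G.lincomb_def)
      finally show "y \<in> \<phi> ` vspan G ?S"
        using B A(2) injB unfolding G.span_def by (auto simp: finite_image_iff)
    qed
    have z: "\<zero>\<^bsub>H\<^esub> \<in> vspan H (\<phi> ` ?S)"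
      using H.span_is_submodule[of "\<phi> ` ?S"] SC \<phi>(3) by (auto simp: submodule_def)
    have spanC: "vspan G ?S \<subseteq> carrier G" by (rule G.span_is_subset2[OF SC])
    show ?thesis
    proof (intro equalityI subsetI, goal_cases)
      case (1 X)
      hence "X \<in> vspan H (\<phi> ` ?S)" by (simp add: image_UN)
      then obtain x where x: "x \<in> vspan G ?S" "X = \<phi> x" using span by blast
      have "bracket G x y = \<zero>\<^bsub>G\<^esub>" if y: "y \<in> gr (- 1)" for y
      proof -
        have C: "x \<in> carrier G" "y \<in> carrier G" using x y spanC grC by blast+
        have "bracket H X (\<phi> y) = \<zero>\<^bsub>H\<^esub>" using 1 y by blast
        thus ?thesis using C x br zero G.bracket_closed by auto
      qed
      hence "x = \<zero>\<^bsub>G\<^esub>" using G_eff x by blast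
      thus ?case using x by simp
    next
      case (2 X)
      have "bracket H \<zero>\<^bsub>H\<^esub> Y = \<zero>\<^bsub>H\<^esub>" if Y: "Y \<in> \<phi> ` gr (- 1)" for Y
      proof -
        obtain y where y: "y \<in> gr (- 1)" "Y = \<phi> y" using Y by blast
        have "bracket G \<zero>\<^bsub>G\<^esub> y = \<zero>\<^bsub>G\<^esub>" using G_eff y by blast
        thus ?thesis using y grD[of y "- 1"] br[of "\<zero>\<^bsub>G\<^esub>" y] by simp
      qed
      thus ?case using 2 z by (simp add: image_UN)
    qed
  qed
  moreover have "\<exists>T\<in>\<LL>. \<forall>v\<in>carrier V. bracket H A ((\<phi> \<circ> \<iota>) (fund_gen V \<K> v)) = (\<phi> \<circ> \<iota>) (fund_gen V \<K> (T v))"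
    if A: "A \<in> \<phi> ` gr 0" for A
  proof -
    obtain a where a: "a \<in> gr 0" "A = \<phi> a" using A by blast
    then obtain T where T: "T \<in> \<LL>"
      "\<forall>v\<in>carrier V. bracket G a (\<iota> (fund_gen V \<K> v)) = \<iota> (fund_gen V \<K> (T v))"
      using G_der by blast
    have aC: "a \<in> carrier G" using grD[OF a(1)] .
    show ?thesis
    proof (rule bexI[OF ballI T(1)])
      fix v assume v: "v \<in> carrier V"
      show "bracket H A ((\<phi> \<circ> \<iota>) (fund_gen V \<K> v)) = (\<phi> \<circ> \<iota>) (fund_gen V \<K> (T v))"
        using T(2) v a(2) br[OF aC \<iota>C[OF fund_gen_closed[OF v]]] by simp
    qed
  qed
  ultimately show ?thesis unfolding effective_prolongation_def by blast
qed

theorem effective_prolongation_realized: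
  fixes V :: "('k::field, 'v, 'm) module_scheme" and G :: "('k, 'g) lie"
  assumes G: "effective_prolongation V \<LL> \<K> G gr \<iota>"
  shows "\<exists>(H :: ('k, ('k, 'v) fundamental list \<Rightarrow> int \<Rightarrow> ('k, 'v) fundamental) lie) gr' \<kappa> \<phi>.
    effective_prolongation V \<LL> \<K> H gr' \<kappa> \<and> lie_hom G H \<phi> \<and>
    bij_betw \<phi> (carrier G) (carrier H) \<and> (\<forall>p. \<phi> ` gr p = gr' p) \<and>
    (\<forall>x\<in>carrier (fund V \<K>). \<phi> (\<iota> x) = \<kappa> x)"
proof -
  note G_lie = effective_prolongationD(1)[OF G] and G_sub = effective_prolongationD(2)[OF G]
    and G_dec = effective_prolongationD(3)[OF G] and G_br = effective_prolongationD(4)[OF G]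
    and G_hom = effective_prolongationD(5)[OF G] and G_inj = effective_prolongationD(6)[OF G]
    and G_neg = effective_prolongationD(7)[OF G] and G_eff = effective_prolongationD(8)[OF G]
  interpret G: lie_algebra G by (rule G_lie)
  have gr: "submodule class_ring (gr p) G" for p
    using G_sub by (auto simp: VectorSpace.subspace_def)
  have grC: "gr p \<subseteq> carrier G" for p using submodule.subset[OF gr] .
  have grD: "x \<in> carrier G" if "x \<in> gr p" for x p using that grC by blast
  define Q where "Q = (\<lambda>x c. (\<forall>p. c p \<in> gr p) \<and> finite {p. c p \<noteq> \<zero>\<^bsub>G\<^esub>} \<and>
        x = (\<Oplus>\<^bsub>G\<^esub>p\<in>{p. c p \<noteq> \<zero>\<^bsub>G\<^esub>}. c p))"
  define comp where "comp = (\<lambda>x. THE c. Q x c)"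
  have Q: "\<exists>!c. Q x c" if "x \<in> carrier G" for x
    unfolding Q_def by (rule bspec[OF G_dec that])
  have comp: "Q x (comp x)" if "x \<in> carrier G" for x
    unfolding comp_def by (rule theI'[OF Q[OF that]])
  have comp_eq: "comp x = c" if "x \<in> carrier G" "Q x c" for x c
    unfolding comp_def by (rule the1_equality[OF Q[OF that(1)], OF that(2)])
  have comp_gr: "comp x p \<in> gr p" if "x \<in> carrier G" for x p
    using comp[OF that] by (simp add: Q_def)
  have comp_fin: "finite {p. comp x p \<noteq> \<zero>\<^bsub>G\<^esub>}" if "x \<in> carrier G" for x
    using comp[OF that] by (simp add: Q_def)
  have comp_sum: "x = (\<Oplus>\<^bsub>G\<^esub>p\<in>{p. comp x p \<noteq> \<zero>\<^bsub>G\<^esub>}. comp x p)" if "x \<in> carrier G" for x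
    using comp[OF that] by (simp add: Q_def)
  have br_zero: "bracket G \<zero>\<^bsub>G\<^esub> y = \<zero>\<^bsub>G\<^esub>" if y: "y \<in> carrier G" for y
  proof -
    have "bracket G (0 \<odot>\<^bsub>G\<^esub> \<zero>\<^bsub>G\<^esub>) y = 0 \<odot>\<^bsub>G\<^esub> bracket G \<zero>\<^bsub>G\<^esub> y"
      using y by (intro G.bracket_smult_left) auto
    thus ?thesis using G.lmult_0[of "\<zero>\<^bsub>G\<^esub>"] G.lmult_0[of "bracket G \<zero>\<^bsub>G\<^esub> y"] y
      by (simp add: G.bracket_closed)
  qed
  have br_sum: "bracket G (finsum G f A) y = (\<Oplus>\<^bsub>G\<^esub>p\<in>A. bracket G (f p) y)"
    if "y \<in> carrier G" "\<And>p. f p \<in> carrier G" for y f and A :: "int set"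
  proof (induction A rule: infinite_finite_induct)
    case (insert a A)
    thus ?case using that by (simp add: Pi_iff G.bracket_closed G.bracket_add_left)
  qed (use br_zero that in simp_all)
  have comp_br: "comp (bracket G x y) p = bracket G (comp x (p + 1)) y"
    if x: "x \<in> carrier G" and y: "y \<in> gr (- 1)" for x y p
  proof -
    let ?c = "comp x" and ?d = "\<lambda>p. bracket G (comp x (p + 1)) y"
    have yC: "y \<in> carrier G" using grD[OF y] .
    have cC: "?c p \<in> carrier G" for p using grD[OF comp_gr[OF x]] .
    have dC: "?d p \<in> carrier G" for p using cC yC by (rule G.bracket_closed)
    have "?d p \<in> gr p" for p
      using G_br[rule_format, OF comp_gr[OF x, of "p + 1"] y] by simp
    moreover
    have inj: "inj_on (\<lambda>q. q - 1 :: int) S" for S by (auto intro: inj_onI)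
    have sub: "{p. ?d p \<noteq> \<zero>\<^bsub>G\<^esub>} \<subseteq> (\<lambda>q. q - 1) ` {q. ?c q \<noteq> \<zero>\<^bsub>G\<^esub>}"
    proof
      fix p assume "p \<in> {p. ?d p \<noteq> \<zero>\<^bsub>G\<^esub>}"
      hence "?c (p + 1) \<noteq> \<zero>\<^bsub>G\<^esub>" using br_zero[OF yC] by auto
      thus "p \<in> (\<lambda>q. q - 1) ` {q. ?c q \<noteq> \<zero>\<^bsub>G\<^esub>}" by (intro image_eqI[of _ _ "p + 1"]) auto
    qed
    have fin: "finite ((\<lambda>q. q - 1) ` {q. ?c q \<noteq> \<zero>\<^bsub>G\<^esub>})" using comp_fin[OF x] by blast
    have "finite {p. ?d p \<noteq> \<zero>\<^bsub>G\<^esub>}" using sub fin by (rule finite_subset)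
    moreover have "bracket G x y = (\<Oplus>\<^bsub>G\<^esub>p\<in>{p. ?d p \<noteq> \<zero>\<^bsub>G\<^esub>}. ?d p)"
    proof -
      have "bracket G x y = bracket G (finsum G ?c {q. ?c q \<noteq> \<zero>\<^bsub>G\<^esub>}) y"
        using comp_sum[OF x] by simp
      also have "\<dots> = (\<Oplus>\<^bsub>G\<^esub>q\<in>{q. ?c q \<noteq> \<zero>\<^bsub>G\<^esub>}. bracket G (?c q) y)"
        by (rule br_sum[OF yC cC])
      also have "\<dots> = (\<Oplus>\<^bsub>G\<^esub>q\<in>{q. ?c q \<noteq> \<zero>\<^bsub>G\<^esub>}. ?d (q - 1))" by simp
      also have "\<dots> = (\<Oplus>\<^bsub>G\<^esub>p\<in>(\<lambda>q. q - 1) ` {q. ?c q \<noteq> \<zero>\<^bsub>G\<^esub>}. ?d p)"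
        using dC by (intro G.add.finprod_reindex[OF _ inj, symmetric]) auto
      also have "\<dots> = (\<Oplus>\<^bsub>G\<^esub>p\<in>{p. ?d p \<noteq> \<zero>\<^bsub>G\<^esub>}. ?d p)"
        using dC by (intro G.add.finprod_mono_neutral_cong_right[OF fin sub]) auto
      finally show ?thesis .
    qed
    ultimately have "Q (bracket G x y) ?d" by (simp add: Q_def)
    thus ?thesis using comp_eq G.bracket_closed[OF x yC] by metis
  qed
  define act where "act = foldl (\<lambda>x m. bracket G x (\<iota> m))"
  have negD: "\<iota> m \<in> gr (- 1)" if "m \<in> fund_gr V \<K> (- 1)" for m
    using G_neg[rule_format, of "- 1", simplified] that by blast
  have act_closed: "act x ms \<in> carrier G" if "x \<in> carrier G" "set ms \<subseteq> fund_gr V \<K> (- 1)" for x ms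
    using that by (induction ms arbitrary: x)
      (auto simp: act_def intro!: G.bracket_closed grD[OF negD])
  have act_Cons: "act x (m # ms) = act (bracket G x (\<iota> m)) ms" for x m ms
    by (simp add: act_def)
  have sep: "\<forall>p<int k. comp x p = comp y p"
    if "x \<in> carrier G" "y \<in> carrier G"
      "\<And>ms p. set ms \<subseteq> fund_gr V \<K> (- 1) \<Longrightarrow> p < 0 \<Longrightarrow> comp (act x ms) p = comp (act y ms) p"
    for k x y
    using that
  proof (induction k arbitrary: x y)
    case 0
    thus ?case using "0.prems"(3)[of "[]"] by (simp add: act_def)
  next
    case (Suc k)
    have IH: "\<forall>p<int k. comp x p = comp y p" using Suc.prems by (rule Suc.IH)
    let ?a = "comp x (int k)" and ?b = "comp y (int k)"
    have aC: "?a \<in> carrier G" and bC: "?b \<in> carrier G"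
      using grD[OF comp_gr] Suc.prems by blast+
    have mC: "(- 1) \<odot>\<^bsub>G\<^esub> ?b \<in> carrier G" using bC by simp
    let ?D = "?a \<oplus>\<^bsub>G\<^esub> ((- 1) \<odot>\<^bsub>G\<^esub> ?b)"
    have cancel: "u \<oplus>\<^bsub>G\<^esub> ((- 1) \<odot>\<^bsub>G\<^esub> u) = \<zero>\<^bsub>G\<^esub>" if "u \<in> carrier G" for u
      using G.smult_l_distr[of 1 "- 1" u] G.smult_one[of u] G.lmult_0[of u] that by simp
    have "bracket G ?D Y = \<zero>\<^bsub>G\<^esub>" if Y: "Y \<in> gr (- 1)" for Y
    proof -
      have "Y \<in> \<iota> ` fund_gr V \<K> (- 1)" using G_neg Y by simp
      then obtain m where m: "m \<in> fund_gr V \<K> (- 1)" "Y = \<iota> m" by blast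
      have YC: "Y \<in> carrier G" using grD[OF Y] .
      have "\<forall>p<int k. comp (bracket G x Y) p = comp (bracket G y Y) p"
      proof (rule Suc.IH)
        show "bracket G x Y \<in> carrier G" "bracket G y Y \<in> carrier G"
          using Suc.prems YC G.bracket_closed by blast+
        fix ms :: "('k, 'v) fundamental list" and p :: int
        assume "set ms \<subseteq> fund_gr V \<K> (- 1)" "p < 0"
        thus "comp (act (bracket G x Y) ms) p = comp (act (bracket G y Y) ms) p"
          using Suc.prems(3)[of "m # ms" p] m by (simp add: act_Cons)
      qed
      moreover have "comp (bracket G x Y) (int k - 1) = bracket G ?a Y"
        "comp (bracket G y Y) (int k - 1) = bracket G ?b Y"
        using comp_br[OF Suc.prems(1) Y, of "int k - 1"] comp_br[OF Suc.prems(2) Y, of "int k - 1"]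
        by simp_all
      ultimately have "bracket G ?a Y = bracket G ?b Y" by (metis zless_add1_eq diff_add_cancel)
      thus ?thesis
        using aC bC mC YC cancel[of "bracket G ?b Y"]
        by (simp add: G.bracket_add_left G.bracket_smult_left G.bracket_closed)
    qed
    moreover have "?D \<in> vspan G (\<Union>p\<in>{0..}. gr p)"
    proof -
      interpret s: submodule class_ring "gr (int k)" G by (rule gr)
      have "?D \<in> gr (int k)"
        using comp_gr Suc.prems s.smult_closed[of "- 1" ?b] by simp
      thus ?thesis using G.in_own_span[of "\<Union>p\<in>{0..}. gr p"] grC by force
    qed
    ultimately have "?D = \<zero>\<^bsub>G\<^esub>" using G_eff by blast
    hence "?D = ?b \<oplus>\<^bsub>G\<^esub> ((- 1) \<odot>\<^bsub>G\<^esub> ?b)" using cancel[OF bC] by simp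
    hence "?a = ?b" using aC bC mC by simp
    show ?case
    proof (intro allI impI)
      fix p assume "p < int (Suc k)"
      hence "p < int k \<or> p = int k" by auto
      thus "comp x p = comp y p" using IH \<open>?a = ?b\<close> by blast
    qed
  qed
  define \<phi> where "\<phi> = (\<lambda>x ms p. if p < 0 \<and> set ms \<subseteq> fund_gr V \<K> (- 1)
    then inv_into (carrier (fund V \<K>)) \<iota> (comp (act x ms) p) else undefined)"
  have "inj_on \<phi> (carrier G)"
  proof (rule inj_onI)
    fix x y assume x: "x \<in> carrier G" and y: "y \<in> carrier G" and eq: "\<phi> x = \<phi> y"
    have img: "comp (act z ms) p \<in> \<iota> ` carrier (fund V \<K>)"
      if "z \<in> carrier G" "set ms \<subseteq> fund_gr V \<K> (- 1)" "p < 0" for z ms p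
    proof -
      have "comp (act z ms) p \<in> \<iota> ` fund_gr V \<K> p"
        using comp_gr[OF act_closed[OF that(1,2)], of p] G_neg that(3) by simp
      thus ?thesis using fund_gr_subset by blast
    qed
    have c: "comp (act x ms) p = comp (act y ms) p"
      if ms: "set ms \<subseteq> fund_gr V \<K> (- 1)" and p: "p < 0" for ms p
    proof -
      have "\<phi> x ms p = \<phi> y ms p" using eq by simp
      hence "inv_into (carrier (fund V \<K>)) \<iota> (comp (act x ms) p)
          = inv_into (carrier (fund V \<K>)) \<iota> (comp (act y ms) p)"
        using ms p by (simp add: \<phi>_def)
      thus ?thesis using img[OF x ms p] img[OF y ms p] by (rule inv_into_injective)
    qed
    have "comp x p = comp y p" for p
    proof -
      have "\<forall>q<int (nat p + 1). comp x q = comp y q" using x y c by (rule sep)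
      thus ?thesis by auto
    qed
    hence "comp x = comp y" by blast
    thus "x = y" using comp_sum[OF x] comp_sum[OF y] by simp
  qed
  then obtain H :: "('k, ('k, 'v) fundamental list \<Rightarrow> int \<Rightarrow> ('k, 'v) fundamental) lie"
    where H: "lie_algebra H" "lie_hom G H \<phi>" "carrier H = \<phi> ` carrier G"
    using lie_algebra_transport[OF G_lie, of \<phi>] by blast
  have "effective_prolongation V \<LL> \<K> H (\<lambda>p. \<phi> ` gr p) (\<phi> \<circ> \<iota>)"
    using G H(1,2) \<open>inj_on \<phi> (carrier G)\<close> H(3) by (rule effective_prolongation_iso)
  moreover have "bij_betw \<phi> (carrier G) (carrier H)"
    using \<open>inj_on \<phi> (carrier G)\<close> H(3) by (simp add: bij_betw_def)
  ultimately show ?thesis using H(2)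
    by (intro exI[of _ H] exI[of _ "\<lambda>p. \<phi> ` gr p"] exI[of _ "\<phi> \<circ> \<iota>"] exI[of _ \<phi>]) simp
qed

text \<open>
  HOL cannot quantify over the types of all competitors \<open>H\<close>.  By
  \<open>effective_prolongation_realized\<close> it is enough to let \<open>H\<close> range over the algebras
  carried by subsets of one fixed type.
\<close>

definition maximal_effective_prolongation :: "('k::field, 'v, 'm) module_scheme
    \<Rightarrow> ('v \<Rightarrow> 'v) set \<Rightarrow> ('k, 'v) lie_term set set \<Rightarrow> ('k, 'g) lie \<Rightarrow> (int \<Rightarrow> 'g set)
    \<Rightarrow> (('k, 'v) fundamental \<Rightarrow> 'g) \<Rightarrow> bool" where
  "maximal_effective_prolongation V \<LL> \<K> G gr \<iota> \<longleftrightarrow>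
     effective_prolongation V \<LL> \<K> G gr \<iota> \<and>
     (\<forall>(H :: ('k, ('k, 'v) fundamental list \<Rightarrow> int \<Rightarrow> ('k, 'v) fundamental) lie) gr' \<kappa>.
        effective_prolongation V \<LL> \<K> H gr' \<kappa> \<longrightarrow>
        (\<exists>\<phi>. lie_hom H G \<phi> \<and> inj_on \<phi> (carrier H) \<and> (\<forall>p. \<phi> ` gr' p \<subseteq> gr p) \<and>
             (\<forall>x\<in>carrier (fund V \<K>). \<phi> (\<kappa> x) = \<iota> x)))"

section \<open>The space \<open>W(\<K>)\<close> and the matrices\<close>

definition W_space :: "('k::field, 'v, 'm) module_scheme \<Rightarrow> ('k, 'v) lie_term set set
    \<Rightarrow> 'v set" where
  "W_space V \<K> =
     {v \<in> carrier V. \<forall>x\<in>free_lie_from V 2. bracket (free_lie V) (free_gen V v) x \<in> \<K>}"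

text \<open>Coordinates with respect to the basis \<open>e 0, \<dots>, e (n - 1)\<close>.\<close>

definition coords :: "('k::field, 'v, 'm) module_scheme \<Rightarrow> (nat \<Rightarrow> 'v) \<Rightarrow> nat \<Rightarrow> 'v \<Rightarrow> 'k vec" where
  "coords V e n v =
     (THE x. x \<in> carrier_vec n \<and> v = (\<Oplus>\<^bsub>V\<^esub>i\<in>{..<n}. (x $ i) \<odot>\<^bsub>V\<^esub> e i))"

definition matrix_of :: "('k::field, 'v, 'm) module_scheme \<Rightarrow> (nat \<Rightarrow> 'v) \<Rightarrow> nat
    \<Rightarrow> ('v \<Rightarrow> 'v) \<Rightarrow> 'k mat" where
  "matrix_of V e n f = mat_of_cols n (map (\<lambda>j. coords V e n (f (e j))) [0..<n])"

definition mat_trace :: "'k::comm_ring_1 mat \<Rightarrow> 'k" where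
  "mat_trace A = (\<Sum>i<dim_row A. A $$ (i, i))"

definition antisym_mats :: "nat \<Rightarrow> 'k::field mat set" where
  "antisym_mats n = {X \<in> carrier_mat n n. transpose_mat X = - X}"

definition L_perp :: "('k::field, 'v, 'm) module_scheme \<Rightarrow> (nat \<Rightarrow> 'v) \<Rightarrow> nat
    \<Rightarrow> ('v \<Rightarrow> 'v) set \<Rightarrow> 'k mat set" where
  "L_perp V e n \<LL> =
     {A \<in> carrier_mat n n. \<forall>X\<in>\<LL>. mat_trace (A * matrix_of V e n X) = 0}"

definition wedge_mat :: "nat \<Rightarrow> 'k::field vec \<Rightarrow> 'k vec \<Rightarrow> 'k mat" where
  "wedge_mat n v w = mat n n (\<lambda>(i, j). v $ i * w $ j - w $ i * v $ j)"

text \<open>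
  The matrices of the elements of \<open>\<K>\<close> of degree \<open>-2\<close>.  The elements of \<open>\<ff>\<^sub>-\<^sub>2(V)\<close>, that
  is, of \<open>\<Lambda>\<^sup>2(V)\<close>, are the finite sums of brackets \<open>[v, w]\<close>, and \<open>[v, w]\<close> corresponds to
  \<open>v w\<^sup>T - w v\<^sup>T\<close>.
\<close>

definition K2_mats :: "('k::field, 'v, 'm) module_scheme \<Rightarrow> (nat \<Rightarrow> 'v) \<Rightarrow> nat
    \<Rightarrow> ('k, 'v) lie_term set set \<Rightarrow> 'k mat set" where
  "K2_mats V e n \<K> =
     {finsum (module_mat TYPE('k) n n)
        (\<lambda>i. wedge_mat n (coords V e n (v i)) (coords V e n (w i))) {..<l} | (l::nat) v w.
      (\<forall>i<l. v i \<in> carrier V \<and> w i \<in> carrier V) \<and>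
      finsum (free_lie V) (\<lambda>i. bracket (free_lie V) (free_gen V (v i)) (free_gen V (w i))) {..<l}
        \<in> \<K>}"

definition K2_perp :: "('k::field, 'v, 'm) module_scheme \<Rightarrow> (nat \<Rightarrow> 'v) \<Rightarrow> nat
    \<Rightarrow> ('k, 'v) lie_term set set \<Rightarrow> 'k mat set" where
  "K2_perp V e n \<K> =
     {X \<in> antisym_mats n. \<forall>Z\<in>K2_mats V e n \<K>. mat_trace (X * Z) = 0}"

definition generates_mats :: "nat \<Rightarrow> 'k::field mat list \<Rightarrow> 'k mat set \<Rightarrow> bool" where
  "generates_mats n As S \<longleftrightarrow>
     set As \<subseteq> carrier_mat n n \<and> vspan (module_mat TYPE('k) n n) (set As) = S"

abbreviation mat_ac :: "'k::field mat \<Rightarrow> 'k alg_closure mat" where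
  "mat_ac \<equiv> map_mat to_ac"

text \<open>Columns of the matrices \<open>M\<^sub>1\<close> and \<open>M\<^sub>2\<close>.\<close>

definition M1_cols :: "'k::field mat list \<Rightarrow> 'k alg_closure vec \<Rightarrow> 'k alg_closure vec list" where
  "M1_cols As z = map (\<lambda>A. mat_ac A *\<^sub>v z) As"

definition M2_cols :: "'k::field mat list \<Rightarrow> 'k mat list \<Rightarrow> 'k alg_closure vec
    \<Rightarrow> 'k alg_closure vec list" where
  "M2_cols Xs Ys z = concat (map (\<lambda>Y. map (\<lambda>X. mat_ac X *\<^sub>v (mat_ac Y *\<^sub>v z)) Xs) Ys)"

end

(*
Evaluating iterated brackets with elements of V attaches to an element of degree k of an effective
prolongation a V-valued symmetric form of degree k + 1. On the elements that commute with the components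
of degree < -1 this is injective, and every slice of the form lies in the space T of those endomorphisms
in L that, extended by zero to the components of degree < -1, are derivations of m. T is cut out by linear
equations, and (M_1, M_2) drops rank at a nonzero z in W iff T, after extension of scalars, contains a
nonzero endomorphism z (x) eta of rank one.

If T contains no element of rank one, then the forms vanish in large degree: a common eigenvector of the
contractions would have a slice of rank one. The condition of commuting with the components of degree < -1
is then dropped one component at a time; an obstruction would be a Heisenberg algebra acting on a finite
dimensional space with its centre acting invertibly, which is impossible by a trace argument.

If T contains z (x) eta, then the forms x |-> eta(x)^(k+1) z, brought down to the ground field by a linear
functional, are nonzero in every degree, and m together with the polynomial vector fields with slices in T
is an effective prolongation of m.
*)
theory Submission
  imports Defs "HOL-Library.Function_Algebras"
begin

section \<open>Linear algebra\<close>

text \<open>A covector eta kills every column A z iff trace(A z eta^T) = 0, and it kills every X Y z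
  with X running over all antisymmetric matrices iff Y z and eta are linearly dependent, that is iff
  Y z eta^T is symmetric. For z in W these are exactly the equations of T at the matrix z eta^T: a
  left kernel vector of (M_1, M_2) is the second factor of a rank one element. Towards finite
  dimension the obstacle is that a bracket with an element of negative degree moves from one
  component to another, so no single finite dimensional space carries the Heisenberg triple. Where
  the central element s lowers the degree by q and is injective, the sequences with s (f (k + q)) =
  f k form such a space: they are determined by their first q entries, and on them s acts as the
  identity. Contraction with one basis vector is treated in the same way to find the common
  eigenvector. Both arguments need injectivity in large degree, which the preceding induction step
  provides. Characteristic zero enters in the trace of the identity, in divisions by 2 and in the
  distinct powers of 2 that define gradings.\<close>

definition lin_on :: "('a \<Rightarrow> 'b::plus \<Rightarrow> 'b) \<Rightarrow> 'b set \<Rightarrow> ('b \<Rightarrow> 'b) \<Rightarrow> bool" where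
  "lin_on scale S f \<longleftrightarrow> (\<forall>x\<in>S. \<forall>y\<in>S. f (x + y) = f x + f y) \<and> (\<forall>c. \<forall>x\<in>S. f (scale c x) = scale c (f x))"

lemma lin_onD:
  assumes "lin_on scale S f"
  shows "x \<in> S \<Longrightarrow> y \<in> S \<Longrightarrow> f (x + y) = f x + f y" and "x \<in> S \<Longrightarrow> f (scale c x) = scale c (f x)"
  using assms by (auto simp: lin_on_def)

lemma sum_apply: "sum f A x = (\<Sum>i\<in>A. f i x)" for f :: "'i \<Rightarrow> 'j \<Rightarrow> 'k::comm_monoid_add"
  by (induction A rule: infinite_finite_induct) auto

section \<open>Towers of finite dimensional spaces\<close>

context vector_space
begin

lemma lin_on_zero: "lin_on scale S f \<Longrightarrow> subspace S \<Longrightarrow> f 0 = 0"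
  using lin_onD(2)[of scale S f 0 0] subspace_0[of S] by simp

lemma lin_on_diff:
  assumes "lin_on scale S f" "subspace S" "x \<in> S" "y \<in> S"
  shows "f (x - y) = f x - f y"
proof -
  have "f (x + (-1) *s y) = f x + f ((-1) *s y)"
    by (rule lin_onD(1)[OF assms(1)]) (use assms subspace_scale subspace_neg in auto)
  also have "f ((-1) *s y) = (-1) *s f y" using assms by (intro lin_onD(2)) auto
  finally show ?thesis by (simp add: scale_minus_left)
qed

lemma lin_on_sum:
  assumes "lin_on scale S f" "subspace S" "\<And>i. i \<in> A \<Longrightarrow> g i \<in> S"
  shows "f (sum g A) = (\<Sum>i\<in>A. f (g i))"
  using assms(3)
proof (induction A rule: infinite_finite_induct)
  case (insert a A)
  have "sum g A \<in> S" using insert.prems by (intro subspace_sum[OF assms(2)]) auto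
  then show ?case using insert lin_onD(1)[OF assms(1)] by simp
qed (auto simp: lin_on_zero[OF assms(1,2)])

lemma subspace_image_lin_on:
  assumes f: "lin_on scale S f" and S: "subspace S"
  shows "subspace (f ` S)"
proof (rule subspaceI)
  show "0 \<in> f ` S" using lin_on_zero[OF f S] subspace_0[OF S] by (metis image_eqI)
next
  fix x y assume "x \<in> f ` S" "y \<in> f ` S"
  then obtain u v where u: "u \<in> S" "x = f u" and v: "v \<in> S" "y = f v" by blast
  have "x + y = f (u + v)" using u v lin_onD(1)[OF f] by simp
  then show "x + y \<in> f ` S" using u v subspace_add[OF S] by blast
next
  fix c x assume "x \<in> f ` S"
  then obtain u where u: "u \<in> S" "x = f u" by blast
  have "scale c x = f (scale c u)" using u lin_onD(2)[OF f] by simp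
  then show "scale c x \<in> f ` S" using u subspace_scale[OF S] by blast
qed

text \<open>A member of least dimension is contained in all the others: a later member lies inside
  it and has no smaller dimension, so the two are equal. Hence the chain is stationary, and any
  nonzero vector of that member lies in the intersection.\<close>

lemma decreasing_subspaces_Inter:
  assumes sub: "\<And>j. subspace (I j)" and dec: "\<And>j. I (Suc j) \<subseteq> I j"
    and F: "finite F" "I 0 \<subseteq> span F" and ne: "\<And>j. I j \<noteq> {0}"
  obtains x where "x \<noteq> 0" "\<And>j. x \<in> I j"
proof -
  have mono: "I i \<subseteq> I j" if "j \<le> i" for i j :: nat
    using that dec by (induction i rule: dec_induct) auto
  obtain j where j: "\<And>i. dim (I j) \<le> dim (I i)"
    using ex_has_least_nat[of "\<lambda>_. True" 0 "\<lambda>j. dim (I j)"] by auto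
  have sub_j: "I j \<subseteq> I i" for i
  proof (cases "i \<le> j")
    case True then show ?thesis using mono by blast
  next
    case False
    obtain B where B: "B \<subseteq> I i" "independent B" "I i \<subseteq> span B" "card B = dim (I i)" by (rule basis_exists)
    have "B \<subseteq> I j" using B mono[of j i] False by auto
    then obtain C where C: "B \<subseteq> C" "C \<subseteq> I j" "independent C" "I j \<subseteq> span C"
      using maximal_independent_subset_extend B(2) by blast
    have "card C = dim (I j)" using C by (intro basis_card_eq_dim)
    moreover have "finite C" using independent_span_bound[OF F(1) C(3)] C(2) F(2) mono[of 0 j] by blast
    ultimately have "B = C" using B(4) j[of i] C(1) by (intro card_seteq) auto
    then show ?thesis using C(4) span_minimal[OF B(1) sub] by blast
  qed
  obtain x where "x \<in> I j" "x \<noteq> 0" using ne[of j] subspace_0[OF sub[of j]] by blast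
  then show ?thesis using sub_j that by blast
qed

text \<open>A compatible thread through a tower of injective maps. All stages embed into
  \<open>P 0\<close> by composition, the images decrease and are nonzero, so they share a vector;
  its preimages are unique and therefore compatible.\<close>

lemma inverse_limit_nonzero:
  assumes P: "\<And>j. subspace (P j)" and s: "\<And>j. lin_on scale (P (Suc j)) (s j)"
    and sP: "\<And>j x. x \<in> P (Suc j) \<Longrightarrow> s j x \<in> P j"
    and inj: "\<And>j x. x \<in> P (Suc j) \<Longrightarrow> s j x = 0 \<Longrightarrow> x = 0"
    and F: "finite F" "P 0 \<subseteq> span F" and ne: "\<And>j. P j \<noteq> {0}"
  obtains f where "\<And>j. f j \<in> P j" "\<And>j. s j (f (Suc j)) = f j" "f 0 \<noteq> 0"
proof -
  \<comment> \<open>\<open>S j\<close> is the composite of the maps from stage \<open>j\<close> down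
    to stage 0; it is injective on \<open>P j\<close>.\<close>
  define S where "S = rec_nat id (\<lambda>j g. g \<circ> s j)"
  have S0: "S 0 x = x" and SS: "S (Suc j) x = S j (s j x)" for j x by (simp_all add: S_def)
  have Slin: "lin_on scale (P j) (S j) \<and> S j ` P j \<subseteq> P 0 \<and> (\<forall>x\<in>P j. S j x = 0 \<longrightarrow> x = 0)" for j
  proof (induction j)
    case 0 then show ?case by (auto simp: lin_on_def S0)
  next
    case (Suc j)
    have "lin_on scale (P (Suc j)) (S (Suc j))"
      unfolding lin_on_def SS using Suc lin_onD[OF s[of j]] sP[of _ j] lin_onD[of scale "P j" "S j"] by metis
    moreover have "S (Suc j) ` P (Suc j) \<subseteq> P 0" "\<forall>x\<in>P (Suc j). S (Suc j) x = 0 \<longrightarrow> x = 0"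
      using Suc inj[of _ j] sP[of _ j] by (auto simp: SS)
    ultimately show ?case by blast
  qed
  obtain x where x: "x \<noteq> 0" "\<And>j. x \<in> S j ` P j"
  proof (rule decreasing_subspaces_Inter[of "\<lambda>j. S j ` P j" F])
    show "subspace (S j ` P j)" for j using Slin P by (intro subspace_image_lin_on) auto
    show "S (Suc j) ` P (Suc j) \<subseteq> S j ` P j" for j using sP by (auto simp: SS)
    show "finite F" "S 0 ` P 0 \<subseteq> span F" using F by (auto simp: S0)
    show "S j ` P j \<noteq> {0}" for j
    proof -
      obtain y where "y \<in> P j" "y \<noteq> 0" using ne[of j] subspace_0[OF P[of j]] by blast
      then show ?thesis using Slin[of j] by blast
    qed
    fix x assume "x \<noteq> 0" "\<And>j. x \<in> S j ` P j"
    then show thesis by (rule that)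
  qed
  have "\<exists>y. y \<in> P j \<and> S j y = x" for j using x(2)[of j] by blast
  then obtain f where f: "\<And>j. f j \<in> P j" "\<And>j. S j (f j) = x" by metis
  have "s j (f (Suc j)) = f j" for j
  proof -
    have sf: "s j (f (Suc j)) \<in> P j" using f sP by blast
    have "S j (s j (f (Suc j)) - f j) = 0"
      using lin_on_diff[of "P j" "S j" "s j (f (Suc j))" "f j"] Slin[of j] P sf f(1)[of j] f(2)[of j]
        SS[of j "f (Suc j)"] f(2)[of "Suc j"] by simp
    then show ?thesis using Slin[of j] sf f subspace_diff[OF P[of j]] by force
  qed
  moreover have "f 0 \<noteq> 0" using f(2)[of 0] x by (simp add: S0)
  ultimately show ?thesis using that f by blast
qed

text \<open>Serves for spaces of infinite sequences, or of tensors with components of all orders,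
  whose elements are determined by finitely many components: \<open>R\<close> will be the
  restriction to those components.\<close>

lemma finite_basis_of_injective:
  assumes E: "subspace E" and R: "vector_space scale'" "Vector_Spaces.linear scale scale' R"
    and inj: "\<And>x. x \<in> E \<Longrightarrow> R x = 0 \<Longrightarrow> x = 0"
    and F: "finite F" "R ` E \<subseteq> module.span scale' F"
  obtains B where "finite B" "independent B" "B \<subseteq> E" "span B = E"
proof -
  interpret V': vector_space scale' by fact
  interpret R: Vector_Spaces.linear scale scale' R by fact
  obtain B where B: "B \<subseteq> E" "independent B" "E \<subseteq> span B" by (rule maximal_independent_subset)
  have sB: "span B = E" using B span_minimal[OF B(1) E] by auto
  have "inj_on R (span B)"
  proof (rule inj_onI)
    fix x y assume "x \<in> span B" "y \<in> span B" "R x = R y"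
    then have "x - y \<in> E" "R (x - y) = 0" using sB E by (auto simp: R.diff subspace_diff)
    then show "x = y" using inj by fastforce
  qed
  then have "V'.independent (R ` B)" using B(2) by (intro R.independent_injective_image) auto
  moreover have "R ` B \<subseteq> V'.span F" using F B(1) by auto
  ultimately have "finite (R ` B)" using V'.independent_span_bound[OF F(1)] by blast
  moreover have "inj_on R B" using \<open>inj_on R (span B)\<close> span_superset inj_on_subset by blast
  ultimately have "finite B" using finite_imageD by blast
  then show ?thesis using that B sB by blast
qed

lemma vector_space_fun: "vector_space (\<lambda>c (f::'i \<Rightarrow> 'b) k. scale c (f k))"
  by unfold_locales (auto simp: fun_eq_iff algebra_simps)

text \<open>The relation is indexed by naturals, so that it can be read as a polynomial. Dependence
  is a property of sets and does not see repetitions, hence the separate case of a repeated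
  vector.\<close>

lemma nontrivial_relation:
  fixes v :: "nat \<Rightarrow> 'b"
  assumes F: "finite F" "range v \<subseteq> span F"
  obtains N c where "(\<Sum>i\<le>N::nat. scale (c i) (v i)) = 0" "\<exists>i\<le>N. c i \<noteq> 0"
proof (cases "inj v")
  case False
  then obtain i j where ij: "i \<noteq> j" "v i = v j" by (auto simp: inj_def)
  let ?c = "\<lambda>k. if k = i then 1 else if k = j then -1 else (0::'a)"
  have "(\<Sum>k\<le>max i j. scale (?c k) (v k)) = (\<Sum>k\<in>{i,j}. scale (?c k) (v k))"
    by (intro sum.mono_neutral_right) auto
  also have "\<dots> = 0" using ij by simp
  finally have "(\<Sum>k\<le>max i j. scale (?c k) (v k)) = 0" .
  moreover have "\<exists>k\<le>max i j. ?c k \<noteq> 0" by (rule exI[of _ i]) simp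
  ultimately show ?thesis by (rule that)
next
  case True
  have "infinite (range v)" using True finite_imageD infinite_UNIV_nat by blast
  then have "dependent (range v)" using independent_span_bound[OF F(1)] F(2) by blast
  then obtain t u where t: "finite t" "t \<subseteq> range v" "(\<Sum>x\<in>t. scale (u x) x) = 0" "\<exists>x\<in>t. u x \<noteq> 0"
    unfolding dependent_explicit by blast
  obtain J where J: "t = v ` J" "finite J"
    using t(1,2) finite_subset_image by (metis subset_image_iff)
  define N where "N = Max (insert 0 J)"
  have JN: "J \<subseteq> {..N}" using J(2) by (auto simp: N_def)
  let ?c = "\<lambda>k. if k \<in> J then u (v k) else 0"
  have "(\<Sum>k\<le>N. scale (?c k) (v k)) = (\<Sum>k\<in>J. scale (u (v k)) (v k))"
    using JN by (intro sum.mono_neutral_cong_right) auto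
  also have "\<dots> = (\<Sum>x\<in>t. scale (u x) x)" unfolding J(1)
    using True by (subst sum.reindex) (auto intro: inj_on_subset)
  finally have "(\<Sum>k\<le>N. scale (?c k) (v k)) = 0" using t(3) by simp
  moreover obtain k where "k \<in> J" "u (v k) \<noteq> 0" using t(4) J(1) by blast
  then have "\<exists>k\<le>N. ?c k \<noteq> 0" using JN by (intro exI[of _ k]) auto
  ultimately show ?thesis by (rule that)
qed

end

text \<open>The trace of a commutator is 0 and the trace of the identity is the dimension, which in
  characteristic zero vanishes only for the zero space. The trace is written through the
  coefficients \<open>representation B\<close>, since the operators are linear on \<open>E\<close>
  only.\<close>

lemma commutator_trace_contradiction:
  fixes scale :: "'a::field_char_0 \<Rightarrow> 'b::ab_group_add \<Rightarrow> 'b"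
  assumes "vector_space scale"
    and E: "finite B" "\<not> module.dependent scale B" "module.span scale B = E"
    and a: "lin_on scale E a" "\<And>x. x \<in> E \<Longrightarrow> a x \<in> E"
    and b: "lin_on scale E b" "\<And>x. x \<in> E \<Longrightarrow> b x \<in> E"
    and comm: "\<And>x. x \<in> E \<Longrightarrow> a (b x) - b (a x) = x"
  shows "E = {0}"
proof -
  interpret vector_space scale by fact
  let ?r = "representation B"
  have sE: "subspace E" using E(3) subspace_span by blast
  have BE: "e \<in> E" if "e \<in> B" for e using that E(3) span_base by blast
  \<comment> \<open>The trace of a composite as a double sum over matrix entries; exchanging the two
    sums gives tr(ab) = tr(ba).\<close>
  have tr: "(\<Sum>e\<in>B. ?r (f (g e)) e) = (\<Sum>e\<in>B. \<Sum>e'\<in>B. ?r (g e) e' * ?r (f e') e)"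
    if f: "lin_on scale E f" "\<And>x. x \<in> E \<Longrightarrow> f x \<in> E" and g: "\<And>x. x \<in> E \<Longrightarrow> g x \<in> E" for f g
  proof (rule sum.cong[OF HOL.refl])
    fix e assume e: "e \<in> B"
    have ge: "g e \<in> E" using g BE e by blast
    have "f (g e) = f (\<Sum>e'\<in>B. scale (?r (g e) e') e')"
      using E ge by (subst sum_representation_eq) auto
    also have "\<dots> = (\<Sum>e'\<in>B. f (scale (?r (g e) e') e'))"
      by (rule lin_on_sum[OF f(1) sE]) (use BE subspace_scale[OF sE] in auto)
    also have "\<dots> = (\<Sum>e'\<in>B. scale (?r (g e) e') (f e'))"
      using BE lin_onD(2)[OF f(1)] by (intro sum.cong) auto
    finally have "?r (f (g e)) e = ?r (\<Sum>e'\<in>B. scale (?r (g e) e') (f e')) e" by simp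
    also have "\<dots> = (\<Sum>e'\<in>B. ?r (scale (?r (g e) e') (f e')) e)"
      using E f(2) BE subspace_scale[OF sE] by (subst representation_sum) auto
    also have "\<dots> = (\<Sum>e'\<in>B. ?r (g e) e' * ?r (f e') e)"
      using E f(2) BE by (intro sum.cong HOL.refl) (subst representation_scale, auto)
    finally show "?r (f (g e)) e = (\<Sum>e'\<in>B. ?r (g e) e' * ?r (f e') e)" .
  qed
  have "(\<Sum>e\<in>B. ?r (a (b e)) e) = (\<Sum>e\<in>B. ?r (b (a e)) e)"
    using tr[OF a b(2)] tr[OF b a(2)] by (subst tr[OF a b(2)], simp, subst tr[OF b a(2)], simp)
       (subst sum.swap, simp add: mult.commute)
  then have "0 = (\<Sum>e\<in>B. ?r (a (b e)) e - ?r (b (a e)) e)" by (simp add: sum_subtractf)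
  also have "\<dots> = (\<Sum>e\<in>B. ?r e e)"
  proof (rule sum.cong[OF HOL.refl])
    fix e assume e: "e \<in> B"
    have "?r (a (b e) - b (a e)) = (\<lambda>x. ?r (a (b e)) x - ?r (b (a e)) x)"
      using E a b BE e by (intro representation_diff) auto
    then show "?r (a (b e)) e - ?r (b (a e)) e = ?r e e" using comm[OF BE[OF e]] by (metis)
  qed
  also have "\<dots> = of_nat (card B)" using E by (simp add: representation_basis)
  finally have "B = {}" using E(1) by simp
  then show ?thesis using E(3) by simp
qed

text \<open>Graded form of the impossibility of [a, b] = 1 in finite dimension: \<open>a\<close>,
  \<open>b\<close> and their commutator \<open>s\<close> lower the degree by 1, \<open>r\<close> and
  \<open>q\<close>. If infinitely many stages were nonzero, the sequences fixed by \<open>s\<close>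
  up to the shift would form a nonzero finite dimensional space. It is stable under \<open>a\<close>
  and \<open>b\<close>, as both commute with \<open>s\<close>, and on it their commutator is the
  identity.\<close>

lemma weyl_tower:
  fixes scale :: "'a::field_char_0 \<Rightarrow> 'b::ab_group_add \<Rightarrow> 'b"
  assumes "vector_space scale" and q: "q = r + (1::nat)"
    and P: "\<And>k. module.subspace scale (P k)" "\<And>k. \<exists>F. finite F \<and> P k \<subseteq> module.span scale F"
    and a: "\<And>k. lin_on scale (P (k + 1)) (a k)" "\<And>k x. x \<in> P (k + 1) \<Longrightarrow> a k x \<in> P k"
    and b: "\<And>k. lin_on scale (P (k + r)) (b k)" "\<And>k x. x \<in> P (k + r) \<Longrightarrow> b k x \<in> P k"
    and s: "\<And>k. lin_on scale (P (k + q)) (s k)" "\<And>k x. x \<in> P (k + q) \<Longrightarrow> s k x \<in> P k"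
    and comm: "\<And>k x. x \<in> P (k + q) \<Longrightarrow> s k x = a k (b (k + 1) x) - b k (a (k + r) x)"
    and sa: "\<And>k x. x \<in> P (k + q + 1) \<Longrightarrow> s k (a (k + q) x) = a k (s (k + 1) x)"
    and sb: "\<And>k x. x \<in> P (k + q + r) \<Longrightarrow> s k (b (k + q) x) = b k (s (k + r) x)"
    and inj: "\<And>k x. x \<in> P (k + q) \<Longrightarrow> s k x = 0 \<Longrightarrow> x = 0"
  shows "\<exists>k0. \<forall>k\<ge>k0. P k = {0}"
proof (rule ccontr)
  assume inf: "\<not> ?thesis"
  interpret vector_space scale by fact
  let ?sc = "\<lambda>c (f::nat \<Rightarrow> 'b) k. scale c (f k)"
  interpret W: vector_space ?sc by (rule vector_space_fun)
  have q0: "q > 0" using q by simp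
  \<comment> \<open>Injectivity of \<open>s\<close> propagates a zero stage upwards in its residue
    class modulo \<open>q\<close>.\<close>
  have down: "P (k + q * j) = {0}" if "P k = {0}" for k j
  proof (induction j)
    case (Suc j)
    have "P (k + q * j + q) \<subseteq> {0}" using s(2)[of _ "k + q * j"] inj[of _ "k + q * j"] Suc by auto
    then show ?case using subspace_0[OF P(1)] by (auto simp: algebra_simps)
  qed (use that in simp)
  \<comment> \<open>Were each of the \<open>q\<close> residue classes to reach zero, all stages from
    \<open>q * M\<close> on would vanish.\<close>
  obtain i where i: "i < q" "\<And>j. P (i + q * j) \<noteq> {0}"
  proof (rule ccontr)
    assume "\<not> thesis"
    then have "\<forall>i<q. \<exists>j. P (i + q * j) = {0}" using that by blast
    then obtain J where J: "\<And>i. i < q \<Longrightarrow> P (i + q * J i) = {0}" by metis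
    define M where "M = (\<Sum>i<q. J i)"
    have "P k = {0}" if "k \<ge> q * M" for k
    proof -
      have lt: "k mod q < q" using q0 by simp
      have "J (k mod q) \<le> M" unfolding M_def using lt by (intro member_le_sum) auto
      moreover have "M \<le> k div q" using that q0 by (metis div_le_mono nonzero_mult_div_cancel_left not_gr_zero)
      ultimately obtain d where d: "k div q = J (k mod q) + d" using le_Suc_ex le_trans by blast
      have "k = k mod q + q * J (k mod q) + q * d"
        using d by (metis add.assoc add_mult_distrib2 mod_mult_div_eq)
      then show ?thesis using down[OF J[OF lt], of d] by simp
    qed
    then show False using inf by blast
  qed
  obtain F0 where F0: "finite F0" "P i \<subseteq> span F0" using P(2) by blast
  obtain f where f: "\<And>j. f j \<in> P (i + q * j)" "\<And>j. s (i + q * j) (f (Suc j)) = f j" "f 0 \<noteq> 0"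
  proof (rule inverse_limit_nonzero[of "\<lambda>j. P (i + q * j)" "\<lambda>j. s (i + q * j)" F0])
    fix j x
    have eq: "i + q * Suc j = i + q * j + q" by simp
    show "subspace (P (i + q * j))" by (rule P)
    show "lin_on scale (P (i + q * Suc j)) (s (i + q * j))" unfolding eq by (rule s)
    show "x \<in> P (i + q * Suc j) \<Longrightarrow> s (i + q * j) x \<in> P (i + q * j)" unfolding eq by (rule s)
    show "x \<in> P (i + q * Suc j) \<Longrightarrow> s (i + q * j) x = 0 \<Longrightarrow> x = 0" unfolding eq by (rule inj)
  qed (use F0 i in auto)
  \<comment> \<open>Sequences over all degrees and not over one residue class, because
    \<open>a\<close> and \<open>b\<close> change the class.\<close>
  define E where "E = {f. \<forall>k. f k \<in> P k \<and> s k (f (k + q)) = f k}"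
  have s0: "s k 0 = 0" for k using lin_on_zero[OF s(1) P(1)] .
  have EP: "g k \<in> P k" and Es: "s k (g (k + q)) = g k" if "g \<in> E" for g k using that by (auto simp: E_def)
  have E: "W.subspace E"
  proof (rule W.subspaceI)
    show "0 \<in> E" using subspace_0[OF P(1)] s0 by (simp add: E_def)
    show "x + y \<in> E" if "x \<in> E" "y \<in> E" for x y
      using that lin_onD(1)[OF s(1)] subspace_add[OF P(1)] by (simp add: E_def)
    show "(\<lambda>k. scale c (x k)) \<in> E" if "x \<in> E" for x c
      using that lin_onD(2)[OF s(1)] subspace_scale[OF P(1)] by (simp add: E_def)
  qed
  \<comment> \<open>An element of \<open>E\<close> is determined by its first \<open>q\<close>
    entries, because \<open>s\<close> is injective.\<close>
  define R where "R = (\<lambda>(f::nat \<Rightarrow> 'b) k. if k < q then f k else 0)"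
  obtain Fk where Fk: "\<And>k. finite (Fk k)" "\<And>k. P k \<subseteq> span (Fk k)" using P(2) by metis
  define FF where "FF = (\<Union>k<q. (\<lambda>v l. if l = k then v else 0) ` Fk k)"
  have finFF: "finite FF" by (auto simp: FF_def Fk)
  have single: "(\<lambda>l. if l = k then x else 0) \<in> W.span FF" if "k < q" "x \<in> P k" for k x
  proof -
    have "x \<in> span (Fk k)" using that Fk by blast
    then show ?thesis
    proof (induction rule: span_induct_alt)
      case base
      have "(\<lambda>l. if l = k then 0 else 0) = (0::nat \<Rightarrow> 'b)" by auto
      then show ?case using W.span_zero by metis
    next
      case (step c x y)
      have "(\<lambda>l. if l = k then x else 0) \<in> W.span FF"
        using step that by (intro W.span_base) (auto simp: FF_def)
      then have "(\<lambda>j. scale c (if j = k then x else 0)) + (\<lambda>l. if l = k then y else 0) \<in> W.span FF"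
        using step W.span_scale W.span_add by blast
      moreover have "(\<lambda>j. scale c (if j = k then x else 0)) + (\<lambda>l. if l = k then y else 0)
          = (\<lambda>l. if l = k then scale c x + y else 0)" by auto
      ultimately show ?case by simp
    qed
  qed
  obtain B where B: "finite B" "\<not> W.dependent B" "B \<subseteq> E" "W.span B = E"
  proof (rule W.finite_basis_of_injective[OF E])
    show "vector_space ?sc" by (rule vector_space_fun)
    show "Vector_Spaces.linear ?sc ?sc R"
      by unfold_locales (auto simp: R_def)
    show "finite FF" by (rule finFF)
    show "R ` E \<subseteq> W.span FF"
    proof
      fix y assume "y \<in> R ` E"
      then obtain g where g: "g \<in> E" "y = R g" by blast
      have "y = (\<Sum>k<q. (\<lambda>l. if l = k then g k else 0))"
        unfolding g R_def by (rule ext) (simp add: sum.delta sum_apply cong: if_cong)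
      also have "\<dots> \<in> W.span FF" using single EP[OF g(1)] by (intro W.span_sum) auto
      finally show "y \<in> W.span FF" .
    qed
    fix g assume g: "g \<in> E" "R g = 0"
    have "g k = 0" for k
    proof (induction k rule: less_induct)
      case (less k)
      show ?case
      proof (cases "k < q")
        case True then show ?thesis using fun_cong[OF g(2), of k] by (simp add: R_def)
      next
        case False
        have "g (k - q) = 0" using less False q0 by simp
        then show ?thesis using Es[OF g(1), of "k - q"] EP[OF g(1), of k] inj[of "g k" "k - q"] False by simp
      qed
    qed
    then show "g = 0" by auto
  next
    fix B assume "finite B" "\<not> W.dependent B" "B \<subseteq> E" "W.span B = E"
    then show thesis by (rule that)
  qed
  have "E = {0}"
  proof -
    let ?a = "\<lambda>f k. a k (f (k + 1))" and ?b = "\<lambda>f k. b k (f (k + r))"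
    show ?thesis
    proof (rule commutator_trace_contradiction[OF vector_space_fun[where 'i = nat] B(1,2,4), where a = ?a and b = ?b])
    have aadd: "a k ((f + g) (k + 1)) = a k (f (k + 1)) + a k (g (k + 1))" if "f \<in> E" "g \<in> E" for f g k
      using lin_onD(1)[OF a(1) EP[OF that(1)] EP[OF that(2)], of k] by simp
    have asc: "a k (scale c (f (k + 1))) = scale c (a k (f (k + 1)))" if "f \<in> E" for f k c
      using lin_onD(2)[OF a(1) EP[OF that], of k] by simp
    show "lin_on ?sc E ?a"
      unfolding lin_on_def by (intro conjI ballI allI; rule ext) (simp_all only: aadd[unfolded plus_fun_def] asc plus_fun_def)
    have badd: "b k ((f + g) (k + r)) = b k (f (k + r)) + b k (g (k + r))" if "f \<in> E" "g \<in> E" for f g k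
      using lin_onD(1)[OF b(1) EP[OF that(1)] EP[OF that(2)], of k] by simp
    have bsc: "b k (scale c (f (k + r))) = scale c (b k (f (k + r)))" if "f \<in> E" for f k c
      using lin_onD(2)[OF b(1) EP[OF that], of k] by simp
    show "lin_on ?sc E ?b"
      unfolding lin_on_def by (intro conjI ballI allI; rule ext) (simp_all only: badd[unfolded plus_fun_def] bsc plus_fun_def)
    fix g assume g: "g \<in> E"
    have "s k (a (k + q) (g (k + q + 1))) = a k (g (k + 1))" for k
    proof -
      have "s k (a (k + q) (g (k + q + 1))) = a k (s (k + 1) (g (k + q + 1)))" by (rule sa[OF EP[OF g]])
      also have "k + q + 1 = k + 1 + q" by simp
      also have "s (k + 1) (g (k + 1 + q)) = g (k + 1)" by (rule Es[OF g])
      finally show ?thesis by simp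
    qed
    then show "?a g \<in> E" using a(2) EP[OF g] by (simp add: E_def)
    have "s k (b (k + q) (g (k + q + r))) = b k (g (k + r))" for k
    proof -
      have "s k (b (k + q) (g (k + q + r))) = b k (s (k + r) (g (k + q + r)))" by (rule sb[OF EP[OF g]])
      also have "k + q + r = k + r + q" by simp
      also have "s (k + r) (g (k + r + q)) = g (k + r)" by (rule Es[OF g])
      finally show ?thesis by (simp add: algebra_simps)
    qed
    then show "?b g \<in> E" using b(2) EP[OF g] by (simp add: E_def)
    show "?a (?b g) - ?b (?a g) = g"
    proof
      fix k
      have "g k = s k (g (k + q))" using Es[OF g] by simp
      also have "\<dots> = a k (b (k + 1) (g (k + q))) - b k (a (k + r) (g (k + q)))"
        by (rule comm[OF EP[OF g]])
      finally show "(?a (?b g) - ?b (?a g)) k = g k" using q by (simp add: add.commute add.left_commute)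
    qed
    qed
  qed
  \<comment> \<open>The thread lives on one residue class; extended by zero to the other classes it
    is a nonzero element of \<open>E\<close>.\<close>
  moreover define g where "g = (\<lambda>k. if k mod q = i then f (k div q) else 0)"
  have "g \<in> E"
  proof -
    have "g k \<in> P k" for k
      using f(1)[of "k div q"] subspace_0[OF P(1)] by (auto simp: g_def)
    moreover have "s k (g (k + q)) = g k" for k
      using f(2)[of "k div q"] s0 q0 by (auto simp: g_def)
    ultimately show ?thesis by (simp add: E_def)
  qed
  moreover have "g i \<noteq> 0" using f(3) i(1) by (simp add: g_def)
  ultimately show False by auto
qed

text \<open>For \<open>p = \<Sum> c\<^sub>i X\<^sup>i\<close> this is \<open>p(D) x\<close>.\<close>

definition poly_act :: "('a::field \<Rightarrow> 'b::ab_group_add \<Rightarrow> 'b) \<Rightarrow> ('b \<Rightarrow> 'b) \<Rightarrow> 'a poly \<Rightarrow> 'b \<Rightarrow> 'b" where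
  "poly_act scale D p x = (\<Sum>i\<le>Polynomial.degree p. scale (Polynomial.coeff p i) ((D ^^ i) x))"

text \<open>The powers of \<open>D\<close> on one vector \<open>x\<close> are linearly dependent, so
  some nonzero polynomial p has p(D) x = 0. Linear factors X - c are split off one after another; as
  soon as the quotient p' has p'(D) x nonzero, that vector is an eigenvector for c.\<close>

lemma eigenvector_exists:
  fixes scale :: "'a::alg_closed_field \<Rightarrow> 'b::ab_group_add \<Rightarrow> 'b"
  assumes "vector_space scale"
    and E: "module.subspace scale E" "finite F" "E \<subseteq> module.span scale F" "E \<noteq> {0}"
    and D: "lin_on scale E D" "\<And>x. x \<in> E \<Longrightarrow> D x \<in> E"
  obtains c x where "x \<in> E" "x \<noteq> 0" "D x = scale c x"
proof -
  interpret vector_space scale by fact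
  have DE: "(D ^^ i) x \<in> E" if "x \<in> E" for i x using that D(2) by (induction i) auto
  have pE: "poly_act scale D p x \<in> E" if "x \<in> E" for p x
    unfolding poly_act_def using that DE subspace_scale[OF E(1)] by (intro subspace_sum[OF E(1)]) auto
  have act: "poly_act scale D p x = (\<Sum>i\<le>N. scale (Polynomial.coeff p i) ((D ^^ i) x))" if "Polynomial.degree p \<le> N" for p x N
    unfolding poly_act_def using that by (intro sum.mono_neutral_left) (auto simp: coeff_eq_0)
  have mult: "poly_act scale D ([:- c, 1:] * p) x = D (poly_act scale D p x) - scale c (poly_act scale D p x)"
    if x: "x \<in> E" for p c x
  proof -
    let ?N = "Polynomial.degree p"
    have "Polynomial.degree ([:- c, 1:] * p) \<le> Suc ?N"
      using Polynomial.degree_mult_le[of "[:- c, 1:]" p] by simp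
    then have "poly_act scale D ([:- c, 1:] * p) x = (\<Sum>i\<le>Suc ?N. scale (Polynomial.coeff ([:- c, 1:] * p) i) ((D ^^ i) x))"
      by (rule act)
    also have "\<dots> = (\<Sum>i\<le>Suc ?N. scale (Polynomial.coeff (pCons 0 p) i) ((D ^^ i) x)) - (\<Sum>i\<le>Suc ?N. scale (c * Polynomial.coeff p i) ((D ^^ i) x))"
      by (simp add: sum_subtractf[symmetric] scale_left_diff_distrib[symmetric] del: sum.atMost_Suc)
    also have "(\<Sum>i\<le>Suc ?N. scale (Polynomial.coeff (pCons 0 p) i) ((D ^^ i) x)) = (\<Sum>i\<le>?N. scale (Polynomial.coeff p i) (D ((D ^^ i) x)))"
      by (subst sum.atMost_Suc_shift) simp
    also have "\<dots> = (\<Sum>i\<le>?N. D (scale (Polynomial.coeff p i) ((D ^^ i) x)))"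
      using lin_onD(2)[OF D(1) DE[OF x]] by simp
    also have "\<dots> = D (poly_act scale D p x)"
      unfolding poly_act_def by (subst lin_on_sum[OF D(1) E(1)]) (use DE[OF x] subspace_scale[OF E(1)] in auto)
    also have "(\<Sum>i\<le>Suc ?N. scale (c * Polynomial.coeff p i) ((D ^^ i) x)) = scale c (poly_act scale D p x)"
      by (subst act[of p "Suc ?N"]) (simp_all add: coeff_eq_0 scale_sum_right scale_scale[symmetric] scale_right_distrib del: scale_scale)
    finally show ?thesis .
  qed
  obtain x where x: "x \<in> E" "x \<noteq> 0" using E(4) subspace_0[OF E(1)] by blast
  have "\<exists>c x. x \<in> E \<and> x \<noteq> 0 \<and> D x = scale c x" if "p \<noteq> 0" "poly_act scale D p x = 0" for p
    using that
  proof (induction "Polynomial.degree p" arbitrary: p rule: less_induct)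
    case less
    show ?case
    proof (cases "Polynomial.degree p = 0")
      case True
      moreover have "Polynomial.coeff p (Polynomial.degree p) \<noteq> 0" using less.prems by simp
      ultimately show ?thesis using less.prems x by (auto simp: poly_act_def)
    next
      case False
      then obtain c where "poly p c = 0" using alg_closed_imp_poly_has_root by blast
      then obtain p' where p': "p = [:- c, 1:] * p'" by (metis dvdE poly_eq_0_iff_dvd)
      have "p' \<noteq> 0" using p' less.prems by auto
      have "Polynomial.degree p = Suc (Polynomial.degree p')" unfolding p' using \<open>p' \<noteq> 0\<close> by (subst degree_mult_eq) auto
      show ?thesis
      proof (cases "poly_act scale D p' x = 0")
        case True
        then show ?thesis using less.hyps[of p'] \<open>p' \<noteq> 0\<close> \<open>Polynomial.degree p = _\<close> by simp
      next
        case False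
        have "D (poly_act scale D p' x) = scale c (poly_act scale D p' x)"
          using mult[OF x(1), of c p'] less.prems p' by simp
        then show ?thesis using False pE[OF x(1)] by blast
      qed
    qed
  qed
  moreover obtain N c where c: "(\<Sum>i\<le>N. scale (c i) ((D ^^ i) x)) = 0" "\<exists>i\<le>N. c i \<noteq> 0"
    by (rule nontrivial_relation[OF E(2), of "\<lambda>i. (D ^^ i) x"]) (use DE[OF x(1)] E(3) in auto)
  define p where "p = Poly (map c [0..<Suc N])"
  have cp: "Polynomial.coeff p i = (if i \<le> N then c i else 0)" for i
    by (auto simp: p_def nth_default_def simp del: upt_Suc)
  have "p \<noteq> 0" using c(2) cp by (metis coeff_0)
  moreover have "Polynomial.degree p \<le> N" using cp by (intro Polynomial.degree_le) auto
  then have "poly_act scale D p x = 0" using c(1) by (subst act[of p N]) (auto simp: cp)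
  ultimately show ?thesis using that by blast
qed

text \<open>The joint eigenspace of the first \<open>k\<close> operators is stable under the next
  one because they commute, so the next eigenvector can be sought inside it.\<close>

lemma common_eigenvector_exists:
  fixes scale :: "'a::alg_closed_field \<Rightarrow> 'b::ab_group_add \<Rightarrow> 'b" and n :: nat
  assumes "vector_space scale"
    and E: "module.subspace scale E" "finite F" "E \<subseteq> module.span scale F" "E \<noteq> {0}"
    and D: "\<And>i. i < n \<Longrightarrow> lin_on scale E (D i)" "\<And>i x. i < n \<Longrightarrow> x \<in> E \<Longrightarrow> D i x \<in> E"
    and comm: "\<And>i j x. i < n \<Longrightarrow> j < n \<Longrightarrow> x \<in> E \<Longrightarrow> D i (D j x) = D j (D i x)"
  obtains c x where "x \<in> E" "x \<noteq> 0" "\<And>i. i < n \<Longrightarrow> D i x = scale (c i) x"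
proof -
  interpret vector_space scale by fact
  have "\<exists>c x. x \<in> E \<and> x \<noteq> 0 \<and> (\<forall>i<k. D i x = scale (c i) x)" if "k \<le> n" for k
    using that
  proof (induction k)
    case 0 then show ?case using E(4) subspace_0[OF E(1)] by blast
  next
    case (Suc k)
    then obtain c x where c: "x \<in> E" "x \<noteq> 0" "\<forall>i<k. D i x = scale (c i) x" by auto
    define E' where "E' = {x \<in> E. \<forall>i<k. D i x = scale (c i) x}"
    have sub: "subspace E'"
    proof (rule subspaceI)
      show "0 \<in> E'" using lin_on_zero[OF D(1) E(1)] Suc.prems subspace_0[OF E(1)] by (auto simp: E'_def)
      show "x + y \<in> E'" if "x \<in> E'" "y \<in> E'" for x y
        using that lin_onD(1)[OF D(1)] Suc.prems subspace_add[OF E(1)] by (auto simp: E'_def scale_right_distrib)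
      show "scale a x \<in> E'" if "x \<in> E'" for x a
        using that lin_onD(2)[OF D(1)] Suc.prems subspace_scale[OF E(1)] by (auto simp: E'_def scale_left_commute)
    qed
    obtain a y where y: "y \<in> E'" "y \<noteq> 0" "D k y = scale a y"
    proof (rule eigenvector_exists[of scale E' F "D k"])
      show "vector_space scale" by fact
      show "subspace E'" "finite F" "E' \<subseteq> span F" "E' \<noteq> {0}" using sub E c by (auto simp: E'_def)
      show "lin_on scale E' (D k)" using D(1)[of k] Suc.prems by (auto simp: lin_on_def E'_def)
      show "D k x \<in> E'" if "x \<in> E'" for x
      proof -
        have "D i (D k x) = scale (c i) (D k x)" if "i < k" for i
          using \<open>x \<in> E'\<close> that Suc.prems comm[of i k x] lin_onD(2)[OF D(1)[of k], of x "c i"] by (auto simp: E'_def)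
        then show ?thesis using that D(2)[of k x] Suc.prems by (auto simp: E'_def)
      qed
      fix c x assume "x \<in> E'" "x \<noteq> 0" "D k x = scale c x"
      then show thesis by (rule that)
    qed
    then show ?case
      by (intro exI[of _ "c(k := a)"] exI[of _ y]) (auto simp: E'_def less_Suc_eq)
  qed
  then show ?thesis using that by blast
qed

section \<open>Symmetric tensors with slices in a linear system\<close>

text \<open>Adjacent transpositions generate all permutations. This reduces the symmetry of the
  forms attached to a prolongation to neighbouring indices.\<close>

lemma swap_invariant_imp_mset_invariant:
  assumes swap: "\<And>us i j js. f (us @ i # j # js) = f (us @ j # i # js)"
    and "mset xs = mset ys"
  shows "f xs = f ys"
proof -
  have move: "f (us @ as @ x # bs) = f (us @ x # as @ bs)" for us as x bs
  proof (induction as arbitrary: us)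
    case (Cons a as)
    have "f (us @ (a # as) @ x # bs) = f ((us @ [a]) @ as @ x # bs)" by simp
    also have "\<dots> = f ((us @ [a]) @ x # as @ bs)" by (rule Cons)
    also have "\<dots> = f (us @ x # a # as @ bs)" using swap[of us a x] by simp
    finally show ?case by simp
  qed simp
  have "f (us @ xs) = f (us @ ys)" if "mset xs = mset ys" for us
    using that
  proof (induction xs arbitrary: us ys)
    case (Cons x xs)
    then have "x \<in> set ys" by (metis list.set_intros(1) mset_eq_setD)
    then obtain as bs where ys: "ys = as @ x # bs" by (meson split_list)
    then have "mset xs = mset (as @ bs)" using Cons.prems by simp
    then have "f ((us @ [x]) @ xs) = f ((us @ [x]) @ as @ bs)" by (rule Cons.IH)
    then show ?case using move[of us as x bs] ys by simp
  qed simp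
  from this[of "[]"] show ?thesis using assms(2) by simp
qed

text \<open>\<open>X js j\<close> is the coefficient with lower indices \<open>js\<close> and upper index \<open>j\<close>.\<close>

type_synonym 'k tensor = "nat list \<Rightarrow> nat \<Rightarrow> 'k"

definition tscale :: "'k::field \<Rightarrow> 'k tensor \<Rightarrow> 'k tensor" where
  "tscale c X = (\<lambda>js j. c * X js j)"

lemma vector_space_tscale: "vector_space tscale"
  by unfold_locales (auto simp: tscale_def fun_eq_iff algebra_simps)

interpretation ts: vector_space tscale by (rule vector_space_tscale)

lemma tensors_finite_dim:
  fixes n :: nat
  obtains F where "finite F" "{X. \<forall>js j. X js j \<noteq> 0 \<longrightarrow> length js = k \<and> set js \<subseteq> {..<n} \<and> j < n} \<subseteq> ts.span F"
proof
  let ?I = "{js. set js \<subseteq> {..<n} \<and> length js = k} \<times> {..<n}"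
  define \<delta> where "\<delta> = (\<lambda>p::nat list \<times> nat. \<lambda>js j. if p = (js, j) then 1 else (0::'a))"
  have fin: "finite ?I" by (intro finite_cartesian_product finite_lists_length_eq) auto
  then show "finite (\<delta> ` ?I)" by blast
  show "{X. \<forall>js j. X js j \<noteq> 0 \<longrightarrow> length js = k \<and> set js \<subseteq> {..<n} \<and> j < n} \<subseteq> ts.span (\<delta> ` ?I)"
  proof
    fix X :: "'a tensor" assume X: "X \<in> {X. \<forall>js j. X js j \<noteq> 0 \<longrightarrow> length js = k \<and> set js \<subseteq> {..<n} \<and> j < n}"
    have "X = (\<Sum>p\<in>?I. tscale (X (fst p) (snd p)) (\<delta> p))"
    proof (intro ext)
      fix js j
      have "(\<Sum>p\<in>?I. tscale (X (fst p) (snd p)) (\<delta> p)) js j = (\<Sum>p\<in>?I. if p = (js, j) then X js j else 0)"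
        unfolding sum_apply by (intro sum.cong) (auto simp: tscale_def \<delta>_def)
      also have "\<dots> = X js j" using fin X by (auto simp: sum.delta')
      finally show "X js j = (\<Sum>p\<in>?I. tscale (X (fst p) (snd p)) (\<delta> p)) js j" by simp
    qed
    also have "\<dots> \<in> ts.span (\<delta> ` ?I)" by (intro ts.span_sum ts.span_scale ts.span_base) auto
    finally show "X \<in> ts.span (\<delta> ` ?I)" .
  qed
qed

text \<open>The linear system is kept as a set of equations and not as a subspace: extending scalars
  to the algebraic closure then amounts to applying \<open>to_ac\<close> to the
  coefficients.\<close>

definition slice_eqs :: "(nat \<Rightarrow> nat \<Rightarrow> 'k::field) set \<Rightarrow> nat \<Rightarrow> (nat \<Rightarrow> nat \<Rightarrow> 'k) \<Rightarrow> bool" where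
  "slice_eqs R n A \<longleftrightarrow> (\<forall>r\<in>R. (\<Sum>j<n. \<Sum>l<n. r j l * A j l) = 0)"

lemma slice_eqs_zero: "slice_eqs R n (\<lambda>j l. 0)"
  by (simp add: slice_eqs_def)

lemma slice_eqs_add: "slice_eqs R n A \<Longrightarrow> slice_eqs R n B \<Longrightarrow> slice_eqs R n (\<lambda>j l. A j l + B j l)"
  by (simp add: slice_eqs_def distrib_left sum.distrib)

lemma slice_eqs_scale: "slice_eqs R n A \<Longrightarrow> slice_eqs R n (\<lambda>j l. c * A j l)"
  by (simp add: slice_eqs_def mult.left_commute[of _ c] sum_distrib_left[symmetric])

text \<open>The forms of degree \<open>k\<close> in the prolongation of the linear system,
  restricted to those that do not involve the first \<open>i\<close> basis directions;
  \<open>i\<close> is the induction variable of the rank one argument. By symmetry it is enough to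
  constrain slices in the first index.\<close>

definition sym_tensors :: "(nat \<Rightarrow> nat \<Rightarrow> 'k::field) set \<Rightarrow> nat \<Rightarrow> nat \<Rightarrow> nat \<Rightarrow> 'k tensor set" where
  "sym_tensors R n i k = {X.
     (\<forall>js j. X js j \<noteq> 0 \<longrightarrow> length js = k \<and> set js \<subseteq> {i..<n} \<and> j < n) \<and>
     (\<forall>js js'. mset js = mset js' \<longrightarrow> X js = X js') \<and>
     (\<forall>js. slice_eqs R n (\<lambda>j l. X (l # js) j))}"

lemma sym_tensorsD:
  assumes "X \<in> sym_tensors R n i k"
  shows "X js j \<noteq> 0 \<Longrightarrow> length js = k \<and> set js \<subseteq> {i..<n} \<and> j < n"
    and "mset js = mset js' \<Longrightarrow> X js = X js'" and "slice_eqs R n (\<lambda>j l. X (l # js) j)"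
  using assms unfolding sym_tensors_def by blast+

lemma subspace_sym_tensors: "ts.subspace (sym_tensors R n i k)"
proof (rule ts.subspaceI)
  show "0 \<in> sym_tensors R n i k" by (simp add: sym_tensors_def slice_eqs_zero)
next
  fix X Y assume X: "X \<in> sym_tensors R n i k" and Y: "Y \<in> sym_tensors R n i k"
  show "X + Y \<in> sym_tensors R n i k"
    unfolding sym_tensors_def
  proof (intro CollectI conjI allI impI, goal_cases)
    case (1 js j) then have "X js j \<noteq> 0 \<or> Y js j \<noteq> 0" by auto
    then show ?case using sym_tensorsD(1)[OF X] sym_tensorsD(1)[OF Y] by blast
  next
    case (2 js j) then have "X js j \<noteq> 0 \<or> Y js j \<noteq> 0" by auto
    then show ?case using sym_tensorsD(1)[OF X] sym_tensorsD(1)[OF Y] by blast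
  next
    case (3 js j) then have "X js j \<noteq> 0 \<or> Y js j \<noteq> 0" by auto
    then show ?case using sym_tensorsD(1)[OF X] sym_tensorsD(1)[OF Y] by blast
  next
    case (4 js js') then show ?case using sym_tensorsD(2)[OF X 4] sym_tensorsD(2)[OF Y 4] by simp
  next
    case (5 js) then show ?case using slice_eqs_add[OF sym_tensorsD(3)[OF X] sym_tensorsD(3)[OF Y]] by simp
  qed
next
  fix c X assume X: "X \<in> sym_tensors R n i k"
  show "tscale c X \<in> sym_tensors R n i k"
    unfolding sym_tensors_def tscale_def
  proof (intro CollectI conjI allI impI, goal_cases)
    case (1 js j) then show ?case using sym_tensorsD(1)[OF X, of js j] by auto
  next
    case (2 js j) then show ?case using sym_tensorsD(1)[OF X, of js j] by auto
  next
    case (3 js j) then show ?case using sym_tensorsD(1)[OF X, of js j] by auto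
  next
    case (4 js js') then show ?case using sym_tensorsD(2)[OF X 4] by simp
  next
    case (5 js) then show ?case using slice_eqs_scale[OF sym_tensorsD(3)[OF X]] by simp
  qed
qed

text \<open>The characteristic variety argument without commutative algebra: among the tensors not
  involving the indices below \<open>i\<close>, contraction with \<open>e\<^sub>i\<close> is eventually bijective, and a
  common eigenvector of the other contractions has a slice of rank one.\<close>

theorem no_rank_one_imp_finite_type:
  fixes R :: "(nat \<Rightarrow> nat \<Rightarrow> 'f::alg_closed_field) set"
  assumes norank1: "\<And>z \<eta>. \<exists>j<n. z j \<noteq> 0 \<Longrightarrow> \<exists>l<n. \<eta> l \<noteq> 0 \<Longrightarrow> \<not> slice_eqs R n (\<lambda>j l. z j * \<eta> l)"
  shows "\<exists>k0. \<forall>k\<ge>k0. sym_tensors R n 0 k = {0}"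
proof -
  let ?T = "sym_tensors R n"
  \<comment> \<open>Descending induction on \<open>i\<close>: from the tensors avoiding all indices
    up to \<open>i\<close> to those avoiding only the indices below \<open>i\<close>.\<close>
  have step: "\<exists>k0. \<forall>k\<ge>k0. ?T i k = {0}" if "i < n" and ex: "\<exists>k0. \<forall>k\<ge>k0. ?T (Suc i) k = {0}" for i
  proof -
    obtain k0 where k0: "\<And>k. k \<ge> k0 \<Longrightarrow> ?T (Suc i) k = {0}" using ex by blast
    define C where "C = (\<lambda>(l::nat) (X::'f tensor) js. X (l # js))"
    have C: "C l X \<in> ?T i k" if X: "X \<in> ?T i (Suc k)" for l k X
      unfolding sym_tensors_def C_def
    proof (intro CollectI conjI allI impI, goal_cases)
      case (1 js j) then show ?case using sym_tensorsD(1)[OF X, of "l # js" j] by auto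
    next
      case (2 js j) then show ?case using sym_tensorsD(1)[OF X, of "l # js" j] by auto
    next
      case (3 js j) then show ?case using sym_tensorsD(1)[OF X, of "l # js" j] by auto
    next
      case (4 js js') then show ?case by (intro sym_tensorsD(2)[OF X]) simp
    next
      case (5 js)
      have "X (l # l' # js) = X (l' # l # js)" for l' by (intro sym_tensorsD(2)[OF X]) simp
      then show ?case using sym_tensorsD(3)[OF X, of "l # js"] by simp
    qed
    have Clin: "lin_on tscale S (C l)" for l S
      by (auto simp: lin_on_def C_def tscale_def fun_eq_iff)
    \<comment> \<open>A symmetric tensor killed by contraction with the basis vector of index
      \<open>i\<close> involves that index nowhere, so it belongs to the previous induction stage,
      which is zero from order \<open>k0\<close> on.\<close>
    have Cinj: "X = 0" if X: "X \<in> ?T i k" and z: "C i X = 0" and k: "k \<ge> k0" for k X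
    proof -
      have "X \<in> ?T (Suc i) k"
      proof -
        have "i \<notin> set js" if nz: "X js j \<noteq> 0" for js j
        proof
          assume "i \<in> set js"
          then obtain as bs where js: "js = as @ i # bs" by (meson split_list)
          have "X js = X (i # as @ bs)" by (intro sym_tensorsD(2)[OF X]) (simp add: js)
          also have "\<dots> = 0" using fun_cong[OF z, of "as @ bs"] by (simp add: C_def)
          finally show False using nz by simp
        qed
        moreover have "{i..<n} - {i} = {Suc i..<n}" by auto
        ultimately show ?thesis
          using sym_tensorsD[OF X] unfolding sym_tensors_def by blast
      qed
      then show ?thesis using k0[OF k] by simp
    qed
    show ?thesis
    proof (rule ccontr)
      assume inf: "\<not> ?thesis"
      \<comment> \<open>By injectivity one zero stage would force all later ones to vanish.\<close>
      have ne: "?T i (k0 + m) \<noteq> {0}" for m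
      proof
        assume z: "?T i (k0 + m) = {0}"
        have "?T i k = {0}" if "k \<ge> k0 + m" for k
          using that
        proof (induction k rule: dec_induct)
          case (step k)
          have "X = 0" if X: "X \<in> ?T i (Suc k)" for X
          proof (rule Cinj[OF X])
            show "C i X = 0" using C[OF X, of i] step.IH by (metis singletonD)
            show "Suc k \<ge> k0" using step.hyps by simp
          qed
          then show ?case using ts.subspace_0[OF subspace_sym_tensors] by blast
        qed (rule z)
        then show False using inf by blast
      qed
      obtain F where F: "finite F" "{X::'f tensor. \<forall>js j. X js j \<noteq> 0 \<longrightarrow> length js = k0 \<and> set js \<subseteq> {..<n} \<and> j < n} \<subseteq> ts.span F"
        by (rule tensors_finite_dim)
      have TF: "?T i k0 \<subseteq> ts.span F"
      proof (intro subset_trans[OF _ F(2)] subsetI CollectI allI impI)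
        fix X js j assume "X \<in> ?T i k0" "X js j \<noteq> 0"
        then show "length js = k0 \<and> set js \<subseteq> {..<n} \<and> j < n" using sym_tensorsD(1)[of X R n i k0 js j] by auto
      qed
      obtain f where f: "\<And>m. f m \<in> ?T i (k0 + m)" "\<And>m. C i (f (Suc m)) = f m" "f 0 \<noteq> 0"
      proof (rule ts.inverse_limit_nonzero[of "\<lambda>m. ?T i (k0 + m)" "\<lambda>m. C i" F])
        fix m X
        show "X \<in> ?T i (k0 + Suc m) \<Longrightarrow> C i X \<in> ?T i (k0 + m)" using C by simp
        show "X \<in> ?T i (k0 + Suc m) \<Longrightarrow> C i X = 0 \<Longrightarrow> X = 0" using Cinj[of X "k0 + Suc m"] by simp
      next
        fix f assume "\<And>m. f m \<in> ?T i (k0 + m)" "\<And>m. C i (f (Suc m)) = f m" "f 0 \<noteq> 0"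
        then show thesis by (rule that)
      qed (use subspace_sym_tensors Clin F TF ne in auto)
      \<comment> \<open>The threads of the contraction with index \<open>i\<close>, each packed into
        one tensor with components of all orders at least \<open>k0\<close>. On \<open>E\<close>
        that contraction is the identity, while the other contractions act on \<open>E\<close> and
        commute by symmetry.\<close>
      define E where "E = {X::'f tensor. (\<forall>js j. X js j \<noteq> 0 \<longrightarrow> length js \<ge> k0 \<and> set js \<subseteq> {i..<n} \<and> j < n) \<and>
        (\<forall>js js'. mset js = mset js' \<longrightarrow> X js = X js') \<and> (\<forall>js. length js \<ge> k0 \<longrightarrow> X (i # js) = X js) \<and>
        (\<forall>js. length js \<ge> k0 \<longrightarrow> slice_eqs R n (\<lambda>j l. X (l # js) j))}"
      have E1: "X js j \<noteq> 0 \<Longrightarrow> length js \<ge> k0 \<and> set js \<subseteq> {i..<n} \<and> j < n"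
        and E2: "mset js = mset js' \<Longrightarrow> X js = X js'" and E3: "length js \<ge> k0 \<Longrightarrow> X (i # js) = X js"
        and E4: "length js \<ge> k0 \<Longrightarrow> slice_eqs R n (\<lambda>j l. X (l # js) j)" if "X \<in> E" for X js js' j
        using that unfolding E_def by blast+
      have subE: "ts.subspace E"
      proof (rule ts.subspaceI)
        show "0 \<in> E" by (simp add: E_def slice_eqs_zero)
      next
        fix X Y assume X: "X \<in> E" and Y: "Y \<in> E"
        show "X + Y \<in> E"
          unfolding E_def
        proof (intro CollectI conjI allI impI, goal_cases)
          case (1 js j) then have "X js j \<noteq> 0 \<or> Y js j \<noteq> 0" by auto
          then show ?case using E1[OF X] E1[OF Y] by blast
        next
          case (2 js j) then have "X js j \<noteq> 0 \<or> Y js j \<noteq> 0" by auto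
          then show ?case using E1[OF X] E1[OF Y] by blast
        next
          case (3 js j) then have "X js j \<noteq> 0 \<or> Y js j \<noteq> 0" by auto
          then show ?case using E1[OF X] E1[OF Y] by blast
        next
          case (4 js js') then show ?case using E2[OF X 4] E2[OF Y 4] by simp
        next
          case (5 js) then show ?case using E3[OF X 5] E3[OF Y 5] by simp
        next
          case (6 js) then show ?case using slice_eqs_add[OF E4[OF X 6] E4[OF Y 6]] by simp
        qed
      next
        fix c X assume X: "X \<in> E"
        show "tscale c X \<in> E"
          unfolding E_def tscale_def
        proof (intro CollectI conjI allI impI, goal_cases)
          case (1 js j) then show ?case using E1[OF X, of js j] by auto
        next
          case (2 js j) then show ?case using E1[OF X, of js j] by auto
        next
          case (3 js j) then show ?case using E1[OF X, of js j] by auto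
        next
          case (4 js js') then show ?case using E2[OF X 4] by simp
        next
          case (5 js) then show ?case using E3[OF X 5] by simp
        next
          case (6 js) then show ?case using slice_eqs_scale[OF E4[OF X 6]] by simp
        qed
      qed
      \<comment> \<open>An element is determined by its component of order \<open>k0\<close>, by
        injectivity of the contraction with index \<open>i\<close>; hence \<open>E\<close> is finite
        dimensional.\<close>
      have Ezero: "X = 0" if X: "X \<in> E" and z: "\<And>js. length js = k0 \<Longrightarrow> X js = 0" for X
      proof -
        have "X js = 0" if "length js = k0 + m" for js m
          using that
        proof (induction m arbitrary: js)
          case 0 then show ?case using z by simp
        next
          case (Suc m)
          define Y where "Y = (\<lambda>js. if length js = Suc (k0 + m) then X js else 0)"
          have "Y \<in> ?T i (Suc (k0 + m))"
            unfolding sym_tensors_def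
          proof (intro CollectI conjI allI impI, goal_cases)
            case (1 js j) then show ?case by (auto simp: Y_def split: if_splits)
          next
            case (2 js j) then show ?case using E1[OF X, of js j] by (auto simp: Y_def split: if_splits)
          next
            case (3 js j) then show ?case using E1[OF X, of js j] by (auto simp: Y_def split: if_splits)
          next
            case (4 js js') then show ?case using E2[OF X 4] mset_eq_length[OF 4] by (simp add: Y_def)
          next
            case (5 js) then show ?case using E4[OF X, of js] slice_eqs_zero by (cases "length js = k0 + m") (auto simp: Y_def)
          qed
          moreover have "C i Y = 0"
            using Suc.IH E3[OF X] by (auto simp: C_def Y_def fun_eq_iff)
          ultimately have "Y = 0" using Cinj[of Y "Suc (k0 + m)"] by simp
          have "X js = 0" using Suc.prems fun_cong[OF \<open>Y = 0\<close>, of js] by (simp add: Y_def)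
          then show ?case .
        qed
        moreover have "X js = 0" if "length js < k0" for js
          using E1[OF X, of js] that by (intro ext) (force simp: not_less)
        ultimately have "X js = 0" for js using le_add_diff_inverse[of k0 "length js"] by (metis not_less)
        then show ?thesis by (intro ext) simp
      qed
      define res where "res = (\<lambda>(X::'f tensor) js. if length js = k0 then X js else 0)"
      obtain B where B: "finite B" "\<not> ts.dependent B" "B \<subseteq> E" "ts.span B = E"
      proof (rule ts.finite_basis_of_injective[OF subE vector_space_tscale])
        show "Vector_Spaces.linear tscale tscale res"
          by unfold_locales (auto simp: res_def tscale_def fun_eq_iff)
        show "X = 0" if "X \<in> E" "res X = 0" for X
        proof (rule Ezero[OF that(1)])
          show "X js = 0" if "length js = k0" for js using fun_cong[OF \<open>res X = 0\<close>, of js] that by (simp add: res_def)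
        qed
        show "finite F" by (rule F(1))
        have "res ` E \<subseteq> {X. \<forall>js j. X js j \<noteq> 0 \<longrightarrow> length js = k0 \<and> set js \<subseteq> {..<n} \<and> j < n}"
        proof (intro subsetI CollectI allI impI)
          fix Y js j assume "Y \<in> res ` E" and nz: "Y js j \<noteq> 0"
          then obtain X where X: "X \<in> E" "Y = res X" by blast
          have "length js = k0" "X js j \<noteq> 0" using nz X(2) by (auto simp: res_def split: if_splits)
          then show "length js = k0 \<and> set js \<subseteq> {..<n} \<and> j < n" using E1[OF X(1), of js j] by auto
        qed
        then show "res ` E \<subseteq> ts.span F" by (rule subset_trans[OF _ F(2)])
      next
        fix B assume "finite B" "\<not> ts.dependent B" "B \<subseteq> E" "ts.span B = E"
        then show thesis by (rule that)
      qed
      define X0 where "X0 = (\<lambda>js. if length js \<ge> k0 then f (length js - k0) js else 0)"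
      have "X0 \<in> E"
        unfolding E_def
      proof (intro CollectI conjI allI impI, goal_cases)
        case (1 js j) then show ?case by (auto simp: X0_def split: if_splits)
      next
        case (2 js j) then show ?case using sym_tensorsD(1)[OF f(1), of "length js - k0" js j] by (auto simp: X0_def split: if_splits)
      next
        case (3 js j) then show ?case using sym_tensorsD(1)[OF f(1), of "length js - k0" js j] by (auto simp: X0_def split: if_splits)
      next
        case (4 js js') then show ?case using mset_eq_length[OF 4] sym_tensorsD(2)[OF f(1) 4] by (simp add: X0_def)
      next
        case (5 js)
        then have "X0 (i # js) = C i (f (Suc (length js - k0))) js" by (simp add: X0_def C_def Suc_diff_le)
        then show ?case using 5 by (simp add: f X0_def)
      next
        case (6 js)
        then show ?case using sym_tensorsD(3)[OF f(1)[of "Suc (length js - k0)"], of js] by (simp add: X0_def Suc_diff_le)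
      qed
      moreover have "X0 \<noteq> 0"
      proof
        assume "X0 = 0"
        have "f 0 js j = 0" if "length js = k0" for js j
          using that fun_cong[OF \<open>X0 = 0\<close>, of js] by (simp add: X0_def)
        moreover have "f 0 js j = 0" if "length js \<noteq> k0" for js j
          using that sym_tensorsD(1)[OF f(1)[of 0], of js j] by auto
        ultimately have "f 0 js j = 0" for js j by (cases "length js = k0")
        then have "f 0 = 0" by (intro ext) simp
        then show False using f(3) by simp
      qed
      ultimately have Ene: "E \<noteq> {0}" by blast
      \<comment> \<open>The cut-off removes the component of order \<open>k0 - 1\<close> that
        contraction would otherwise create.\<close>
      define D where "D = (\<lambda>l (X::'f tensor) js. if length js \<ge> k0 then X (l # js) else 0)"
      have DE: "D l X \<in> E" if X: "X \<in> E" for l X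
        unfolding E_def
      proof (intro CollectI conjI allI impI, goal_cases)
        case (1 js j) then show ?case by (auto simp: D_def split: if_splits)
      next
        case (2 js j) then show ?case using E1[OF X, of "l # js" j] by (auto simp: D_def split: if_splits)
      next
        case (3 js j) then show ?case using E1[OF X, of "l # js" j] by (auto simp: D_def split: if_splits)
      next
        case (4 js js') then show ?case using mset_eq_length[OF 4] E2[OF X, of "l # js" "l # js'"] by (simp add: D_def)
      next
        case (5 js) then show ?case using E2[OF X, of "l # i # js" "i # l # js"] E3[OF X, of "l # js"] by (simp add: D_def)
      next
        case (6 js)
        have "X (l # l' # js) = X (l' # l # js)" for l' by (rule E2[OF X]) simp
        then show ?case using 6 E4[OF X, of "l # js"] by (simp add: D_def)
      qed
      obtain c X where X: "X \<in> E" "X \<noteq> 0" "\<And>l. l < n \<Longrightarrow> D l X = tscale (c l) X"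
      proof (rule common_eigenvector_exists[OF vector_space_tscale subE B(1) _ Ene, of n D])
        show "E \<subseteq> ts.span B" using B by simp
        show "lin_on tscale E (D l)" for l by (auto simp: lin_on_def D_def tscale_def fun_eq_iff)
        show "X \<in> E \<Longrightarrow> D l X \<in> E" for l X by (rule DE)
        show "D l (D l' X) = D l' (D l X)" if "X \<in> E" for l l' X
          using E2[OF that, of "l # l' # js" "l' # l # js" for js] by (auto simp: D_def fun_eq_iff)
      next
        fix c X assume "X \<in> E" "X \<noteq> 0" "\<And>l. l < n \<Longrightarrow> D l X = tscale (c l) X"
        then show thesis by (rule that)
      qed
      have ev: "X (l # js) j = c l * X js j" if "l < n" "length js \<ge> k0" for l js j
        using fun_cong[OF fun_cong[OF X(3)[OF that(1)], of js], of j] that(2) by (simp add: D_def tscale_def)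
      have evs: "X (ls @ js) j = (\<Prod>l\<leftarrow>ls. c l) * X js j" if "set ls \<subseteq> {..<n}" "length js \<ge> k0" for ls js j
        using that(1) by (induction ls) (auto simp: ev trans_le_add2[OF that(2)] mult.assoc)
      \<comment> \<open>For the common eigenvector \<open>X\<close> with eigenvalues
        \<open>c\<close>, the slice at this multi-index is the matrix \<open>z j * c l\<close>. Both
        factors are nonzero: by symmetry every coefficient vector of order \<open>k0\<close> with
        indices in range is a multiple of \<open>z\<close>, and \<open>c i = 1\<close>.\<close>
      define z where "z = X (replicate k0 i)"
      have ci: "X (replicate m i @ js) = X js" if "length js \<ge> k0" for m js
        using that by (induction m) (auto simp: E3[OF X(1)])
      have "\<exists>j<n. z j \<noteq> 0"
      proof (rule ccontr)
        assume "\<not> ?thesis"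
        then have z0: "z j = 0" for j using E1[OF X(1), of "replicate k0 i" j] by (auto simp: z_def)
        have "X js j = 0" if js: "length js = k0" for js j
        proof (cases "set js \<subseteq> {..<n}")
          case True
          have "X js = X (replicate k0 i @ js)" using ci js by simp
          also have "\<dots> = X (js @ replicate k0 i)" by (rule E2[OF X(1)]) simp
          finally show ?thesis using evs[OF True, of "replicate k0 i" j] z0 by (simp add: z_def)
        next
          case False
          then show ?thesis using E1[OF X(1), of js j] by (metis atLeastLessThan_iff lessThan_iff subset_iff)
        qed
        then have "X = 0" by (intro Ezero[OF X(1)]) auto
        then show False using X(2) by blast
      qed
      moreover have "\<exists>l<n. c l \<noteq> 0"
      proof -
        obtain j where j: "z j \<noteq> 0" using calculation by blast
        have "X (i # replicate k0 i) j = X (replicate k0 i) j" using E3[OF X(1)] by simp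
        then have "c i * z j = z j" using ev[of i "replicate k0 i" j] \<open>i < n\<close> by (simp add: z_def)
        then show ?thesis using j \<open>i < n\<close> by (intro exI[of _ i]) auto
      qed
      ultimately have "\<not> slice_eqs R n (\<lambda>j l. z j * c l)" by (rule norank1)
      moreover have "slice_eqs R n (\<lambda>j l. z j * c l)"
      proof -
        have "slice_eqs R n (\<lambda>j l. X (l # replicate k0 i) j)" by (rule E4[OF X(1)]) simp
        moreover have "(\<Sum>j<n. \<Sum>l<n. r j l * X (l # replicate k0 i) j) = (\<Sum>j<n. \<Sum>l<n. r j l * (z j * c l))" for r
          by (intro sum.cong) (auto simp: ev z_def)
        ultimately show ?thesis by (simp add: slice_eqs_def)
      qed
      ultimately show False by blast
    qed
  qed
  \<comment> \<open>The induction starts at \<open>i = n\<close>, where no lower index is allowed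
    and every form of positive degree is zero.\<close>
  have "\<exists>k0. \<forall>k\<ge>k0. ?T (n - m) k = {0}" if "m \<le> n" for m
    using that
  proof (induction m)
    case 0
    have "?T n k = {0}" if "k \<ge> 1" for k
    proof -
      have "X = 0" if X: "X \<in> ?T n k" for X
      proof (intro ext, rule ccontr)
        fix js j assume "X js j \<noteq> (0::'f tensor) js j"
        then have "length js = k \<and> set js \<subseteq> {n..<n}" using sym_tensorsD(1)[OF X, of js j] by auto
        then show False using \<open>k \<ge> 1\<close> by auto
      qed
      then show ?thesis using ts.subspace_0[OF subspace_sym_tensors] by blast
    qed
    then have "\<exists>k0. \<forall>k\<ge>k0. ?T (n - 0) k = {0}" by (intro exI[of _ 1]) simp
    then show ?case .
  next
    case (Suc m)
    have "n - m = Suc (n - Suc m)" using Suc.prems by arith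
    moreover have "\<exists>k0. \<forall>k\<ge>k0. ?T (n - m) k = {0}" by (rule Suc.IH) (use Suc.prems in simp)
    ultimately have "\<exists>k0. \<forall>k\<ge>k0. ?T (Suc (n - Suc m)) k = {0}" by (simp only:)
    then show ?case by (rule step[rotated]) (use Suc.prems in simp)
  qed
  from this[of n] show ?thesis by simp
qed

text \<open>Source of all double annihilator arguments: for L, for K_-2 and for the span of the
  columns. The functional is returned as a family of coefficients, which is possible because all
  functions concerned are supported in the finite set \<open>I\<close>.\<close>

lemma separating_functional:
  fixes S :: "('i \<Rightarrow> 'k::field) set"
  assumes I: "finite I" and S: "module.subspace (\<lambda>c f i. c * f i) S"
    and supp: "\<And>f i. f \<in> insert x S \<Longrightarrow> i \<notin> I \<Longrightarrow> f i = 0" and x: "x \<notin> S"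
  obtains r where "\<And>f. f \<in> S \<Longrightarrow> (\<Sum>i\<in>I. r i * f i) = 0" "(\<Sum>i\<in>I. r i * x i) \<noteq> 0"
proof -
  let ?sc = "\<lambda>c (f::'i \<Rightarrow> 'k) i. c * f i"
  interpret k: vector_space "(*) :: 'k \<Rightarrow> 'k \<Rightarrow> 'k" by unfold_locales (auto simp: algebra_simps)
  interpret v: vector_space ?sc by (rule k.vector_space_fun)
  interpret p: vector_space_pair ?sc "(*) :: 'k \<Rightarrow> 'k \<Rightarrow> 'k" ..
  obtain B where B: "B \<subseteq> S" "v.independent B" "S \<subseteq> v.span B" by (rule v.maximal_independent_subset)
  have sB: "v.span B = S" using B v.span_minimal[OF B(1) S] by auto
  then have "v.independent (insert x B)" using x B(2) by (intro v.independent_insertI) auto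
  then obtain f where f: "Vector_Spaces.linear ?sc (*) f" "\<forall>y\<in>insert x B. f y = (if y = x then 1 else 0)"
    using p.linear_independent_extend[of "insert x B" "\<lambda>y. if y = x then 1 else 0"] by blast
  interpret f: Vector_Spaces.linear ?sc "(*)" f by fact
  have "x \<notin> B" using x B by blast
  then have "f y = 0" if "y \<in> B" for y using f(2) that by auto
  then have f0: "f y = 0" if "y \<in> S" for y using f.eq_0_on_span[of B y] that sB by blast
  define r where "r = (\<lambda>i. f (\<lambda>j. if j = i then 1 else 0))"
  have fr: "f g = (\<Sum>i\<in>I. r i * g i)" if "g \<in> insert x S" for g
  proof -
    have "g = (\<Sum>i\<in>I. ?sc (g i) (\<lambda>j. if j = i then 1 else 0))"
    proof
      fix j show "g j = (\<Sum>i\<in>I. ?sc (g i) (\<lambda>j. if j = i then 1 else 0)) j"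
        using I supp[OF that, of j] by (simp add: sum_apply if_distrib[of "\<lambda>x. _ * x"] cong: if_cong)
    qed
    then have "f g = f (\<Sum>i\<in>I. ?sc (g i) (\<lambda>j. if j = i then 1 else 0))" by simp
    also have "\<dots> = (\<Sum>i\<in>I. f (?sc (g i) (\<lambda>j. if j = i then 1 else 0)))" by (rule f.sum)
    also have "\<dots> = (\<Sum>i\<in>I. g i * r i)" unfolding r_def using f.scale by (intro sum.cong) auto
    finally show ?thesis by (simp add: mult.commute)
  qed
  show ?thesis
  proof (rule that[of r])
    show "(\<Sum>i\<in>I. r i * f i) = 0" if "f \<in> S" for f using f0[OF that] fr[of f] that by simp
    show "(\<Sum>i\<in>I. r i * x i) \<noteq> 0" using fr[of x] f(2) by simp
  qed
qed

text \<open>Descent from the algebraic closure: a system of linear equations over \<open>'k\<close> is preserved by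
  applying such a functional to every coordinate of a solution.\<close>

lemma closure_functional:
  fixes c :: "'k::field alg_closure"
  assumes "c \<noteq> 0"
  obtains \<phi> :: "'k alg_closure \<Rightarrow> 'k" where "\<And>x y. \<phi> (x + y) = \<phi> x + \<phi> y"
    "\<And>a x. \<phi> (to_ac a * x) = a * \<phi> x" "\<phi> c \<noteq> 0"
proof -
  let ?sc = "\<lambda>(a::'k) (x::'k alg_closure). to_ac a * x"
  interpret k: vector_space "(*) :: 'k \<Rightarrow> 'k \<Rightarrow> 'k" by unfold_locales (auto simp: algebra_simps)
  interpret v: vector_space ?sc by unfold_locales (auto simp: algebra_simps)
  interpret p: vector_space_pair ?sc "(*) :: 'k \<Rightarrow> 'k \<Rightarrow> 'k" ..
  have "v.independent {c}" using assms by (simp add: v.dependent_single)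
  then obtain f where f: "Vector_Spaces.linear ?sc (*) f" "\<forall>y\<in>{c}. f y = 1"
    using p.linear_independent_extend[of "{c}" "\<lambda>_. 1"] by blast
  interpret f: Vector_Spaces.linear ?sc "(*)" f by fact
  show ?thesis by (rule that[of f]) (use f.add f.scale f(2) in auto)
qed

section \<open>The Lie algebra of formal vector fields\<close>

text \<open>\<open>X js\<close> stands for the derivative at the origin of the vector field \<open>X\<close> in the directions \<open>js\<close>.\<close>

primrec vf_br_at :: "nat \<Rightarrow> nat list \<Rightarrow> 'k::field tensor \<Rightarrow> 'k tensor \<Rightarrow> nat \<Rightarrow> 'k" where
  "vf_br_at n [] X Y = (\<lambda>j. \<Sum>i<n. X [i] j * Y [] i - Y [i] j * X [] i)"
| "vf_br_at n (i # is) X Y = vf_br_at n is (\<lambda>js. X (i # js)) Y + vf_br_at n is X (\<lambda>js. Y (i # js))"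

definition vf_br :: "nat \<Rightarrow> 'k::field tensor \<Rightarrow> 'k tensor \<Rightarrow> 'k tensor" where
  "vf_br n X Y = (\<lambda>is. vf_br_at n is X Y)"

lemma vf_br_Nil: "vf_br n X Y [] = (\<lambda>j. \<Sum>i<n. X [i] j * Y [] i - Y [i] j * X [] i)"
  and vf_br_Cons: "vf_br n X Y (i # is) = vf_br n (\<lambda>js. X (i # js)) Y is + vf_br n X (\<lambda>js. Y (i # js)) is"
  by (simp_all add: vf_br_def)

lemma vf_br_add_left: "vf_br n (X + X') Y = vf_br n X Y + vf_br n X' Y"
proof
  fix js show "vf_br n (X + X') Y js = (vf_br n X Y + vf_br n X' Y) js"
  proof (induction js arbitrary: X X' Y)
    case Nil show ?case by (rule ext) (simp add: vf_br_Nil algebra_simps sum.distrib sum_subtractf)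
  next
    case (Cons i js)
    have "(\<lambda>js. (X + X') (i # js)) = (\<lambda>js. X (i # js)) + (\<lambda>js. X' (i # js))" by auto
    then show ?case using Cons[of "\<lambda>js. X (i # js)" "\<lambda>js. X' (i # js)" Y] Cons[of X X' "\<lambda>js. Y (i # js)"]
      by (simp add: vf_br_Cons add_ac)
  qed
qed

lemma vf_br_scale_left: "vf_br n (tscale c X) Y = tscale c (vf_br n X Y)"
proof
  fix js show "vf_br n (tscale c X) Y js = tscale c (vf_br n X Y) js"
  proof (induction js arbitrary: X Y)
    case Nil show ?case by (rule ext) (simp add: vf_br_Nil tscale_def algebra_simps sum_distrib_left)
  next
    case (Cons i js)
    have "(\<lambda>js. tscale c X (i # js)) = tscale c (\<lambda>js. X (i # js))" by (simp add: tscale_def)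
    then show ?case using Cons[of "\<lambda>js. X (i # js)" Y] Cons[of X "\<lambda>js. Y (i # js)"]
      by (simp add: vf_br_Cons tscale_def fun_eq_iff algebra_simps)
  qed
qed

lemma vf_br_antisym: "vf_br n Y X = - vf_br n X Y"
proof
  fix js show "vf_br n Y X js = (- vf_br n X Y) js"
  proof (induction js arbitrary: X Y)
    case Nil
    have "vf_br n Y X [] j = (- vf_br n X Y) [] j" for j
      unfolding fun_Compl_def vf_br_Nil by (simp add: sum_subtractf)
    then show ?case by blast
  next
    case (Cons i js)
    show ?case using Cons[of X "\<lambda>js. Y (i # js)"] Cons[of "\<lambda>js. X (i # js)" Y]
      by (simp add: vf_br_Cons add.commute)
  qed
qed

lemma vf_br_add_right: "vf_br n X (Y + Y') = vf_br n X Y + vf_br n X Y'"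
  by (simp only: vf_br_antisym[of n X] vf_br_add_left minus_add_distrib)

lemma vf_br_scale_right: "vf_br n X (tscale c Y) = tscale c (vf_br n X Y)"
  by (simp only: vf_br_antisym[of n X] vf_br_scale_left ts.scale_minus_right)

lemma vf_br_zero:
  fixes X Y :: "'a::field tensor"
  shows "vf_br n 0 Y = 0" "vf_br n X 0 = 0"
proof -
  have z: "vf_br n 0 Z = 0" for Z :: "'a tensor" using vf_br_scale_left[of n 0 0 Z] by simp
  show "vf_br n 0 Y = 0" by (rule z)
  show "vf_br n X 0 = 0" by (simp only: vf_br_antisym[of n X] z minus_zero)
qed

text \<open>Equality of mixed partial derivatives. The transposition may sit anywhere in the list,
  which makes the property pass to derivatives of the field (\<open>swap_sym_slice\<close>).\<close>

definition swap_sym :: "'k tensor \<Rightarrow> bool" where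
  "swap_sym X \<longleftrightarrow> (\<forall>us i j js. X (us @ i # j # js) = X (us @ j # i # js))"

lemma swap_symD: "swap_sym X \<Longrightarrow> X (i # j # js) = X (j # i # js)"
  unfolding swap_sym_def by (metis append_Nil)

lemma swap_sym_slice: "swap_sym X \<Longrightarrow> swap_sym (\<lambda>js. X (i # js))"
  unfolding swap_sym_def by (metis append_Cons)

text \<open>By the Leibniz rule a derivative of the Jacobi expression is the sum of three Jacobi
  expressions in which one field is replaced by its derivative. This reduces the claim to the value
  at the origin, where it follows from the symmetry of second derivatives.\<close>

lemma vf_jacobi:
  fixes X Y Z :: "'k::field_char_0 tensor"
  assumes "swap_sym X" "swap_sym Y" "swap_sym Z"
  shows "vf_br n X (vf_br n Y Z) + vf_br n Y (vf_br n Z X) + vf_br n Z (vf_br n X Y) = 0"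
proof
  fix js show "(vf_br n X (vf_br n Y Z) + vf_br n Y (vf_br n Z X) + vf_br n Z (vf_br n X Y)) js = (0::'k tensor) js"
    using assms
  proof (induction js arbitrary: X Y Z)
    case (Cons i js)
    let ?X = "\<lambda>js. X (i # js)" and ?Y = "\<lambda>js. Y (i # js)" and ?Z = "\<lambda>js. Z (i # js)"
    have sl: "(\<lambda>js. vf_br n A B (i # js)) = vf_br n (\<lambda>js. A (i # js)) B + vf_br n A (\<lambda>js. B (i # js))" for A B :: "'k tensor"
      by (rule ext) (simp add: vf_br_Cons)
    have ex: "vf_br n A (vf_br n B C) (i # js) j = vf_br n (\<lambda>js. A (i # js)) (vf_br n B C) js j
        + (vf_br n A (vf_br n (\<lambda>js. B (i # js)) C) js j + vf_br n A (vf_br n B (\<lambda>js. C (i # js))) js j)"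
      for A B C :: "'k tensor" and j
      unfolding vf_br_Cons[of n A] sl vf_br_add_right by simp
    note s = Cons.prems swap_sym_slice[OF Cons.prems(1)] swap_sym_slice[OF Cons.prems(2)] swap_sym_slice[OF Cons.prems(3)]
    let ?J = "\<lambda>X Y Z js j. vf_br n X (vf_br n Y Z) js j + vf_br n Y (vf_br n Z X) js j + vf_br n Z (vf_br n X Y) js j"
    show ?case
    proof
      fix j
      have "?J ?X Y Z js j = 0" "?J X ?Y Z js j = 0" "?J X Y ?Z js j = 0"
        using fun_cong[OF Cons.IH[of ?X Y Z], of j] fun_cong[OF Cons.IH[of X ?Y Z], of j]
          fun_cong[OF Cons.IH[of X Y ?Z], of j] s by simp_all
      moreover have "?J X Y Z (i # js) j = ?J ?X Y Z js j + ?J X ?Y Z js j + ?J X Y ?Z js j"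
        by (simp add: ex add_ac)
      ultimately show "(vf_br n X (vf_br n Y Z) + vf_br n Y (vf_br n Z X) + vf_br n Z (vf_br n X Y)) (i # js) j
          = (0::'k tensor) (i # js) j" by simp
    qed
  next
    case Nil
    show ?case
    proof
      fix j
      define T where "T = (\<lambda>(X::'k tensor) Y Z (i::nat) (l::nat).
        X [i] j * (Y [l] i * Z [] l - Z [l] i * Y [] l)
        - (Y [i, l] j * Z [] l - Z [l] j * Y [i] l + (Y [l] j * Z [i] l - Z [i, l] j * Y [] l)) * X [] i)"
      have ex: "vf_br n X (vf_br n Y Z) [] j = (\<Sum>i<n. \<Sum>l<n. T X Y Z i l)" for X Y Z :: "'k tensor"
      proof -
        have aux: "x * sum a A - sum b A * y = (\<Sum>l\<in>A. x * a l - b l * y)" for x y :: 'k and a b and A :: "nat set"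
          by (simp add: sum_distrib_left sum_distrib_right sum_subtractf)
        have 1: "vf_br n Y Z [] i = (\<Sum>l<n. Y [l] i * Z [] l - Z [l] i * Y [] l)" for i
          by (simp add: vf_br_Nil)
        have 2: "vf_br n Y Z [i] j = (\<Sum>l<n. Y [i, l] j * Z [] l - Z [l] j * Y [i] l + (Y [l] j * Z [i] l - Z [i, l] j * Y [] l))" for i
          unfolding sum.distrib by (simp add: vf_br_Cons vf_br_Nil)
        show ?thesis
          unfolding vf_br_Nil[of n X] 1 2 T_def aux by simp
      qed
      \<comment> \<open>The cyclic sum of the terms is antisymmetric in the two summation indices,
        so its double sum equals its own negative.\<close>
      define A where "A = (\<lambda>i l. T X Y Z i l + T Y Z X i l + T Z X Y i l)"
      have sw: "X [i, l] = X [l, i]" "Y [i, l] = Y [l, i]" "Z [i, l] = Z [l, i]" for i l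
        using Nil swap_symD by blast+
      have "A i l + A l i = 0" for i l
        unfolding A_def T_def sw[of l i] by (simp add: algebra_simps)
      then have "(\<Sum>i<n. \<Sum>l<n. A i l + A l i) = 0" by simp
      then have "(\<Sum>i<n. \<Sum>l<n. A i l) + (\<Sum>i<n. \<Sum>l<n. A l i) = 0" by (simp add: sum.distrib)
      moreover have "(\<Sum>i<n. \<Sum>l<n. A l i) = (\<Sum>i<n. \<Sum>l<n. A i l)" by (rule sum.swap)
      ultimately have "2 * (\<Sum>i<n. \<Sum>l<n. A i l) = 0" by (simp only: mult_2)
      then have "(\<Sum>i<n. \<Sum>l<n. A i l) = 0" by simp
      then show "(vf_br n X (vf_br n Y Z) + vf_br n Y (vf_br n Z X) + vf_br n Z (vf_br n X Y)) [] j = (0::'k tensor) [] j"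
        by (simp add: ex A_def sum.distrib)
    qed
  qed
qed

lemma swap_sym_vf_br:
  assumes "swap_sym X" "swap_sym Y"
  shows "swap_sym (vf_br n X Y)"
proof -
  have "vf_br n X Y (us @ i # j # js) = vf_br n X Y (us @ j # i # js)" for us i j js
    using assms
  proof (induction us arbitrary: X Y)
    case Nil
    have "(\<lambda>js. X (i # j # js)) = (\<lambda>js. X (j # i # js))" "(\<lambda>js. Y (i # j # js)) = (\<lambda>js. Y (j # i # js))"
      using Nil swap_symD by blast+
    then show ?case by (simp add: vf_br_Cons add_ac)
  next
    case (Cons u us)
    then show ?case by (simp add: vf_br_Cons swap_sym_slice)
  qed
  then show ?thesis by (simp add: swap_sym_def)
qed

lemma vf_br_support:
  assumes "\<And>js j. X js j \<noteq> 0 \<Longrightarrow> set js \<subseteq> {..<n} \<and> j < n" "\<And>js j. Y js j \<noteq> 0 \<Longrightarrow> set js \<subseteq> {..<n} \<and> j < n"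
    and "vf_br n X Y js j \<noteq> 0"
  shows "set js \<subseteq> {..<n} \<and> j < n"
  using assms
proof (induction js arbitrary: X Y)
  case Nil
  have "j < n"
  proof (rule ccontr)
    assume "\<not> j < n"
    then have "X [i] j = 0" "Y [i] j = 0" for i using Nil(1,2)[of "[i]" j] by blast+
    then show False using Nil(3) by (simp add: vf_br_Nil)
  qed
  then show ?case by simp
next
  case (Cons i js)
  have X: "set ks \<subseteq> {..<n} \<and> k < n \<and> i < n" if "X (i # ks) k \<noteq> 0" for ks k using Cons.prems(1)[OF that] by simp
  have Y: "set ks \<subseteq> {..<n} \<and> k < n \<and> i < n" if "Y (i # ks) k \<noteq> 0" for ks k using Cons.prems(2)[OF that] by simp
  have "i < n"
  proof (rule ccontr)
    assume "\<not> i < n"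
    then have "(\<lambda>ks. X (i # ks)) = 0" "(\<lambda>ks. Y (i # ks)) = 0" using X Y by (auto simp: fun_eq_iff)
    then show False using Cons.prems(3) by (simp add: vf_br_Cons vf_br_zero)
  qed
  moreover have "vf_br n (\<lambda>js. X (i # js)) Y js j \<noteq> 0 \<or> vf_br n X (\<lambda>js. Y (i # js)) js j \<noteq> 0"
    using Cons.prems(3) by (auto simp: vf_br_Cons)
  then have "set js \<subseteq> {..<n} \<and> j < n"
    using Cons.IH[of "\<lambda>js. X (i # js)" Y] Cons.IH[of X "\<lambda>js. Y (i # js)"] X Y Cons.prems(1,2) by blast
  ultimately show ?case by simp
qed

lemma vf_br_bounded:
  assumes "\<And>js. length js \<ge> N \<Longrightarrow> X js = 0" "\<And>js. length js \<ge> M \<Longrightarrow> Y js = 0" "length js \<ge> N + M"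
  shows "vf_br n X Y js = 0"
  using assms
proof (induction js arbitrary: X Y N M)
  case Nil
  then have "X = 0" by (intro ext) simp
  then have "vf_br n X Y [] = 0" by (simp only: vf_br_zero zero_fun_apply)
  then show ?case .
next
  case (Cons i js)
  have "vf_br n (\<lambda>js. X (i # js)) Y js = 0"
  proof (cases N)
    case 0
    then have "(\<lambda>js. X (i # js)) = 0" using Cons.prems(1) by (intro ext) auto
    then show ?thesis by (simp only: vf_br_zero zero_fun_apply)
  next
    case (Suc N')
    show ?thesis by (rule Cons.IH[of N' _ M]) (use Cons.prems Suc in auto)
  qed
  moreover have "vf_br n X (\<lambda>js. Y (i # js)) js = 0"
  proof (cases M)
    case 0
    then have "(\<lambda>js. Y (i # js)) = 0" using Cons.prems(2) by (intro ext) auto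
    then show ?thesis by (simp only: vf_br_zero zero_fun_apply)
  next
    case (Suc M')
    show ?thesis by (rule Cons.IH[of N _ M']) (use Cons.prems Suc in auto)
  qed
  ultimately show ?case by (simp only: vf_br_Cons add_0)
qed

text \<open>The bracket contracts one lower index of one field with the upper index of the other,
  hence the loss of one index.\<close>

lemma vf_br_homogeneous:
  assumes "\<And>js. X js \<noteq> 0 \<Longrightarrow> length js = a" "\<And>js. Y js \<noteq> 0 \<Longrightarrow> length js = b" "vf_br n X Y js \<noteq> 0"
  shows "length js + 1 = a + b"
  using assms
proof (induction js arbitrary: X Y a b)
  case Nil
  have "\<exists>i. X [i] \<noteq> 0 \<and> Y [] \<noteq> 0 \<or> Y [i] \<noteq> 0 \<and> X [] \<noteq> 0"
  proof (rule ccontr)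
    assume "\<not> ?thesis"
    then have "X [i] j * Y [] i - Y [i] j * X [] i = 0" for i j
      by (cases "Y [] = 0"; cases "X [] = 0") auto
    then show False using Nil(3) by (auto simp: vf_br_Nil fun_eq_iff)
  qed
  then show ?case using Nil(1)[of "[]"] Nil(1)[of "[_]"] Nil(2)[of "[]"] Nil(2)[of "[_]"] by force
next
  case (Cons i js)
  consider "vf_br n (\<lambda>js. X (i # js)) Y js \<noteq> 0" | "vf_br n X (\<lambda>js. Y (i # js)) js \<noteq> 0"
    using Cons.prems(3) unfolding vf_br_Cons by (metis add_0)
  then show ?case
  proof cases
    case 1
    have "length ks = a - 1" if "X (i # ks) \<noteq> 0" for ks
    proof -
      have "length (i # ks) = a" by (rule Cons.prems(1)[OF that])
      then show ?thesis by simp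
    qed
    then have e: "length js + 1 = a - 1 + b" using Cons.IH[of "\<lambda>js. X (i # js)" "a - 1" Y b] Cons.prems(2) 1 by blast
    have "a \<noteq> 0"
    proof
      assume "a = 0"
      then have "(\<lambda>js. X (i # js)) = 0" using Cons.prems(1) by (fastforce simp: fun_eq_iff)
      then show False using 1 by (simp add: vf_br_zero)
    qed
    then show ?thesis using e by simp
  next
    case 2
    have "length ks = b - 1" if "Y (i # ks) \<noteq> 0" for ks
    proof -
      have "length (i # ks) = b" by (rule Cons.prems(2)[OF that])
      then show ?thesis by simp
    qed
    then have e: "length js + 1 = a + (b - 1)" using Cons.IH[of X a "\<lambda>js. Y (i # js)" "b - 1"] Cons.prems(1) 2 by blast
    have "b \<noteq> 0"
    proof
      assume "b = 0"
      then have "(\<lambda>js. Y (i # js)) = 0" using Cons.prems(2) by (fastforce simp: fun_eq_iff)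
      then show False using 2 by (simp add: vf_br_zero)
    qed
    then show ?thesis using e by simp
  qed
qed

lemma slice_eqs_sum: "(\<And>i. i \<in> I \<Longrightarrow> slice_eqs R n (A i)) \<Longrightarrow> slice_eqs R n (\<lambda>j l. \<Sum>i\<in>I. A i j l)"
  by (induction I rule: infinite_finite_induct) (simp_all add: slice_eqs_zero slice_eqs_add)

text \<open>The first derivative of a bracket is the commutator of the two first derivatives plus
  contractions of second derivatives with the values of the fields. The contractions are linear
  combinations of slices, so closure of the system under commutators suffices.\<close>

lemma vf_br_slice_eqs:
  assumes comm: "\<And>A B. slice_eqs R n A \<Longrightarrow> slice_eqs R n B \<Longrightarrow>
      slice_eqs R n (\<lambda>j l. \<Sum>i<n. A j i * B i l - B j i * A i l)"
    and "swap_sym X" "swap_sym Y"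
    and "\<And>js. slice_eqs R n (\<lambda>j l. X (l # js) j)" "\<And>js. slice_eqs R n (\<lambda>j l. Y (l # js) j)"
  shows "slice_eqs R n (\<lambda>j l. vf_br n X Y (l # js) j)"
  using assms(2-)
proof (induction js arbitrary: X Y)
  case Nil
  have "slice_eqs R n (\<lambda>j l. \<Sum>i<n. Y [] i * X [l, i] j)"
    "slice_eqs R n (\<lambda>j l. \<Sum>i<n. (- X [] i) * Y [l, i] j)"
    using Nil by (intro slice_eqs_sum slice_eqs_scale; blast)+
  moreover have "slice_eqs R n (\<lambda>j l. \<Sum>i<n. X [i] j * Y [l] i - Y [i] j * X [l] i)"
    using Nil by (intro comm[of "\<lambda>j l. X [l] j" "\<lambda>j l. Y [l] j"]) blast+
  ultimately have "slice_eqs R n (\<lambda>j l. (\<Sum>i<n. Y [] i * X [l, i] j) + (\<Sum>i<n. (- X [] i) * Y [l, i] j)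
      + (\<Sum>i<n. X [i] j * Y [l] i - Y [i] j * X [l] i))"
    by (intro slice_eqs_add)
  moreover have "(\<Sum>i<n. Y [] i * X [l, i] j) + (\<Sum>i<n. (- X [] i) * Y [l, i] j)
      + (\<Sum>i<n. X [i] j * Y [l] i - Y [i] j * X [l] i) = vf_br n X Y [l] j" for j l
    by (simp add: vf_br_Cons vf_br_Nil sum.distrib[symmetric] algebra_simps)
  ultimately show ?case by simp
next
  case (Cons i js)
  have sw: "X (i # l # ks) = X (l # i # ks)" "Y (i # l # ks) = Y (l # i # ks)" for l ks
    using Cons.prems swap_symD by blast+
  have "slice_eqs R n (\<lambda>j l. vf_br n (\<lambda>js. X (i # js)) Y (l # js) j)"
    by (rule Cons.IH) (use Cons.prems swap_sym_slice sw in auto)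
  moreover have "slice_eqs R n (\<lambda>j l. vf_br n X (\<lambda>js. Y (i # js)) (l # js) j)"
    by (rule Cons.IH) (use Cons.prems swap_sym_slice sw in auto)
  ultimately have "slice_eqs R n (\<lambda>j l. vf_br n (\<lambda>js. X (i # js)) Y (l # js) j + vf_br n X (\<lambda>js. Y (i # js)) (l # js) j)"
    by (rule slice_eqs_add)
  \<comment> \<open>The Leibniz rule splits off the first index, while the slice index
    \<open>l\<close> has to stay first; symmetry exchanges the two.\<close>
  moreover have "vf_br n X Y (l # i # js) = vf_br n X Y (i # l # js)" for l
    by (rule swap_symD[OF swap_sym_vf_br]) (use Cons.prems in auto)
  ultimately show ?case by (simp add: vf_br_Cons[of n X Y i])
qed

section \<open>Lie algebras and their quotients\<close>

context
  fixes G :: "('k::field, 'a, 'm) module_scheme"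
  assumes G: "vectorspace class_ring G"
begin

interpretation vectorspace class_ring G by (rule G)

lemma submodule_class_ringI:
  assumes "S \<subseteq> carrier G" "\<zero>\<^bsub>G\<^esub> \<in> S" "\<And>x y. x \<in> S \<Longrightarrow> y \<in> S \<Longrightarrow> x \<oplus>\<^bsub>G\<^esub> y \<in> S" "\<And>c x. x \<in> S \<Longrightarrow> c \<odot>\<^bsub>G\<^esub> x \<in> S"
  shows "submodule class_ring S G"
  using assms by (intro submodule.intro module_axioms) auto

lemma vspan_submodule: "A \<subseteq> carrier G \<Longrightarrow> submodule class_ring (vspan G A) G"
  by (rule span_is_submodule)

lemma vspan_closed: "A \<subseteq> carrier G \<Longrightarrow> x \<in> vspan G A \<Longrightarrow> x \<in> carrier G"
  using span_is_subset2 by blast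

lemma vspan_zero: "A \<subseteq> carrier G \<Longrightarrow> \<zero>\<^bsub>G\<^esub> \<in> vspan G A"
  and vspan_add: "A \<subseteq> carrier G \<Longrightarrow> x \<in> vspan G A \<Longrightarrow> y \<in> vspan G A \<Longrightarrow> x \<oplus>\<^bsub>G\<^esub> y \<in> vspan G A"
  and vspan_smult: "A \<subseteq> carrier G \<Longrightarrow> x \<in> vspan G A \<Longrightarrow> c \<odot>\<^bsub>G\<^esub> x \<in> vspan G A"
  and vspan_base: "A \<subseteq> carrier G \<Longrightarrow> x \<in> A \<Longrightarrow> x \<in> vspan G A"
  using submodule.zero_closed[OF vspan_submodule] submodule.m_closed[OF vspan_submodule]
    submodule.smult_closed[OF vspan_submodule, of A c x] in_own_span[of A] by auto

lemma vspan_mono: "A \<subseteq> B \<Longrightarrow> vspan G A \<subseteq> vspan G B"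
  by (rule span_is_monotone)

lemma vspan_minimal: "A \<subseteq> S \<Longrightarrow> submodule class_ring S G \<Longrightarrow> vspan G A \<subseteq> S"
  by (rule span_is_subset)

lemma vspan_induct:
  assumes "x \<in> vspan G A" "A \<subseteq> carrier G" "P \<zero>\<^bsub>G\<^esub>" "\<And>a. a \<in> A \<Longrightarrow> P a"
    and "\<And>x y. x \<in> carrier G \<Longrightarrow> y \<in> carrier G \<Longrightarrow> P x \<Longrightarrow> P y \<Longrightarrow> P (x \<oplus>\<^bsub>G\<^esub> y)"
    and "\<And>c x. x \<in> carrier G \<Longrightarrow> P x \<Longrightarrow> P (c \<odot>\<^bsub>G\<^esub> x)"
  shows "P x"
proof -
  have "vspan G A \<subseteq> {x \<in> carrier G. P x}"
    by (intro vspan_minimal submodule_class_ringI) (use assms in auto)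
  then show ?thesis using assms(1) by blast
qed

lemma zero_smult: "x \<in> carrier G \<Longrightarrow> 0 \<odot>\<^bsub>G\<^esub> x = \<zero>\<^bsub>G\<^esub>"
  and smult_zero: "c \<odot>\<^bsub>G\<^esub> \<zero>\<^bsub>G\<^esub> = \<zero>\<^bsub>G\<^esub>"
  and add_neg: "x \<in> carrier G \<Longrightarrow> x \<oplus>\<^bsub>G\<^esub> ((- 1) \<odot>\<^bsub>G\<^esub> x) = \<zero>\<^bsub>G\<^esub>"
  and smult_assoc_class: "x \<in> carrier G \<Longrightarrow> a \<odot>\<^bsub>G\<^esub> (b \<odot>\<^bsub>G\<^esub> x) = (a * b) \<odot>\<^bsub>G\<^esub> x"
  and smult_add_class: "x \<in> carrier G \<Longrightarrow> (a + b) \<odot>\<^bsub>G\<^esub> x = a \<odot>\<^bsub>G\<^esub> x \<oplus>\<^bsub>G\<^esub> b \<odot>\<^bsub>G\<^esub> x"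
  and smult_distrib_class: "x \<in> carrier G \<Longrightarrow> y \<in> carrier G \<Longrightarrow> a \<odot>\<^bsub>G\<^esub> (x \<oplus>\<^bsub>G\<^esub> y) = a \<odot>\<^bsub>G\<^esub> x \<oplus>\<^bsub>G\<^esub> a \<odot>\<^bsub>G\<^esub> y"
  and one_smult: "x \<in> carrier G \<Longrightarrow> 1 \<odot>\<^bsub>G\<^esub> x = x"
  and smult_closed_class: "x \<in> carrier G \<Longrightarrow> c \<odot>\<^bsub>G\<^esub> x \<in> carrier G"
proof -
  show z: "0 \<odot>\<^bsub>G\<^esub> x = \<zero>\<^bsub>G\<^esub>" if "x \<in> carrier G" for x using lmult_0[of x] that by simp
  show "c \<odot>\<^bsub>G\<^esub> \<zero>\<^bsub>G\<^esub> = \<zero>\<^bsub>G\<^esub>" using smult_r_null[of c] by simp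
  show o: "1 \<odot>\<^bsub>G\<^esub> x = x" if "x \<in> carrier G" for x using smult_one[of x] that by simp
  show "a \<odot>\<^bsub>G\<^esub> (b \<odot>\<^bsub>G\<^esub> x) = (a * b) \<odot>\<^bsub>G\<^esub> x" if "x \<in> carrier G" using smult_assoc1[of a b x] that by simp
  show a: "(a + b) \<odot>\<^bsub>G\<^esub> x = a \<odot>\<^bsub>G\<^esub> x \<oplus>\<^bsub>G\<^esub> b \<odot>\<^bsub>G\<^esub> x" if "x \<in> carrier G" for a b x
    using smult_l_distr[of a b x] that by simp
  show "a \<odot>\<^bsub>G\<^esub> (x \<oplus>\<^bsub>G\<^esub> y) = a \<odot>\<^bsub>G\<^esub> x \<oplus>\<^bsub>G\<^esub> a \<odot>\<^bsub>G\<^esub> y" if "x \<in> carrier G" "y \<in> carrier G"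
    using smult_r_distr[of a x y] that by simp
  show "x \<oplus>\<^bsub>G\<^esub> ((- 1) \<odot>\<^bsub>G\<^esub> x) = \<zero>\<^bsub>G\<^esub>" if "x \<in> carrier G"
    using a[OF that, of 1 "- 1"] o[OF that] z[OF that] by simp
  show "c \<odot>\<^bsub>G\<^esub> x \<in> carrier G" if "x \<in> carrier G" using that by simp
qed

lemma eq_if_diff_zero:
  assumes "x \<in> carrier G" "y \<in> carrier G" "x \<oplus>\<^bsub>G\<^esub> ((- 1) \<odot>\<^bsub>G\<^esub> y) = \<zero>\<^bsub>G\<^esub>"
  shows "x = y"
  using assms add_neg[OF assms(2)] a_comm[of x "(- 1) \<odot>\<^bsub>G\<^esub> y"] a_comm[of y "(- 1) \<odot>\<^bsub>G\<^esub> y"]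
  by (metis add.r_cancel smult_closed_class)

end

definition vlin :: "('k::field, 'a, 'm) module_scheme \<Rightarrow> ('k, 'b, 'n) module_scheme \<Rightarrow> ('a \<Rightarrow> 'b) \<Rightarrow> bool" where
  "vlin M N f \<longleftrightarrow> f \<in> module_hom class_ring M N"

lemma vlin_iff: "vlin M N f \<longleftrightarrow> (\<forall>x\<in>carrier M. f x \<in> carrier N) \<and>
    (\<forall>x\<in>carrier M. \<forall>y\<in>carrier M. f (x \<oplus>\<^bsub>M\<^esub> y) = f x \<oplus>\<^bsub>N\<^esub> f y) \<and>
    (\<forall>c. \<forall>x\<in>carrier M. f (c \<odot>\<^bsub>M\<^esub> x) = c \<odot>\<^bsub>N\<^esub> f x)"
  by (auto simp: vlin_def LinearCombinations.module_hom_def)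

lemma vlinD:
  assumes "vlin M N f"
  shows "x \<in> carrier M \<Longrightarrow> f x \<in> carrier N"
    and "x \<in> carrier M \<Longrightarrow> y \<in> carrier M \<Longrightarrow> f (x \<oplus>\<^bsub>M\<^esub> y) = f x \<oplus>\<^bsub>N\<^esub> f y"
    and "x \<in> carrier M \<Longrightarrow> f (c \<odot>\<^bsub>M\<^esub> x) = c \<odot>\<^bsub>N\<^esub> f x"
  using assms by (auto simp: vlin_iff)

lemma vlin_zero:
  assumes "vectorspace class_ring M" "vectorspace class_ring N" "vlin M N f"
  shows "f \<zero>\<^bsub>M\<^esub> = \<zero>\<^bsub>N\<^esub>"
proof -
  interpret M: vectorspace class_ring M by fact
  interpret N: vectorspace class_ring N by fact
  have "f (0 \<odot>\<^bsub>M\<^esub> \<zero>\<^bsub>M\<^esub>) = 0 \<odot>\<^bsub>N\<^esub> f \<zero>\<^bsub>M\<^esub>" by (rule vlinD(3)[OF assms(3)]) simp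
  then show ?thesis using zero_smult[OF assms(1), of "\<zero>\<^bsub>M\<^esub>"] zero_smult[OF assms(2)] vlinD(1)[OF assms(3), of "\<zero>\<^bsub>M\<^esub>"] by simp
qed

lemma vlin_finsum:
  assumes M: "vectorspace class_ring M" and N: "vectorspace class_ring N" and f: "vlin M N f"
    and g: "\<And>i. i \<in> A \<Longrightarrow> g i \<in> carrier M"
  shows "f (finsum M g A) = finsum N (\<lambda>i. f (g i)) A"
proof -
  interpret M: vectorspace class_ring M by fact
  interpret N: vectorspace class_ring N by fact
  show ?thesis
    using g
  proof (induction A rule: infinite_finite_induct)
    case (insert a A)
    have "finsum M g A \<in> carrier M" using insert.prems by (intro M.finsum_closed) auto
    then show ?case using insert vlinD(1,2)[OF f] by (simp add: Pi_iff)
  qed (use vlin_zero[OF M N f] in auto)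
qed

lemma vlin_comp: "vlin L M f \<Longrightarrow> vlin M N g \<Longrightarrow> vlin L N (\<lambda>x. g (f x))"
  by (auto simp: vlin_iff)

lemma vlin_eq_on_span:
  assumes M: "vectorspace class_ring M" and N: "vectorspace class_ring N" and f: "vlin M N f" "vlin M N g"
    and A: "A \<subseteq> carrier M" "\<And>a. a \<in> A \<Longrightarrow> f a = g a" and x: "x \<in> vspan M A"
  shows "f x = g x"
  using x A(1)
  by (rule vspan_induct[OF M, where P = "\<lambda>x. f x = g x"])
    (use A vlin_zero[OF M N f(1)] vlin_zero[OF M N f(2)] vlinD[OF f(1)] vlinD[OF f(2)] in auto)

lemma lie_hom_vlin: "lie_hom G H f \<Longrightarrow> vlin G H f"
  by (simp add: lie_hom_def vlin_def)

lemma lie_hom_bracket: "lie_hom G H f \<Longrightarrow> x \<in> carrier G \<Longrightarrow> y \<in> carrier G \<Longrightarrow> f (bracket G x y) = bracket H (f x) (f y)"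
  by (simp add: lie_hom_def)

lemma lie_hom_comp: "lie_hom G H f \<Longrightarrow> lie_hom H L g \<Longrightarrow> lie_hom G L (\<lambda>x. g (f x))"
  using vlin_comp[of G H f L g] by (auto simp: lie_hom_def vlin_iff simp flip: vlin_def)

section \<open>Identities for the bracket\<close>

context lie_algebra
begin

lemma is_vs: "vectorspace class_ring G" by (rule vectorspace_axioms)

lemma bracket_zero: "x \<in> carrier G \<Longrightarrow> bracket G \<zero>\<^bsub>G\<^esub> x = \<zero>\<^bsub>G\<^esub>" "x \<in> carrier G \<Longrightarrow> bracket G x \<zero>\<^bsub>G\<^esub> = \<zero>\<^bsub>G\<^esub>"
  using bracket_smult_left[of "\<zero>\<^bsub>G\<^esub>" x 0] bracket_smult_right[of x "\<zero>\<^bsub>G\<^esub>" 0] zero_smult[OF is_vs] bracket_closed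
  by (metis zero_closed)+

lemma bracket_anti:
  assumes "x \<in> carrier G" "y \<in> carrier G"
  shows "bracket G x y = (- 1) \<odot>\<^bsub>G\<^esub> bracket G y x"
proof (rule eq_if_diff_zero[OF is_vs])
  have "\<zero>\<^bsub>G\<^esub> = bracket G (x \<oplus>\<^bsub>G\<^esub> y) (x \<oplus>\<^bsub>G\<^esub> y)" using assms bracket_self by simp
  also have "\<dots> = bracket G x y \<oplus>\<^bsub>G\<^esub> bracket G y x"
    using assms by (simp add: bracket_add_left bracket_add_right bracket_self[of x] bracket_self[of y] bracket_closed a_comm)
  finally show "bracket G x y \<oplus>\<^bsub>G\<^esub> (- 1) \<odot>\<^bsub>G\<^esub> ((- 1) \<odot>\<^bsub>G\<^esub> bracket G y x) = \<zero>\<^bsub>G\<^esub>"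
    using assms by (simp add: smult_assoc_class[OF is_vs] one_smult[OF is_vs] bracket_closed)
qed (use assms bracket_closed smult_closed_class[OF is_vs] in auto)

text \<open>The Jacobi identity as a statement on right multiplications: bracketing with [y, z] is
  the commutator of bracketing with y and with z. In this form the elements of negative degree act
  as operators on a prolongation.\<close>

lemma bracket_bracket:
  assumes "x \<in> carrier G" "y \<in> carrier G" "z \<in> carrier G"
  shows "bracket G x (bracket G y z) = bracket G (bracket G x y) z \<oplus>\<^bsub>G\<^esub> (- 1) \<odot>\<^bsub>G\<^esub> bracket G (bracket G x z) y"
proof (rule eq_if_diff_zero[OF is_vs])
  let ?a = "bracket G x (bracket G y z)" and ?b = "bracket G (bracket G x y) z" and ?c = "bracket G (bracket G x z) y"
  note C = assms bracket_closed smult_closed_class[OF is_vs]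
  have 1: "bracket G y (bracket G z x) = ?c"
  proof -
    have "bracket G z x = (- 1) \<odot>\<^bsub>G\<^esub> bracket G x z" by (rule bracket_anti) (use C in auto)
    then have "bracket G y (bracket G z x) = (- 1) \<odot>\<^bsub>G\<^esub> bracket G y (bracket G x z)" using C by (simp add: bracket_smult_right)
    also have "bracket G y (bracket G x z) = (- 1) \<odot>\<^bsub>G\<^esub> ?c" by (rule bracket_anti) (use C in auto)
    finally show ?thesis using C by (simp add: smult_assoc_class[OF is_vs] one_smult[OF is_vs])
  qed
  have 2: "bracket G z (bracket G x y) = (- 1) \<odot>\<^bsub>G\<^esub> ?b" by (rule bracket_anti) (use C in auto)
  have "?a \<oplus>\<^bsub>G\<^esub> ?c \<oplus>\<^bsub>G\<^esub> (- 1) \<odot>\<^bsub>G\<^esub> ?b = \<zero>\<^bsub>G\<^esub>" using jacobi[OF assms] unfolding 1 2 .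
  then show "?a \<oplus>\<^bsub>G\<^esub> (- 1) \<odot>\<^bsub>G\<^esub> (?b \<oplus>\<^bsub>G\<^esub> (- 1) \<odot>\<^bsub>G\<^esub> ?c) = \<zero>\<^bsub>G\<^esub>"
    using C by (simp add: smult_distrib_class[OF is_vs] smult_assoc_class[OF is_vs] one_smult[OF is_vs] a_ac)
qed (use assms bracket_closed smult_closed_class[OF is_vs] in auto)

lemma vlin_bracket_left: "y \<in> carrier G \<Longrightarrow> vlin G G (\<lambda>x. bracket G x y)"
  and vlin_bracket_right: "x \<in> carrier G \<Longrightarrow> vlin G G (\<lambda>y. bracket G x y)"
  by (auto simp: vlin_iff bracket_closed bracket_add_left bracket_add_right bracket_smult_left bracket_smult_right)

lemma bracket_span_closed:
  assumes A: "A \<subseteq> carrier G" and B: "B \<subseteq> carrier G" and C: "submodule class_ring C G"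
    and AB: "\<And>a b. a \<in> A \<Longrightarrow> b \<in> B \<Longrightarrow> bracket G a b \<in> C"
    and x: "x \<in> vspan G A" and y: "y \<in> vspan G B"
  shows "bracket G x y \<in> C"
proof -
  interpret C: submodule class_ring C G by fact
  have 1: "bracket G a y \<in> C" if a: "a \<in> A" for a
    using y B
  proof (rule vspan_induct[OF is_vs])
    show "bracket G a \<zero>\<^bsub>G\<^esub> \<in> C" using a A bracket_zero by auto
  qed (use a A AB bracket_add_right bracket_smult_right C.m_closed in \<open>auto simp: subset_iff\<close>)
  have yC: "y \<in> carrier G" by (rule vspan_closed[OF is_vs B y])
  show ?thesis
    using x A
  proof (rule vspan_induct[OF is_vs])
    show "bracket G \<zero>\<^bsub>G\<^esub> y \<in> C" using yC bracket_zero by auto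
  qed (use 1 yC bracket_add_left bracket_smult_left C.m_closed in auto)
qed

end

text \<open>Apart from the existence of negatives, which are images of negatives, the axioms are
  identities and closure conditions; these pass to a surjective image of the operations.\<close>

lemma lie_algebra_surjective_image:
  fixes G :: "('k::field, 'a, 'm) lie_scheme" and H :: "('k, 'b, 'n) lie_scheme"
  assumes "lie_algebra G" and C: "carrier H = \<phi> ` carrier G" and Z: "\<zero>\<^bsub>H\<^esub> = \<phi> \<zero>\<^bsub>G\<^esub>"
    and A: "\<And>x y. x \<in> carrier G \<Longrightarrow> y \<in> carrier G \<Longrightarrow> \<phi> x \<oplus>\<^bsub>H\<^esub> \<phi> y = \<phi> (x \<oplus>\<^bsub>G\<^esub> y)"
    and S: "\<And>a x. x \<in> carrier G \<Longrightarrow> a \<odot>\<^bsub>H\<^esub> \<phi> x = \<phi> (a \<odot>\<^bsub>G\<^esub> x)"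
    and B: "\<And>x y. x \<in> carrier G \<Longrightarrow> y \<in> carrier G \<Longrightarrow> bracket H (\<phi> x) (\<phi> y) = \<phi> (bracket G x y)"
  shows "lie_algebra H"
proof -
  interpret G: lie_algebra G by fact
  note sm = smult_closed_class[OF G.is_vs]
  have "vectorspace class_ring H"
  proof (rule vs_criteria)
    show "field (class_ring :: 'k ring)" by (rule class_field.field_axioms)
    show "\<zero>\<^bsub>H\<^esub> \<in> carrier H" by (simp add: C Z)
    show "\<forall>v w. v \<in> carrier H \<and> w \<in> carrier H \<longrightarrow> v \<oplus>\<^bsub>H\<^esub> w \<in> carrier H" by (auto simp: C A)
    show "\<forall>v\<in>carrier H. \<exists>neg_v\<in>carrier H. v \<oplus>\<^bsub>H\<^esub> neg_v = \<zero>\<^bsub>H\<^esub>"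
    proof
      fix v assume "v \<in> carrier H"
      then obtain x where "x \<in> carrier G" "v = \<phi> x" by (auto simp: C)
      then show "\<exists>neg_v\<in>carrier H. v \<oplus>\<^bsub>H\<^esub> neg_v = \<zero>\<^bsub>H\<^esub>"
        by (intro bexI[of _ "\<phi> (\<ominus>\<^bsub>G\<^esub> x)"]) (auto simp: C A Z G.r_neg)
    qed
    show "\<forall>c v. c \<in> carrier (class_ring :: 'k ring) \<and> v \<in> carrier H \<longrightarrow> c \<odot>\<^bsub>H\<^esub> v \<in> carrier H" by (auto simp: C S sm)
    show "\<forall>v w. v \<in> carrier H \<and> w \<in> carrier H \<longrightarrow> v \<oplus>\<^bsub>H\<^esub> w = w \<oplus>\<^bsub>H\<^esub> v" by (auto simp: C A G.a_comm)
    show "\<forall>v w x. v \<in> carrier H \<and> w \<in> carrier H \<and> x \<in> carrier H \<longrightarrow> v \<oplus>\<^bsub>H\<^esub> w \<oplus>\<^bsub>H\<^esub> x = v \<oplus>\<^bsub>H\<^esub> (w \<oplus>\<^bsub>H\<^esub> x)"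
      by (auto simp: C A G.a_assoc)
    show "\<forall>v\<in>carrier H. v \<oplus>\<^bsub>H\<^esub> \<zero>\<^bsub>H\<^esub> = v" by (auto simp: C A Z)
    show "\<forall>a b v. a \<in> carrier (class_ring :: 'k ring) \<and> b \<in> carrier (class_ring :: 'k ring) \<and> v \<in> carrier H
        \<longrightarrow> (a \<otimes>\<^bsub>class_ring\<^esub> b) \<odot>\<^bsub>H\<^esub> v = a \<odot>\<^bsub>H\<^esub> (b \<odot>\<^bsub>H\<^esub> v)"
      by (auto simp: C S sm smult_assoc_class[OF G.is_vs])
    show "\<forall>v\<in>carrier H. \<one>\<^bsub>class_ring\<^esub> \<odot>\<^bsub>H\<^esub> v = v" by (auto simp: C S one_smult[OF G.is_vs])
    show "\<forall>a b v. a \<in> carrier (class_ring :: 'k ring) \<and> b \<in> carrier (class_ring :: 'k ring) \<and> v \<in> carrier H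
        \<longrightarrow> (a \<oplus>\<^bsub>class_ring\<^esub> b) \<odot>\<^bsub>H\<^esub> v = a \<odot>\<^bsub>H\<^esub> v \<oplus>\<^bsub>H\<^esub> b \<odot>\<^bsub>H\<^esub> v"
      by (auto simp: C S A sm smult_add_class[OF G.is_vs])
    show "\<forall>a v w. a \<in> carrier (class_ring :: 'k ring) \<and> v \<in> carrier H \<and> w \<in> carrier H
        \<longrightarrow> a \<odot>\<^bsub>H\<^esub> (v \<oplus>\<^bsub>H\<^esub> w) = a \<odot>\<^bsub>H\<^esub> v \<oplus>\<^bsub>H\<^esub> a \<odot>\<^bsub>H\<^esub> w"
      by (auto simp: C S A sm smult_distrib_class[OF G.is_vs])
  qed
  moreover have "lie_algebra_axioms H"
    unfolding lie_algebra_axioms_def C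
    by (intro conjI allI impI; elim imageE)
       (simp_all add: A B S Z sm G.bracket_closed G.bracket_add_left G.bracket_add_right
          G.bracket_smult_left G.bracket_smult_right G.bracket_self G.jacobi)
  ultimately show ?thesis by (rule lie_algebra.intro)
qed

section \<open>The quotient of a Lie algebra by an ideal\<close>

context
  fixes G :: "('k::field, 'a, 'm) lie_scheme" and I :: "'a set"
  assumes G: "lie_algebra G" and I: "lie_ideal I G"
begin

interpretation lie_algebra G by (rule G)

lemma ideal_submodule: "submodule class_ring I G"
  using I by (simp add: lie_ideal_def VectorSpace.subspace_def)

interpretation I: submodule class_ring I G by (rule ideal_submodule)

lemma ideal_bracket: "x \<in> carrier G \<Longrightarrow> y \<in> I \<Longrightarrow> bracket G x y \<in> I"
  and ideal_bracket_left: "x \<in> carrier G \<Longrightarrow> y \<in> I \<Longrightarrow> bracket G y x \<in> I"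
proof -
  show *: "bracket G x y \<in> I" if "x \<in> carrier G" "y \<in> I" using I that by (simp add: lie_ideal_def)
  show "bracket G y x \<in> I" if "x \<in> carrier G" "y \<in> I"
  proof -
    have "bracket G y x = (- 1) \<odot>\<^bsub>G\<^esub> bracket G x y" using that I.subset by (intro bracket_anti) auto
    then show ?thesis using I.smult_closed[of "- 1", OF _ *[OF that]] by (simp only: UNIV_I partial_object.select_convs)
  qed
qed

lemma coset_eq_iff:
  assumes "x \<in> carrier G" "y \<in> carrier G"
  shows "I +>\<^bsub>G\<^esub> x = I +>\<^bsub>G\<^esub> y \<longleftrightarrow> x \<oplus>\<^bsub>G\<^esub> (- 1) \<odot>\<^bsub>G\<^esub> y \<in> I"
proof
  have self: "x \<in> I +>\<^bsub>G\<^esub> x" unfolding a_r_coset_def'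
    using assms by (intro UN_I[of "\<zero>\<^bsub>G\<^esub>"]) auto
  assume "I +>\<^bsub>G\<^esub> x = I +>\<^bsub>G\<^esub> y"
  then obtain h where h: "h \<in> I" "x = h \<oplus>\<^bsub>G\<^esub> y" using self by (auto simp: a_r_coset_def')
  have hC: "h \<in> carrier G" using h I.subset by blast
  have "x \<oplus>\<^bsub>G\<^esub> (- 1) \<odot>\<^bsub>G\<^esub> y = h \<oplus>\<^bsub>G\<^esub> (y \<oplus>\<^bsub>G\<^esub> (- 1) \<odot>\<^bsub>G\<^esub> y)" using h hC assms by (simp add: a_assoc)
  then show "x \<oplus>\<^bsub>G\<^esub> (- 1) \<odot>\<^bsub>G\<^esub> y \<in> I" using h hC assms add_neg[OF is_vs] by simp
next
  assume d: "x \<oplus>\<^bsub>G\<^esub> (- 1) \<odot>\<^bsub>G\<^esub> y \<in> I"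
  have sub: "I +>\<^bsub>G\<^esub> u \<subseteq> I +>\<^bsub>G\<^esub> v" if uv: "u \<oplus>\<^bsub>G\<^esub> (- 1) \<odot>\<^bsub>G\<^esub> v \<in> I" "u \<in> carrier G" "v \<in> carrier G" for u v
  proof
    fix w assume "w \<in> I +>\<^bsub>G\<^esub> u"
    then obtain h where h: "h \<in> I" "w = h \<oplus>\<^bsub>G\<^esub> u" by (auto simp: a_r_coset_def')
    have hC: "h \<in> carrier G" using h I.subset by blast
    have "w = h \<oplus>\<^bsub>G\<^esub> (u \<oplus>\<^bsub>G\<^esub> (v \<oplus>\<^bsub>G\<^esub> (- 1) \<odot>\<^bsub>G\<^esub> v))" using h hC uv add_neg[OF is_vs, of v] by simp
    also have "\<dots> = (h \<oplus>\<^bsub>G\<^esub> (u \<oplus>\<^bsub>G\<^esub> (- 1) \<odot>\<^bsub>G\<^esub> v)) \<oplus>\<^bsub>G\<^esub> v" using h hC uv by (simp add: a_ac)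
    finally show "w \<in> I +>\<^bsub>G\<^esub> v" unfolding a_r_coset_def' using uv h I.m_closed by blast
  qed
  have "y \<oplus>\<^bsub>G\<^esub> (- 1) \<odot>\<^bsub>G\<^esub> x = (- 1) \<odot>\<^bsub>G\<^esub> (x \<oplus>\<^bsub>G\<^esub> (- 1) \<odot>\<^bsub>G\<^esub> y)"
    using assms by (simp add: smult_distrib_class[OF is_vs] smult_assoc_class[OF is_vs] one_smult[OF is_vs] a_comm)
  then have "y \<oplus>\<^bsub>G\<^esub> (- 1) \<odot>\<^bsub>G\<^esub> x \<in> I" using d I.smult_closed[of "- 1"] by simp
  then show "I +>\<^bsub>G\<^esub> x = I +>\<^bsub>G\<^esub> y" using sub d assms by blast
qed

lemma coset_self: "x \<in> carrier G \<Longrightarrow> x \<in> I +>\<^bsub>G\<^esub> x"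
  unfolding a_r_coset_def' by (intro UN_I[of "\<zero>\<^bsub>G\<^esub>"]) auto

lemma coset_mem:
  assumes "x \<in> carrier G" "x' \<in> I +>\<^bsub>G\<^esub> x"
  shows "x' \<in> carrier G" "x' \<oplus>\<^bsub>G\<^esub> (- 1) \<odot>\<^bsub>G\<^esub> x \<in> I"
proof -
  obtain h where h: "h \<in> I" "x' = h \<oplus>\<^bsub>G\<^esub> x" using assms by (auto simp: a_r_coset_def')
  have hC: "h \<in> carrier G" using h I.subset by blast
  then show "x' \<in> carrier G" using h assms by simp
  have "x' \<oplus>\<^bsub>G\<^esub> (- 1) \<odot>\<^bsub>G\<^esub> x = h \<oplus>\<^bsub>G\<^esub> (x \<oplus>\<^bsub>G\<^esub> (- 1) \<odot>\<^bsub>G\<^esub> x)" using h hC assms by (simp add: a_assoc)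
  then show "x' \<oplus>\<^bsub>G\<^esub> (- 1) \<odot>\<^bsub>G\<^esub> x \<in> I" using h hC assms add_neg[OF is_vs] by simp
qed

lemma quotient_carrier: "carrier (lie_quotient G I) = (\<lambda>x. I +>\<^bsub>G\<^esub> x) ` carrier G"
  by (auto simp: lie_quotient_def A_RCOSETS_def')

lemma quotient_zero: "\<zero>\<^bsub>lie_quotient G I\<^esub> = I +>\<^bsub>G\<^esub> \<zero>\<^bsub>G\<^esub>"
proof -
  have "(\<Union>h\<in>I. {h \<oplus>\<^bsub>G\<^esub> \<zero>\<^bsub>G\<^esub>}) = (\<Union>h\<in>I. {h})" by (intro SUP_cong) (use I.subset in auto)
  then show ?thesis by (simp add: lie_quotient_def a_r_coset_def')
qed

lemma quotient_add:
  assumes "x \<in> carrier G" "y \<in> carrier G"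
  shows "(I +>\<^bsub>G\<^esub> x) \<oplus>\<^bsub>lie_quotient G I\<^esub> (I +>\<^bsub>G\<^esub> y) = I +>\<^bsub>G\<^esub> (x \<oplus>\<^bsub>G\<^esub> y)"
proof -
  have "set_add G (I +>\<^bsub>G\<^esub> x) (I +>\<^bsub>G\<^esub> y) = I +>\<^bsub>G\<^esub> (x \<oplus>\<^bsub>G\<^esub> y)"
  proof (intro equalityI subsetI)
    fix w assume "w \<in> set_add G (I +>\<^bsub>G\<^esub> x) (I +>\<^bsub>G\<^esub> y)"
    then obtain h k where h: "h \<in> I" "k \<in> I" "w = (h \<oplus>\<^bsub>G\<^esub> x) \<oplus>\<^bsub>G\<^esub> (k \<oplus>\<^bsub>G\<^esub> y)"
      by (auto simp: set_add_def' a_r_coset_def')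
    have "h \<in> carrier G" "k \<in> carrier G" using h I.subset by auto
    then have "w = (h \<oplus>\<^bsub>G\<^esub> k) \<oplus>\<^bsub>G\<^esub> (x \<oplus>\<^bsub>G\<^esub> y)" using h assms by (simp add: a_ac)
    then show "w \<in> I +>\<^bsub>G\<^esub> (x \<oplus>\<^bsub>G\<^esub> y)" using h I.m_closed by (auto simp: a_r_coset_def')
  next
    fix w assume "w \<in> I +>\<^bsub>G\<^esub> (x \<oplus>\<^bsub>G\<^esub> y)"
    then obtain h where h: "h \<in> I" "w = h \<oplus>\<^bsub>G\<^esub> (x \<oplus>\<^bsub>G\<^esub> y)" by (auto simp: a_r_coset_def')
    then have "w = (h \<oplus>\<^bsub>G\<^esub> x) \<oplus>\<^bsub>G\<^esub> (\<zero>\<^bsub>G\<^esub> \<oplus>\<^bsub>G\<^esub> y)" using assms I.subset by (auto simp: a_ac)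
    then show "w \<in> set_add G (I +>\<^bsub>G\<^esub> x) (I +>\<^bsub>G\<^esub> y)"
      unfolding set_add_def' a_r_coset_def' using h I.zero_closed by blast
  qed
  then show ?thesis by (simp add: lie_quotient_def)
qed

lemma quotient_smult:
  assumes "x \<in> carrier G"
  shows "a \<odot>\<^bsub>lie_quotient G I\<^esub> (I +>\<^bsub>G\<^esub> x) = I +>\<^bsub>G\<^esub> (a \<odot>\<^bsub>G\<^esub> x)"
proof -
  have "I +>\<^bsub>G\<^esub> (a \<odot>\<^bsub>G\<^esub> x') = I +>\<^bsub>G\<^esub> (a \<odot>\<^bsub>G\<^esub> x)" if x': "x' \<in> I +>\<^bsub>G\<^esub> x" for x'
  proof -
    note m = coset_mem[OF assms x']
    have "(a \<odot>\<^bsub>G\<^esub> x') \<oplus>\<^bsub>G\<^esub> (- 1) \<odot>\<^bsub>G\<^esub> (a \<odot>\<^bsub>G\<^esub> x) = a \<odot>\<^bsub>G\<^esub> (x' \<oplus>\<^bsub>G\<^esub> (- 1) \<odot>\<^bsub>G\<^esub> x)"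
      using assms m(1) by (simp add: smult_distrib_class[OF is_vs] smult_assoc_class[OF is_vs])
    then show ?thesis using assms m I.smult_closed[of a] by (subst coset_eq_iff) auto
  qed
  then have "(\<Union>x'\<in>I +>\<^bsub>G\<^esub> x. I +>\<^bsub>G\<^esub> (a \<odot>\<^bsub>G\<^esub> x')) = I +>\<^bsub>G\<^esub> (a \<odot>\<^bsub>G\<^esub> x)"
    by (intro UN_constant_eq[OF coset_self[OF assms]] ballI)
  then show ?thesis by (simp add: lie_quotient_def)
qed

lemma quotient_bracket:
  assumes "x \<in> carrier G" "y \<in> carrier G"
  shows "bracket (lie_quotient G I) (I +>\<^bsub>G\<^esub> x) (I +>\<^bsub>G\<^esub> y) = I +>\<^bsub>G\<^esub> bracket G x y"
proof -
  have *: "I +>\<^bsub>G\<^esub> bracket G x' y' = I +>\<^bsub>G\<^esub> bracket G x y" if x': "x' \<in> I +>\<^bsub>G\<^esub> x" and y': "y' \<in> I +>\<^bsub>G\<^esub> y" for x' y'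
  proof -
    note m = coset_mem[OF assms(1) x'] and m' = coset_mem[OF assms(2) y']
    let ?d = "x' \<oplus>\<^bsub>G\<^esub> (- 1) \<odot>\<^bsub>G\<^esub> x" and ?e = "y' \<oplus>\<^bsub>G\<^esub> (- 1) \<odot>\<^bsub>G\<^esub> y"
    have bc: "bracket G x' y' \<in> carrier G" "bracket G x y' \<in> carrier G" "bracket G x y \<in> carrier G"
      using m m' assms bracket_closed by auto
    have "I +>\<^bsub>G\<^esub> bracket G x' y' = I +>\<^bsub>G\<^esub> bracket G x y'"
    proof (subst coset_eq_iff)
      have "bracket G ?d y' = bracket G x' y' \<oplus>\<^bsub>G\<^esub> (- 1) \<odot>\<^bsub>G\<^esub> bracket G x y'"
        using m m' assms by (simp add: bracket_add_left bracket_smult_left)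
      then show "bracket G x' y' \<oplus>\<^bsub>G\<^esub> (- 1) \<odot>\<^bsub>G\<^esub> bracket G x y' \<in> I"
        using ideal_bracket_left[of y' ?d] m m' by simp
    qed (use bc in auto)
    also have "\<dots> = I +>\<^bsub>G\<^esub> bracket G x y"
    proof (subst coset_eq_iff)
      have "bracket G x ?e = bracket G x y' \<oplus>\<^bsub>G\<^esub> (- 1) \<odot>\<^bsub>G\<^esub> bracket G x y"
        using m m' assms by (simp add: bracket_add_right bracket_smult_right)
      then show "bracket G x y' \<oplus>\<^bsub>G\<^esub> (- 1) \<odot>\<^bsub>G\<^esub> bracket G x y \<in> I"
        using ideal_bracket[of x ?e] m m' assms by simp
    qed (use bc in auto)
    finally show ?thesis .
  qed
  then have "(\<Union>y'\<in>I +>\<^bsub>G\<^esub> y. I +>\<^bsub>G\<^esub> bracket G x' y') = I +>\<^bsub>G\<^esub> bracket G x y" if "x' \<in> I +>\<^bsub>G\<^esub> x" for x'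
    by (intro UN_constant_eq[OF coset_self[OF assms(2)]]) (use that in auto)
  then have "(\<Union>x'\<in>I +>\<^bsub>G\<^esub> x. \<Union>y'\<in>I +>\<^bsub>G\<^esub> y. I +>\<^bsub>G\<^esub> bracket G x' y') = I +>\<^bsub>G\<^esub> bracket G x y"
    by (intro UN_constant_eq[OF coset_self[OF assms(1)]]) auto
  then show ?thesis by (simp add: lie_quotient_def)
qed

lemma lie_algebra_quotient: "lie_algebra (lie_quotient G I)"
  by (rule lie_algebra_surjective_image[OF G, of _ "\<lambda>x. I +>\<^bsub>G\<^esub> x"])
    (simp_all add: quotient_carrier quotient_zero quotient_add quotient_smult quotient_bracket)

lemma quotient_hom: "lie_hom G (lie_quotient G I) (\<lambda>x. I +>\<^bsub>G\<^esub> x)"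
  by (auto simp: lie_hom_def LinearCombinations.module_hom_def quotient_carrier quotient_add quotient_smult quotient_bracket)

lemma quotient_zero_iff: "x \<in> carrier G \<Longrightarrow> I +>\<^bsub>G\<^esub> x = \<zero>\<^bsub>lie_quotient G I\<^esub> \<longleftrightarrow> x \<in> I"
  by (simp add: quotient_zero coset_eq_iff smult_zero[OF is_vs])

end

section \<open>The grading of the free Lie algebra\<close>

lemma lie_monomial_terms: "lie_monomial V p t \<Longrightarrow> t \<in> lie_terms V" and lie_monomial_pos: "lie_monomial V p t \<Longrightarrow> p \<ge> 1"
  by (induction rule: lie_monomial.induct) auto

context
  fixes V :: "('k::field, 'v, 'm) module_scheme"
  assumes V: "vectorspace class_ring V"
begin

interpretation V: vectorspace class_ring V by (rule V)
interpretation F: lie_algebra "free_lie V" by (rule lie_algebra_free_lie)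

abbreviation (input) "FF \<equiv> free_lie V"
abbreviation (input) "FG p \<equiv> free_lie_gr V (- int p)"

lemma lie_class_closed: "t \<in> lie_terms V \<Longrightarrow> lie_class V t \<in> carrier FF"
  by (simp add: free_lie_simps)

lemma free_gen_closed: "v \<in> carrier V \<Longrightarrow> free_gen V v \<in> carrier FF"
  by (simp add: free_gen_def lie_class_closed)

lemma monomials_closed: "lie_class V ` {t. lie_monomial V p t} \<subseteq> carrier FF"
  using lie_monomial_terms lie_class_closed by blast

lemma FG_def: "FG p = vspan FF (lie_class V ` {t. lie_monomial V p t})"
  by (simp add: free_lie_gr_def)

lemma free_lie_gr_nonneg: "d \<ge> 0 \<Longrightarrow> free_lie_gr V d = {\<zero>\<^bsub>FF\<^esub>}"
proof -
  assume "d \<ge> 0"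
  then have "{t. lie_monomial V (nat (- d)) t} = {}" using lie_monomial_pos by fastforce
  then show ?thesis by (simp add: free_lie_gr_def F.span_empty)
qed

lemma FG_submodule: "submodule class_ring (FG p) FF"
  unfolding FG_def by (rule vspan_submodule[OF F.is_vs monomials_closed])

lemma FG_closed: "x \<in> FG p \<Longrightarrow> x \<in> carrier FF"
  using free_lie_gr_subset by blast

lemma monomial_FG: "lie_monomial V p t \<Longrightarrow> lie_class V t \<in> FG p"
  unfolding FG_def by (rule vspan_base[OF F.is_vs monomials_closed]) blast

lemma FG_bracket:
  assumes "x \<in> FG p" "y \<in> FG q"
  shows "bracket FF x y \<in> FG (p + q)"
proof (rule F.bracket_span_closed[OF monomials_closed monomials_closed FG_submodule _ assms[unfolded FG_def]])
  fix a b assume "a \<in> lie_class V ` {t. lie_monomial V p t}" "b \<in> lie_class V ` {t. lie_monomial V q t}"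
  then obtain s t where st: "lie_monomial V p s" "lie_monomial V q t" "a = lie_class V s" "b = lie_class V t" by blast
  then have "bracket FF a b = lie_class V (Br s t)" using lie_monomial_terms free_lie_class_ops(3) by metis
  then show "bracket FF a b \<in> FG (p + q)" using monomial_FG[OF lie_monomial.intros(2)[OF st(1,2)]] by simp
qed

lemma FG_union_closed: "(\<Union>p\<in>{q..}. FG p) \<subseteq> carrier FF"
  using FG_closed by blast

lemma free_lie_from_submodule: "submodule class_ring (free_lie_from V q) FF"
  unfolding free_lie_from_def by (rule vspan_submodule[OF F.is_vs FG_union_closed])

lemma free_lie_from_closed: "x \<in> free_lie_from V q \<Longrightarrow> x \<in> carrier FF"
  using submodule.subset[OF free_lie_from_submodule] by blast

lemma FG_free_lie_from: "x \<in> FG p \<Longrightarrow> q \<le> p \<Longrightarrow> x \<in> free_lie_from V q"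
  unfolding free_lie_from_def by (rule vspan_base[OF F.is_vs FG_union_closed]) auto

lemma free_lie_from_mono: "p \<le> q \<Longrightarrow> free_lie_from V q \<subseteq> free_lie_from V p"
  unfolding free_lie_from_def by (intro vspan_mono[OF F.is_vs] UN_mono) auto

lemma bracket_free_lie_from:
  assumes "x \<in> free_lie_from V p" "y \<in> free_lie_from V q"
  shows "bracket FF x y \<in> free_lie_from V (p + q)"
proof (rule F.bracket_span_closed[OF FG_union_closed FG_union_closed free_lie_from_submodule _ assms[unfolded free_lie_from_def]])
  fix a b assume "a \<in> (\<Union>p\<in>{p..}. FG p)" "b \<in> (\<Union>p\<in>{q..}. FG p)"
  then obtain p' q' where "p \<le> p'" "q \<le> q'" "a \<in> FG p'" "b \<in> FG q'" by auto
  then show "bracket FF a b \<in> free_lie_from V (p + q)" using FG_free_lie_from[OF FG_bracket] by simp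
qed

text \<open>Structural induction on expressions. It is what permits arguments by homogeneous
  components on the whole free Lie algebra.\<close>

lemma free_lie_from_1: "free_lie_from V 1 = carrier FF"
proof
  show "free_lie_from V 1 \<subseteq> carrier FF" using free_lie_from_closed by blast
  interpret S: submodule class_ring "free_lie_from V 1" FF by (rule free_lie_from_submodule)
  have "lie_class V t \<in> free_lie_from V 1" if "t \<in> lie_terms V" for t
    using that
  proof (induction t)
    case (Gen v)
    then show ?case by (intro FG_free_lie_from[OF monomial_FG, of 1] lie_monomial.intros) auto
  next
    case Zero then show ?case using S.zero_closed by (simp add: free_lie_simps)
  next
    case (Plus s t)
    then have "lie_class V s \<in> free_lie_from V 1" "lie_class V t \<in> free_lie_from V 1" by auto
    then have "lie_class V s \<oplus>\<^bsub>FF\<^esub> lie_class V t \<in> free_lie_from V 1" by (rule S.m_closed)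
    then show ?case using Plus.prems by (simp add: free_lie_class_ops)
  next
    case (Scale a t)
    then have "lie_class V t \<in> free_lie_from V 1" by auto
    then have "a \<odot>\<^bsub>FF\<^esub> lie_class V t \<in> free_lie_from V 1" using S.smult_closed[of a "lie_class V t"] by auto
    then show ?case using Scale.prems by (simp add: free_lie_class_ops)
  next
    case (Br s t)
    then have "bracket FF (lie_class V s) (lie_class V t) \<in> free_lie_from V (1 + 1)" by (intro bracket_free_lie_from) auto
    then have "bracket FF (lie_class V s) (lie_class V t) \<in> free_lie_from V 1"
      by (rule set_mp[OF free_lie_from_mono, rotated]) (rule le_add1)
    then show ?case using Br.prems by (simp add: free_lie_class_ops)
  qed
  then show "carrier FF \<subseteq> free_lie_from V 1" by (auto simp: free_lie_simps)
qed

lemma bracket_from_2: "x \<in> carrier FF \<Longrightarrow> y \<in> carrier FF \<Longrightarrow> bracket FF x y \<in> free_lie_from V 2"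
proof -
  assume "x \<in> carrier FF" "y \<in> carrier FF"
  then have "bracket FF x y \<in> free_lie_from V (1 + 1)" by (intro bracket_free_lie_from) (simp_all only: free_lie_from_1)
  then show ?thesis by (simp only: one_add_one)
qed

lemma FG_1: "FG 1 = free_gen V ` carrier V"
proof
  have mono: "lie_monomial V 1 t \<longleftrightarrow> (\<exists>v\<in>carrier V. t = Gen v)" for t
  proof
    assume "lie_monomial V 1 t"
    then show "\<exists>v\<in>carrier V. t = Gen v"
      by (cases rule: lie_monomial.cases) (auto dest!: lie_monomial_pos)
  qed (use lie_monomial.intros(1)[of _ V] in blast)
  then have eq: "lie_class V ` {t. lie_monomial V 1 t} = free_gen V ` carrier V"
    by (auto simp: free_gen_def mono image_def)
  note hom = free_gen_hom[OF V, folded vlin_def]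
  have "submodule class_ring (free_gen V ` carrier V) FF"
  proof (rule submodule_class_ringI[OF F.is_vs])
    show "free_gen V ` carrier V \<subseteq> carrier FF" using free_gen_closed by blast
    show "\<zero>\<^bsub>FF\<^esub> \<in> free_gen V ` carrier V" using vlin_zero[OF V F.is_vs hom] V.zero_closed by (metis image_eqI)
    show "x \<oplus>\<^bsub>FF\<^esub> y \<in> free_gen V ` carrier V" if "x \<in> free_gen V ` carrier V" "y \<in> free_gen V ` carrier V" for x y
      using that vlinD(2)[OF hom] V.a_closed by (smt (verit) image_iff)
    show "c \<odot>\<^bsub>FF\<^esub> x \<in> free_gen V ` carrier V" if "x \<in> free_gen V ` carrier V" for c x
      using that vlinD(3)[OF hom] smult_closed_class[OF V] by (smt (verit) image_iff)
  qed
  then show "FG 1 \<subseteq> free_gen V ` carrier V"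
    unfolding FG_def using eq by (intro vspan_minimal[OF F.is_vs]) auto
  show "free_gen V ` carrier V \<subseteq> FG 1"
    unfolding FG_def eq using vspan_base[OF F.is_vs, of "free_gen V ` carrier V"] free_gen_closed by blast
qed

text \<open>The automorphism induced by \<open>v \<mapsto> 2 v\<close>, which has distinct eigenvalues on the components.\<close>

lemma free_lie_doubling:
  obtains \<theta> where "vlin FF FF \<theta>" "\<And>p x. x \<in> FG p \<Longrightarrow> \<theta> x = 2 ^ p \<odot>\<^bsub>FF\<^esub> x"
proof -
  note hom = free_gen_hom[OF V, folded vlin_def]
  let ?f = "\<lambda>v. 2 \<odot>\<^bsub>FF\<^esub> free_gen V v"
  have "?f \<in> module_hom class_ring V FF"
    unfolding vlin_def[symmetric] vlin_iff
    using vlinD[OF hom] smult_closed_class[OF F.is_vs] smult_distrib_class[OF F.is_vs] smult_assoc_class[OF F.is_vs]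
    by (auto simp: mult.commute)
  from free_lie_universal[OF V lie_algebra_free_lie this] obtain \<theta>
    where \<theta>: "lie_hom FF FF \<theta>" "\<And>v. v \<in> carrier V \<Longrightarrow> \<theta> (free_gen V v) = ?f v" by blast
  have mono: "\<theta> (lie_class V t) = 2 ^ p \<odot>\<^bsub>FF\<^esub> lie_class V t" if "lie_monomial V p t" for p t
    using that
  proof (induction rule: lie_monomial.induct)
    case (1 v) then show ?case using \<theta>(2)[of v] by (simp add: free_gen_def)
  next
    case (2 p s q t)
    note st = lie_monomial_terms[OF 2(1)] lie_monomial_terms[OF 2(2)]
    have "\<theta> (bracket FF (lie_class V s) (lie_class V t)) = bracket FF (2 ^ p \<odot>\<^bsub>FF\<^esub> lie_class V s) (2 ^ q \<odot>\<^bsub>FF\<^esub> lie_class V t)"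
      using lie_hom_bracket[OF \<theta>(1)] lie_class_closed st 2 by simp
    also have "\<dots> = 2 ^ (p + q) \<odot>\<^bsub>FF\<^esub> bracket FF (lie_class V s) (lie_class V t)"
      using lie_class_closed st
      by (simp add: F.bracket_smult_left F.bracket_smult_right F.bracket_closed smult_closed_class[OF F.is_vs] smult_assoc_class[OF F.is_vs] power_add mult.commute)
    finally show ?case using st by (simp add: free_lie_class_ops)
  qed
  note lin = lie_hom_vlin[OF \<theta>(1)]
  show ?thesis
  proof (rule that[OF lin])
    fix p x assume x: "x \<in> FG p"
    show "\<theta> x = 2 ^ p \<odot>\<^bsub>FF\<^esub> x"
    proof (rule vlin_eq_on_span[OF F.is_vs F.is_vs lin _ monomials_closed _ x[unfolded FG_def]])
      show "vlin FF FF (\<lambda>x. 2 ^ p \<odot>\<^bsub>FF\<^esub> x)"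
        by (auto simp: vlin_iff smult_closed_class[OF F.is_vs] smult_distrib_class[OF F.is_vs] smult_assoc_class[OF F.is_vs] mult.commute)
    qed (use mono in auto)
  qed
qed

text \<open>\<open>V\<close> with the zero bracket is a Lie algebra, so the identity of
  \<open>V\<close> extends to the free Lie algebra and kills all brackets. It follows that
  \<open>V\<close> embeds and meets the span of the components of degree at most -2 in zero.\<close>

lemma free_lie_projection:
  obtains \<pi> where "vlin FF V \<pi>" "\<And>v. v \<in> carrier V \<Longrightarrow> \<pi> (free_gen V v) = v" "\<And>x. x \<in> free_lie_from V 2 \<Longrightarrow> \<pi> x = \<zero>\<^bsub>V\<^esub>"
proof -
  define A :: "('k, 'v) lie" where "A = \<lparr>carrier = carrier V, mult = mult V, one = one V, zero = zero V, add = add V,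
    smult = smult V, bracket = (\<lambda>x y. \<zero>\<^bsub>V\<^esub>)\<rparr>"
  have A: "carrier A = carrier V" "\<zero>\<^bsub>A\<^esub> = \<zero>\<^bsub>V\<^esub>" "x \<oplus>\<^bsub>A\<^esub> y = x \<oplus>\<^bsub>V\<^esub> y" "c \<odot>\<^bsub>A\<^esub> x = c \<odot>\<^bsub>V\<^esub> x" "bracket A x y = \<zero>\<^bsub>V\<^esub>" for x y c
    by (simp_all add: A_def)
  have "vectorspace class_ring A"
    by (rule vs_criteria)
      (use V.add.m_assoc V.a_comm V.r_neg V.a_inv_closed smult_closed_class[OF V] smult_add_class[OF V] smult_assoc_class[OF V]
        smult_distrib_class[OF V] one_smult[OF V] class_field.field_axioms in \<open>auto simp: A\<close>)
  then have lA: "lie_algebra A"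
    by (intro lie_algebra.intro) (auto simp: lie_algebra_axioms_def A smult_zero[OF V])
  have "(\<lambda>v. v) \<in> module_hom class_ring V A" by (auto simp: LinearCombinations.module_hom_def A)
  from free_lie_universal[OF V lA this] obtain \<pi>
    where \<pi>: "lie_hom FF A \<pi>" "\<And>v. v \<in> carrier V \<Longrightarrow> \<pi> (free_gen V v) = v" by blast
  have lin: "vlin FF V \<pi>" using lie_hom_vlin[OF \<pi>(1)] by (simp add: vlin_iff A)
  have FG0: "\<pi> x = \<zero>\<^bsub>V\<^esub>" if x: "x \<in> FG p" and p: "p \<ge> 2" for p x
  proof (rule vlin_eq_on_span[OF F.is_vs V lin _ monomials_closed _ x[unfolded FG_def]])
    show "vlin FF V (\<lambda>x. \<zero>\<^bsub>V\<^esub>)" by (auto simp: vlin_iff smult_zero[OF V])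
    fix a assume "a \<in> lie_class V ` {t. lie_monomial V p t}"
    then obtain t where t: "lie_monomial V p t" "a = lie_class V t" by blast
    from t(1) p obtain s u where su: "t = Br s u" "s \<in> lie_terms V" "u \<in> lie_terms V"
      by (cases rule: lie_monomial.cases) (auto dest: lie_monomial_terms)
    then have "\<pi> (bracket FF (lie_class V s) (lie_class V u)) = \<zero>\<^bsub>V\<^esub>"
      using lie_hom_bracket[OF \<pi>(1)] lie_class_closed by (simp add: A)
    then show "\<pi> a = \<zero>\<^bsub>V\<^esub>" using su t by (simp add: free_lie_class_ops)
  qed
  show ?thesis
  proof (rule that[OF lin \<pi>(2)])
    fix x assume x: "x \<in> free_lie_from V 2"
    show "\<pi> x = \<zero>\<^bsub>V\<^esub>"
    proof (rule vlin_eq_on_span[OF F.is_vs V lin _ FG_union_closed _ x[unfolded free_lie_from_def]])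
      show "vlin FF V (\<lambda>x. \<zero>\<^bsub>V\<^esub>)" by (auto simp: vlin_iff smult_zero[OF V])
    qed (use FG0 in auto)
  qed
qed

lemma free_lie_decompose:
  assumes "vlin FF V \<pi>" "\<And>v. v \<in> carrier V \<Longrightarrow> \<pi> (free_gen V v) = v" "\<And>x. x \<in> free_lie_from V 2 \<Longrightarrow> \<pi> x = \<zero>\<^bsub>V\<^esub>"
    and x: "x \<in> carrier FF"
  obtains y where "y \<in> free_lie_from V 2" "x = free_gen V (\<pi> x) \<oplus>\<^bsub>FF\<^esub> y"
proof -
  interpret S: submodule class_ring "free_lie_from V 2" FF by (rule free_lie_from_submodule)
  note hom = free_gen_hom[OF V, folded vlin_def]
  have SC: "y \<in> carrier FF" if "y \<in> free_lie_from V 2" for y by (rule free_lie_from_closed[OF that])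
  have "\<exists>y\<in>free_lie_from V 2. x = free_gen V (\<pi> x) \<oplus>\<^bsub>FF\<^esub> y"
    using x[folded free_lie_from_1, unfolded free_lie_from_def] FG_union_closed
  proof (rule vspan_induct[OF F.is_vs])
    show "\<exists>y\<in>free_lie_from V 2. \<zero>\<^bsub>FF\<^esub> = free_gen V (\<pi> \<zero>\<^bsub>FF\<^esub>) \<oplus>\<^bsub>FF\<^esub> y"
      using vlin_zero[OF F.is_vs V assms(1)] vlin_zero[OF V F.is_vs hom] S.zero_closed by (intro bexI[of _ "\<zero>\<^bsub>FF\<^esub>"]) auto
  next
    fix a assume "a \<in> (\<Union>p\<in>{1..}. FG p)"
    then obtain p where p: "p \<ge> 1" "a \<in> FG p" by auto
    show "\<exists>y\<in>free_lie_from V 2. a = free_gen V (\<pi> a) \<oplus>\<^bsub>FF\<^esub> y"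
    proof (cases "p = 1")
      case True
      then obtain v where "v \<in> carrier V" "a = free_gen V v" using p FG_1 by auto
      then show ?thesis using assms(2) free_gen_closed S.zero_closed by (intro bexI[of _ "\<zero>\<^bsub>FF\<^esub>"]) auto
    next
      case False
      then have "a \<in> free_lie_from V 2" using p FG_free_lie_from by simp
      then show ?thesis using assms(3) vlin_zero[OF V F.is_vs hom] SC by (intro bexI[of _ a]) auto
    qed
  next
    fix x x' assume C: "x \<in> carrier FF" "x' \<in> carrier FF"
      and "\<exists>y\<in>free_lie_from V 2. x = free_gen V (\<pi> x) \<oplus>\<^bsub>FF\<^esub> y" "\<exists>y\<in>free_lie_from V 2. x' = free_gen V (\<pi> x') \<oplus>\<^bsub>FF\<^esub> y"
    then obtain y y' where y: "y \<in> free_lie_from V 2" "x = free_gen V (\<pi> x) \<oplus>\<^bsub>FF\<^esub> y"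
      and y': "y' \<in> free_lie_from V 2" "x' = free_gen V (\<pi> x') \<oplus>\<^bsub>FF\<^esub> y'" by blast
    have "x \<oplus>\<^bsub>FF\<^esub> x' = (free_gen V (\<pi> x) \<oplus>\<^bsub>FF\<^esub> y) \<oplus>\<^bsub>FF\<^esub> (free_gen V (\<pi> x') \<oplus>\<^bsub>FF\<^esub> y')"
      using y y' by simp
    also have "\<dots> = free_gen V (\<pi> (x \<oplus>\<^bsub>FF\<^esub> x')) \<oplus>\<^bsub>FF\<^esub> (y \<oplus>\<^bsub>FF\<^esub> y')"
      using C vlinD[OF assms(1)] vlinD[OF hom] SC[OF y(1)] SC[OF y'(1)] by (simp add: F.a_ac)
    finally show "\<exists>y\<in>free_lie_from V 2. x \<oplus>\<^bsub>FF\<^esub> x' = free_gen V (\<pi> (x \<oplus>\<^bsub>FF\<^esub> x')) \<oplus>\<^bsub>FF\<^esub> y"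
      using y y' S.m_closed by blast
  next
    fix c x assume C: "x \<in> carrier FF" and "\<exists>y\<in>free_lie_from V 2. x = free_gen V (\<pi> x) \<oplus>\<^bsub>FF\<^esub> y"
    then obtain y where y: "y \<in> free_lie_from V 2" "x = free_gen V (\<pi> x) \<oplus>\<^bsub>FF\<^esub> y" by blast
    have "c \<odot>\<^bsub>FF\<^esub> x = c \<odot>\<^bsub>FF\<^esub> (free_gen V (\<pi> x) \<oplus>\<^bsub>FF\<^esub> y)" using y by simp
    also have "\<dots> = free_gen V (\<pi> (c \<odot>\<^bsub>FF\<^esub> x)) \<oplus>\<^bsub>FF\<^esub> c \<odot>\<^bsub>FF\<^esub> y"
      using C vlinD[OF assms(1)] vlinD[OF hom] SC[OF y(1)] smult_distrib_class[OF F.is_vs] by simp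
    finally show "\<exists>y\<in>free_lie_from V 2. c \<odot>\<^bsub>FF\<^esub> x = free_gen V (\<pi> (c \<odot>\<^bsub>FF\<^esub> x)) \<oplus>\<^bsub>FF\<^esub> y"
      using y S.smult_closed[of c y] by auto
  qed
  then show ?thesis using that by blast
qed

end

section \<open>Coordinates\<close>

locale based_space =
  fixes V :: "('k::field, 'v, 'm) module_scheme" and e :: "nat \<Rightarrow> 'v" and n :: nat
  assumes V: "vectorspace class_ring V" and inj_e: "inj_on e {..<n}"
    and basis_e: "vectorspace.basis class_ring V (e ` {..<n})"
begin

sublocale V: vectorspace class_ring V by (rule V)

lemma e_closed: "i < n \<Longrightarrow> e i \<in> carrier V"
  using basis_e by (auto simp: V.basis_def)

lemma e_image_closed: "e ` {..<n} \<subseteq> carrier V"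
  using e_closed by auto

lemma vspan_e: "vspan V (e ` {..<n}) = carrier V"
  using basis_e by (simp add: V.basis_def)

definition comb :: "(nat \<Rightarrow> 'k) \<Rightarrow> 'v" where
  "comb c = (\<Oplus>\<^bsub>V\<^esub>i\<in>{..<n}. c i \<odot>\<^bsub>V\<^esub> e i)"

text \<open>Only the entries below \<open>n\<close> carry meaning; for larger indices this is an
  out-of-range vector entry.\<close>

definition co :: "'v \<Rightarrow> nat \<Rightarrow> 'k" where
  "co v i = coords V e n v $ i"

lemma comb_closed: "comb c \<in> carrier V"
  unfolding comb_def using e_closed smult_closed_class[OF V] by (intro V.finsum_closed) auto

lemma comb_cong: "(\<And>i. i < n \<Longrightarrow> c i = d i) \<Longrightarrow> comb c = comb d"
  unfolding comb_def using e_closed smult_closed_class[OF V] by (intro V.finsum_cong') auto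

lemma comb_lincomb: "V.lincomb a (e ` {..<n}) = comb (\<lambda>i. a (e i))"
  unfolding V.lincomb_def comb_def
  using e_closed smult_closed_class[OF V] by (subst V.add.finprod_reindex[OF _ inj_e]) auto

lemma comb_ex1:
  assumes "v \<in> carrier V"
  shows "\<exists>!x. x \<in> carrier_vec n \<and> v = comb (\<lambda>i. x $ i)"
proof -
  have "\<exists>!a. a \<in> (e ` {..<n}) \<rightarrow>\<^sub>E carrier (class_ring :: 'k ring) \<and> V.lincomb a (e ` {..<n}) = v"
    using V.basis_criterion[of "e ` {..<n}"] e_image_closed basis_e assms by blast
  then obtain a where a: "V.lincomb a (e ` {..<n}) = v"
    and uniq: "\<And>b. b \<in> (e ` {..<n}) \<rightarrow>\<^sub>E UNIV \<Longrightarrow> V.lincomb b (e ` {..<n}) = v \<Longrightarrow> b = a"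
    by (auto simp: Ex1_def)
  show ?thesis
  proof (rule ex1I[of _ "Matrix.vec n (\<lambda>i. a (e i))"])
    have "comb (\<lambda>i. Matrix.vec n (\<lambda>i. a (e i)) $ i) = comb (\<lambda>i. a (e i))" by (rule comb_cong) simp
    then show "Matrix.vec n (\<lambda>i. a (e i)) \<in> carrier_vec n \<and> v = comb (\<lambda>i. Matrix.vec n (\<lambda>i. a (e i)) $ i)"
      using a by (simp add: comb_lincomb)
  next
    fix x assume x: "x \<in> carrier_vec n \<and> v = comb (\<lambda>i. x $ i)"
    define b where "b = restrict (\<lambda>w. x $ (inv_into {..<n} e w)) (e ` {..<n})"
    have be: "b (e i) = x $ i" if "i < n" for i using that inj_e by (simp add: b_def)
    have "V.lincomb b (e ` {..<n}) = v"
      unfolding comb_lincomb using x be comb_cong[of "\<lambda>i. b (e i)" "\<lambda>i. x $ i"] by simp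
    then have "b = a" by (intro uniq) (auto simp: b_def)
    then show "x = Matrix.vec n (\<lambda>i. a (e i))" using x be by (intro eq_vecI) auto
  qed
qed

lemma coords_props: "v \<in> carrier V \<Longrightarrow> coords V e n v \<in> carrier_vec n \<and> v = comb (co v)"
  using theI'[OF comb_ex1, of v] by (simp add: coords_def co_def[abs_def] comb_def)

lemma comb_co: "v \<in> carrier V \<Longrightarrow> comb (co v) = v"
  using coords_props by auto

lemma comb_inj:
  assumes "comb c = comb d" "i < n" shows "c i = d i"
proof -
  have "comb (\<lambda>i. Matrix.vec n c $ i) = comb c" "comb (\<lambda>i. Matrix.vec n d $ i) = comb d" by (auto intro: comb_cong)
  then have "Matrix.vec n c = Matrix.vec n d"
    using comb_ex1[OF comb_closed[of c]] assms(1) by (metis vec_carrier)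
  then show ?thesis using assms(2) by (metis index_vec)
qed

lemma co_comb: "i < n \<Longrightarrow> co (comb c) i = c i"
  using comb_inj[of "co (comb c)" c] comb_co[OF comb_closed] by simp

lemma comb_add: "comb (\<lambda>i. c i + d i) = comb c \<oplus>\<^bsub>V\<^esub> comb d"
proof -
  have "comb (\<lambda>i. c i + d i) = (\<Oplus>\<^bsub>V\<^esub>i\<in>{..<n}. c i \<odot>\<^bsub>V\<^esub> e i \<oplus>\<^bsub>V\<^esub> d i \<odot>\<^bsub>V\<^esub> e i)"
    unfolding comb_def using e_closed smult_closed_class[OF V] smult_add_class[OF V]
    by (intro V.finsum_cong') auto
  also have "\<dots> = comb c \<oplus>\<^bsub>V\<^esub> comb d"
    unfolding comb_def using e_closed smult_closed_class[OF V] by (intro V.finsum_addf) auto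
  finally show ?thesis .
qed

lemma comb_smult: "comb (\<lambda>i. a * c i) = a \<odot>\<^bsub>V\<^esub> comb c"
proof -
  have lin: "vlin V V (\<lambda>v. a \<odot>\<^bsub>V\<^esub> v)"
    by (auto simp: vlin_iff smult_closed_class[OF V] smult_distrib_class[OF V] smult_assoc_class[OF V] mult.commute)
  have "a \<odot>\<^bsub>V\<^esub> comb c = (\<Oplus>\<^bsub>V\<^esub>i\<in>{..<n}. a \<odot>\<^bsub>V\<^esub> (c i \<odot>\<^bsub>V\<^esub> e i))"
    unfolding comb_def using e_closed smult_closed_class[OF V] by (intro vlin_finsum[OF V V lin]) auto
  also have "\<dots> = comb (\<lambda>i. a * c i)"
    unfolding comb_def using e_closed smult_closed_class[OF V] smult_assoc_class[OF V] by (intro V.finsum_cong') auto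
  finally show ?thesis by simp
qed

lemma co_add: "v \<in> carrier V \<Longrightarrow> w \<in> carrier V \<Longrightarrow> i < n \<Longrightarrow> co (v \<oplus>\<^bsub>V\<^esub> w) i = co v i + co w i"
  using co_comb[of i "\<lambda>i. co v i + co w i"] by (simp add: comb_add comb_co)

lemma co_smult: "v \<in> carrier V \<Longrightarrow> i < n \<Longrightarrow> co (a \<odot>\<^bsub>V\<^esub> v) i = a * co v i"
  using co_comb[of i "\<lambda>i. a * co v i"] by (simp add: comb_smult comb_co)

lemma co_zero: "i < n \<Longrightarrow> co \<zero>\<^bsub>V\<^esub> i = 0"
  using co_smult[of "\<zero>\<^bsub>V\<^esub>" i 0] zero_smult[OF V, of "\<zero>\<^bsub>V\<^esub>"] by simp

lemma comb_unit: "l < n \<Longrightarrow> comb (\<lambda>i. if i = l then 1 else 0) = e l"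
proof -
  assume l: "l < n"
  have "comb (\<lambda>i. if i = l then 1 else 0) = (\<Oplus>\<^bsub>V\<^esub>i\<in>{..<n}. if l = i then e i else \<zero>\<^bsub>V\<^esub>)"
    unfolding comb_def using e_closed zero_smult[OF V] one_smult[OF V] by (intro V.finsum_cong') auto
  also have "\<dots> = e l" using l e_closed by (subst V.add.finprod_singleton) auto
  finally show ?thesis .
qed

lemma co_e: "l < n \<Longrightarrow> i < n \<Longrightarrow> co (e l) i = (if i = l then 1 else 0)"
  using co_comb[of i "\<lambda>i. if i = l then 1 else 0"] comb_unit[of l] by simp

lemma co_inj: "v \<in> carrier V \<Longrightarrow> w \<in> carrier V \<Longrightarrow> (\<And>i. i < n \<Longrightarrow> co v i = co w i) \<Longrightarrow> v = w"
  using comb_cong[of "co v" "co w"] by (simp add: comb_co)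

lemma matrix_of_index: "j < n \<Longrightarrow> l < n \<Longrightarrow> matrix_of V e n f $$ (j, l) = co (f (e l)) j"
  by (simp add: matrix_of_def mat_of_cols_def co_def)

lemma matrix_of_carrier: "matrix_of V e n f \<in> carrier_mat n n"
  by (simp add: matrix_of_def mat_of_cols_def)

lemma wedge_coords_index: "i < n \<Longrightarrow> j < n \<Longrightarrow> wedge_mat n (coords V e n v) (coords V e n w) $$ (i, j) = co v i * co w j - co w i * co v j"
  by (simp add: wedge_mat_def co_def)

end

lemma mat_trace_mult:
  assumes "A \<in> carrier_mat n n" "B \<in> carrier_mat n n"
  shows "mat_trace (A * B) = (\<Sum>i<n. \<Sum>j<n. A $$ (i, j) * B $$ (j, i))"
  unfolding mat_trace_def using assms
  by (intro sum.cong) (auto simp: scalar_prod_def lessThan_atLeast0 intro!: sum.cong)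

lemma antisym_index:
  assumes "Y \<in> antisym_mats n" "i < n" "j < n"
  shows "Y $$ (j, i) = - Y $$ (i, j)"
proof -
  have Y: "Y \<in> carrier_mat n n" "transpose_mat Y = - Y" using assms by (auto simp: antisym_mats_def)
  have "Y $$ (j, i) = transpose_mat Y $$ (i, j)" using Y(1) assms by simp
  also have "\<dots> = - Y $$ (i, j)" unfolding Y(2) using Y(1) assms by simp
  finally show ?thesis .
qed

text \<open>The trace of Y v w^T is w^T Y v, and the antisymmetry of Y makes the two halves of the
  wedge contribute equally.\<close>

lemma mat_trace_antisym_wedge:
  assumes Y: "Y \<in> antisym_mats n"
  shows "mat_trace (Y * wedge_mat n v w) = 2 * (\<Sum>i<n. \<Sum>j<n. Y $$ (i, j) * (w $ i * v $ j))"
proof -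
  have YC: "Y \<in> carrier_mat n n" using Y by (simp add: antisym_mats_def)
  have "mat_trace (Y * wedge_mat n v w) = (\<Sum>i<n. \<Sum>j<n. Y $$ (i, j) * (v $ j * w $ i - w $ j * v $ i))"
    by (subst mat_trace_mult[OF YC]) (auto simp: wedge_mat_def intro!: sum.cong)
  also have "\<dots> = (\<Sum>i<n. \<Sum>j<n. Y $$ (i, j) * (w $ i * v $ j)) - (\<Sum>i<n. \<Sum>j<n. Y $$ (i, j) * (w $ j * v $ i))"
    by (simp add: sum_subtractf[symmetric] algebra_simps)
  also have "(\<Sum>i<n. \<Sum>j<n. Y $$ (i, j) * (w $ j * v $ i)) = (\<Sum>j<n. \<Sum>i<n. Y $$ (i, j) * (w $ j * v $ i))"
    by (rule sum.swap)
  also have "\<dots> = (\<Sum>j<n. \<Sum>i<n. - (Y $$ (j, i) * (w $ j * v $ i)))"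
  proof (intro sum.cong HOL.refl)
    fix j i assume "j \<in> {..<n}" "i \<in> {..<n}"
    then have y: "Y $$ (i, j) = - Y $$ (j, i)" by (intro antisym_index[OF Y]) auto
    show "Y $$ (i, j) * (w $ j * v $ i) = - (Y $$ (j, i) * (w $ j * v $ i))" unfolding y by simp
  qed
  finally show ?thesis by (simp add: sum_negf)
qed

lemma K2_perp_antisym: "Y \<in> K2_perp V e n K \<Longrightarrow> Y \<in> antisym_mats n"
  by (simp add: K2_perp_def)

section \<open>The linear system of the degree zero derivations\<close>

text \<open>The endomorphisms in \<open>\<LL>\<close> that, extended by zero to the components of degree \<open>\<le> -2\<close>, are
  derivations of \<open>\<ff>(V)/\<K>\<close>. The matrix entry \<open>A j l\<close> is the coefficient of \<open>e j\<close> in the image of \<open>e l\<close>.\<close>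

definition der_eqs :: "('k::field, 'v, 'm) module_scheme \<Rightarrow> (nat \<Rightarrow> 'v) \<Rightarrow> nat \<Rightarrow> ('v \<Rightarrow> 'v) set
    \<Rightarrow> ('k, 'v) lie_term set set \<Rightarrow> nat \<Rightarrow> (nat \<Rightarrow> nat \<Rightarrow> 'k) set" where
  "der_eqs V e n \<LL> \<K> m = {\<lambda>j l. A $$ (l, j) | A. A \<in> L_perp V e n \<LL>} \<union>
     {\<lambda>j l. (if l = q then Y $$ (p, j) else 0) - (if l = p then Y $$ (q, j) else 0) | Y p q.
        Y \<in> K2_perp V e n \<K> \<and> p < n \<and> q < n} \<union>
     {\<lambda>j l. if j = a \<and> l = b then 1 else 0 | a b. m \<le> a \<and> a < n \<and> b < n}"

text \<open>The equations have coefficients in \<open>'k\<close>; \<open>h\<close> allows solutions in an extension field.\<close>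

lemma der_eqs_iff:
  fixes h :: "'k::field \<Rightarrow> 'f::field" and A :: "nat \<Rightarrow> nat \<Rightarrow> 'f"
  assumes h: "h 0 = 0" "h 1 = 1" "\<And>x y. h (x - y) = h x - h y"
  shows "slice_eqs ((\<lambda>r j l. h (r j l)) ` der_eqs V e n \<LL> \<K> m) n A \<longleftrightarrow>
    (\<forall>B\<in>L_perp V e n \<LL>. (\<Sum>j<n. \<Sum>l<n. h (B $$ (l, j)) * A j l) = 0) \<and>
    (\<forall>Y\<in>K2_perp V e n \<K>. \<forall>p<n. \<forall>q<n. (\<Sum>j<n. h (Y $$ (p, j)) * A j q) = (\<Sum>j<n. h (Y $$ (q, j)) * A j p)) \<and>
    (\<forall>a<n. \<forall>b<n. m \<le> a \<longrightarrow> A a b = 0)"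
proof -
  \<comment> \<open>The second family says that Y A is symmetric. As Y is antisymmetric, this is Y A
    + A^T Y = 0: the image of the derivation of the exterior square induced by A is orthogonal to
    Y.\<close>
  have eq2: "(\<Sum>j<n. \<Sum>l<n. h ((if l = q then Y $$ (p, j) else 0) - (if l = p then Y $$ (q, j) else 0)) * A j l)
      = (\<Sum>j<n. h (Y $$ (p, j)) * A j q) - (\<Sum>j<n. h (Y $$ (q, j)) * A j p)" if "p < n" "q < n" for Y p q
  proof -
    have "h ((if l = q then Y $$ (p, j) else 0) - (if l = p then Y $$ (q, j) else 0)) * A j l
        = (if l = q then h (Y $$ (p, j)) * A j q else 0) - (if l = p then h (Y $$ (q, j)) * A j p else 0)" for j l
      using h(1) h(3) by auto
    then show ?thesis using that by (simp add: sum_subtractf)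
  qed
  \<comment> \<open>The third family says that the image of A lies in W.\<close>
  have eq3: "(\<Sum>j<n. \<Sum>l<n. h (if j = a \<and> l = b then 1 else 0) * A j l) = A a b" if "a < n" "b < n" for a b
  proof -
    have "(\<Sum>j<n. \<Sum>l<n. h (if j = a \<and> l = b then 1 else 0) * A j l) = (\<Sum>j<n. if j = a then A a b else 0)"
    proof (rule sum.cong[OF HOL.refl])
      fix j assume "j \<in> {..<n}"
      have "(\<Sum>l<n. h (if j = a \<and> l = b then 1 else 0) * A j l) = (\<Sum>l<n. if l = b then (if j = a then A j b else 0) else 0)"
        using h by (intro sum.cong) auto
      then show "(\<Sum>l<n. h (if j = a \<and> l = b then 1 else 0) * A j l) = (if j = a then A a b else 0)" using that by auto
    qed
    then show ?thesis using that by simp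
  qed
  define f where "f = (\<lambda>r. \<Sum>j<n. \<Sum>l<n. h (r j l) * A j l)"
  have "(\<forall>r\<in>{\<lambda>j l. B $$ (l, j) | B. B \<in> L_perp V e n \<LL>}. f r = 0) \<longleftrightarrow>
      (\<forall>B\<in>L_perp V e n \<LL>. f (\<lambda>j l. B $$ (l, j)) = 0)" by blast
  moreover have "(\<forall>r\<in>{\<lambda>j l. (if l = q then Y $$ (p, j) else 0) - (if l = p then Y $$ (q, j) else 0) | Y p q.
        Y \<in> K2_perp V e n \<K> \<and> p < n \<and> q < n}. f r = 0) \<longleftrightarrow>
      (\<forall>Y\<in>K2_perp V e n \<K>. \<forall>p<n. \<forall>q<n. f (\<lambda>j l. (if l = q then Y $$ (p, j) else 0) - (if l = p then Y $$ (q, j) else 0)) = 0)"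
    by blast
  moreover have "(\<forall>r\<in>{\<lambda>j l. if j = a \<and> l = b then 1 else 0 | a b. m \<le> a \<and> a < n \<and> b < n}. f r = 0) \<longleftrightarrow>
      (\<forall>a<n. \<forall>b<n. m \<le> a \<longrightarrow> f (\<lambda>j l. if j = a \<and> l = b then 1 else 0) = 0)" by blast
  moreover have "slice_eqs ((\<lambda>r j l. h (r j l)) ` der_eqs V e n \<LL> \<K> m) n A \<longleftrightarrow> (\<forall>r\<in>der_eqs V e n \<LL> \<K> m. f r = 0)"
    by (simp add: slice_eqs_def f_def)
  ultimately show ?thesis by (simp add: der_eqs_def ball_Un f_def eq2 eq3)
qed

section \<open>The quotient of the free Lie algebra, and the equations coming from W, K_-2 and
  L\<close>

locale tanaka = based_space V e n
  for V :: "('k::field_char_0, 'v, 'w) module_scheme" and e n +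
  fixes \<LL> :: "('v \<Rightarrow> 'v) set" and \<K> :: "('k, 'v) lie_term set set" and m \<mu> :: nat
  assumes K_graded: "graded_lie_ideal \<K> (free_lie V) (free_lie_gr V)"
    and K_lower: "free_lie_from V (\<mu> + 1) \<subseteq> \<K>" and K_upper: "\<K> \<subseteq> free_lie_from V 2"
    and m_le: "m \<le> n" and W_basis: "vectorspace.basis class_ring (V\<lparr>carrier := W_space V \<K>\<rparr>) (e ` {..<m})"
begin

abbreviation "FL \<equiv> free_lie V"
abbreviation "FLG p \<equiv> free_lie_gr V (- int p)"
abbreviation "MM \<equiv> fund V \<K>"
abbreviation "R \<equiv> der_eqs V e n \<LL> \<K> m"
abbreviation "gen \<equiv> free_gen V"

sublocale F: lie_algebra FL by (rule lie_algebra_free_lie)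

lemma K_ideal: "lie_ideal \<K> FL"
  using K_graded by (simp add: graded_lie_ideal_def)

lemma K_submodule: "submodule class_ring \<K> FL"
  by (rule ideal_submodule[OF lie_algebra_free_lie K_ideal])

sublocale K: submodule class_ring \<K> FL by (rule K_submodule)

sublocale M: lie_algebra MM
  unfolding fund_def by (rule lie_algebra_quotient[OF lie_algebra_free_lie K_ideal])

definition qm :: "('k, 'v) lie_term set \<Rightarrow> ('k, 'v) fundamental" where
  "qm x = \<K> +>\<^bsub>FL\<^esub> x"

lemma qm_hom: "lie_hom FL MM qm"
  unfolding qm_def[abs_def] fund_def by (rule quotient_hom[OF lie_algebra_free_lie K_ideal])

lemmas qm_lin = lie_hom_vlin[OF qm_hom]

lemma qm_zero_iff: "x \<in> carrier FL \<Longrightarrow> qm x = \<zero>\<^bsub>MM\<^esub> \<longleftrightarrow> x \<in> \<K>"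
  unfolding qm_def fund_def by (rule quotient_zero_iff[OF lie_algebra_free_lie K_ideal])

lemma MM_carrier: "carrier MM = qm ` carrier FL"
  unfolding qm_def fund_def by (rule quotient_carrier[OF lie_algebra_free_lie K_ideal])

lemma fund_gr_qm: "fund_gr V \<K> p = qm ` free_lie_gr V p"
  by (simp add: fund_gr_def qm_def)

lemma fund_gen_qm: "fund_gen V \<K> v = qm (gen v)"
  by (simp add: fund_gen_def qm_def)

lemma gen_lin: "vlin V FL gen"
  unfolding vlin_def by (rule free_gen_hom[OF V])

lemma gen_closed: "v \<in> carrier V \<Longrightarrow> gen v \<in> carrier FL"
  by (rule vlinD(1)[OF gen_lin])

definition pr :: "('k, 'v) lie_term set \<Rightarrow> 'v" where
  "pr = (SOME \<pi>. vlin FL V \<pi> \<and> (\<forall>v\<in>carrier V. \<pi> (gen v) = v) \<and> (\<forall>x\<in>free_lie_from V 2. \<pi> x = \<zero>\<^bsub>V\<^esub>))"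

lemma pr: "vlin FL V pr" "v \<in> carrier V \<Longrightarrow> pr (gen v) = v" "x \<in> free_lie_from V 2 \<Longrightarrow> pr x = \<zero>\<^bsub>V\<^esub>"
proof -
  have "\<exists>\<pi>. vlin FL V \<pi> \<and> (\<forall>v\<in>carrier V. \<pi> (gen v) = v) \<and> (\<forall>x\<in>free_lie_from V 2. \<pi> x = \<zero>\<^bsub>V\<^esub>)"
    using free_lie_projection[OF V] by metis
  from someI_ex[OF this] show "vlin FL V pr" "v \<in> carrier V \<Longrightarrow> pr (gen v) = v" "x \<in> free_lie_from V 2 \<Longrightarrow> pr x = \<zero>\<^bsub>V\<^esub>"
    unfolding pr_def by blast+
qed

text \<open>The ideal has no component of degree -1, so V embeds into the quotient.\<close>

lemma gen_in_K_iff: "v \<in> carrier V \<Longrightarrow> gen v \<in> \<K> \<longleftrightarrow> v = \<zero>\<^bsub>V\<^esub>"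
  using pr(2,3) K_upper vlin_zero[OF V F.is_vs gen_lin] K.zero_closed by (metis subsetD)

lemma W_subspace: "submodule class_ring (W_space V \<K>) V"
proof (rule submodule_class_ringI[OF V])
  note C = free_lie_from_closed[OF V]
  show "W_space V \<K> \<subseteq> carrier V" by (auto simp: W_space_def)
  show "\<zero>\<^bsub>V\<^esub> \<in> W_space V \<K>"
    using vlin_zero[OF V F.is_vs gen_lin] F.bracket_zero C K.zero_closed by (auto simp: W_space_def)
  fix v w assume "v \<in> W_space V \<K>" "w \<in> W_space V \<K>"
  then show "v \<oplus>\<^bsub>V\<^esub> w \<in> W_space V \<K>"
    using vlinD[OF gen_lin] F.bracket_add_left C K.m_closed by (auto simp: W_space_def)
next
  fix c v assume "v \<in> W_space V \<K>"
  then show "c \<odot>\<^bsub>V\<^esub> v \<in> W_space V \<K>"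
    using vlinD[OF gen_lin] F.bracket_smult_left free_lie_from_closed[OF V] K.smult_closed[of c] smult_closed_class[OF V]
    by (auto simp: W_space_def)
qed

lemma W_span: "W_space V \<K> = vspan V (e ` {..<m})"
proof -
  have sub: "VectorSpace.subspace class_ring (W_space V \<K>) V"
    using W_subspace V by (simp add: VectorSpace.subspace_def)
  interpret W: vectorspace class_ring "V\<lparr>carrier := W_space V \<K>\<rparr>" by (rule V.subspace_is_vs[OF sub])
  have b: "e ` {..<m} \<subseteq> W_space V \<K>" "W.span (e ` {..<m}) = W_space V \<K>"
    using W_basis by (auto simp: W.basis_def)
  show ?thesis using V.span_li_not_depend(1)[OF b(1) W_subspace] b(2) by simp
qed

text \<open>The adapted basis turns membership in W into the vanishing of the last coordinates,
  which is the shape of the third family of equations.\<close>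

lemma W_iff: "v \<in> W_space V \<K> \<longleftrightarrow> v \<in> carrier V \<and> (\<forall>j<n. m \<le> j \<longrightarrow> co v j = 0)"
proof
  have em: "e ` {..<m} \<subseteq> carrier V" using e_closed m_le by auto
  assume v: "v \<in> W_space V \<K>"
  then have vC: "v \<in> carrier V" by (simp add: W_space_def)
  have "v \<in> carrier V \<and> (\<forall>j<n. m \<le> j \<longrightarrow> co v j = 0)"
    using v[unfolded W_span] em
    by (rule vspan_induct[OF V])
      (use m_le e_closed in \<open>auto simp: co_zero co_e co_add co_smult smult_closed_class[OF V]\<close>)
  then show "v \<in> carrier V \<and> (\<forall>j<n. m \<le> j \<longrightarrow> co v j = 0)" .
next
  have em: "e ` {..<m} \<subseteq> carrier V" using e_closed m_le by auto
  interpret S: submodule class_ring "vspan V (e ` {..<m})" V by (rule vspan_submodule[OF V em])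
  assume v: "v \<in> carrier V \<and> (\<forall>j<n. m \<le> j \<longrightarrow> co v j = 0)"
  have "finsum V (\<lambda>i. co v i \<odot>\<^bsub>V\<^esub> e i) A \<in> vspan V (e ` {..<m})" if "A \<subseteq> {..<n}" for A
    using finite_subset[OF that finite_lessThan] that
  proof (induction A rule: finite_induct)
    case empty then show ?case using S.zero_closed by simp
  next
    case (insert a A)
    have "co v a \<odot>\<^bsub>V\<^esub> e a \<in> vspan V (e ` {..<m})"
    proof (cases "a < m")
      case True
      then show ?thesis using vspan_smult[OF V em] vspan_base[OF V em] by simp
    next
      case False
      then show ?thesis using v insert.prems e_closed zero_smult[OF V] S.zero_closed by simp
    qed
    moreover have "finsum V (\<lambda>i. co v i \<odot>\<^bsub>V\<^esub> e i) (insert a A) = co v a \<odot>\<^bsub>V\<^esub> e a \<oplus>\<^bsub>V\<^esub> finsum V (\<lambda>i. co v i \<odot>\<^bsub>V\<^esub> e i) A"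
      using insert e_closed smult_closed_class[OF V] by (intro V.finsum_insert) auto
    ultimately show ?case using insert S.m_closed by simp
  qed
  from this[of "{..<n}"] show "v \<in> W_space V \<K>" using v comb_co[of v] by (simp add: W_span comb_def)
qed

text \<open>Used with \<open>a = T (e q)\<close> and \<open>b = T (e p)\<close>, where the last
  hypothesis says that T, acting as a derivation, sends [e_q, e_p] into the ideal. Pairing the sum
  of the two wedges with Y gives 2 (Y a)_p - 2 (Y b)_q.\<close>

lemma K2_perp_slice:
  assumes Y: "Y \<in> K2_perp V e n \<K>" and pq: "p < n" "q < n" and ab: "a \<in> carrier V" "b \<in> carrier V"
    and K: "bracket FL (gen a) (gen (e p)) \<oplus>\<^bsub>FL\<^esub> bracket FL (gen (e q)) (gen b) \<in> \<K>"
  shows "(\<Sum>j<n. Y $$ (p, j) * co a j) = (\<Sum>j<n. Y $$ (q, j) * co b j)"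
proof -
  interpret MM: vectorspace class_ring "module_mat TYPE('k) n n" by (rule matrix_vs)
  define v w where "v = (\<lambda>i::nat. if i = 0 then a else e q)" and "w = (\<lambda>i::nat. if i = 0 then e p else b)"
  note Yanti = K2_perp_antisym[OF Y]
  have YC: "Y \<in> carrier_mat n n" using Yanti by (simp add: antisym_mats_def)
  have two: "{..<2} = {0, 1::nat}" by auto
  have two0: "x = 0" if "2 * x = 0" for x :: 'k using that by simp
  let ?W = "\<lambda>v w. wedge_mat n (coords V e n v) (coords V e n w)"
  have WC: "?W v w \<in> carrier_mat n n" for v w by (simp add: wedge_mat_def)
  have bC: "bracket FL (gen x) (gen y) \<in> carrier FL" if "x \<in> carrier V" "y \<in> carrier V" for x y
    using that gen_closed F.bracket_closed by blast
  have "finsum FL (\<lambda>i. bracket FL (gen (v i)) (gen (w i))) {..<2} \<in> \<K>"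
    unfolding two using K bC e_closed pq ab by (simp add: v_def w_def)
  then have "finsum (module_mat TYPE('k) n n) (\<lambda>i. ?W (v i) (w i)) {..<2} \<in> K2_mats V e n \<K>"
    unfolding K2_mats_def using e_closed pq ab
    by (intro CollectI exI[of _ 2] exI[of _ v] exI[of _ w]) (auto simp: v_def w_def)
  moreover have "finsum (module_mat TYPE('k) n n) (\<lambda>i. ?W (v i) (w i)) {..<2} = ?W a (e p) + ?W (e q) b"
    unfolding two using WC by (simp add: v_def w_def module_mat_simps)
  ultimately have "mat_trace (Y * (?W a (e p) + ?W (e q) b)) = 0" using Y by (simp add: K2_perp_def)
  moreover have "mat_trace (Y * (?W a (e p) + ?W (e q) b)) = mat_trace (Y * ?W a (e p)) + mat_trace (Y * ?W (e q) b)"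
  proof -
    have "mat_trace (Y * (?W a (e p) + ?W (e q) b)) = (\<Sum>i<n. \<Sum>j<n. Y $$ (i, j) * ?W a (e p) $$ (j, i) + Y $$ (i, j) * ?W (e q) b $$ (j, i))"
      using WC[of a "e p"] WC[of "e q" b] YC by (subst mat_trace_mult) (auto simp: algebra_simps intro!: sum.cong)
    then show ?thesis using WC YC by (simp add: mat_trace_mult sum.distrib)
  qed
  moreover have "mat_trace (Y * ?W a (e p)) = 2 * (\<Sum>i<n. \<Sum>j<n. Y $$ (i, j) * (co (e p) i * co a j))"
    unfolding mat_trace_antisym_wedge[OF Yanti] co_def ..
  moreover have "mat_trace (Y * ?W (e q) b) = 2 * (\<Sum>i<n. \<Sum>j<n. Y $$ (i, j) * (co b i * co (e q) j))"
    unfolding mat_trace_antisym_wedge[OF Yanti] co_def ..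
  ultimately have "2 * ((\<Sum>i<n. \<Sum>j<n. Y $$ (i, j) * (co (e p) i * co a j)) + (\<Sum>i<n. \<Sum>j<n. Y $$ (i, j) * (co b i * co (e q) j))) = 0"
    by (simp only: distrib_left)
  then have "(\<Sum>i<n. \<Sum>j<n. Y $$ (i, j) * (co (e p) i * co a j)) + (\<Sum>i<n. \<Sum>j<n. Y $$ (i, j) * (co b i * co (e q) j)) = 0"
    by (rule two0)
  moreover have "(\<Sum>i<n. \<Sum>j<n. Y $$ (i, j) * (co (e p) i * co a j)) = (\<Sum>i<n. if i = p then \<Sum>j<n. Y $$ (p, j) * co a j else 0)"
    using pq by (intro sum.cong) (auto simp: co_e)
  moreover have "(\<Sum>i<n. \<Sum>j<n. Y $$ (i, j) * (co b i * co (e q) j)) = (\<Sum>i<n. \<Sum>j<n. if j = q then Y $$ (i, q) * co b i else 0)"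
    using pq by (intro sum.cong HOL.refl) (auto simp: co_e)
  moreover have "(\<Sum>i<n. Y $$ (i, q) * co b i) = - (\<Sum>i<n. Y $$ (q, i) * co b i)"
    unfolding sum_negf[symmetric] using antisym_index[OF Yanti, of q] pq by (intro sum.cong) auto
  ultimately show ?thesis using pq by simp
qed

lemma L_perp_slice:
  assumes "B \<in> L_perp V e n \<LL>" "T \<in> \<LL>"
  shows "(\<Sum>j<n. \<Sum>l<n. B $$ (l, j) * co (T (e l)) j) = 0"
proof -
  have B: "B \<in> carrier_mat n n" "mat_trace (B * matrix_of V e n T) = 0" using assms by (auto simp: L_perp_def)
  have "mat_trace (B * matrix_of V e n T) = (\<Sum>l<n. \<Sum>j<n. B $$ (l, j) * co (T (e l)) j)"
    by (subst mat_trace_mult[OF B(1) matrix_of_carrier]) (auto simp: matrix_of_index intro!: sum.cong)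
  also have "\<dots> = (\<Sum>j<n. \<Sum>l<n. B $$ (l, j) * co (T (e l)) j)" by (rule sum.swap)
  finally show ?thesis using B by simp
qed

end

section \<open>Finite type implies finite dimension\<close>

locale tanaka_prolongation = tanaka V e n \<LL> \<K> m \<mu>
  for V :: "('k::field_char_0, 'v, 'w) module_scheme" and e n \<LL> \<K> m \<mu> +
  fixes G :: "('k, 'g) lie" and gr :: "int \<Rightarrow> 'g set" and \<iota> :: "('k, 'v) fundamental \<Rightarrow> 'g"
  assumes prol: "effective_prolongation V \<LL> \<K> G gr \<iota>" and LL: "lie_subalgebra \<LL> (gl V)"
begin

sublocale G: lie_algebra G by (rule effective_prolongationD(1)[OF prol])

lemmas Gvs = G.is_vs

lemma gr_sub: "submodule class_ring (gr p) G"
  using effective_prolongationD(2)[OF prol] by (simp add: VectorSpace.subspace_def)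

lemma gr_closed: "x \<in> gr p \<Longrightarrow> x \<in> carrier G"
  using submodule.subset[OF gr_sub] by blast

lemma gr_zero: "\<zero>\<^bsub>G\<^esub> \<in> gr p"
  by (rule submodule.zero_closed[OF gr_sub])

lemma gr_bracket: "x \<in> gr p \<Longrightarrow> y \<in> gr q \<Longrightarrow> bracket G x y \<in> gr (p + q)"
  using effective_prolongationD(4)[OF prol] by blast

definition \<kappa> :: "('k, 'v) lie_term set \<Rightarrow> 'g" where "\<kappa> x = \<iota> (qm x)"
definition \<gamma> :: "'v \<Rightarrow> 'g" where "\<gamma> v = \<kappa> (gen v)"
definition E :: "nat \<Rightarrow> 'g" where "E i = \<gamma> (e i)"

lemma \<kappa>_hom: "lie_hom FL G \<kappa>"
  unfolding \<kappa>_def[abs_def] by (rule lie_hom_comp[OF qm_hom effective_prolongationD(5)[OF prol]])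

lemmas \<kappa>_lin = lie_hom_vlin[OF \<kappa>_hom]

lemma \<kappa>_zero_iff: "x \<in> carrier FL \<Longrightarrow> \<kappa> x = \<zero>\<^bsub>G\<^esub> \<longleftrightarrow> x \<in> \<K>"
proof -
  assume x: "x \<in> carrier FL"
  note \<iota> = lie_hom_vlin[OF effective_prolongationD(5)[OF prol]]
  have "\<kappa> x = \<zero>\<^bsub>G\<^esub> \<longleftrightarrow> \<iota> (qm x) = \<iota> \<zero>\<^bsub>MM\<^esub>" using vlin_zero[OF M.is_vs Gvs \<iota>] by (simp add: \<kappa>_def)
  also have "\<dots> \<longleftrightarrow> qm x = \<zero>\<^bsub>MM\<^esub>"
    using inj_on_eq_iff[OF effective_prolongationD(6)[OF prol]] vlinD(1)[OF qm_lin x] by simp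
  finally show ?thesis using qm_zero_iff[OF x] by simp
qed

lemma gr_neg: "p \<ge> 1 \<Longrightarrow> gr (- int p) = \<kappa> ` FLG p"
  using effective_prolongationD(7)[OF prol, rule_format, of "- int p"]
  by (auto simp: fund_gr_qm \<kappa>_def image_image)

lemma \<kappa>_closed: "x \<in> carrier FL \<Longrightarrow> \<kappa> x \<in> carrier G"
  by (rule vlinD(1)[OF \<kappa>_lin])

lemma \<gamma>_lin: "vlin V G \<gamma>"
  unfolding \<gamma>_def[abs_def] by (rule vlin_comp[OF gen_lin \<kappa>_lin])

lemma \<gamma>_closed: "v \<in> carrier V \<Longrightarrow> \<gamma> v \<in> carrier G"
  by (rule vlinD(1)[OF \<gamma>_lin])

lemma gr_minus_1: "gr (- 1) = \<gamma> ` carrier V"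
  using gr_neg[of 1] FG_1[OF V] by (auto simp: \<gamma>_def image_image)

lemma \<gamma>_inj: "inj_on \<gamma> (carrier V)"
proof (rule inj_onI)
  fix v w assume v: "v \<in> carrier V" and w: "w \<in> carrier V" and eq: "\<gamma> v = \<gamma> w"
  have d: "v \<oplus>\<^bsub>V\<^esub> (- 1) \<odot>\<^bsub>V\<^esub> w \<in> carrier V" using v w smult_closed_class[OF V] by simp
  have "\<gamma> (v \<oplus>\<^bsub>V\<^esub> (- 1) \<odot>\<^bsub>V\<^esub> w) = \<zero>\<^bsub>G\<^esub>"
    using v w eq vlinD[OF \<gamma>_lin] smult_closed_class[OF V] add_neg[OF Gvs] \<gamma>_closed by simp
  then have "v \<oplus>\<^bsub>V\<^esub> (- 1) \<odot>\<^bsub>V\<^esub> w = \<zero>\<^bsub>V\<^esub>" unfolding \<gamma>_def using \<kappa>_zero_iff gen_in_K_iff d gen_closed by blast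
  then show "v = w" using eq_if_diff_zero[OF V] v w by blast
qed

lemma E_gr: "i < n \<Longrightarrow> E i \<in> gr (- 1)"
  unfolding E_def gr_minus_1 using e_closed by blast

lemma E_closed: "i < n \<Longrightarrow> E i \<in> carrier G"
  using E_gr gr_closed by blast

lemma bracket_E_gr: "X \<in> gr p \<Longrightarrow> i < n \<Longrightarrow> bracket G X (E i) \<in> gr (p - 1)"
  using gr_bracket[OF _ E_gr, of X p i] by simp

lemma bracket_swap:
  assumes "x \<in> carrier G" "y \<in> carrier G" "z \<in> carrier G" "bracket G x (bracket G y z) = \<zero>\<^bsub>G\<^esub>"
  shows "bracket G (bracket G x y) z = bracket G (bracket G x z) y"
proof (rule eq_if_diff_zero[OF Gvs])
  show "bracket G (bracket G x y) z \<in> carrier G" "bracket G (bracket G x z) y \<in> carrier G"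
    using assms G.bracket_closed by blast+
  show "bracket G (bracket G x y) z \<oplus>\<^bsub>G\<^esub> (- 1) \<odot>\<^bsub>G\<^esub> bracket G (bracket G x z) y = \<zero>\<^bsub>G\<^esub>"
    by (rule HOL.trans[OF G.bracket_bracket[OF assms(1-3), symmetric] assms(4)])
qed

lemma effective:
  assumes X: "X \<in> gr (int k)" and z: "\<And>i. i < n \<Longrightarrow> bracket G X (E i) = \<zero>\<^bsub>G\<^esub>"
  shows "X = \<zero>\<^bsub>G\<^esub>"
proof -
  have XC: "X \<in> carrier G" by (rule gr_closed[OF X])
  have "bracket G X (\<gamma> v) = \<zero>\<^bsub>G\<^esub>" if v: "v \<in> carrier V" for v
  proof (rule vlin_eq_on_span[OF V Gvs _ _ e_image_closed _ v[folded vspan_e]])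
    show "vlin V G (\<lambda>v. bracket G X (\<gamma> v))" by (rule vlin_comp[OF \<gamma>_lin G.vlin_bracket_right[OF XC]])
    show "vlin V G (\<lambda>v. \<zero>\<^bsub>G\<^esub>)" by (auto simp: vlin_iff smult_zero[OF Gvs])
  qed (use z in \<open>auto simp: E_def\<close>)
  then have "\<forall>Y\<in>gr (- 1). bracket G X Y = \<zero>\<^bsub>G\<^esub>" by (auto simp: gr_minus_1)
  moreover have "X \<in> vspan G (\<Union>p\<in>{0..}. gr p)"
    using X gr_closed by (intro vspan_base[OF Gvs]) auto
  ultimately show ?thesis using effective_prolongationD(8)[OF prol] by blast
qed

section \<open>Iterated brackets and the forms attached to elements of degree k\<close>

definition act :: "'g \<Rightarrow> nat list \<Rightarrow> 'g" where
  "act X js = foldl (\<lambda>X i. bracket G X (E i)) X js"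

lemma act_simps: "act X [] = X" "act X (i # js) = act (bracket G X (E i)) js" "act X (us @ js) = act (act X us) js"
  by (simp_all add: act_def)

lemma act_lin: "set js \<subseteq> {..<n} \<Longrightarrow> vlin G G (\<lambda>X. act X js)"
proof (induction js)
  case Nil show ?case by (simp add: act_simps vlin_iff)
next
  case (Cons i js)
  then show ?case unfolding act_simps
    by (intro vlin_comp[OF G.vlin_bracket_left[OF E_closed]]) auto
qed

lemma act_gr: "X \<in> gr p \<Longrightarrow> set js \<subseteq> {..<n} \<Longrightarrow> act X js \<in> gr (p - int (length js))"
proof (induction js arbitrary: X p)
  case (Cons i js)
  then have "act (bracket G X (E i)) js \<in> gr (p - 1 - int (length js))" by (intro Cons.IH bracket_E_gr) auto
  then show ?case by (simp add: act_simps algebra_simps)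
qed (simp add: act_simps)

text \<open>Effectivity is a condition on single brackets; applied in each degree from 0 up to
  \<open>k\<close>, it shows that the \<open>k + 1\<close> brackets leading from degree
  \<open>k\<close> to degree -1 lose no information.\<close>

lemma act_effective:
  "X \<in> gr (int k) \<Longrightarrow> (\<And>js. length js = Suc k \<Longrightarrow> set js \<subseteq> {..<n} \<Longrightarrow> act X js = \<zero>\<^bsub>G\<^esub>) \<Longrightarrow> X = \<zero>\<^bsub>G\<^esub>"
proof (induction k arbitrary: X)
  case 0
  have "bracket G X (E i) = \<zero>\<^bsub>G\<^esub>" if "i < n" for i using 0(2)[of "[i]"] that by (simp add: act_simps)
  then show ?case using effective[OF 0(1)] by blast
next
  case (Suc k)
  have "bracket G X (E i) = \<zero>\<^bsub>G\<^esub>" if i: "i < n" for i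
  proof (rule Suc.IH)
    show "bracket G X (E i) \<in> gr (int k)" using bracket_E_gr[OF Suc.prems(1) i] by simp
    show "act (bracket G X (E i)) js = \<zero>\<^bsub>G\<^esub>" if "length js = Suc k" "set js \<subseteq> {..<n}" for js
      using Suc.prems(2)[of "i # js"] that i by (simp add: act_simps)
  qed
  then show ?case using effective[OF Suc.prems(1)] by blast
qed

definition cg :: "'g \<Rightarrow> nat \<Rightarrow> 'k" where
  "cg Y = co (inv_into (carrier V) \<gamma> Y)"

lemma cg_\<gamma>: "v \<in> carrier V \<Longrightarrow> cg (\<gamma> v) = co v"
  by (simp add: cg_def inv_into_f_f[OF \<gamma>_inj])

lemma cg_add: "x \<in> gr (- 1) \<Longrightarrow> y \<in> gr (- 1) \<Longrightarrow> j < n \<Longrightarrow> cg (x \<oplus>\<^bsub>G\<^esub> y) j = cg x j + cg y j"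
  using vlinD(2)[OF \<gamma>_lin] by (auto simp: gr_minus_1 cg_\<gamma> co_add simp flip: vlinD(2)[OF \<gamma>_lin])

lemma cg_smult: "x \<in> gr (- 1) \<Longrightarrow> j < n \<Longrightarrow> cg (c \<odot>\<^bsub>G\<^esub> x) j = c * cg x j"
  by (auto simp: gr_minus_1 cg_\<gamma> co_smult smult_closed_class[OF V] simp flip: vlinD(3)[OF \<gamma>_lin])

lemma cg_zero_imp: "x \<in> gr (- 1) \<Longrightarrow> (\<And>j. j < n \<Longrightarrow> cg x j = 0) \<Longrightarrow> x = \<zero>\<^bsub>G\<^esub>"
proof -
  assume "x \<in> gr (- 1)" and z: "\<And>j. j < n \<Longrightarrow> cg x j = 0"
  then obtain v where v: "v \<in> carrier V" "x = \<gamma> v" by (auto simp: gr_minus_1)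
  then have "v = \<zero>\<^bsub>V\<^esub>" using z by (intro co_inj) (auto simp: cg_\<gamma> co_zero)
  then show ?thesis using v vlin_zero[OF V Gvs \<gamma>_lin] by simp
qed

text \<open>Defined on all elements of degree \<open>k\<close>, where it is already injective
  although it need not be symmetric. It thereby bounds the dimension of each component before any
  symmetry is known, and gives all components a common home in the type of tensors.\<close>

definition \<tau> :: "nat \<Rightarrow> 'g \<Rightarrow> 'k tensor" where
  "\<tau> k X = (\<lambda>js j. if length js = Suc k \<and> set js \<subseteq> {..<n} \<and> j < n then cg (act X js) j else 0)"

lemma act_top: "X \<in> gr (int k) \<Longrightarrow> length js = Suc k \<Longrightarrow> set js \<subseteq> {..<n} \<Longrightarrow> act X js \<in> gr (- 1)"
  using act_gr[of X "int k" js] by simp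

lemma \<tau>_add: "X \<in> gr (int k) \<Longrightarrow> Y \<in> gr (int k) \<Longrightarrow> \<tau> k (X \<oplus>\<^bsub>G\<^esub> Y) = \<tau> k X + \<tau> k Y"
proof (intro ext)
  fix js j assume X: "X \<in> gr (int k)" and Y: "Y \<in> gr (int k)"
  show "\<tau> k (X \<oplus>\<^bsub>G\<^esub> Y) js j = (\<tau> k X + \<tau> k Y) js j"
  proof (cases "length js = Suc k \<and> set js \<subseteq> {..<n} \<and> j < n")
    case True
    then have "act (X \<oplus>\<^bsub>G\<^esub> Y) js = act X js \<oplus>\<^bsub>G\<^esub> act Y js" using vlinD(2)[OF act_lin] gr_closed X Y by blast
    then show ?thesis using True cg_add[OF act_top[OF X] act_top[OF Y]] by (simp add: \<tau>_def)
  qed (auto simp: \<tau>_def)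
qed

lemma \<tau>_smult: "X \<in> gr (int k) \<Longrightarrow> \<tau> k (c \<odot>\<^bsub>G\<^esub> X) = tscale c (\<tau> k X)"
proof (intro ext)
  fix js j assume X: "X \<in> gr (int k)"
  show "\<tau> k (c \<odot>\<^bsub>G\<^esub> X) js j = tscale c (\<tau> k X) js j"
  proof (cases "length js = Suc k \<and> set js \<subseteq> {..<n} \<and> j < n")
    case True
    then have "act (c \<odot>\<^bsub>G\<^esub> X) js = c \<odot>\<^bsub>G\<^esub> act X js" using vlinD(3)[OF act_lin] gr_closed X by blast
    then show ?thesis using True cg_smult[OF act_top[OF X]] by (simp add: \<tau>_def tscale_def)
  qed (auto simp: \<tau>_def tscale_def)
qed

lemma \<tau>_zero_imp:
  assumes X: "X \<in> gr (int k)" and z: "\<tau> k X = 0"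
  shows "X = \<zero>\<^bsub>G\<^esub>"
proof (rule act_effective[OF X])
  fix js assume js: "length js = Suc k" "set js \<subseteq> {..<n}"
  show "act X js = \<zero>\<^bsub>G\<^esub>"
  proof (rule cg_zero_imp[OF act_top[OF X js]])
    fix j assume "j < n"
    then show "cg (act X js) j = 0" using fun_cong[OF fun_cong[OF z, of js], of j] js by (simp add: \<tau>_def)
  qed
qed

lemma gr_diff: "X \<in> gr p \<Longrightarrow> Y \<in> gr p \<Longrightarrow> X \<oplus>\<^bsub>G\<^esub> (- 1) \<odot>\<^bsub>G\<^esub> Y \<in> gr p"
  using submodule.m_closed[OF gr_sub] submodule.smult_closed[OF gr_sub, of "- 1"] by simp

lemma \<tau>_diff: "X \<in> gr (int k) \<Longrightarrow> Y \<in> gr (int k) \<Longrightarrow> \<tau> k (X \<oplus>\<^bsub>G\<^esub> (- 1) \<odot>\<^bsub>G\<^esub> Y) = \<tau> k X - \<tau> k Y"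
  using submodule.smult_closed[OF gr_sub, of "- 1" Y] by (simp add: \<tau>_add \<tau>_smult ts.scale_minus_left)

lemma \<tau>_inj: "inj_on (\<tau> k) (gr (int k))"
proof (rule inj_onI)
  fix X Y assume XY: "X \<in> gr (int k)" "Y \<in> gr (int k)" "\<tau> k X = \<tau> k Y"
  have "\<tau> k (X \<oplus>\<^bsub>G\<^esub> (- 1) \<odot>\<^bsub>G\<^esub> Y) = \<tau> k X - \<tau> k Y" by (rule \<tau>_diff[OF XY(1,2)])
  also have "\<dots> = 0" unfolding XY(3) by (rule diff_self)
  finally have "X \<oplus>\<^bsub>G\<^esub> (- 1) \<odot>\<^bsub>G\<^esub> Y = \<zero>\<^bsub>G\<^esub>" by (rule \<tau>_zero_imp[OF gr_diff[OF XY(1,2)]])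
  then show "X = Y" using XY gr_closed eq_if_diff_zero[OF Gvs] by blast
qed

lemma \<tau>_zero: "\<tau> k \<zero>\<^bsub>G\<^esub> = 0"
  using \<tau>_smult[OF gr_zero, of k 0] smult_zero[OF Gvs, of 0] by simp

lemma \<tau>_finite:
  obtains F where "finite F" "range (\<tau> k) \<subseteq> ts.span F"
proof -
  obtain F where F: "finite F" "{X::'k tensor. \<forall>js j. X js j \<noteq> 0 \<longrightarrow> length js = Suc k \<and> set js \<subseteq> {..<n} \<and> j < n} \<subseteq> ts.span F"
    by (rule tensors_finite_dim)
  have "range (\<tau> k) \<subseteq> {X. \<forall>js j. X js j \<noteq> 0 \<longrightarrow> length js = Suc k \<and> set js \<subseteq> {..<n} \<and> j < n}"
    by (auto simp: \<tau>_def split: if_splits)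
  from that[OF F(1) subset_trans[OF this F(2)]] show ?thesis .
qed

section \<open>Centralisers of families of brackets\<close>

definition N :: "'g set \<Rightarrow> 'g set" where
  "N S = {X \<in> carrier G. \<forall>b\<in>S. bracket G X b = \<zero>\<^bsub>G\<^esub>}"

lemma N_sub:
  assumes "S \<subseteq> carrier G" shows "submodule class_ring (N S) G"
proof (rule submodule_class_ringI[OF Gvs])
  have SC: "b \<in> carrier G" if "b \<in> S" for b using assms that by blast
  show "N S \<subseteq> carrier G" by (auto simp: N_def)
  show "\<zero>\<^bsub>G\<^esub> \<in> N S" using G.bracket_zero(1) SC by (simp add: N_def)
  fix x y assume "x \<in> N S" "y \<in> N S"
  then show "x \<oplus>\<^bsub>G\<^esub> y \<in> N S" using G.bracket_add_left SC by (simp add: N_def)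
next
  have SC: "b \<in> carrier G" if "b \<in> S" for b using assms that by blast
  fix c x assume "x \<in> N S"
  then show "c \<odot>\<^bsub>G\<^esub> x \<in> N S"
    using G.bracket_smult_left SC smult_zero[OF Gvs] smult_closed_class[OF Gvs] by (simp add: N_def)
qed

lemma N_closed: "X \<in> N S \<Longrightarrow> X \<in> carrier G" and N_bracket: "X \<in> N S \<Longrightarrow> b \<in> S \<Longrightarrow> bracket G X b = \<zero>\<^bsub>G\<^esub>"
  by (auto simp: N_def)

definition E_closed_set :: "'g set \<Rightarrow> bool" where
  "E_closed_set S \<longleftrightarrow> S \<subseteq> carrier G \<and> (\<forall>b\<in>S. \<forall>i<n. bracket G b (E i) \<in> S)"

text \<open>Left-normed brackets of \<open>q + 1\<close> basis vectors, of degree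
  \<open>-(q + 1)\<close>. They span the component of that degree and are finite in number, so the
  conditions of commuting with them can be given up one by one.\<close>

primrec BB :: "nat \<Rightarrow> 'g set" where
  "BB 0 = E ` {..<n}"
| "BB (Suc q) = (\<lambda>(b, i). bracket G b (E i)) ` (BB q \<times> {..<n})"

lemma BB_finite: "finite (BB q)"
  by (induction q) auto

lemma BB_gr: "b \<in> BB q \<Longrightarrow> b \<in> gr (- int (Suc q))"
proof (induction q arbitrary: b)
  case 0 then show ?case using E_gr by auto
next
  case (Suc q)
  then obtain b' i where b: "b' \<in> BB q" "i < n" "b = bracket G b' (E i)" by auto
  have "- int (Suc q) - 1 = - int (Suc (Suc q))" by simp
  then show ?case using bracket_E_gr[OF Suc.IH[OF b(1)] b(2)] b(3) by metis
qed

lemma BB_closed: "b \<in> BB q \<Longrightarrow> b \<in> carrier G"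
  using BB_gr gr_closed by blast

lemma BB_bracket: "b \<in> BB q \<Longrightarrow> i < n \<Longrightarrow> bracket G b (E i) \<in> BB (Suc q)"
  by force

lemma BB_zero: "q \<ge> \<mu> \<Longrightarrow> b \<in> BB q \<Longrightarrow> b = \<zero>\<^bsub>G\<^esub>"
proof -
  assume q: "q \<ge> \<mu>" and b: "b \<in> BB q"
  then obtain x where x: "x \<in> FLG (Suc q)" "b = \<kappa> x" using BB_gr[OF b] gr_neg[of "Suc q"] by auto
  then have "x \<in> free_lie_from V (\<mu> + 1)" using FG_free_lie_from[OF V x(1), of "\<mu> + 1"] q by simp
  then show ?thesis using K_lower \<kappa>_zero_iff x FG_closed[OF V] by blast
qed

text \<open>Bracketing [X, b] = 0 with \<open>E i\<close> gives [[X, E i], b] = 0 up to [X,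
  [b, E i]], and the latter vanishes because \<open>S\<close> is stable under bracketing with
  \<open>E i\<close>.\<close>

lemma N_stable_E:
  assumes S: "E_closed_set S" and X: "X \<in> N S" and i: "i < n"
  shows "bracket G X (E i) \<in> N S"
proof -
  have SC: "S \<subseteq> carrier G" using S by (simp add: E_closed_set_def)
  have XC: "X \<in> carrier G" by (rule N_closed[OF X])
  have "bracket G (bracket G X (E i)) b = \<zero>\<^bsub>G\<^esub>" if b: "b \<in> S" for b
  proof -
    have bC: "b \<in> carrier G" using SC b by blast
    have "bracket G X (bracket G b (E i)) = \<zero>\<^bsub>G\<^esub>" using S b i N_bracket[OF X] by (simp add: E_closed_set_def)
    then have "bracket G (bracket G X b) (E i) = bracket G (bracket G X (E i)) b"
      by (rule bracket_swap[OF XC bC E_closed[OF i]])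
    then show ?thesis using N_bracket[OF X b] G.bracket_zero(1)[OF E_closed[OF i]] by simp
  qed
  then show ?thesis using XC E_closed[OF i] by (auto simp: N_def G.bracket_closed)
qed

lemma N_stable_bracket:
  assumes "S \<subseteq> carrier G" and y: "y \<in> carrier G" and z: "z \<in> carrier G"
    and sy: "\<And>X. X \<in> N S \<Longrightarrow> bracket G X y \<in> N S" and sz: "\<And>X. X \<in> N S \<Longrightarrow> bracket G X z \<in> N S"
    and X: "X \<in> N S"
  shows "bracket G X (bracket G y z) \<in> N S"
  unfolding G.bracket_bracket[OF N_closed[OF X] y z]
  using submodule.m_closed[OF N_sub[OF assms(1)]] submodule.smult_closed[OF N_sub[OF assms(1)], of "- 1"] sy sz X by simp

lemma N_stable_BB:
  assumes S: "E_closed_set S"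
  shows "z \<in> BB p \<Longrightarrow> X \<in> N S \<Longrightarrow> bracket G X z \<in> N S"
proof (induction p arbitrary: z X)
  case 0 then show ?case using N_stable_E[OF S] by auto
next
  case (Suc p)
  then obtain z' i where z: "z' \<in> BB p" "i < n" "z = bracket G z' (E i)" by auto
  have SC: "S \<subseteq> carrier G" using S by (simp add: E_closed_set_def)
  show ?case unfolding z(3)
    by (rule N_stable_bracket[OF SC BB_closed[OF z(1)] E_closed[OF z(2)] Suc.IH[OF z(1)] N_stable_E[OF S _ z(2)] Suc.prems(2)])
qed

text \<open>The hypothesis makes \<open>s\<close> central modulo \<open>S\<close>: on the elements
  commuting with \<open>S\<close> it acts as an operator that commutes with all \<open>E i\<close>,
  hence with all their brackets.\<close>

lemma N_commute_BB:
  assumes S: "E_closed_set S" and s: "s \<in> carrier G" "\<And>i. i < n \<Longrightarrow> bracket G s (E i) \<in> S"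
  shows "z \<in> BB p \<Longrightarrow> X \<in> N S \<Longrightarrow> bracket G (bracket G X s) z = bracket G (bracket G X z) s"
proof (induction p arbitrary: z X)
  case 0
  then obtain i where i: "i < n" "z = E i" by auto
  show ?case unfolding i(2)
    by (rule bracket_swap[OF N_closed[OF 0(2)] s(1) E_closed[OF i(1)] N_bracket[OF 0(2) s(2)[OF i(1)]]])
next
  case (Suc p)
  then obtain z' i where z: "z' \<in> BB p" "i < n" "z = bracket G z' (E i)" by auto
  have base: "bracket G (bracket G X s) (E i) = bracket G (bracket G X (E i)) s" if "X \<in> N S" for X
    by (rule bracket_swap[OF N_closed[OF that] s(1) E_closed[OF z(2)] N_bracket[OF that s(2)[OF z(2)]]])
  note X = Suc.prems(2)
  have XC: "X \<in> carrier G" and zC: "z' \<in> carrier G" and iC: "E i \<in> carrier G"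
    using N_closed[OF X] BB_closed[OF z(1)] E_closed[OF z(2)] by auto
  have Xz: "bracket G X z' \<in> N S" and XE: "bracket G X (E i) \<in> N S"
    using N_stable_BB[OF S z(1) X] N_stable_E[OF S X z(2)] by auto
  have C: "bracket G (bracket G X z') (E i) \<in> carrier G" "bracket G (bracket G X (E i)) z' \<in> carrier G"
    using XC zC iC G.bracket_closed by auto
  have "bracket G (bracket G X s) z = bracket G (bracket G (bracket G X s) z') (E i)
      \<oplus>\<^bsub>G\<^esub> (- 1) \<odot>\<^bsub>G\<^esub> bracket G (bracket G (bracket G X s) (E i)) z'"
    unfolding z(3) by (rule G.bracket_bracket) (use XC s zC iC G.bracket_closed in auto)
  also have "\<dots> = bracket G (bracket G (bracket G X z') (E i)) s
      \<oplus>\<^bsub>G\<^esub> (- 1) \<odot>\<^bsub>G\<^esub> bracket G (bracket G (bracket G X (E i)) z') s"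
    by (simp only: Suc.IH[OF z(1) X] base[OF X] base[OF Xz] Suc.IH[OF z(1) XE])
  also have "\<dots> = bracket G (bracket G (bracket G X z') (E i) \<oplus>\<^bsub>G\<^esub> (- 1) \<odot>\<^bsub>G\<^esub> bracket G (bracket G X (E i)) z') s"
    using C s by (simp add: G.bracket_add_left G.bracket_smult_left smult_closed_class[OF Gvs])
  also have "\<dots> = bracket G (bracket G X z) s" unfolding z(3) by (simp only: G.bracket_bracket[OF XC zC iC])
  finally show ?case .
qed

section \<open>Giving up the commutation conditions one bracket at a time\<close>

definition bounded :: "'g set \<Rightarrow> bool" where
  "bounded A \<longleftrightarrow> (\<exists>k0. \<forall>k\<ge>k0. A \<inter> gr (int k) \<subseteq> {\<zero>\<^bsub>G\<^esub>})"

text \<open>If \<open>b = [y, e]\<close> acts injectively in large degree and commutes with \<open>y\<close> and \<open>e\<close>, these three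
  would generate a Heisenberg algebra with \<open>b\<close> invertible on a finite-dimensional space.\<close>

lemma bounded_step:
  assumes S: "E_closed_set S" and b: "b \<in> BB (Suc q)" "\<And>i. i < n \<Longrightarrow> bracket G b (E i) \<in> S"
    and bd: "bounded (N (insert b S))"
  shows "bounded (N S)"
proof -
  have SC: "S \<subseteq> carrier G" using S by (simp add: E_closed_set_def)
  obtain y l where y: "y \<in> BB q" "l < n" "b = bracket G y (E l)" using b(1) by auto
  obtain k0 where k0: "\<And>k. k \<ge> k0 \<Longrightarrow> N (insert b S) \<inter> gr (int k) \<subseteq> {\<zero>\<^bsub>G\<^esub>}" using bd by (auto simp: bounded_def)
  \<comment> \<open>Degrees are counted from \<open>k0\<close>, so that \<open>b\<close> acts
    injectively on every stage from which it is defined: an element of \<open>N S\<close> killed by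
    \<open>b\<close> lies in \<open>N (insert b S)\<close>.\<close>
  define D where "D = (\<lambda>j. N S \<inter> gr (int (k0 + j)))"
  define t where "t = (\<lambda>j. \<tau> (k0 + j))"
  define P where "P = (\<lambda>j. t j ` D j)"
  \<comment> \<open>The components are subsets of a carrier, while the tower argument speaks of
    subspaces of a vector space type. \<open>t\<close> moves them to tensors,
    \<open>\<sigma>\<close> is its inverse on the image, and \<open>op u\<close> is bracketing with
    \<open>u\<close> seen on tensors.\<close>
  define \<sigma> where "\<sigma> = (\<lambda>j. inv_into (D j) (t j))"
  define op where "op = (\<lambda>u j k x. t k (bracket G (\<sigma> j x) u))"
  have Dgr: "X \<in> gr (int (k0 + j))" and DN: "X \<in> N S" and DC: "X \<in> carrier G" if "X \<in> D j" for X j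
    using that N_closed by (auto simp: D_def)
  have Dsub: "submodule class_ring (D j) G" for j
    using submodule.m_closed[OF gr_sub] submodule.smult_closed[OF gr_sub] submodule.m_closed[OF N_sub[OF SC]]
      submodule.smult_closed[OF N_sub[OF SC]] submodule.zero_closed[OF N_sub[OF SC]] gr_zero
    by (intro submodule_class_ringI[OF Gvs]) (auto simp: D_def gr_closed)
  have Dadd: "X \<oplus>\<^bsub>G\<^esub> Y \<in> D j" if "X \<in> D j" "Y \<in> D j" for X Y j using that submodule.m_closed[OF Dsub] by blast
  have Dsm: "c \<odot>\<^bsub>G\<^esub> X \<in> D j" if "X \<in> D j" for X j c using that submodule.smult_closed[OF Dsub, of c] by simp
  have tadd: "t j (X \<oplus>\<^bsub>G\<^esub> Y) = t j X + t j Y" if "X \<in> D j" "Y \<in> D j" for X Y j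
    unfolding t_def by (rule \<tau>_add[OF Dgr[OF that(1)] Dgr[OF that(2)]])
  have tsm: "t j (c \<odot>\<^bsub>G\<^esub> X) = tscale c (t j X)" if "X \<in> D j" for X j c
    unfolding t_def by (rule \<tau>_smult[OF Dgr[OF that]])
  have tz: "t j \<zero>\<^bsub>G\<^esub> = 0" for j by (simp add: t_def \<tau>_zero)
  have tinj: "inj_on (t j) (D j)" for j
    unfolding t_def by (rule inj_on_subset[OF \<tau>_inj]) (auto simp: D_def)
  have \<sigma>t: "\<sigma> j (t j X) = X" if "X \<in> D j" for j X using that tinj by (simp add: \<sigma>_def)
  have \<sigma>D: "\<sigma> j x \<in> D j" and t\<sigma>: "t j (\<sigma> j x) = x" if "x \<in> P j" for j x
    using that by (auto simp: P_def \<sigma>t)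
  have \<sigma>add: "\<sigma> j (x + y) = \<sigma> j x \<oplus>\<^bsub>G\<^esub> \<sigma> j y" if "x \<in> P j" "y \<in> P j" for x y j
    using \<sigma>t[OF Dadd[OF \<sigma>D[OF that(1)] \<sigma>D[OF that(2)]]] tadd[OF \<sigma>D[OF that(1)] \<sigma>D[OF that(2)]] t\<sigma> that by simp
  have \<sigma>sm: "\<sigma> j (tscale c x) = c \<odot>\<^bsub>G\<^esub> \<sigma> j x" if "x \<in> P j" for x j c
    using \<sigma>t[OF Dsm[OF \<sigma>D[OF that]], of c] tsm[OF \<sigma>D[OF that]] t\<sigma>[OF that] by simp
  have Psub: "ts.subspace (P j)" for j
  proof (rule ts.subspaceI)
    show "0 \<in> P j" using tz[of j] submodule.zero_closed[OF Dsub, of j] unfolding P_def by (metis image_eqI)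
    show "x + y \<in> P j" if "x \<in> P j" "y \<in> P j" for x y
      using that Dadd tadd unfolding P_def by (smt (verit) image_iff)
    show "tscale c x \<in> P j" if "x \<in> P j" for x c
      using that Dsm tsm unfolding P_def by (smt (verit) image_iff)
  qed
  have opc: "op u i k (op v j i x) = t k (bracket G (bracket G (\<sigma> j x) v) u)" if "bracket G (\<sigma> j x) v \<in> D i" for u v i j k x
    using \<sigma>t[OF that] by (simp add: op_def)
  have oplin: "lin_on tscale (P j) (op u j k)" if u: "u \<in> carrier G" "\<And>X. X \<in> D j \<Longrightarrow> bracket G X u \<in> D k" for u j k
    using u DC[OF \<sigma>D]
    by (auto simp: lin_on_def op_def \<sigma>add \<sigma>sm G.bracket_add_left G.bracket_smult_left tadd tsm \<sigma>D)
  have opP: "op u j k x \<in> P k" if "\<And>X. X \<in> D j \<Longrightarrow> bracket G X u \<in> D k" "x \<in> P j" for u j k x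
    using that \<sigma>D by (auto simp: op_def P_def)
  have sC: "b \<in> carrier G" by (rule BB_closed[OF b(1)])
  have yC: "y \<in> carrier G" by (rule BB_closed[OF y(1)])
  have EC: "E l \<in> carrier G" by (rule E_closed[OF y(2)])
  have DE: "bracket G X (E l) \<in> D k" if "X \<in> D (k + 1)" for X k
    using bracket_E_gr[OF Dgr[OF that] y(2)] N_stable_E[OF S DN[OF that] y(2)] by (simp add: D_def)
  have Dy: "bracket G X y \<in> D k" if "X \<in> D (k + Suc q)" for X k
    using gr_bracket[OF Dgr[OF that] BB_gr[OF y(1)]] N_stable_BB[OF S y(1) DN[OF that]] by (simp add: D_def)
  have Db: "bracket G X b \<in> D k" if "X \<in> D (k + (Suc q + 1))" for X k
    using gr_bracket[OF Dgr[OF that] BB_gr[OF b(1)]] N_stable_BB[OF S b(1) DN[OF that]] by (simp add: D_def)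
  have comm: "bracket G (bracket G X b) z = bracket G (bracket G X z) b" if "z \<in> BB p" "X \<in> N S" for z p X
    by (rule N_commute_BB[OF S sC b(2) that])
  \<comment> \<open>\<open>E l\<close>, \<open>y\<close> and \<open>b = [y, E l]\<close> lower the
    degree by 1, \<open>q + 1\<close> and \<open>q + 2\<close>, and take the roles of
    \<open>a\<close>, \<open>b\<close> and \<open>s\<close> in the tower. On \<open>N S\<close> the
    action of \<open>b\<close> commutes with that of the other two, because the brackets of
    \<open>b\<close> with all \<open>E i\<close> lie in \<open>S\<close>.\<close>
  have "\<exists>k1. \<forall>k\<ge>k1. P k = {0}"
  proof (rule weyl_tower[OF vector_space_tscale HOL.refl, where r = "Suc q" and a = "\<lambda>k. op (E l) (k + 1) k"
        and b = "\<lambda>k. op y (k + Suc q) k" and s = "\<lambda>k. op b (k + (Suc q + 1)) k"])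
    fix k
    show "ts.subspace (P k)" by (rule Psub)
    obtain F where F: "finite F" "range (\<tau> (k0 + k)) \<subseteq> ts.span F" by (rule \<tau>_finite)
    then show "\<exists>F. finite F \<and> P k \<subseteq> ts.span F" by (intro exI[of _ F]) (auto simp: P_def t_def)
    show "lin_on tscale (P (k + 1)) (op (E l) (k + 1) k)" by (rule oplin[OF EC DE])
    show "lin_on tscale (P (k + Suc q)) (op y (k + Suc q) k)" by (rule oplin[OF yC Dy])
    show "lin_on tscale (P (k + (Suc q + 1))) (op b (k + (Suc q + 1)) k)" by (rule oplin[OF sC Db])
    fix x
    show "x \<in> P (k + 1) \<Longrightarrow> op (E l) (k + 1) k x \<in> P k" by (rule opP[OF DE])
    show "x \<in> P (k + Suc q) \<Longrightarrow> op y (k + Suc q) k x \<in> P k" by (rule opP[OF Dy])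
    show "x \<in> P (k + (Suc q + 1)) \<Longrightarrow> op b (k + (Suc q + 1)) k x \<in> P k" by (rule opP[OF Db])
  next
    fix k x assume x: "x \<in> P (k + (Suc q + 1))"
    let ?X = "\<sigma> (k + (Suc q + 1)) x"
    have X: "?X \<in> D (k + (Suc q + 1))" by (rule \<sigma>D[OF x])
    have i1: "k + 1 + Suc q = k + (Suc q + 1)" and i2: "k + Suc q + 1 = k + (Suc q + 1)" by simp_all
    have Xy: "bracket G ?X y \<in> D (k + 1)" using Dy[of ?X "k + 1"] X by (simp only: i1)
    have XE: "bracket G ?X (E l) \<in> D (k + Suc q)" using DE[of ?X "k + Suc q"] X by (simp only: i2)
    have "op b (k + (Suc q + 1)) k x = t k (bracket G (bracket G ?X y) (E l) \<oplus>\<^bsub>G\<^esub> (- 1) \<odot>\<^bsub>G\<^esub> bracket G (bracket G ?X (E l)) y)"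
      unfolding op_def y(3) G.bracket_bracket[OF DC[OF X] yC EC] ..
    also have "\<dots> = t k (bracket G (bracket G ?X y) (E l)) - t k (bracket G (bracket G ?X (E l)) y)"
      by (simp only: tadd[OF DE[OF Xy] Dsm[OF Dy[OF XE]]] tsm[OF Dy[OF XE]] ts.scale_minus_left ts.scale_one add_uminus_conv_diff)
    also have "t k (bracket G (bracket G ?X y) (E l)) = op (E l) (k + 1) k (op y (k + 1 + Suc q) (k + 1) x)"
      unfolding i1 by (rule opc[OF Xy, symmetric])
    also have "t k (bracket G (bracket G ?X (E l)) y) = op y (k + Suc q) k (op (E l) (k + Suc q + 1) (k + Suc q) x)"
      unfolding i2 by (rule opc[OF XE, symmetric])
    finally show "op b (k + (Suc q + 1)) k x = op (E l) (k + 1) k (op y (k + 1 + Suc q) (k + 1) x)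
        - op y (k + Suc q) k (op (E l) (k + Suc q + 1) (k + Suc q) x)" .
    assume z: "op b (k + (Suc q + 1)) k x = 0"
    have "bracket G ?X b = \<zero>\<^bsub>G\<^esub>"
      using inj_onD[OF tinj _ Db[OF X] submodule.zero_closed[OF Dsub]] z tz by (simp add: op_def)
    then have "?X \<in> N (insert b S) \<inter> gr (int (k0 + (k + (Suc q + 1))))"
      using DN[OF X] Dgr[OF X] by (simp add: N_def)
    then have "?X = \<zero>\<^bsub>G\<^esub>" using k0[of "k0 + (k + (Suc q + 1))"] by auto
    then show "x = 0" using t\<sigma>[OF x] tz by metis
  next
    fix k x assume x: "x \<in> P (k + (Suc q + 1) + 1)"
    let ?X = "\<sigma> (k + (Suc q + 1) + 1) x"
    have X: "?X \<in> D (k + (Suc q + 1) + 1)" by (rule \<sigma>D[OF x])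
    have i1: "k + 1 + (Suc q + 1) = k + (Suc q + 1) + 1" by simp
    have Xb: "bracket G ?X b \<in> D (k + 1)" using Db[of ?X "k + 1"] X by (simp only: i1)
    have "op b (k + (Suc q + 1)) k (op (E l) (k + (Suc q + 1) + 1) (k + (Suc q + 1)) x) = t k (bracket G (bracket G ?X (E l)) b)"
      by (rule opc[OF DE[OF X]])
    also have "bracket G (bracket G ?X (E l)) b = bracket G (bracket G ?X b) (E l)"
      using y(2) by (intro comm[of "E l" 0, symmetric] DN[OF X]) simp
    also have "t k \<dots> = op (E l) (k + 1) k (op b (k + 1 + (Suc q + 1)) (k + 1) x)"
      unfolding i1 by (rule opc[OF Xb, symmetric])
    finally show "op b (k + (Suc q + 1)) k (op (E l) (k + (Suc q + 1) + 1) (k + (Suc q + 1)) x)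
        = op (E l) (k + 1) k (op b (k + 1 + (Suc q + 1)) (k + 1) x)" .
  next
    fix k x assume x: "x \<in> P (k + (Suc q + 1) + Suc q)"
    let ?X = "\<sigma> (k + (Suc q + 1) + Suc q) x"
    have X: "?X \<in> D (k + (Suc q + 1) + Suc q)" by (rule \<sigma>D[OF x])
    have i1: "k + Suc q + (Suc q + 1) = k + (Suc q + 1) + Suc q" by simp
    have Xb: "bracket G ?X b \<in> D (k + Suc q)" using Db[of ?X "k + Suc q"] X by (simp only: i1)
    have "op b (k + (Suc q + 1)) k (op y (k + (Suc q + 1) + Suc q) (k + (Suc q + 1)) x) = t k (bracket G (bracket G ?X y) b)"
      by (rule opc[OF Dy[OF X]])
    also have "bracket G (bracket G ?X y) b = bracket G (bracket G ?X b) y"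
      by (rule comm[OF y(1) DN[OF X], symmetric])
    also have "t k \<dots> = op y (k + Suc q) k (op b (k + Suc q + (Suc q + 1)) (k + Suc q) x)"
      unfolding i1 by (rule opc[OF Xb, symmetric])
    finally show "op b (k + (Suc q + 1)) k (op y (k + (Suc q + 1) + Suc q) (k + (Suc q + 1)) x)
        = op y (k + Suc q) k (op b (k + Suc q + (Suc q + 1)) (k + Suc q) x)" .
  qed
  then obtain k1 where k1: "\<And>k. k \<ge> k1 \<Longrightarrow> P k = {0}" by blast
  have "N S \<inter> gr (int k) \<subseteq> {\<zero>\<^bsub>G\<^esub>}" if k: "k \<ge> k0 + k1" for k
  proof
    fix X assume "X \<in> N S \<inter> gr (int k)"
    then have X: "X \<in> D (k - k0)" using k by (simp add: D_def)
    have "t (k - k0) X \<in> P (k - k0)" using X by (simp add: P_def)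
    moreover have "k - k0 \<ge> k1" using k by simp
    ultimately have "t (k - k0) X = t (k - k0) \<zero>\<^bsub>G\<^esub>" using k1[of "k - k0"] by (simp add: tz)
    then show "X \<in> {\<zero>\<^bsub>G\<^esub>}" using inj_onD[OF tinj _ X submodule.zero_closed[OF Dsub]] by simp
  qed
  then show ?thesis by (auto simp: bounded_def)
qed

text \<open>Spans the components of degree at most \<open>-(q + 1)\<close>; in particular
  \<open>SS 1\<close> stands for everything of degree below -1.\<close>

definition SS :: "nat \<Rightarrow> 'g set" where "SS q = (\<Union>q'\<in>{q..}. BB q')"

lemma SS_closed: "SS q \<subseteq> carrier G"
  using BB_closed by (auto simp: SS_def)

text \<open>\<open>SS (Suc q)\<close> is \<open>SS (Suc (Suc q))\<close> together with the finite
  set \<open>BB (Suc q)\<close>, whose brackets with the \<open>E i\<close> lie in the former of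
  these two constituents. So the single-element step applies to each of its members in turn.\<close>

lemma bounded_level:
  assumes "bounded (N (SS (Suc q)))" shows "bounded (N (SS (Suc (Suc q))))"
proof -
  have SSq: "SS (Suc (Suc q)) \<union> BB (Suc q) = SS (Suc q)"
  proof -
    have "{Suc q..} = insert (Suc q) {Suc (Suc q)..}" by auto
    then show ?thesis by (auto simp: SS_def simp del: BB.simps)
  qed
  have "bounded (N (SS (Suc (Suc q)) \<union> F)) \<Longrightarrow> bounded (N (SS (Suc (Suc q))))" if "finite F" "F \<subseteq> BB (Suc q)" for F
    using that
  proof (induction F rule: finite_induct)
    case (insert b F)
    have up: "bracket G b' (E i) \<in> SS (Suc (Suc q))" if "b' \<in> BB q'" "Suc q \<le> q'" "i < n" for b' q' i
      using BB_bracket[OF that(1,3)] that(2) unfolding SS_def by (metis UN_I atLeast_iff Suc_le_mono)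
    have "E_closed_set (SS (Suc (Suc q)) \<union> F)"
      unfolding E_closed_set_def
    proof (intro conjI ballI allI impI)
      show "SS (Suc (Suc q)) \<union> F \<subseteq> carrier G" using SS_closed insert.prems BB_closed by blast
      fix b' i assume b': "b' \<in> SS (Suc (Suc q)) \<union> F" and i: "i < n"
      then obtain q' where "b' \<in> BB q'" "Suc q \<le> q'" using insert.prems
        unfolding SS_def by (auto simp del: BB.simps)
      then show "bracket G b' (E i) \<in> SS (Suc (Suc q)) \<union> F" using up i by blast
    qed
    moreover have "b \<in> BB (Suc q)" using insert.prems by blast
    moreover have "bracket G b (E i) \<in> SS (Suc (Suc q)) \<union> F" if "i < n" for i
      using up[OF \<open>b \<in> BB (Suc q)\<close> _ that] by simp
    moreover have "bounded (N (insert b (SS (Suc (Suc q)) \<union> F)))" using insert.prems by simp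
    ultimately have "bounded (N (SS (Suc (Suc q)) \<union> F))" by (rule bounded_step)
    then show ?case using insert by blast
  qed simp
  from this[OF BB_finite subset_refl] show ?thesis using assms by (simp only: SSq)
qed

text \<open>Below degree \<open>-\<mu>\<close> the algebra is zero, so after finitely many levels no
  commutation condition is left.\<close>

lemma bounded_all:
  assumes "bounded (N (SS 1))" shows "bounded (carrier G)"
proof -
  have "bounded (N (SS (Suc q)))" for q
    by (induction q) (use assms bounded_level in auto)
  moreover have "N (SS (Suc \<mu>)) = carrier G"
    using BB_zero G.bracket_zero unfolding N_def SS_def by (auto simp del: BB.simps) (metis Suc_leD)
  ultimately show ?thesis by metis
qed

section \<open>Elements that commute with all components of degree below -1\<close>

lemma SS_bracket_E: "p < n \<Longrightarrow> q < n \<Longrightarrow> bracket G (E p) (E q) \<in> SS 1"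
  using BB_bracket[of "E p" 0 q] by (auto simp: SS_def simp del: BB.simps(2) intro!: exI[of _ 1])

lemma SS_1_closed: "E_closed_set (SS 1)"
  using SS_closed BB_bracket unfolding E_closed_set_def SS_def by (auto simp del: BB.simps) (metis Suc_leI atLeast_iff less_Suc_eq_le less_imp_le)

lemma N_swap:
  assumes X: "X \<in> N (SS 1)" and pq: "p < n" "q < n"
  shows "bracket G (bracket G X (E p)) (E q) = bracket G (bracket G X (E q)) (E p)"
  by (rule bracket_swap[OF N_closed[OF X] E_closed[OF pq(1)] E_closed[OF pq(2)] N_bracket[OF X SS_bracket_E[OF pq]]])

lemma N_act: "X \<in> N (SS 1) \<Longrightarrow> set js \<subseteq> {..<n} \<Longrightarrow> act X js \<in> N (SS 1)"
  by (induction js arbitrary: X) (auto simp: act_simps intro: N_stable_E[OF SS_1_closed] simp del: One_nat_def)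

lemma N_stable_\<gamma>:
  assumes X: "X \<in> N (SS 1)" and v: "v \<in> carrier V"
  shows "bracket G X (\<gamma> v) \<in> N (SS 1)"
proof -
  interpret S: submodule class_ring "N (SS 1)" G by (rule N_sub[OF SS_closed])
  note XC = N_closed[OF X]
  note lin = vlin_comp[OF \<gamma>_lin G.vlin_bracket_right[OF XC]]
  show ?thesis
    using v[folded vspan_e] e_image_closed
  proof (rule vspan_induct[OF V])
    show "bracket G X (\<gamma> \<zero>\<^bsub>V\<^esub>) \<in> N (SS 1)" using vlin_zero[OF V Gvs lin] S.zero_closed by (simp only:)
  next
    fix a assume "a \<in> e ` {..<n}"
    then show "bracket G X (\<gamma> a) \<in> N (SS 1)" using N_stable_E[OF SS_1_closed X] by (auto simp: E_def)
  next
    fix x y assume "x \<in> carrier V" "y \<in> carrier V" "bracket G X (\<gamma> x) \<in> N (SS 1)" "bracket G X (\<gamma> y) \<in> N (SS 1)"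
    then show "bracket G X (\<gamma> (x \<oplus>\<^bsub>V\<^esub> y)) \<in> N (SS 1)" using vlinD(2)[OF lin] S.m_closed by simp
  next
    fix c x assume "x \<in> carrier V" "bracket G X (\<gamma> x) \<in> N (SS 1)"
    then show "bracket G X (\<gamma> (c \<odot>\<^bsub>V\<^esub> x)) \<in> N (SS 1)" using vlinD(3)[OF lin] S.smult_closed[of c] by simp
  qed
qed

lemma N_kills_\<gamma>\<gamma>:
  assumes X: "X \<in> N (SS 1)" and vw: "v \<in> carrier V" "w \<in> carrier V"
  shows "bracket G X (bracket G (\<gamma> v) (\<gamma> w)) = \<zero>\<^bsub>G\<^esub>"
proof -
  note XC = N_closed[OF X]
  have z: "vlin V G (\<lambda>v. \<zero>\<^bsub>G\<^esub>)" by (auto simp: vlin_iff smult_zero[OF Gvs])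
  have l1: "vlin V G (\<lambda>v. bracket G X (bracket G (\<gamma> v) y))" if "y \<in> carrier G" for y
    by (rule vlin_comp[OF vlin_comp[OF \<gamma>_lin G.vlin_bracket_left[OF that]] G.vlin_bracket_right[OF XC]])
  have l2: "vlin V G (\<lambda>w. bracket G X (bracket G y (\<gamma> w)))" if "y \<in> carrier G" for y
    by (rule vlin_comp[OF vlin_comp[OF \<gamma>_lin G.vlin_bracket_right[OF that]] G.vlin_bracket_right[OF XC]])
  have "bracket G X (bracket G (\<gamma> (e p)) (\<gamma> w)) = \<zero>\<^bsub>G\<^esub>" if p: "p < n" for p
    by (rule vlin_eq_on_span[OF V Gvs l2[OF \<gamma>_closed[OF e_closed[OF p]]] z e_image_closed _ vw(2)[folded vspan_e]])
      (use N_bracket[OF X SS_bracket_E[OF p]] in \<open>auto simp: E_def\<close>)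
  then show ?thesis
    by (intro vlin_eq_on_span[OF V Gvs l1[OF \<gamma>_closed[OF vw(2)]] z e_image_closed _ vw(1)[folded vspan_e]]) auto
qed

text \<open>\<open>SS 1\<close> contains only left-normed brackets of basis vectors, while all
  monomials in vectors of \<open>V\<close> have to be reached. The stability of
  \<open>N (SS 1)\<close> is proved along with the vanishing, since killing [s, t] uses it for the
  brackets with s and with t.\<close>

lemma monomial_N:
  assumes "lie_monomial V p t"
  shows "(\<forall>X\<in>N (SS 1). bracket G X (\<kappa> (lie_class V t)) \<in> N (SS 1)) \<and>
    (p \<ge> 2 \<longrightarrow> (\<forall>X\<in>N (SS 1). bracket G X (\<kappa> (lie_class V t)) = \<zero>\<^bsub>G\<^esub>))"
  using assms
proof (induction rule: lie_monomial.induct)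
  case (1 v) then show ?case using N_stable_\<gamma> by (auto simp: \<gamma>_def free_gen_def)
next
  case (2 p s q t)
  let ?s = "\<kappa> (lie_class V s)" and ?t = "\<kappa> (lie_class V t)"
  note st = lie_monomial_terms[OF 2(1)] lie_monomial_terms[OF 2(2)]
  have C: "?s \<in> carrier G" "?t \<in> carrier G" using st lie_class_closed[OF V] \<kappa>_closed by auto
  have eq: "\<kappa> (lie_class V (Br s t)) = bracket G ?s ?t"
    using lie_hom_bracket[OF \<kappa>_hom] st lie_class_closed[OF V] by (simp flip: free_lie_class_ops)
  have N: "bracket G X (bracket G ?s ?t) \<in> N (SS 1)" if "X \<in> N (SS 1)" for X
    by (rule N_stable_bracket[OF SS_closed C _ _ that]) (use 2 in auto)
  have "bracket G X (bracket G ?s ?t) = \<zero>\<^bsub>G\<^esub>" if X: "X \<in> N (SS 1)" for X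
  proof (cases "p \<ge> 2 \<or> q \<ge> 2")
    case True
    have sw: "bracket G X (bracket G ?s ?t) = bracket G (bracket G X ?s) ?t \<oplus>\<^bsub>G\<^esub> (- 1) \<odot>\<^bsub>G\<^esub> bracket G (bracket G X ?t) ?s"
      by (rule G.bracket_bracket[OF N_closed[OF X] C])
    from True show ?thesis
    proof
      assume "p \<ge> 2"
      then have "bracket G X ?s = \<zero>\<^bsub>G\<^esub>" "bracket G (bracket G X ?t) ?s = \<zero>\<^bsub>G\<^esub>" using 2 X by auto
      then show ?thesis unfolding sw using G.bracket_zero C smult_zero[OF Gvs] by simp
    next
      assume "q \<ge> 2"
      then have "bracket G X ?t = \<zero>\<^bsub>G\<^esub>" "bracket G (bracket G X ?s) ?t = \<zero>\<^bsub>G\<^esub>" using 2 X by auto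
      then show ?thesis unfolding sw using G.bracket_zero C smult_zero[OF Gvs] by simp
    qed
  next
    case False
    then have "p = 1" "q = 1" using lie_monomial_pos[OF 2(1)] lie_monomial_pos[OF 2(2)] by auto
    have gen: "\<exists>v\<in>carrier V. u = Gen v" if "lie_monomial V 1 u" for u
      using that by (cases rule: lie_monomial.cases) (auto dest!: lie_monomial_pos)
    obtain v w where "v \<in> carrier V" "w \<in> carrier V" "s = Gen v" "t = Gen w"
      using gen[of s] gen[of t] 2(1,2) \<open>p = 1\<close> \<open>q = 1\<close> by auto
    then show ?thesis using N_kills_\<gamma>\<gamma>[OF X] by (simp add: \<gamma>_def free_gen_def)
  qed
  then show ?case using N by (simp add: eq)
qed

lemma N_kills_from_2:
  assumes X: "X \<in> N (SS 1)" and x: "x \<in> free_lie_from V 2"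
  shows "bracket G X (\<kappa> x) = \<zero>\<^bsub>G\<^esub>"
proof -
  note lin = vlin_comp[OF \<kappa>_lin G.vlin_bracket_right[OF N_closed[OF X]]]
  have z: "vlin FL G (\<lambda>v. \<zero>\<^bsub>G\<^esub>)" by (auto simp: vlin_iff smult_zero[OF Gvs])
  have FLG: "bracket G X (\<kappa> y) = \<zero>\<^bsub>G\<^esub>" if y: "y \<in> FLG p" and p: "p \<ge> 2" for y p
    by (rule vlin_eq_on_span[OF F.is_vs Gvs lin z monomials_closed[OF V] _ y[unfolded FG_def[OF V]]])
      (use monomial_N X p in auto)
  show ?thesis
    by (rule vlin_eq_on_span[OF F.is_vs Gvs lin z FG_union_closed[OF V] _ x[unfolded free_lie_from_def]])
      (use FLG in auto)
qed

text \<open>A slice is the matrix of the degree zero element Z obtained from \<open>X\<close> by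
  \<open>k\<close> brackets, and Z again commutes with everything of degree below -1. The matrix
  lies in L by the definition of a prolongation. As a derivation killing [e_q, e_p], it satisfies
  the equations of K_-2. Finally [Z, e_l] also commutes with degree below -1, so the image of the
  matrix lies in W.\<close>

lemma \<tau>_sym_tensors:
  assumes X: "X \<in> N (SS 1)" "X \<in> gr (int k)"
  shows "\<tau> k X \<in> sym_tensors R n 0 (Suc k)"
proof -
  have swap: "\<tau> k X (us @ i # j # js) = \<tau> k X (us @ j # i # js)" for us i j js
  proof (cases "length (us @ i # j # js) = Suc k \<and> set (us @ i # j # js) \<subseteq> {..<n}")
    case True
    then have "act X (us @ i # j # js) = act X (us @ j # i # js)"
      using N_swap[OF N_act[OF X(1)], of us i j] by (simp add: act_simps)
    then show ?thesis using True by (intro ext) (auto simp: \<tau>_def)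
  qed (auto simp: \<tau>_def fun_eq_iff)
  note msym = swap_invariant_imp_mset_invariant[of "\<tau> k X", OF swap]
  have slice: "slice_eqs R n (\<lambda>j l. \<tau> k X (l # js) j)" for js
  proof (cases "length js = k \<and> set js \<subseteq> {..<n}")
    case False
    then have "(\<lambda>j l. \<tau> k X (l # js) j) = (\<lambda>j l. 0)" by (auto simp: \<tau>_def fun_eq_iff)
    then show ?thesis using slice_eqs_zero by metis
  next
    case True
    define Z where "Z = act X js"
    have ZN: "Z \<in> N (SS 1)" using N_act[OF X(1)] True by (simp add: Z_def)
    have Z0: "Z \<in> gr 0" using act_gr[OF X(2), of js] True by (simp add: Z_def)
    have ZC: "Z \<in> carrier G" by (rule N_closed[OF ZN])
    obtain T where T: "T \<in> \<LL>" "\<And>v. v \<in> carrier V \<Longrightarrow> bracket G Z (\<gamma> v) = \<iota> (fund_gen V \<K> (T v))"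
      using effective_prolongationD(9)[OF prol] Z0 unfolding \<gamma>_def \<kappa>_def fund_gen_qm by blast
    have TV: "T v \<in> carrier V" if "v \<in> carrier V" for v
    proof -
      have "\<LL> \<subseteq> carrier (gl V)" using LL submodule.subset by (auto simp: lie_subalgebra_def VectorSpace.subspace_def)
      then show ?thesis using T(1) that by (auto simp: gl_def LinearCombinations.module_hom_def)
    qed
    have ZT: "bracket G Z (\<gamma> v) = \<gamma> (T v)" if "v \<in> carrier V" for v
      using T(2)[OF that] by (simp add: \<gamma>_def \<kappa>_def fund_gen_qm)
    define A where "A = (\<lambda>j l. co (T (e l)) j)"
    \<comment> \<open>Written with \<open>id\<close>, so that the description of the equations for
      extension fields applies to the ground field itself.\<close>
    have "slice_eqs ((\<lambda>r j l. id (r j l)) ` R) n A"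
    proof (subst der_eqs_iff, goal_cases)
      case 4
      have "(\<Sum>j<n. Y $$ (p, j) * co (T (e q)) j) = (\<Sum>j<n. Y $$ (q, j) * co (T (e p)) j)"
        if Y: "Y \<in> K2_perp V e n \<K>" and pq: "p < n" "q < n" for Y p q
      proof (rule K2_perp_slice[OF Y pq TV[OF e_closed[OF pq(2)]] TV[OF e_closed[OF pq(1)]]])
        let ?x = "bracket FL (gen (T (e q))) (gen (e p))" and ?y = "bracket FL (gen (e q)) (gen (T (e p)))"
        have g: "gen (T (e q)) \<in> carrier FL" "gen (T (e p)) \<in> carrier FL" "gen (e p) \<in> carrier FL" "gen (e q) \<in> carrier FL"
          using gen_closed TV e_closed pq by auto
        have "\<kappa> (?x \<oplus>\<^bsub>FL\<^esub> ?y) = bracket G (\<gamma> (T (e q))) (E p) \<oplus>\<^bsub>G\<^esub> bracket G (E q) (\<gamma> (T (e p)))"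
          using g F.bracket_closed vlinD(2)[OF \<kappa>_lin] lie_hom_bracket[OF \<kappa>_hom] by (simp add: \<gamma>_def E_def)
        also have "\<dots> = bracket G (bracket G Z (E q)) (E p) \<oplus>\<^bsub>G\<^esub> bracket G (E q) (bracket G Z (E p))"
          using ZT e_closed pq by (simp add: E_def)
        also have "bracket G (E q) (bracket G Z (E p)) = (- 1) \<odot>\<^bsub>G\<^esub> bracket G (bracket G Z (E p)) (E q)"
          using E_closed pq ZC G.bracket_closed by (intro G.bracket_anti) auto
        also have "bracket G (bracket G Z (E q)) (E p) \<oplus>\<^bsub>G\<^esub> \<dots> = bracket G Z (bracket G (E q) (E p))"
          using E_closed pq ZC by (intro G.bracket_bracket[symmetric]) auto
        also have "\<dots> = \<zero>\<^bsub>G\<^esub>" by (rule N_bracket[OF ZN SS_bracket_E[OF pq(2,1)]])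
        finally show "?x \<oplus>\<^bsub>FL\<^esub> ?y \<in> \<K>" using g F.bracket_closed by (subst \<kappa>_zero_iff[symmetric]) auto
      qed
      moreover have "co (T (e l)) j = 0" if jl: "j < n" "l < n" "m \<le> j" for j l
      proof -
        have "T (e l) \<in> W_space V \<K>"
          unfolding W_space_def
        proof (intro CollectI conjI ballI)
          show TC: "T (e l) \<in> carrier V" using TV e_closed jl by auto
          fix x assume x: "x \<in> free_lie_from V 2"
          have xC: "x \<in> carrier FL" by (rule free_lie_from_closed[OF V x])
          have "\<kappa> (bracket FL (gen (T (e l))) x) = bracket G (bracket G Z (E l)) (\<kappa> x)"
            using lie_hom_bracket[OF \<kappa>_hom gen_closed[OF TC] xC] ZT[OF e_closed] jl by (simp add: \<gamma>_def E_def)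
          also have "\<dots> = \<zero>\<^bsub>G\<^esub>" by (rule N_kills_from_2[OF N_stable_E[OF SS_1_closed ZN jl(2)] x])
          finally show "bracket FL (gen (T (e l))) x \<in> \<K>"
            using \<kappa>_zero_iff F.bracket_closed gen_closed[OF TC] xC by blast
        qed
        then show ?thesis using W_iff jl by blast
      qed
      ultimately show ?case using L_perp_slice T(1) by (simp add: A_def)
    qed auto
    then have "slice_eqs R n A" by simp
    \<comment> \<open>The slice index comes first in the list, but the bracket that evaluates Z on a
      basis vector comes last; symmetry moves the index.\<close>
    moreover have "\<tau> k X (l # js) j = A j l" if "j < n" "l < n" for j l
    proof -
      have "\<tau> k X (l # js) = \<tau> k X (js @ [l])" by (rule msym) simp
      moreover have "\<tau> k X (js @ [l]) j = cg (bracket G Z (E l)) j" using that True by (simp add: \<tau>_def act_simps Z_def)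
      moreover have "cg (bracket G Z (E l)) j = A j l" using ZT[OF e_closed[OF that(2)]] cg_\<gamma> TV e_closed that by (simp add: E_def A_def)
      ultimately show ?thesis by simp
    qed
    ultimately show ?thesis by (simp add: slice_eqs_def)
  qed
  show ?thesis
    unfolding sym_tensors_def
  proof (intro CollectI conjI allI impI, goal_cases)
    case (4 js js') then show ?case by (rule msym)
  next
    case (5 js) show ?case by (rule slice)
  qed (auto simp: \<tau>_def split: if_splits)
qed

section \<open>Finite dimension of the single components\<close>

lemma gr_nonneg_finite:
  obtains C where "finite C" "C \<subseteq> carrier G" "gr (int k) \<subseteq> vspan G C"
proof -
  obtain F where F: "finite F" "range (\<tau> k) \<subseteq> ts.span F" by (rule \<tau>_finite)
  obtain B where B: "B \<subseteq> \<tau> k ` gr (int k)" "ts.independent B" "\<tau> k ` gr (int k) \<subseteq> ts.span B"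
    by (rule ts.maximal_independent_subset)
  have "finite B" using ts.independent_span_bound[OF F(1) B(2)] B(1) F(2) by blast
  define \<sigma> where "\<sigma> = inv_into (gr (int k)) (\<tau> k)"
  have \<sigma>: "\<sigma> b \<in> gr (int k)" "\<tau> k (\<sigma> b) = b" if "b \<in> B" for b
    using that B(1) inv_into_into[of b "\<tau> k" "gr (int k)"] f_inv_into_f[of b "\<tau> k" "gr (int k)"] by (auto simp: \<sigma>_def)
  have C: "\<sigma> ` B \<subseteq> carrier G" using \<sigma> gr_closed by blast
  have lift: "\<exists>x. x \<in> vspan G (\<sigma> ` B) \<and> x \<in> gr (int k) \<and> \<tau> k x = u" if "u \<in> ts.span B" for u
    using that
  proof (induction rule: ts.span_induct_alt)
    case base then show ?case using vspan_zero[OF Gvs C] gr_zero \<tau>_zero by blast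
  next
    case (step c b u)
    then obtain x where x: "x \<in> vspan G (\<sigma> ` B)" "x \<in> gr (int k)" "\<tau> k x = u" by blast
    let ?y = "c \<odot>\<^bsub>G\<^esub> \<sigma> b"
    have y: "?y \<in> gr (int k)" using \<sigma>(1)[OF step(1)] submodule.smult_closed[OF gr_sub, of c] by simp
    have "\<tau> k (?y \<oplus>\<^bsub>G\<^esub> x) = tscale c b + u" using \<tau>_add[OF y x(2)] \<tau>_smult[OF \<sigma>(1)[OF step(1)]] \<sigma>(2)[OF step(1)] x(3) by simp
    moreover have "?y \<oplus>\<^bsub>G\<^esub> x \<in> gr (int k)" by (rule submodule.m_closed[OF gr_sub y x(2)])
    moreover have "?y \<oplus>\<^bsub>G\<^esub> x \<in> vspan G (\<sigma> ` B)"
      using step(1) x(1) vspan_base[OF Gvs C] by (intro vspan_add[OF Gvs C] vspan_smult[OF Gvs C]) auto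
    ultimately show ?case by blast
  qed
  have "gr (int k) \<subseteq> vspan G (\<sigma> ` B)"
  proof
    fix X assume X: "X \<in> gr (int k)"
    then obtain x where x: "x \<in> vspan G (\<sigma> ` B)" "x \<in> gr (int k)" "\<tau> k x = \<tau> k X" using lift B(3) by blast
    then show "X \<in> vspan G (\<sigma> ` B)" using inj_onD[OF \<tau>_inj x(3) x(2) X] by simp
  qed
  then show ?thesis using that[of "\<sigma> ` B"] \<open>finite B\<close> C by blast
qed

lemma BB_subset_closed: "BB q \<subseteq> carrier G"
  using BB_closed by blast

text \<open>The Jacobi identity rewrites a bracket of left-normed brackets as a combination of
  left-normed ones, by induction on the length of the second factor.\<close>

lemma BB_bracket_BB:
  "y \<in> BB b \<Longrightarrow> x \<in> vspan G (BB a) \<Longrightarrow> bracket G x y \<in> vspan G (BB (Suc (a + b)))"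
proof (induction b arbitrary: x y a)
  case 0
  then obtain i where i: "i < n" "y = E i" by auto
  note sub = vspan_submodule[OF Gvs BB_subset_closed]
  have "bracket G x' y' \<in> vspan G (BB (Suc a))" if "x' \<in> BB a" "y' \<in> {E i}" for x' y'
    using that BB_bracket[of x' a i] i vspan_base[OF Gvs BB_subset_closed[of "Suc a"]] by auto
  moreover have "y \<in> vspan G {E i}" using i vspan_base[OF Gvs, of "{E i}"] E_closed by simp
  ultimately show ?case
    using G.bracket_span_closed[OF BB_subset_closed _ sub _ 0(2), of "{E i}" "Suc a" y] E_closed[OF i(1)] by simp
next
  case (Suc b)
  then obtain y' i where y: "y' \<in> BB b" "i < n" "y = bracket G y' (E i)" by auto
  have xC: "x \<in> carrier G" by (rule vspan_closed[OF Gvs BB_subset_closed Suc.prems(2)])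
  have i: "E i \<in> BB 0" using y(2) by simp
  have E: "bracket G u (E i) \<in> vspan G (BB (Suc c))" if "u \<in> vspan G (BB c)" for u c
  proof -
    note sub = vspan_submodule[OF Gvs BB_subset_closed]
    have "bracket G x' y' \<in> vspan G (BB (Suc c))" if "x' \<in> BB c" "y' \<in> {E i}" for x' y'
      using that BB_bracket[of x' c i] y(2) vspan_base[OF Gvs BB_subset_closed[of "Suc c"]] by auto
    moreover have "E i \<in> vspan G {E i}" using y(2) vspan_base[OF Gvs, of "{E i}"] E_closed by simp
    ultimately show ?thesis
      using G.bracket_span_closed[OF BB_subset_closed _ sub _ that, of "{E i}" "Suc c" "E i"] E_closed[OF y(2)] by simp
  qed
  have "bracket G (bracket G x y') (E i) \<in> vspan G (BB (Suc (Suc (a + b))))" by (rule E[OF Suc.IH[OF y(1) Suc.prems(2)]])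
  moreover have "bracket G (bracket G x (E i)) y' \<in> vspan G (BB (Suc (Suc (a + b))))"
    using Suc.IH[OF y(1) E[OF Suc.prems(2)]] by simp
  ultimately show ?case
    unfolding y(3) G.bracket_bracket[OF xC BB_closed[OF y(1)] E_closed[OF y(2)]]
    using vspan_add[OF Gvs BB_subset_closed] vspan_smult[OF Gvs BB_subset_closed] by (simp del: BB.simps)
qed

lemma monomial_BB: "lie_monomial V p t \<Longrightarrow> \<kappa> (lie_class V t) \<in> vspan G (BB (p - 1))"
proof (induction rule: lie_monomial.induct)
  case (1 v)
  have "\<gamma> v \<in> vspan G (BB 0)"
    using 1[folded vspan_e] e_image_closed
  proof (rule vspan_induct[OF V])
    show "\<gamma> \<zero>\<^bsub>V\<^esub> \<in> vspan G (BB 0)" using vlin_zero[OF V Gvs \<gamma>_lin] vspan_zero[OF Gvs BB_subset_closed] by metis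
  next
    fix a assume "a \<in> e ` {..<n}"
    then show "\<gamma> a \<in> vspan G (BB 0)" by (intro vspan_base[OF Gvs BB_subset_closed]) (auto simp: E_def)
  next
    fix x y assume "x \<in> carrier V" "y \<in> carrier V" "\<gamma> x \<in> vspan G (BB 0)" "\<gamma> y \<in> vspan G (BB 0)"
    then show "\<gamma> (x \<oplus>\<^bsub>V\<^esub> y) \<in> vspan G (BB 0)" using vlinD(2)[OF \<gamma>_lin] vspan_add[OF Gvs BB_subset_closed[of 0]] by simp
  next
    fix c x assume "x \<in> carrier V" "\<gamma> x \<in> vspan G (BB 0)"
    then show "\<gamma> (c \<odot>\<^bsub>V\<^esub> x) \<in> vspan G (BB 0)" using vlinD(3)[OF \<gamma>_lin] vspan_smult[OF Gvs BB_subset_closed[of 0]] by simp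
  qed
  then show ?case by (simp add: \<gamma>_def free_gen_def)
next
  case (2 p s q t)
  note st = lie_monomial_terms[OF 2(1)] lie_monomial_terms[OF 2(2)]
  have pq: "p \<ge> 1" "q \<ge> 1" using lie_monomial_pos 2 by auto
  have eq: "\<kappa> (lie_class V (Br s t)) = bracket G (\<kappa> (lie_class V s)) (\<kappa> (lie_class V t))"
    using lie_hom_bracket[OF \<kappa>_hom] st lie_class_closed[OF V] by (simp flip: free_lie_class_ops)
  have "bracket G (\<kappa> (lie_class V s)) (\<kappa> (lie_class V t)) \<in> vspan G (BB (Suc ((p - 1) + (q - 1))))"
    by (rule G.bracket_span_closed[OF BB_subset_closed BB_subset_closed vspan_submodule[OF Gvs BB_subset_closed] _ 2(3,4)])
      (intro BB_bracket_BB vspan_base[OF Gvs BB_subset_closed])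
  moreover have "Suc ((p - 1) + (q - 1)) = p + q - 1" using pq by simp
  ultimately show ?case by (simp only: eq)
qed

lemma gr_neg_span:
  assumes "p \<ge> 1" shows "gr (- int p) \<subseteq> vspan G (BB (p - 1))"
proof
  fix X assume "X \<in> gr (- int p)"
  then obtain x where x: "x \<in> FLG p" "X = \<kappa> x" using gr_neg[OF assms] by auto
  have "\<kappa> x \<in> vspan G (BB (p - 1))"
    using x(1)[unfolded FG_def[OF V]] monomials_closed[OF V]
  proof (rule vspan_induct[OF F.is_vs])
    show "\<kappa> \<zero>\<^bsub>FL\<^esub> \<in> vspan G (BB (p - 1))" using vlin_zero[OF F.is_vs Gvs \<kappa>_lin] vspan_zero[OF Gvs BB_subset_closed] by metis
  next
    fix a assume "a \<in> lie_class V ` {t. lie_monomial V p t}"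
    then show "\<kappa> a \<in> vspan G (BB (p - 1))" using monomial_BB by blast
  next
    fix x y assume "x \<in> carrier FL" "y \<in> carrier FL" "\<kappa> x \<in> vspan G (BB (p - 1))" "\<kappa> y \<in> vspan G (BB (p - 1))"
    then show "\<kappa> (x \<oplus>\<^bsub>FL\<^esub> y) \<in> vspan G (BB (p - 1))" using vlinD(2)[OF \<kappa>_lin] vspan_add[OF Gvs BB_subset_closed] by simp
  next
    fix c x assume "x \<in> carrier FL" "\<kappa> x \<in> vspan G (BB (p - 1))"
    then show "\<kappa> (c \<odot>\<^bsub>FL\<^esub> x) \<in> vspan G (BB (p - 1))" using vlinD(3)[OF \<kappa>_lin] vspan_smult[OF Gvs BB_subset_closed] by simp
  qed
  then show "X \<in> vspan G (BB (p - 1))" using x by simp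
qed

text \<open>Only finitely many degrees survive: above, because boundedness passes from
  \<open>N (SS 1)\<close> to the whole algebra; below, because all brackets of more than
  \<open>\<mu>\<close> vectors vanish in the quotient. Each surviving component is finite
  dimensional.\<close>

theorem finite_type_imp_fin_dim:
  assumes "\<exists>k0. \<forall>k\<ge>k0. sym_tensors R n 0 k = {0}"
  shows "vectorspace.fin_dim class_ring G"
proof -
  obtain k0 where k0: "\<And>k. k \<ge> k0 \<Longrightarrow> sym_tensors R n 0 k = {0}" using assms by blast
  have "X = \<zero>\<^bsub>G\<^esub>" if "k \<ge> k0" "X \<in> N (SS 1)" "X \<in> gr (int k)" for k X
    using \<tau>_sym_tensors[OF that(2,3)] k0[of "Suc k"] that(1) by (intro \<tau>_zero_imp[OF that(3)]) (metis le_SucI singletonD)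
  then have "bounded (N (SS 1))" unfolding bounded_def by blast
  then obtain k1 where k1: "\<And>k. k \<ge> k1 \<Longrightarrow> carrier G \<inter> gr (int k) \<subseteq> {\<zero>\<^bsub>G\<^esub>}"
    using bounded_all unfolding bounded_def by blast
  obtain C where C: "\<And>k. finite (C k)" "\<And>k. C k \<subseteq> carrier G" "\<And>k. gr (int k) \<subseteq> vspan G (C k)"
  proof -
    have "\<exists>C. finite C \<and> C \<subseteq> carrier G \<and> gr (int k) \<subseteq> vspan G C" for k
      by (rule gr_nonneg_finite[of k]) blast
    then obtain C where "\<And>k. finite (C k) \<and> C k \<subseteq> carrier G \<and> gr (int k) \<subseteq> vspan G (C k)" by metis
    then show thesis by (intro that[of C]) blast+
  qed
  define D where "D = (\<Union>k<k1. C k) \<union> (\<Union>q<\<mu>. BB q)"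
  have D: "finite D" "D \<subseteq> carrier G" using C BB_finite BB_closed by (auto simp: D_def)
  interpret S: submodule class_ring "vspan G D" G by (rule vspan_submodule[OF Gvs D(2)])
  have gr: "gr p \<subseteq> vspan G D" for p
  proof (cases "p \<ge> 0")
    case True
    then obtain k where k: "p = int k" using nonneg_int_cases by blast
    show ?thesis
    proof (cases "k < k1")
      case True
      then have "vspan G (C k) \<subseteq> vspan G D" by (intro vspan_mono[OF Gvs]) (auto simp: D_def)
      then show ?thesis using C(3)[of k] k by blast
    next
      case False
      then show ?thesis using k1[of k] gr_closed S.zero_closed k by fastforce
    qed
  next
    case False
    then obtain q where q: "p = - int (Suc q)" by (metis negD not_le_imp_less)
    have *: "gr p \<subseteq> vspan G (BB q)" using gr_neg_span[of "Suc q"] q by simp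
    show ?thesis
    proof (cases "q < \<mu>")
      case True
      then have "vspan G (BB q) \<subseteq> vspan G D" by (intro vspan_mono[OF Gvs]) (auto simp: D_def)
      then show ?thesis using * by blast
    next
      case False
      then have "vspan G (BB q) \<subseteq> vspan G D" using BB_zero S.zero_closed
        by (intro vspan_minimal[OF Gvs _ S.submodule_axioms]) (metis not_less subsetI)
      then show ?thesis using * by blast
    qed
  qed
  have "carrier G \<subseteq> vspan G D"
  proof
    fix x assume "x \<in> carrier G"
    then obtain c where c: "\<forall>p. c p \<in> gr p" "finite {p. c p \<noteq> \<zero>\<^bsub>G\<^esub>}" "x = (\<Oplus>\<^bsub>G\<^esub>p\<in>{p. c p \<noteq> \<zero>\<^bsub>G\<^esub>}. c p)"
      using effective_prolongationD(3)[OF prol] by blast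
    have "finsum G c A \<in> vspan G D" if "finite A" for A
      using that
    proof (induction A rule: finite_induct)
      case empty then show ?case using S.zero_closed by simp
    next
      case (insert a A)
      have eq: "finsum G c (insert a A) = c a \<oplus>\<^bsub>G\<^esub> finsum G c A"
        using insert c(1) gr_closed by (intro G.finsum_insert) auto
      have "c a \<in> vspan G D" using gr c(1) by blast
      then show ?case unfolding eq by (rule S.m_closed) (rule insert.IH)
    qed
    then show "x \<in> vspan G D" using c by simp
  qed
  then have "vspan G D = carrier G" using vspan_closed[OF Gvs D(2)] by blast
  then show ?thesis unfolding G.fin_dim_def using D by blast
qed

end

text \<open>Moves the antisymmetrisation from the pair of vectors to the array of
  coefficients.\<close>

lemma sum_swap_antisym:
  fixes c d :: "nat \<Rightarrow> 'k::comm_ring"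
  shows "(\<Sum>i<n. \<Sum>j<n. r i j * (c i * d j - d i * c j)) = (\<Sum>j<n. \<Sum>i<n. (r i j - r j i) * c i * d j)"
proof -
  have "(\<Sum>i<n. \<Sum>j<n. r i j * (d i * c j)) = (\<Sum>j<n. \<Sum>i<n. r j i * (d j * c i))" by simp
  moreover have "(\<Sum>i<n. \<Sum>j<n. r i j * (c i * d j)) = (\<Sum>j<n. \<Sum>i<n. r i j * (c i * d j))" by (rule sum.swap)
  ultimately show ?thesis by (simp add: right_diff_distrib left_diff_distrib sum_subtractf mult.assoc mult.commute[of "d _"])
qed

lemma separating_functional_ex:
  fixes S :: "('i \<Rightarrow> 'k::field) set"
  assumes "finite I" and "module.subspace (\<lambda>c f i. c * f i) S"
    and "\<forall>f\<in>insert x S. \<forall>i. i \<notin> I \<longrightarrow> f i = 0" and "x \<notin> S"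
  shows "\<exists>r. (\<forall>f\<in>S. (\<Sum>i\<in>I. r i * f i) = 0) \<and> (\<Sum>i\<in>I. r i * x i) \<noteq> 0"
proof (rule separating_functional[where I = I and S = S and x = x])
  fix r assume "\<And>f. f \<in> S \<Longrightarrow> (\<Sum>i\<in>I. r i * f i) = 0" "(\<Sum>i\<in>I. r i * x i) \<noteq> 0"
  then show ?thesis by blast
qed (use assms in blast)+

section \<open>Slices as derivations on the component of degree -2\<close>

context tanaka
begin

definition \<beta> :: "(nat \<Rightarrow> 'k) \<Rightarrow> ('k, 'v) fundamental" where
  "\<beta> c = qm (gen (comb c))"

lemmas Mvs = M.is_vs

lemma K_closed: "x \<in> \<K> \<Longrightarrow> x \<in> carrier FL"
  using K.subset by blast

lemma \<beta>_closed: "\<beta> c \<in> carrier MM"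
  unfolding \<beta>_def by (intro vlinD(1)[OF qm_lin] gen_closed comb_closed)

lemma qm_gen_lin: "vlin V MM (\<lambda>v. qm (gen v))"
  by (rule vlin_comp[OF gen_lin qm_lin])

lemma \<beta>_add: "\<beta> (\<lambda>i. c i + d i) = \<beta> c \<oplus>\<^bsub>MM\<^esub> \<beta> d"
  and \<beta>_smult: "\<beta> (\<lambda>i. a * c i) = a \<odot>\<^bsub>MM\<^esub> \<beta> c"
  unfolding \<beta>_def comb_add comb_smult by (rule vlinD[OF qm_gen_lin] comb_closed)+

lemma \<beta>_zero: "\<beta> (\<lambda>i. 0) = \<zero>\<^bsub>MM\<^esub>"
  using \<beta>_smult[of 0 "\<lambda>i. 0"] zero_smult[OF Mvs \<beta>_closed] by simp

lemma \<beta>_comb: "\<beta> c = (\<Oplus>\<^bsub>MM\<^esub>i\<in>{..<n}. c i \<odot>\<^bsub>MM\<^esub> \<beta> (\<lambda>l. if l = i then 1 else 0))"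
proof -
  have "\<beta> c = (\<Oplus>\<^bsub>MM\<^esub>i\<in>{..<n}. qm (gen (c i \<odot>\<^bsub>V\<^esub> e i)))"
    unfolding \<beta>_def comb_def using e_closed smult_closed_class[OF V]
    by (intro vlin_finsum[OF V Mvs qm_gen_lin]) auto
  also have "\<dots> = (\<Oplus>\<^bsub>MM\<^esub>i\<in>{..<n}. c i \<odot>\<^bsub>MM\<^esub> \<beta> (\<lambda>l. if l = i then 1 else 0))"
    using e_closed vlinD[OF qm_gen_lin] smult_closed_class[OF Mvs]
    by (intro M.finsum_cong') (auto simp: \<beta>_def comb_unit)
  finally show ?thesis .
qed

text \<open>The bracket map from the tensor square of V to the quotient, on arrays of coefficients.
  K_-2 becomes the space of antisymmetric arrays in its kernel, \<open>K2_coeffs\<close>.\<close>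

definition \<Phi> :: "(nat \<times> nat \<Rightarrow> 'k) \<Rightarrow> ('k, 'v) fundamental" where
  "\<Phi> Z = (\<Oplus>\<^bsub>MM\<^esub>i\<in>{..<n}. \<Oplus>\<^bsub>MM\<^esub>j\<in>{..<n}. Z (i, j) \<odot>\<^bsub>MM\<^esub>
     bracket MM (\<beta> (\<lambda>l. if l = i then 1 else 0)) (\<beta> (\<lambda>l. if l = j then 1 else 0)))"

lemma \<Phi>_inner_closed: "Z (i, j) \<odot>\<^bsub>MM\<^esub>
     bracket MM (\<beta> (\<lambda>l. if l = i then 1 else 0)) (\<beta> (\<lambda>l. if l = j then 1 else 0)) \<in> carrier MM"
  by (intro smult_closed_class[OF Mvs] M.bracket_closed \<beta>_closed)

lemma \<Phi>_closed: "\<Phi> Z \<in> carrier MM"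
  unfolding \<Phi>_def using \<Phi>_inner_closed by (intro M.finsum_closed) auto

lemma \<Phi>_add: "\<Phi> (\<lambda>i. Z i + Z' i) = \<Phi> Z \<oplus>\<^bsub>MM\<^esub> \<Phi> Z'"
proof -
  have "\<Phi> (\<lambda>i. Z i + Z' i) = (\<Oplus>\<^bsub>MM\<^esub>i\<in>{..<n}. (\<Oplus>\<^bsub>MM\<^esub>j\<in>{..<n}. Z (i, j) \<odot>\<^bsub>MM\<^esub>
     bracket MM (\<beta> (\<lambda>l. if l = i then 1 else 0)) (\<beta> (\<lambda>l. if l = j then 1 else 0))) \<oplus>\<^bsub>MM\<^esub>
     (\<Oplus>\<^bsub>MM\<^esub>j\<in>{..<n}. Z' (i, j) \<odot>\<^bsub>MM\<^esub>
     bracket MM (\<beta> (\<lambda>l. if l = i then 1 else 0)) (\<beta> (\<lambda>l. if l = j then 1 else 0))))"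
    unfolding \<Phi>_def smult_add_class[OF Mvs M.bracket_closed[OF \<beta>_closed \<beta>_closed]]
    using \<Phi>_inner_closed by (intro M.finsum_cong' M.finsum_addf HOL.refl) (auto intro!: M.finsum_closed M.a_closed)
  also have "\<dots> = \<Phi> Z \<oplus>\<^bsub>MM\<^esub> \<Phi> Z'"
    unfolding \<Phi>_def using \<Phi>_inner_closed by (intro M.finsum_addf) (auto intro!: M.finsum_closed)
  finally show ?thesis .
qed

lemma \<Phi>_smult: "\<Phi> (\<lambda>i. a * Z i) = a \<odot>\<^bsub>MM\<^esub> \<Phi> Z"
proof -
  have lin: "vlin MM MM (\<lambda>x. a \<odot>\<^bsub>MM\<^esub> x)"
    by (auto simp: vlin_iff smult_closed_class[OF Mvs] smult_distrib_class[OF Mvs] smult_assoc_class[OF Mvs] mult.commute)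
  have "a \<odot>\<^bsub>MM\<^esub> \<Phi> Z = (\<Oplus>\<^bsub>MM\<^esub>i\<in>{..<n}. a \<odot>\<^bsub>MM\<^esub> (\<Oplus>\<^bsub>MM\<^esub>j\<in>{..<n}. Z (i, j) \<odot>\<^bsub>MM\<^esub>
     bracket MM (\<beta> (\<lambda>l. if l = i then 1 else 0)) (\<beta> (\<lambda>l. if l = j then 1 else 0))))"
    unfolding \<Phi>_def using \<Phi>_inner_closed by (intro vlin_finsum[OF Mvs Mvs lin]) (auto intro!: M.finsum_closed)
  also have "\<dots> = \<Phi> (\<lambda>i. a * Z i)"
    unfolding \<Phi>_def smult_assoc_class[OF Mvs M.bracket_closed[OF \<beta>_closed \<beta>_closed], symmetric]
    using \<Phi>_inner_closed
    by (intro M.finsum_cong' vlin_finsum[OF Mvs Mvs lin] HOL.refl) (auto intro!: M.finsum_closed smult_closed_class[OF Mvs])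
  finally show ?thesis by simp
qed

lemma \<Phi>_tensor: "\<Phi> (\<lambda>(i, j). c i * d j) = bracket MM (\<beta> c) (\<beta> d)"
proof -
  let ?u = "\<lambda>i. \<beta> (\<lambda>l. if l = i then 1 else 0)"
  note C = \<beta>_closed M.bracket_closed[OF \<beta>_closed \<beta>_closed] smult_closed_class[OF Mvs]
  have "bracket MM (\<beta> c) (\<beta> d) = bracket MM (\<Oplus>\<^bsub>MM\<^esub>i\<in>{..<n}. c i \<odot>\<^bsub>MM\<^esub> ?u i) (\<beta> d)"
    using \<beta>_comb[of c] by simp
  also have "\<dots> = (\<Oplus>\<^bsub>MM\<^esub>i\<in>{..<n}. bracket MM (c i \<odot>\<^bsub>MM\<^esub> ?u i) (\<beta> d))"
    by (rule vlin_finsum[OF Mvs Mvs M.vlin_bracket_left]) (intro C)+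
  also have "\<dots> = \<Phi> (\<lambda>(i, j). c i * d j)"
    unfolding \<Phi>_def
  proof (intro M.finsum_cong' HOL.refl)
    show "(\<lambda>i. \<Oplus>\<^bsub>MM\<^esub>j\<in>{..<n}. (case (i, j) of (i, j) \<Rightarrow> c i * d j) \<odot>\<^bsub>MM\<^esub> bracket MM (?u i) (?u j)) \<in> {..<n} \<rightarrow> carrier MM"
      using C by (auto intro!: M.finsum_closed)
    fix i
    have "bracket MM (c i \<odot>\<^bsub>MM\<^esub> ?u i) (\<beta> d) = bracket MM (c i \<odot>\<^bsub>MM\<^esub> ?u i) (\<Oplus>\<^bsub>MM\<^esub>j\<in>{..<n}. d j \<odot>\<^bsub>MM\<^esub> ?u j)"
      using \<beta>_comb[of d] by simp
    also have "\<dots> = (\<Oplus>\<^bsub>MM\<^esub>j\<in>{..<n}. bracket MM (c i \<odot>\<^bsub>MM\<^esub> ?u i) (d j \<odot>\<^bsub>MM\<^esub> ?u j))"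
      by (rule vlin_finsum[OF Mvs Mvs M.vlin_bracket_right]) (intro C)+
    also have "\<dots> = (\<Oplus>\<^bsub>MM\<^esub>j\<in>{..<n}. (case (i, j) of (i, j) \<Rightarrow> c i * d j) \<odot>\<^bsub>MM\<^esub> bracket MM (?u i) (?u j))"
      using C by (intro M.finsum_cong') (auto simp: M.bracket_smult_left M.bracket_smult_right smult_assoc_class[OF Mvs] mult.commute)
    finally show "bracket MM (c i \<odot>\<^bsub>MM\<^esub> ?u i) (\<beta> d) =
      (\<Oplus>\<^bsub>MM\<^esub>j\<in>{..<n}. (case (i, j) of (i, j) \<Rightarrow> c i * d j) \<odot>\<^bsub>MM\<^esub> bracket MM (?u i) (?u j))" .
  qed
  finally show ?thesis by simp
qed

text \<open>The cut-off gives the arrays finite support, as the separating functional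
  requires.\<close>

definition wedge :: "(nat \<Rightarrow> 'k) \<Rightarrow> (nat \<Rightarrow> 'k) \<Rightarrow> nat \<times> nat \<Rightarrow> 'k" where
  "wedge c d = (\<lambda>(i, j). if i < n \<and> j < n then c i * d j - d i * c j else 0)"

lemma \<Phi>_cong: "(\<And>i j. i < n \<Longrightarrow> j < n \<Longrightarrow> Z (i, j) = Z' (i, j)) \<Longrightarrow> \<Phi> Z = \<Phi> Z'"
  unfolding \<Phi>_def using \<Phi>_inner_closed
  by (intro M.finsum_cong') (auto intro!: M.finsum_closed M.finsum_cong')

lemma \<Phi>_wedge: "\<Phi> (wedge c d) = 2 \<odot>\<^bsub>MM\<^esub> bracket MM (\<beta> c) (\<beta> d)"
proof -
  let ?b = "bracket MM (\<beta> c) (\<beta> d)"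
  have C: "?b \<in> carrier MM" by (intro M.bracket_closed \<beta>_closed)
  have "\<Phi> (wedge c d) = \<Phi> (\<lambda>p. (case p of (i, j) \<Rightarrow> c i * d j) + (- 1) * (case p of (i, j) \<Rightarrow> d i * c j))"
    by (rule \<Phi>_cong) (simp add: wedge_def)
  also have "\<dots> = ?b \<oplus>\<^bsub>MM\<^esub> (- 1) \<odot>\<^bsub>MM\<^esub> bracket MM (\<beta> d) (\<beta> c)"
    unfolding \<Phi>_add \<Phi>_smult \<Phi>_tensor ..
  also have "\<dots> = ?b \<oplus>\<^bsub>MM\<^esub> ?b" using M.bracket_anti[OF \<beta>_closed \<beta>_closed, of c d] by simp
  also have "\<dots> = 2 \<odot>\<^bsub>MM\<^esub> ?b" using smult_add_class[OF Mvs C, of 1 1] one_smult[OF Mvs C] by simp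
  finally show ?thesis .
qed

lemma \<Phi>_zero: "\<Phi> (\<lambda>i. 0) = \<zero>\<^bsub>MM\<^esub>"
  using \<Phi>_smult[of 0 "\<lambda>i. 0"] zero_smult[OF Mvs \<Phi>_closed] by simp

text \<open>Describes K_-2 by linear conditions instead of by sums of brackets, so that it is
  visibly a subspace. The inclusion of \<open>K2_mats\<close> in it is what turns a functional
  vanishing here into an element of \<open>K2_perp\<close>.\<close>

definition K2_coeffs :: "(nat \<times> nat \<Rightarrow> 'k) set" where
  "K2_coeffs = {Z. (\<forall>i j. \<not> (i < n \<and> j < n) \<longrightarrow> Z (i, j) = 0) \<and> (\<forall>i j. Z (j, i) = - Z (i, j)) \<and> \<Phi> Z = \<zero>\<^bsub>MM\<^esub>}"

lemma K2_mats_coeffs: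
  assumes "Z \<in> K2_mats V e n \<K>"
  shows "Z \<in> carrier_mat n n" "(\<lambda>(i, j). if i < n \<and> j < n then Z $$ (i, j) else 0) \<in> K2_coeffs"
proof -
  interpret mm: vectorspace class_ring "module_mat TYPE('k) n n" by (rule matrix_vs)
  obtain l :: nat and v w where vw: "\<And>i. i < l \<Longrightarrow> v i \<in> carrier V" "\<And>i. i < l \<Longrightarrow> w i \<in> carrier V"
    and Kin: "finsum FL (\<lambda>i. bracket FL (gen (v i)) (gen (w i))) {..<l} \<in> \<K>"
    and Z: "Z = finsum (module_mat TYPE('k) n n) (\<lambda>i. wedge_mat n (coords V e n (v i)) (coords V e n (w i))) {..<l}"
    using assms unfolding K2_mats_def by blast
  let ?W = "\<lambda>i. wedge_mat n (coords V e n (v i)) (coords V e n (w i))"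
  let ?b = "\<lambda>i. bracket MM (\<beta> (co (v i))) (\<beta> (co (w i)))"
  \<comment> \<open>Partial sums, so that antisymmetry and the value of \<open>\<Phi>\<close> can be
    followed one bracket at a time.\<close>
  define P where "P = (\<lambda>k. finsum (module_mat TYPE('k) n n) ?W {..<k})"
  define z where "z = (\<lambda>k (i, j). if i < n \<and> j < n then P k $$ (i, j) else 0)"
  have WC: "?W i \<in> carrier_mat n n" for i by (simp add: wedge_mat_def)
  have PC: "P k \<in> carrier_mat n n" for k
    using mm.finsum_closed[of ?W "{..<k}"] WC by (simp add: module_mat_simps P_def)
  have P0: "P 0 = 0\<^sub>m n n" by (simp add: module_mat_simps P_def)
  have PS: "P (Suc k) = ?W k + P k" for k
    unfolding P_def lessThan_Suc using WC by (subst mm.finsum_insert) (auto simp: module_mat_simps)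
  have bC: "?b i \<in> carrier MM" for i by (intro M.bracket_closed \<beta>_closed)
  have zS: "z (Suc k) = (\<lambda>p. wedge (co (v k)) (co (w k)) p + z k p)" for k
  proof
    fix p :: "nat \<times> nat"
    obtain i j where p: "p = (i, j)" by (cases p)
    show "z (Suc k) p = wedge (co (v k)) (co (w k)) p + z k p"
      unfolding z_def p PS wedge_def prod.case using PC[of k]
      by (simp add: wedge_coords_index)
  qed
  have "(\<forall>i j. z k (j, i) = - z k (i, j)) \<and> \<Phi> (z k) = 2 \<odot>\<^bsub>MM\<^esub> finsum MM ?b {..<k}" for k
  proof (induction k)
    case 0
    have z: "z 0 = (\<lambda>i. 0)" by (auto simp: z_def P0)
    show ?case unfolding z using \<Phi>_zero smult_zero[OF Mvs] by simp
  next
    case (Suc k)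
    have 1: "z (Suc k) (j, i) = - z (Suc k) (i, j)" for i j
    proof -
      have "wedge (co (v k)) (co (w k)) (j, i) = - wedge (co (v k)) (co (w k)) (i, j)" by (auto simp: wedge_def)
      moreover have "z k (j, i) = - z k (i, j)" using Suc by blast
      ultimately show ?thesis unfolding zS by simp
    qed
    have 2: "\<Phi> (z (Suc k)) = 2 \<odot>\<^bsub>MM\<^esub> ?b k \<oplus>\<^bsub>MM\<^esub> 2 \<odot>\<^bsub>MM\<^esub> finsum MM ?b {..<k}"
      unfolding zS \<Phi>_add \<Phi>_wedge using Suc by simp
    have 3: "2 \<odot>\<^bsub>MM\<^esub> ?b k \<oplus>\<^bsub>MM\<^esub> 2 \<odot>\<^bsub>MM\<^esub> finsum MM ?b {..<k} = 2 \<odot>\<^bsub>MM\<^esub> finsum MM ?b {..<Suc k}"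
    proof -
      have "finsum MM ?b {..<Suc k} = ?b k \<oplus>\<^bsub>MM\<^esub> finsum MM ?b {..<k}"
        unfolding lessThan_Suc using bC by (intro M.finsum_insert) auto
      then show ?thesis using bC by (simp only: smult_distrib_class[OF Mvs] M.finsum_closed Pi_I)
    qed
    show ?case using 1 HOL.trans[OF 2 3] by blast
  qed
  then have l: "z l (j, i) = - z l (i, j)" "\<Phi> (z l) = 2 \<odot>\<^bsub>MM\<^esub> finsum MM ?b {..<l}" for i j by blast+
  have "finsum MM ?b {..<l} = finsum MM (\<lambda>i. qm (bracket FL (gen (v i)) (gen (w i)))) {..<l}"
    using vw gen_closed by (intro M.finsum_cong')
      (auto simp: \<beta>_def comb_co lie_hom_bracket[OF qm_hom] intro!: M.bracket_closed F.bracket_closed vlinD(1)[OF qm_lin])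
  also have "\<dots> = qm (finsum FL (\<lambda>i. bracket FL (gen (v i)) (gen (w i))) {..<l})"
    using vw gen_closed by (intro vlin_finsum[OF F.is_vs Mvs qm_lin, symmetric] F.bracket_closed gen_closed) auto
  also have "\<dots> = \<zero>\<^bsub>MM\<^esub>" using Kin qm_zero_iff[OF K_closed] by simp
  finally have "\<Phi> (z l) = \<zero>\<^bsub>MM\<^esub>" unfolding l using smult_zero[OF Mvs] by simp
  moreover have "z l (i, j) = 0" if "\<not> (i < n \<and> j < n)" for i j using that by (auto simp: z_def)
  ultimately have "z l \<in> K2_coeffs" unfolding K2_coeffs_def using l(1) by blast
  then show "(\<lambda>(i, j). if i < n \<and> j < n then Z $$ (i, j) else 0) \<in> K2_coeffs"
    unfolding Z z_def P_def .
  show "Z \<in> carrier_mat n n" using PC unfolding Z P_def .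
qed

lemma K2_coeffs_subspace: "module.subspace (\<lambda>c f i. c * f i) K2_coeffs"
proof -
  interpret k: vector_space "(*) :: 'k \<Rightarrow> 'k \<Rightarrow> 'k" by unfold_locales (auto simp: algebra_simps)
  interpret v: vector_space "\<lambda>c (f :: nat \<times> nat \<Rightarrow> 'k) i. c * f i" by (rule k.vector_space_fun)
  show ?thesis
  proof (rule v.subspaceI)
    have z: "(0 :: nat \<times> nat \<Rightarrow> 'k) = (\<lambda>i. 0)" by auto
    show "0 \<in> K2_coeffs" unfolding z K2_coeffs_def using \<Phi>_zero by simp
  next
    fix x y assume xy: "x \<in> K2_coeffs" "y \<in> K2_coeffs"
    show "x + y \<in> K2_coeffs"
      unfolding K2_coeffs_def
    proof (intro CollectI conjI allI impI)
      fix i j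
      have "x (j, i) = - x (i, j)" "y (j, i) = - y (i, j)" using xy unfolding K2_coeffs_def by blast+
      then show "(x + y) (j, i) = - (x + y) (i, j)" by (simp only: plus_fun_apply minus_add_distrib)
    next
      fix i j assume "\<not> (i < n \<and> j < n)"
      then have "x (i, j) = 0" "y (i, j) = 0" using xy unfolding K2_coeffs_def by blast+
      then show "(x + y) (i, j) = 0" by (simp only: plus_fun_apply add_0)
    next
      have "\<Phi> x = \<zero>\<^bsub>MM\<^esub>" "\<Phi> y = \<zero>\<^bsub>MM\<^esub>" using xy unfolding K2_coeffs_def by blast+
      moreover have "x + y = (\<lambda>i. x i + y i)" by auto
      ultimately show "\<Phi> (x + y) = \<zero>\<^bsub>MM\<^esub>" using \<Phi>_add[of x y] M.zero_closed by (simp only: M.l_zero)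
    qed
  next
    fix c x assume x: "x \<in> K2_coeffs"
    show "(\<lambda>i. c * x i) \<in> K2_coeffs"
      unfolding K2_coeffs_def
    proof (intro CollectI conjI allI impI)
      fix i j
      have "x (j, i) = - x (i, j)" using x unfolding K2_coeffs_def by blast
      then show "c * x (j, i) = - (c * x (i, j))" by (simp only: mult_minus_right)
    next
      fix i j assume "\<not> (i < n \<and> j < n)"
      then have "x (i, j) = 0" using x unfolding K2_coeffs_def by blast
      then show "c * x (i, j) = 0" by (simp only: mult_zero_right)
    next
      have "\<Phi> x = \<zero>\<^bsub>MM\<^esub>" using x unfolding K2_coeffs_def by blast
      then show "\<Phi> (\<lambda>i. c * x i) = \<zero>\<^bsub>MM\<^esub>" unfolding \<Phi>_smult using smult_zero[OF Mvs] by simp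
    qed
  qed
qed

text \<open>A solution of the equations from \<open>\<K>\<^sub>-\<^sub>2\<^sup>\<bottom>\<close> acts on \<open>\<Lambda>\<^sup>2(V)\<close> as a derivation vanishing modulo \<open>\<K>\<^sub>-\<^sub>2\<close>,
  because \<open>\<K>\<^sub>-\<^sub>2\<^sup>\<bottom>\<^sup>\<bottom> = \<K>\<^sub>-\<^sub>2\<close>.\<close>

lemma derivation_on_wedge:
  assumes A: "slice_eqs R n A"
  shows "bracket MM (\<beta> (\<lambda>j. \<Sum>l<n. A j l * c l)) (\<beta> d) \<oplus>\<^bsub>MM\<^esub> bracket MM (\<beta> c) (\<beta> (\<lambda>j. \<Sum>l<n. A j l * d l)) = \<zero>\<^bsub>MM\<^esub>"
proof -
  let ?Ac = "\<lambda>j. \<Sum>l<n. A j l * c l" and ?Ad = "\<lambda>j. \<Sum>l<n. A j l * d l"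
  let ?t = "bracket MM (\<beta> ?Ac) (\<beta> d) \<oplus>\<^bsub>MM\<^esub> bracket MM (\<beta> c) (\<beta> ?Ad)"
  have tC: "?t \<in> carrier MM" by (intro M.a_closed M.bracket_closed \<beta>_closed)
  \<comment> \<open>The coefficients of (A c) wedge d + c wedge (A d), whose image under
    \<open>\<Phi>\<close> is twice the element claimed to be zero.\<close>
  define x where "x = (\<lambda>p. wedge ?Ac d p + wedge c ?Ad p)"
  have \<Phi>x: "\<Phi> x = 2 \<odot>\<^bsub>MM\<^esub> ?t"
    unfolding x_def \<Phi>_add \<Phi>_wedge by (intro smult_distrib_class[OF Mvs, symmetric] M.bracket_closed \<beta>_closed)
  have "x \<in> K2_coeffs"
  proof (rule ccontr)
    assume xn: "x \<notin> K2_coeffs"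
    have supp: "f p = 0" if f: "f \<in> insert x K2_coeffs" and p: "p \<notin> {..<n} \<times> {..<n}" for f p
    proof -
      obtain i j where ij: "p = (i, j)" by (cases p)
      have "\<not> (i < n \<and> j < n)" using p ij by simp
      moreover from this have "x (i, j) = 0" unfolding x_def wedge_def prod.case by (simp only: if_False add_0)
      ultimately show ?thesis using f ij unfolding K2_coeffs_def by blast
    qed
    have fin: "finite ({..<n} \<times> {..<n})" by simp
    obtain r where r: "\<And>f. f \<in> K2_coeffs \<Longrightarrow> (\<Sum>p\<in>{..<n} \<times> {..<n}. r p * f p) = 0"
        "(\<Sum>p\<in>{..<n} \<times> {..<n}. r p * x p) \<noteq> 0"
      using separating_functional_ex[OF fin K2_coeffs_subspace _ xn] supp by blast
    \<comment> \<open>The antisymmetric part of the separating functional, up to a factor chosen so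
      that trace(Y Z) is twice the pairing of \<open>r\<close> with an antisymmetric Z.\<close>
    define Y where "Y = mat n n (\<lambda>(i, j). r (j, i) - r (i, j))"
    have YC: "Y \<in> carrier_mat n n" by (simp add: Y_def)
    have "Y \<in> K2_perp V e n \<K>"
      unfolding K2_perp_def
    proof (intro CollectI conjI ballI)
      show "Y \<in> antisym_mats n" by (auto simp: antisym_mats_def Y_def intro!: eq_matI)
      fix Z assume Z: "Z \<in> K2_mats V e n \<K>"
      let ?z = "\<lambda>(i, j). if i < n \<and> j < n then Z $$ (i, j) else 0"
      note zc = K2_mats_coeffs[OF Z]
      have anti: "Z $$ (j, i) = - Z $$ (i, j)" if "i < n" "j < n" for i j
      proof -
        have "?z (j, i) = - ?z (i, j)" using zc(2) unfolding K2_coeffs_def by blast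
        then show ?thesis using that by simp
      qed
      have "mat_trace (Y * Z) = (\<Sum>i<n. \<Sum>j<n. r (j, i) * Z $$ (j, i) + r (i, j) * Z $$ (i, j))"
        unfolding mat_trace_mult[OF YC zc(1)]
      proof (intro sum.cong HOL.refl)
        fix i j assume ij: "i \<in> {..<n}" "j \<in> {..<n}"
        have "Z $$ (j, i) = - Z $$ (i, j)" using ij by (intro anti) auto
        then show "Y $$ (i, j) * Z $$ (j, i) = r (j, i) * Z $$ (j, i) + r (i, j) * Z $$ (i, j)"
          using ij by (simp add: Y_def algebra_simps)
      qed
      also have "\<dots> = (\<Sum>i<n. \<Sum>j<n. r (j, i) * Z $$ (j, i)) + (\<Sum>i<n. \<Sum>j<n. r (i, j) * Z $$ (i, j))"
        by (simp add: sum.distrib)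
      also have "(\<Sum>i<n. \<Sum>j<n. r (j, i) * Z $$ (j, i)) = (\<Sum>i<n. \<Sum>j<n. r (i, j) * Z $$ (i, j))" by (rule sum.swap)
      also have "(\<Sum>i<n. \<Sum>j<n. r (i, j) * Z $$ (i, j)) = (\<Sum>p\<in>{..<n} \<times> {..<n}. r p * ?z p)"
        unfolding sum.cartesian_product by (intro sum.cong) auto
      also have "\<dots> = 0" by (rule r(1)[OF zc(2)])
      finally show "mat_trace (Y * Z) = 0" by simp
    qed
    then have U: "(\<Sum>j<n. Y $$ (p, j) * A j q) = (\<Sum>j<n. Y $$ (q, j) * A j p)" if "p < n" "q < n" for p q
      using A[unfolded slice_eqs_def] der_eqs_iff[of id V e n \<LL> \<K> m A] A that by simp
    \<comment> \<open>Pairs \<open>r\<close> with (A c) wedge d and expresses the result through Y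
      A. Since Y A is symmetric, exchanging \<open>c\<close> and \<open>d\<close> does not change
      the value, and the two halves of \<open>x\<close> cancel.\<close>
    have half: "(\<Sum>i<n. \<Sum>j<n. r (i, j) * ((\<Sum>l<n. A i l * c l) * d j - d i * (\<Sum>l<n. A j l * c l)))
        = (\<Sum>j<n. \<Sum>l<n. (\<Sum>i<n. Y $$ (j, i) * A i l) * c l * d j)" for c d :: "nat \<Rightarrow> 'k"
    proof -
      have "(\<Sum>i<n. \<Sum>j<n. r (i, j) * ((\<Sum>l<n. A i l * c l) * d j - d i * (\<Sum>l<n. A j l * c l)))
        = (\<Sum>j<n. \<Sum>i<n. (r (i, j) - r (j, i)) * (\<Sum>l<n. A i l * c l) * d j)"
        by (rule sum_swap_antisym)
      also have "\<dots> = (\<Sum>j<n. \<Sum>i<n. \<Sum>l<n. Y $$ (j, i) * A i l * c l * d j)"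
        by (intro sum.cong) (auto simp: Y_def sum_distrib_left sum_distrib_right mult.assoc)
      also have "\<dots> = (\<Sum>j<n. \<Sum>l<n. \<Sum>i<n. Y $$ (j, i) * A i l * c l * d j)"
        by (intro sum.cong HOL.refl sum.swap)
      finally show ?thesis by (simp add: sum_distrib_right)
    qed
    have "(\<Sum>p\<in>{..<n} \<times> {..<n}. r p * x p) = (\<Sum>i<n. \<Sum>j<n. r (i, j) * (?Ac i * d j - d i * ?Ac j)
        - r (i, j) * (?Ad i * c j - c i * ?Ad j))"
      unfolding sum.cartesian_product x_def wedge_def by (intro sum.cong) (auto simp: algebra_simps)
    also have "\<dots> = (\<Sum>j<n. \<Sum>l<n. (\<Sum>i<n. Y $$ (j, i) * A i l) * c l * d j)
        - (\<Sum>j<n. \<Sum>l<n. (\<Sum>i<n. Y $$ (j, i) * A i l) * d l * c j)"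
      unfolding sum_subtractf half ..
    also have "(\<Sum>j<n. \<Sum>l<n. (\<Sum>i<n. Y $$ (j, i) * A i l) * d l * c j)
        = (\<Sum>l<n. \<Sum>j<n. (\<Sum>i<n. Y $$ (j, i) * A i l) * d l * c j)" by (rule sum.swap)
    also have "\<dots> = (\<Sum>j<n. \<Sum>l<n. (\<Sum>i<n. Y $$ (j, i) * A i l) * c l * d j)"
    proof (intro sum.cong HOL.refl)
      fix j l assume jl: "j \<in> {..<n}" "l \<in> {..<n}"
      have "(\<Sum>i<n. Y $$ (l, i) * A i j) = (\<Sum>i<n. Y $$ (j, i) * A i l)" using jl by (intro U) auto
      then show "(\<Sum>i<n. Y $$ (l, i) * A i j) * d j * c l = (\<Sum>i<n. Y $$ (j, i) * A i l) * c l * d j" by simp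
    qed
    finally show False using r(2) by simp
  qed
  then have "2 \<odot>\<^bsub>MM\<^esub> ?t = \<zero>\<^bsub>MM\<^esub>" using \<Phi>x by (simp add: K2_coeffs_def)
  then have "(1/2) \<odot>\<^bsub>MM\<^esub> (2 \<odot>\<^bsub>MM\<^esub> ?t) = \<zero>\<^bsub>MM\<^esub>" using smult_zero[OF Mvs] by simp
  then show ?thesis unfolding smult_assoc_class[OF Mvs tC] using one_smult[OF Mvs tC] by simp
qed

text \<open>The form in which the derivation property enters the Jacobi identity of the prolongation
  built from vector fields.\<close>

lemma bracket_swap_slices:
  assumes A: "slice_eqs R n A"
  shows "bracket MM (\<beta> c) (\<beta> (\<lambda>j. \<Sum>l<n. A j l * d l)) = bracket MM (\<beta> d) (\<beta> (\<lambda>j. \<Sum>l<n. A j l * c l))"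
proof (rule eq_if_diff_zero[OF Mvs])
  let ?a = "bracket MM (\<beta> c) (\<beta> (\<lambda>j. \<Sum>l<n. A j l * d l))" and ?b = "bracket MM (\<beta> (\<lambda>j. \<Sum>l<n. A j l * c l)) (\<beta> d)"
  show C: "?a \<in> carrier MM" "bracket MM (\<beta> d) (\<beta> (\<lambda>j. \<Sum>l<n. A j l * c l)) \<in> carrier MM"
    by (intro M.bracket_closed \<beta>_closed)+
  have "?b \<oplus>\<^bsub>MM\<^esub> ?a = \<zero>\<^bsub>MM\<^esub>" by (rule derivation_on_wedge[OF A])
  then have "?a \<oplus>\<^bsub>MM\<^esub> ?b = \<zero>\<^bsub>MM\<^esub>" using M.a_comm[OF C(1) M.bracket_closed[OF \<beta>_closed \<beta>_closed]] by simp
  then show "?a \<oplus>\<^bsub>MM\<^esub> (- 1) \<odot>\<^bsub>MM\<^esub> bracket MM (\<beta> d) (\<beta> (\<lambda>j. \<Sum>l<n. A j l * c l)) = \<zero>\<^bsub>MM\<^esub>"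
    using M.bracket_anti[OF \<beta>_closed \<beta>_closed, of "\<lambda>j. \<Sum>l<n. A j l * c l" d] by simp
qed

end

section \<open>The solutions of the equations as endomorphisms in L, and the projection of the
  quotient to V\<close>

context tanaka
begin

lemma slice_eqs_iff: "slice_eqs R n A \<longleftrightarrow>
    (\<forall>B\<in>L_perp V e n \<LL>. (\<Sum>j<n. \<Sum>l<n. B $$ (l, j) * A j l) = 0) \<and>
    (\<forall>Y\<in>K2_perp V e n \<K>. \<forall>p<n. \<forall>q<n. (\<Sum>j<n. Y $$ (p, j) * A j q) = (\<Sum>j<n. Y $$ (q, j) * A j p)) \<and>
    (\<forall>a<n. \<forall>b<n. m \<le> a \<longrightarrow> A a b = 0)"
  using der_eqs_iff[of id V e n \<LL> \<K> m A] by simp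

text \<open>L is its own double annihilator for the trace form: a matrix outside L would be
  separated from L by some element of \<open>L_perp\<close>. The equations thereby give back an
  actual endomorphism in L.\<close>

lemma LL_member:
  assumes LL: "lie_subalgebra \<LL> (gl V)" and A: "slice_eqs R n A"
  obtains T where "T \<in> \<LL>" "\<And>v. v \<in> carrier V \<Longrightarrow> T v = comb (\<lambda>j. \<Sum>l<n. A j l * co v l)"
    "\<And>j l. j < n \<Longrightarrow> l < n \<Longrightarrow> co (T (e l)) j = A j l"
proof -
  have sub: "submodule class_ring \<LL> (gl V)" using LL by (simp add: lie_subalgebra_def VectorSpace.subspace_def)
  interpret S: submodule class_ring \<LL> "gl V" by (rule sub)
  have lin: "vlin V V T" if "T \<in> \<LL>" for T using S.subset that by (auto simp: gl_def vlin_def)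
  define cf where "cf = (\<lambda>T (j, l). if j < n \<and> l < n then co (T (e l)) j else (0 :: 'k))"
  interpret k: vector_space "(*) :: 'k \<Rightarrow> 'k \<Rightarrow> 'k" by unfold_locales (auto simp: algebra_simps)
  interpret v: vector_space "\<lambda>c (f :: nat \<times> nat \<Rightarrow> 'k) i. c * f i" by (rule k.vector_space_fun)
  have ss: "v.subspace (cf ` \<LL>)"
  proof (rule v.subspaceI)
    have "cf \<zero>\<^bsub>gl V\<^esub> = 0" using e_closed co_zero by (auto simp: cf_def gl_def fun_eq_iff)
    then show "0 \<in> cf ` \<LL>" using S.zero_closed by (metis image_eqI)
  next
    fix x y assume "x \<in> cf ` \<LL>" "y \<in> cf ` \<LL>"
    then obtain S T where ST: "S \<in> \<LL>" "x = cf S" "T \<in> \<LL>" "y = cf T" by blast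
    have "cf (S \<oplus>\<^bsub>gl V\<^esub> T) = x + y"
      using ST e_closed vlinD(1)[OF lin] co_add by (auto simp: cf_def gl_def fun_eq_iff)
    then show "x + y \<in> cf ` \<LL>" using S.m_closed ST by (metis image_eqI)
  next
    fix c x assume "x \<in> cf ` \<LL>"
    then obtain T where T: "T \<in> \<LL>" "x = cf T" by blast
    have "cf (c \<odot>\<^bsub>gl V\<^esub> T) = (\<lambda>i. c * x i)"
      using T e_closed vlinD(1)[OF lin] co_smult by (auto simp: cf_def gl_def fun_eq_iff)
    moreover have "c \<odot>\<^bsub>gl V\<^esub> T \<in> \<LL>" using S.smult_closed[of c T] T by simp
    ultimately show "(\<lambda>i. c * x i) \<in> cf ` \<LL>" by (metis image_eqI)
  qed
  define x where "x = (\<lambda>(j, l). if j < n \<and> l < n then A j l else 0)"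
  have "x \<in> cf ` \<LL>"
  proof (rule ccontr)
    assume xn: "x \<notin> cf ` \<LL>"
    have supp: "f p = 0" if "f \<in> insert x (cf ` \<LL>)" "p \<notin> {..<n} \<times> {..<n}" for f p
      using that by (cases p) (auto simp: x_def cf_def)
    have fin: "finite ({..<n} \<times> {..<n})" by simp
    obtain r where r: "\<And>f. f \<in> cf ` \<LL> \<Longrightarrow> (\<Sum>p\<in>{..<n} \<times> {..<n}. r p * f p) = 0"
        "(\<Sum>p\<in>{..<n} \<times> {..<n}. r p * x p) \<noteq> 0"
      using separating_functional_ex[OF fin ss _ xn] supp by blast
    \<comment> \<open>Transposed, since the trace of B T pairs the entry (l, j) of B with the entry
      (j, l) of T.\<close>
    define B where "B = mat n n (\<lambda>(l, j). r (j, l))"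
    have BC: "B \<in> carrier_mat n n" by (simp add: B_def)
    have "B \<in> L_perp V e n \<LL>"
      unfolding L_perp_def
    proof (intro CollectI conjI ballI BC)
      fix T assume T: "T \<in> \<LL>"
      have "mat_trace (B * matrix_of V e n T) = (\<Sum>l<n. \<Sum>j<n. r (j, l) * co (T (e l)) j)"
        unfolding mat_trace_mult[OF BC matrix_of_carrier] by (intro sum.cong) (auto simp: B_def matrix_of_index)
      also have "\<dots> = (\<Sum>j<n. \<Sum>l<n. r (j, l) * co (T (e l)) j)" by (rule sum.swap)
      also have "\<dots> = (\<Sum>p\<in>{..<n} \<times> {..<n}. r p * cf T p)"
        unfolding sum.cartesian_product by (intro sum.cong) (auto simp: cf_def)
      also have "\<dots> = 0" using r(1) T by blast
      finally show "mat_trace (B * matrix_of V e n T) = 0" .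
    qed
    then have "(\<Sum>j<n. \<Sum>l<n. B $$ (l, j) * A j l) = 0" using A slice_eqs_iff by blast
    moreover have "(\<Sum>j<n. \<Sum>l<n. B $$ (l, j) * A j l) = (\<Sum>p\<in>{..<n} \<times> {..<n}. r p * x p)"
      unfolding sum.cartesian_product by (intro sum.cong) (auto simp: x_def B_def)
    ultimately show False using r(2) by simp
  qed
  then obtain T where T: "T \<in> \<LL>" "x = cf T" by blast
  have ent: "co (T (e l)) j = A j l" if "j < n" "l < n" for j l
    using fun_cong[OF T(2), of "(j, l)"] that by (simp add: x_def cf_def)
  let ?S = "\<lambda>v. comb (\<lambda>j. \<Sum>l<n. A j l * co v l)"
  have linS: "vlin V V ?S"
    unfolding vlin_iff
    by (auto simp: comb_closed comb_add[symmetric] comb_smult[symmetric] co_add co_smult sum.distrib distrib_left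
        sum_distrib_left mult.left_commute intro!: comb_cong sum.cong)
  have "T v = ?S v" if v: "v \<in> carrier V" for v
  proof (rule vlin_eq_on_span[OF V V lin[OF T(1)] linS e_image_closed _ v[folded vspan_e]])
    fix a assume "a \<in> e ` {..<n}"
    then obtain l where l: "a = e l" "l < n" by blast
    have "T (e l) = comb (co (T (e l)))" using l e_closed vlinD(1)[OF lin[OF T(1)]] by (simp add: comb_co)
    also have "\<dots> = ?S (e l)"
    proof (rule comb_cong)
      fix j assume j: "j < n"
      have "(\<Sum>l'<n. A j l' * co (e l) l') = (\<Sum>l'<n. if l' = l then A j l' else 0)"
        using l by (intro sum.cong) (auto simp: co_e)
      then show "co (T (e l)) j = (\<Sum>l'<n. A j l' * co (e l) l')" using ent j l by simp
    qed
    finally show "T a = ?S a" using l by simp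
  qed
  then show thesis using that T(1) ent by blast
qed

text \<open>The equations from L are preserved because L is a subalgebra, those for W because both
  products map into W. For K_-2, the symmetry of Y A and of Y B gives Y A B = - (Y B A)^T, so Y (A B
  - B A) is symmetric.\<close>

lemma slice_eqs_commutator:
  assumes LL: "lie_subalgebra \<LL> (gl V)" and A: "slice_eqs R n A" and B: "slice_eqs R n B"
  shows "slice_eqs R n (\<lambda>j l. \<Sum>i<n. A j i * B i l - B j i * A i l)"
proof -
  let ?C = "\<lambda>j l. \<Sum>i<n. A j i * B i l - B j i * A i l"
  note A' = A[unfolded slice_eqs_iff] and B' = B[unfolded slice_eqs_iff]
  obtain S where S: "S \<in> \<LL>" "\<And>v. v \<in> carrier V \<Longrightarrow> S v = comb (\<lambda>j. \<Sum>l<n. A j l * co v l)"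
      "\<And>j l. j < n \<Longrightarrow> l < n \<Longrightarrow> co (S (e l)) j = A j l"
    by (rule LL_member[OF LL A]) blast
  obtain T where T: "T \<in> \<LL>" "\<And>v. v \<in> carrier V \<Longrightarrow> T v = comb (\<lambda>j. \<Sum>l<n. B j l * co v l)"
      "\<And>j l. j < n \<Longrightarrow> l < n \<Longrightarrow> co (T (e l)) j = B j l"
    by (rule LL_member[OF LL B]) blast
  have C: "S v \<in> carrier V" "T v \<in> carrier V" if "v \<in> carrier V" for v using S T that comb_closed by auto
  have in_LL: "bracket (gl V) S T \<in> \<LL>" using LL S T by (simp add: lie_subalgebra_def)
  have ent: "co (bracket (gl V) S T (e l)) j = ?C j l" if jl: "j < n" "l < n" for j l
  proof -
    have "bracket (gl V) S T (e l) = S (T (e l)) \<ominus>\<^bsub>V\<^esub> T (S (e l))"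
      using e_closed[OF jl(2)] by (simp add: gl_def)
    also have "\<dots> = S (T (e l)) \<oplus>\<^bsub>V\<^esub> (- 1) \<odot>\<^bsub>V\<^esub> T (S (e l))"
    proof -
      have "\<ominus>\<^bsub>V\<^esub> x = (- 1) \<odot>\<^bsub>V\<^esub> x" if "x \<in> carrier V" for x
        using that smult_closed_class[OF V] add_neg[OF V] by (intro V.minus_equality) (auto simp: V.a_comm)
      then show ?thesis using C e_closed[OF jl(2)] by (simp add: a_minus_def)
    qed
    finally have "co (bracket (gl V) S T (e l)) j = co (S (T (e l))) j - co (T (S (e l))) j"
      using C e_closed[OF jl(2)] jl(1) smult_closed_class[OF V] by (simp add: co_add co_smult)
    also have "co (S (T (e l))) j = (\<Sum>i<n. A j i * B i l)"
      using S(2)[OF C(2)[OF e_closed[OF jl(2)]]] T(3) jl by (simp add: co_comb)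
    also have "co (T (S (e l))) j = (\<Sum>i<n. B j i * A i l)"
      using T(2)[OF C(1)[OF e_closed[OF jl(2)]]] S(3) jl by (simp add: co_comb)
    finally show ?thesis by (simp add: sum_subtractf)
  qed
  show ?thesis
    unfolding slice_eqs_iff
  proof (intro conjI ballI allI impI)
    fix P assume P: "P \<in> L_perp V e n \<LL>"
    have "(\<Sum>j<n. \<Sum>l<n. P $$ (l, j) * ?C j l) = (\<Sum>j<n. \<Sum>l<n. P $$ (l, j) * co (bracket (gl V) S T (e l)) j)"
      by (intro sum.cong) (auto simp: ent)
    also have "\<dots> = 0" by (rule L_perp_slice[OF P in_LL])
    finally show "(\<Sum>j<n. \<Sum>l<n. P $$ (l, j) * ?C j l) = 0" .
  next
    fix Y p q assume Y: "Y \<in> K2_perp V e n \<K>" and p: "p < n" and q: "q < n"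
    note anti = antisym_index[OF K2_perp_antisym[OF Y]]
    have prod: "(\<Sum>j<n. Y $$ (p, j) * (\<Sum>i<n. A j i * B i q)) = - (\<Sum>j<n. Y $$ (q, j) * (\<Sum>i<n. B j i * A i p))"
      if A: "\<forall>p<n. \<forall>q<n. (\<Sum>j<n. Y $$ (p, j) * A j q) = (\<Sum>j<n. Y $$ (q, j) * A j p)"
        and B: "\<forall>p<n. \<forall>q<n. (\<Sum>j<n. Y $$ (p, j) * B j q) = (\<Sum>j<n. Y $$ (q, j) * B j p)"
        and p: "p < n" and q: "q < n" for A B :: "nat \<Rightarrow> nat \<Rightarrow> 'k" and p q
    proof -
      have "(\<Sum>j<n. Y $$ (p, j) * (\<Sum>i<n. A j i * B i q)) = (\<Sum>j<n. \<Sum>i<n. Y $$ (p, j) * A j i * B i q)"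
        by (simp add: sum_distrib_left mult.assoc)
      also have "\<dots> = (\<Sum>i<n. \<Sum>j<n. Y $$ (p, j) * A j i * B i q)" by (rule sum.swap)
      also have "\<dots> = (\<Sum>i<n. (\<Sum>j<n. Y $$ (p, j) * A j i) * B i q)" by (simp add: sum_distrib_right)
      also have "\<dots> = (\<Sum>i<n. (\<Sum>j<n. Y $$ (i, j) * A j p) * B i q)"
      proof (intro sum.cong HOL.refl)
        fix i assume "i \<in> {..<n}"
        then have "(\<Sum>j<n. Y $$ (p, j) * A j i) = (\<Sum>j<n. Y $$ (i, j) * A j p)" using A p by blast
        then show "(\<Sum>j<n. Y $$ (p, j) * A j i) * B i q = (\<Sum>j<n. Y $$ (i, j) * A j p) * B i q" by (rule arg_cong)
      qed
      also have "\<dots> = (\<Sum>i<n. \<Sum>j<n. Y $$ (i, j) * A j p * B i q)" by (simp add: sum_distrib_right)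
      also have "\<dots> = (\<Sum>j<n. \<Sum>i<n. Y $$ (i, j) * A j p * B i q)" by (rule sum.swap)
      also have "\<dots> = (\<Sum>j<n. (\<Sum>i<n. - (Y $$ (j, i) * B i q)) * A j p)"
      proof (intro sum.cong HOL.refl)
        fix j assume j: "j \<in> {..<n}"
        have "(\<Sum>i<n. Y $$ (i, j) * A j p * B i q) = (\<Sum>i<n. - (Y $$ (j, i) * B i q) * A j p)"
        proof (intro sum.cong HOL.refl)
          fix i assume "i \<in> {..<n}"
          then have "Y $$ (i, j) = - Y $$ (j, i)" using anti[of j i] j by simp
          then show "Y $$ (i, j) * A j p * B i q = - (Y $$ (j, i) * B i q) * A j p" by simp
        qed
        then show "(\<Sum>i<n. Y $$ (i, j) * A j p * B i q) = (\<Sum>i<n. - (Y $$ (j, i) * B i q)) * A j p"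
          by (simp only: sum_distrib_right)
      qed
      also have "\<dots> = (\<Sum>j<n. - ((\<Sum>i<n. Y $$ (q, i) * B i j) * A j p))"
      proof (intro sum.cong HOL.refl)
        fix j assume "j \<in> {..<n}"
        then have "(\<Sum>i<n. Y $$ (j, i) * B i q) = (\<Sum>i<n. Y $$ (q, i) * B i j)" using B q by blast
        then show "(\<Sum>i<n. - (Y $$ (j, i) * B i q)) * A j p = - ((\<Sum>i<n. Y $$ (q, i) * B i j) * A j p)"
          by (simp add: sum_negf)
      qed
      also have "\<dots> = - (\<Sum>j<n. \<Sum>i<n. Y $$ (q, i) * B i j * A j p)" by (simp add: sum_negf sum_distrib_right)
      also have "(\<Sum>j<n. \<Sum>i<n. Y $$ (q, i) * B i j * A j p) = (\<Sum>i<n. \<Sum>j<n. Y $$ (q, i) * B i j * A j p)" by (rule sum.swap)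
      finally show ?thesis by (simp add: sum_distrib_left mult.assoc)
    qed
    have YA: "\<forall>p<n. \<forall>q<n. (\<Sum>j<n. Y $$ (p, j) * A j q) = (\<Sum>j<n. Y $$ (q, j) * A j p)"
      and YB: "\<forall>p<n. \<forall>q<n. (\<Sum>j<n. Y $$ (p, j) * B j q) = (\<Sum>j<n. Y $$ (q, j) * B j p)"
      using A' B' Y by blast+
    have split: "(\<Sum>j<n. Y $$ (p, j) * ?C j q) = (\<Sum>j<n. Y $$ (p, j) * (\<Sum>i<n. A j i * B i q)) - (\<Sum>j<n. Y $$ (p, j) * (\<Sum>i<n. B j i * A i q))" for p q
      by (simp add: sum_subtractf right_diff_distrib)
    show "(\<Sum>j<n. Y $$ (p, j) * ?C j q) = (\<Sum>j<n. Y $$ (q, j) * ?C j p)"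
      unfolding split using prod[OF YA YB p q] prod[OF YB YA p q] by simp
  next
    fix a b assume "a < n" "b < n" "m \<le> a"
    then show "?C a b = 0" using A' B' by simp
  qed
qed

text \<open>The component in V of an element of the quotient. It is independent of the
  representative because the ideal lies in \<open>free_lie_from V 2\<close>. The value 0 from
  \<open>n\<close> on makes it usable as the constant term of a vector field.\<close>

definition lin_part :: "('k, 'v) fundamental \<Rightarrow> nat \<Rightarrow> 'k" where
  "lin_part u = (\<lambda>j. if j < n then co (pr (SOME x. x \<in> carrier FL \<and> qm x = u)) j else 0)"

lemma lin_part_qm:
  assumes x: "x \<in> carrier FL"
  shows "lin_part (qm x) = (\<lambda>j. if j < n then co (pr x) j else 0)"
proof -
  define y where "y = (SOME y. y \<in> carrier FL \<and> qm y = qm x)"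
  have y: "y \<in> carrier FL" "qm y = qm x"
    using someI[of "\<lambda>y. y \<in> carrier FL \<and> qm y = qm x" x] x by (auto simp: y_def)
  have sC: "(- 1) \<odot>\<^bsub>FL\<^esub> x \<in> carrier FL" by (rule smult_closed_class[OF F.is_vs x])
  have "qm (y \<oplus>\<^bsub>FL\<^esub> (- 1) \<odot>\<^bsub>FL\<^esub> x) = \<zero>\<^bsub>MM\<^esub>"
    using vlinD[OF qm_lin] x y sC add_neg[OF Mvs] by simp
  then have "y \<oplus>\<^bsub>FL\<^esub> (- 1) \<odot>\<^bsub>FL\<^esub> x \<in> \<K>" using qm_zero_iff y(1) sC by simp
  then have "pr (y \<oplus>\<^bsub>FL\<^esub> (- 1) \<odot>\<^bsub>FL\<^esub> x) = \<zero>\<^bsub>V\<^esub>" using pr(3) K_upper by blast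
  then have "pr y \<oplus>\<^bsub>V\<^esub> (- 1) \<odot>\<^bsub>V\<^esub> pr x = \<zero>\<^bsub>V\<^esub>"
    unfolding vlinD(2)[OF pr(1) y(1) sC] vlinD(3)[OF pr(1) x] .
  then have "pr y = pr x"
    by (rule eq_if_diff_zero[OF V vlinD(1)[OF pr(1) y(1)] vlinD(1)[OF pr(1) x]])
  moreover have "lin_part (qm x) = (\<lambda>j. if j < n then co (pr y) j else 0)" unfolding lin_part_def y_def ..
  ultimately show ?thesis by (simp only:)
qed

lemma MM_cases:
  assumes "u \<in> carrier MM"
  obtains x where "x \<in> carrier FL" "u = qm x"
  using assms MM_carrier by blast

lemma lin_part_add:
  assumes "u \<in> carrier MM" "v \<in> carrier MM"
  shows "lin_part (u \<oplus>\<^bsub>MM\<^esub> v) = lin_part u + lin_part v"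
proof -
  obtain x y where xy: "x \<in> carrier FL" "u = qm x" "y \<in> carrier FL" "v = qm y"
    using MM_cases[OF assms(1)] MM_cases[OF assms(2)] by metis
  have "u \<oplus>\<^bsub>MM\<^esub> v = qm (x \<oplus>\<^bsub>FL\<^esub> y)" using xy vlinD(2)[OF qm_lin] by simp
  then show ?thesis using xy vlinD[OF pr(1)] by (auto simp: lin_part_qm co_add fun_eq_iff)
qed

lemma lin_part_smult:
  assumes "u \<in> carrier MM"
  shows "lin_part (c \<odot>\<^bsub>MM\<^esub> u) = (\<lambda>j. c * lin_part u j)"
proof -
  obtain x where x: "x \<in> carrier FL" "u = qm x" using MM_cases[OF assms] by metis
  have "c \<odot>\<^bsub>MM\<^esub> u = qm (c \<odot>\<^bsub>FL\<^esub> x)" using x vlinD(3)[OF qm_lin] by simp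
  then show ?thesis using x vlinD[OF pr(1)] smult_closed_class[OF F.is_vs] by (auto simp: lin_part_qm co_smult fun_eq_iff)
qed

lemma lin_part_from_2: "x \<in> free_lie_from V 2 \<Longrightarrow> lin_part (qm x) = (\<lambda>j. 0)"
  using lin_part_qm[OF free_lie_from_closed[OF V]] pr(3) by (auto simp: co_zero)

lemma lin_part_bracket:
  assumes "u \<in> carrier MM" "v \<in> carrier MM"
  shows "lin_part (bracket MM u v) = (\<lambda>j. 0)"
proof -
  obtain x y where xy: "x \<in> carrier FL" "u = qm x" "y \<in> carrier FL" "v = qm y"
    using MM_cases[OF assms(1)] MM_cases[OF assms(2)] by metis
  have "bracket MM u v = qm (bracket FL x y)" using xy lie_hom_bracket[OF qm_hom] by simp
  then show ?thesis using lin_part_from_2[OF bracket_from_2[OF V xy(1,3)]] by simp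
qed

lemma lin_part_\<beta>: "lin_part (\<beta> c) = (\<lambda>j. if j < n then c j else 0)"
  unfolding \<beta>_def by (subst lin_part_qm) (auto simp: gen_closed comb_closed pr(2) co_comb)

lemma lin_part_zero: "lin_part \<zero>\<^bsub>MM\<^esub> = (\<lambda>j. 0)"
  using lin_part_\<beta>[of "\<lambda>i. 0"] by (simp add: \<beta>_zero)

lemma lin_part_support: "lin_part u j \<noteq> 0 \<Longrightarrow> j < n"
  by (auto simp: lin_part_def split: if_splits)

text \<open>Elements of W commute in the quotient with everything of degree at most -2, so only the
  component of \<open>u\<close> in V matters. This is where the definition of W enters the
  construction.\<close>

lemma bracket_W:
  assumes u: "u \<in> carrier MM" and c: "\<And>j. j < n \<Longrightarrow> m \<le> j \<Longrightarrow> c j = 0"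
  shows "bracket MM u (\<beta> c) = bracket MM (\<beta> (lin_part u)) (\<beta> c)"
proof -
  obtain x where x: "x \<in> carrier FL" "u = qm x" using MM_cases[OF u] by metis
  obtain y where y: "y \<in> free_lie_from V 2" "x = gen (pr x) \<oplus>\<^bsub>FL\<^esub> y"
    using free_lie_decompose[OF V pr(1) pr(2) pr(3) x(1)] by blast
  have yC: "y \<in> carrier FL" by (rule free_lie_from_closed[OF V y(1)])
  have prC: "pr x \<in> carrier V" by (rule vlinD(1)[OF pr(1) x(1)])
  have "comb c \<in> W_space V \<K>" unfolding W_iff using comb_closed c by (simp add: co_comb)
  then have "bracket FL (gen (comb c)) y \<in> \<K>" using y(1) by (simp add: W_space_def)
  then have "bracket FL y (gen (comb c)) \<in> \<K>"
    using F.bracket_anti[OF yC gen_closed[OF comb_closed]] K.smult_closed[of "- 1"] by simp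
  then have "qm (bracket FL y (gen (comb c))) = \<zero>\<^bsub>MM\<^esub>" using qm_zero_iff K_closed by blast
  then have z: "bracket MM (qm y) (\<beta> c) = \<zero>\<^bsub>MM\<^esub>"
    unfolding \<beta>_def lie_hom_bracket[OF qm_hom yC gen_closed[OF comb_closed], symmetric] .
  have "\<beta> (lin_part u) = qm (gen (pr x))"
  proof -
    have "comb (lin_part u) = comb (co (pr x))" unfolding x(2) lin_part_qm[OF x(1)] by (rule comb_cong) simp
    then show ?thesis using comb_co[OF prC] by (simp add: \<beta>_def)
  qed
  moreover have "u = qm (gen (pr x)) \<oplus>\<^bsub>MM\<^esub> qm y"
    using y(2) vlinD(2)[OF qm_lin gen_closed[OF prC] yC] x(2) by metis
  ultimately have u': "u = \<beta> (lin_part u) \<oplus>\<^bsub>MM\<^esub> qm y" by simp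
  have "bracket MM u (\<beta> c) = bracket MM (\<beta> (lin_part u)) (\<beta> c) \<oplus>\<^bsub>MM\<^esub> bracket MM (qm y) (\<beta> c)"
    by (subst u') (intro M.bracket_add_left \<beta>_closed vlinD(1)[OF qm_lin yC])
  then show ?thesis unfolding z using M.bracket_closed[OF \<beta>_closed \<beta>_closed] by simp
qed

end

section \<open>Gradings by eigenspaces\<close>

context
  fixes G :: "('k::field, 'a, 'm) module_scheme" and T :: "'a \<Rightarrow> 'a" and gr :: "int \<Rightarrow> 'a set" and \<chi> :: "int \<Rightarrow> 'k"
  assumes G: "vectorspace class_ring G" and T: "vlin G G T" and gr: "\<And>p. submodule class_ring (gr p) G"
    and eig: "\<And>p x. x \<in> gr p \<Longrightarrow> T x = \<chi> p \<odot>\<^bsub>G\<^esub> x" and inj: "inj \<chi>"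
begin

interpretation G: vectorspace class_ring G by (rule G)

lemma eigen_closed: "x \<in> gr p \<Longrightarrow> x \<in> carrier G"
  using submodule.subset[OF gr] by blast

lemma eigen_smult: "x \<in> gr p \<Longrightarrow> a \<odot>\<^bsub>G\<^esub> x \<in> gr p"
  using submodule.smult_closed[OF gr, of a x p] by simp

text \<open>Applying T minus the eigenvalue of one term kills that term and multiplies the others by
  nonzero scalars, which shortens the relation.\<close>

lemma eigen_independent:
  assumes "finite A" "\<And>p. p \<in> A \<Longrightarrow> c p \<in> gr p" "finsum G c A = \<zero>\<^bsub>G\<^esub>"
  shows "\<forall>p\<in>A. c p = \<zero>\<^bsub>G\<^esub>"
  using assms
proof (induction A arbitrary: c rule: finite_induct)
  case (insert a A)
  have cC: "c p \<in> carrier G" if "p \<in> insert a A" for p using insert.prems(1) eigen_closed that by blast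
  have sC: "finsum G c A \<in> carrier G" using cC by (intro G.finsum_closed) auto
  define U where "U = (\<lambda>x. T x \<oplus>\<^bsub>G\<^esub> (- \<chi> a) \<odot>\<^bsub>G\<^esub> x)"
  have U: "vlin G G U"
    unfolding vlin_iff
  proof (intro conjI ballI allI)
    fix x y assume xy: "x \<in> carrier G" "y \<in> carrier G"
    note C = xy vlinD(1)[OF T] smult_closed_class[OF G]
    show "U x \<in> carrier G" using C by (simp add: U_def)
    show "U (x \<oplus>\<^bsub>G\<^esub> y) = U x \<oplus>\<^bsub>G\<^esub> U y"
      using C by (simp add: U_def vlinD(2)[OF T] smult_distrib_class[OF G] G.a_ac)
  next
    fix b x assume x: "x \<in> carrier G"
    then show "U (b \<odot>\<^bsub>G\<^esub> x) = b \<odot>\<^bsub>G\<^esub> U x"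
      using vlinD(1)[OF T x] smult_closed_class[OF G]
      by (simp add: U_def vlinD(3)[OF T] smult_distrib_class[OF G] smult_assoc_class[OF G] mult.commute)
  qed
  have Uc: "U (c p) = (\<chi> p - \<chi> a) \<odot>\<^bsub>G\<^esub> c p" if "p \<in> insert a A" for p
  proof -
    have "U (c p) = \<chi> p \<odot>\<^bsub>G\<^esub> c p \<oplus>\<^bsub>G\<^esub> (- \<chi> a) \<odot>\<^bsub>G\<^esub> c p"
      unfolding U_def eig[OF insert.prems(1)[OF that]] ..
    also have "\<dots> = (\<chi> p + - \<chi> a) \<odot>\<^bsub>G\<^esub> c p" by (rule smult_add_class[OF G cC[OF that], symmetric])
    finally show ?thesis by simp
  qed
  have ins: "finsum G c (insert a A) = c a \<oplus>\<^bsub>G\<^esub> finsum G c A"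
    using insert.hyps cC by (intro G.finsum_insert) auto
  have "\<zero>\<^bsub>G\<^esub> = U (finsum G c (insert a A))" using insert.prems(2) vlin_zero[OF G G U] by simp
  also have "\<dots> = U (c a) \<oplus>\<^bsub>G\<^esub> U (finsum G c A)" unfolding ins using cC sC by (intro vlinD(2)[OF U]) auto
  also have "U (c a) = \<zero>\<^bsub>G\<^esub>" using Uc[of a] zero_smult[OF G cC[of a]] by simp
  also have "U (finsum G c A) = finsum G (\<lambda>p. U (c p)) A" using cC by (intro vlin_finsum[OF G G U]) auto
  also have "\<dots> = finsum G (\<lambda>p. (\<chi> p - \<chi> a) \<odot>\<^bsub>G\<^esub> c p) A"
    using Uc cC smult_closed_class[OF G] by (intro G.finsum_cong') auto
  finally have "finsum G (\<lambda>p. (\<chi> p - \<chi> a) \<odot>\<^bsub>G\<^esub> c p) A = \<zero>\<^bsub>G\<^esub>"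
    using cC smult_closed_class[OF G] by (simp add: G.l_zero G.finsum_closed Pi_iff)
  then have *: "\<forall>p\<in>A. (\<chi> p - \<chi> a) \<odot>\<^bsub>G\<^esub> c p = \<zero>\<^bsub>G\<^esub>"
    using insert.prems(1) eigen_smult by (intro insert.IH) auto
  have z: "c p = \<zero>\<^bsub>G\<^esub>" if p: "p \<in> A" for p
  proof -
    have "\<chi> p - \<chi> a \<noteq> 0" using inj insert.hyps(2) p by (auto dest: injD)
    moreover have "inverse (\<chi> p - \<chi> a) \<odot>\<^bsub>G\<^esub> ((\<chi> p - \<chi> a) \<odot>\<^bsub>G\<^esub> c p) = \<zero>\<^bsub>G\<^esub>"
      using * p smult_zero[OF G] by simp
    ultimately show ?thesis using cC[of p] p smult_assoc_class[OF G, of "c p"] one_smult[OF G, of "c p"] by simp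
  qed
  moreover have "finsum G c A = \<zero>\<^bsub>G\<^esub>" using z by (intro G.add.finprod_one_eqI) auto
  then have "c a = \<zero>\<^bsub>G\<^esub>" using ins insert.prems(2) cC[of a] by simp
  ultimately show ?case by blast
qed simp

lemma finsum_support:
  assumes "finite A" "{p. c p \<noteq> \<zero>\<^bsub>G\<^esub>} \<subseteq> A" "\<And>p. c p \<in> carrier G"
  shows "finsum G c A = (\<Oplus>\<^bsub>G\<^esub>p\<in>{p. c p \<noteq> \<zero>\<^bsub>G\<^esub>}. c p)"
  using assms by (intro G.add.finprod_mono_neutral_cong_right) auto

text \<open>Provides the decomposition clause of \<open>graded_lie_algebra\<close>. Existence comes
  from spanning; for uniqueness the differences of the components of two decompositions sum to zero
  and are eigenvectors, hence vanish.\<close>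

lemma eigen_decomposition:
  assumes span: "vspan G (\<Union>p. gr p) = carrier G" and x: "x \<in> carrier G"
  shows "\<exists>!c. (\<forall>p. c p \<in> gr p) \<and> finite {p. c p \<noteq> \<zero>\<^bsub>G\<^esub>} \<and> x = (\<Oplus>\<^bsub>G\<^esub>p\<in>{p. c p \<noteq> \<zero>\<^bsub>G\<^esub>}. c p)"
proof (rule ex_ex1I)
  have grC: "(\<Union>p. gr p) \<subseteq> carrier G" using eigen_closed by blast
  have z: "\<zero>\<^bsub>G\<^esub> \<in> gr p" for p by (rule submodule.zero_closed[OF gr])
  have "\<exists>c A. (\<forall>p. c p \<in> gr p) \<and> finite A \<and> {p. c p \<noteq> \<zero>\<^bsub>G\<^esub>} \<subseteq> A \<and> x = finsum G c A"
    using x[folded span] grC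
  proof (rule vspan_induct[OF G])
    show "\<exists>c A. (\<forall>p. c p \<in> gr p) \<and> finite A \<and> {p. c p \<noteq> \<zero>\<^bsub>G\<^esub>} \<subseteq> A \<and> \<zero>\<^bsub>G\<^esub> = finsum G c A"
      using z by (intro exI[of _ "\<lambda>p. \<zero>\<^bsub>G\<^esub>"] exI[of _ "{}"]) simp
  next
    fix y assume "y \<in> (\<Union>p. gr p)"
    then obtain q where q: "y \<in> gr q" by blast
    have "finsum G (\<lambda>p. if p = q then y else \<zero>\<^bsub>G\<^esub>) {q} = y" using eigen_closed[OF q] by simp
    then show "\<exists>c A. (\<forall>p. c p \<in> gr p) \<and> finite A \<and> {p. c p \<noteq> \<zero>\<^bsub>G\<^esub>} \<subseteq> A \<and> y = finsum G c A"
      using q z by (intro exI[of _ "\<lambda>p. if p = q then y else \<zero>\<^bsub>G\<^esub>"] exI[of _ "{q}"]) auto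
  next
    fix y w assume "\<exists>c A. (\<forall>p. c p \<in> gr p) \<and> finite A \<and> {p. c p \<noteq> \<zero>\<^bsub>G\<^esub>} \<subseteq> A \<and> y = finsum G c A"
    then obtain c A where c: "\<And>p. c p \<in> gr p" "finite A" "{p. c p \<noteq> \<zero>\<^bsub>G\<^esub>} \<subseteq> A" "y = finsum G c A" by blast
    assume "\<exists>c A. (\<forall>p. c p \<in> gr p) \<and> finite A \<and> {p. c p \<noteq> \<zero>\<^bsub>G\<^esub>} \<subseteq> A \<and> w = finsum G c A"
    then obtain d B where d: "\<And>p. d p \<in> gr p" "finite B" "{p. d p \<noteq> \<zero>\<^bsub>G\<^esub>} \<subseteq> B" "w = finsum G d B" by blast
    note C = eigen_closed[OF c(1)] eigen_closed[OF d(1)]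
    have AB: "finite (A \<union> B)" "{p. c p \<noteq> \<zero>\<^bsub>G\<^esub>} \<subseteq> A \<union> B" "{p. d p \<noteq> \<zero>\<^bsub>G\<^esub>} \<subseteq> A \<union> B" using c d by auto
    have "y = finsum G c (A \<union> B)"
      unfolding c(4) finsum_support[OF c(2,3) C(1)] by (rule finsum_support[OF AB(1,2) C(1), symmetric])
    moreover have "w = finsum G d (A \<union> B)"
      unfolding d(4) finsum_support[OF d(2,3) C(2)] by (rule finsum_support[OF AB(1,3) C(2), symmetric])
    ultimately have s: "y \<oplus>\<^bsub>G\<^esub> w = finsum G (\<lambda>p. c p \<oplus>\<^bsub>G\<^esub> d p) (A \<union> B)"
      using C by (simp add: G.finsum_addf)
    show "\<exists>c A. (\<forall>p. c p \<in> gr p) \<and> finite A \<and> {p. c p \<noteq> \<zero>\<^bsub>G\<^esub>} \<subseteq> A \<and> y \<oplus>\<^bsub>G\<^esub> w = finsum G c A"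
    proof (intro exI[of _ "\<lambda>p. c p \<oplus>\<^bsub>G\<^esub> d p"] exI[of _ "A \<union> B"] conjI allI)
      show "y \<oplus>\<^bsub>G\<^esub> w = finsum G (\<lambda>p. c p \<oplus>\<^bsub>G\<^esub> d p) (A \<union> B)" by (rule s)
      show "finite (A \<union> B)" by (rule AB(1))
      show "c p \<oplus>\<^bsub>G\<^esub> d p \<in> gr p" for p by (rule submodule.m_closed[OF gr c(1) d(1)])
      show "{p. c p \<oplus>\<^bsub>G\<^esub> d p \<noteq> \<zero>\<^bsub>G\<^esub>} \<subseteq> A \<union> B"
      proof
        fix p assume p: "p \<in> {p. c p \<oplus>\<^bsub>G\<^esub> d p \<noteq> \<zero>\<^bsub>G\<^esub>}"
        show "p \<in> A \<union> B"
        proof (rule ccontr)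
          assume "p \<notin> A \<union> B"
          then have "c p = \<zero>\<^bsub>G\<^esub>" "d p = \<zero>\<^bsub>G\<^esub>" using c(3) d(3) by blast+
          then show False using p by simp
        qed
      qed
    qed
  next
    fix b y assume "y \<in> carrier G" "\<exists>c A. (\<forall>p. c p \<in> gr p) \<and> finite A \<and> {p. c p \<noteq> \<zero>\<^bsub>G\<^esub>} \<subseteq> A \<and> y = finsum G c A"
    then obtain c A where c: "\<And>p. c p \<in> gr p" "finite A" "{p. c p \<noteq> \<zero>\<^bsub>G\<^esub>} \<subseteq> A" "y = finsum G c A" by blast
    have lin: "vlin G G (\<lambda>x. b \<odot>\<^bsub>G\<^esub> x)"
      by (auto simp: vlin_iff smult_closed_class[OF G] smult_distrib_class[OF G] smult_assoc_class[OF G] mult.commute)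
    have s: "b \<odot>\<^bsub>G\<^esub> y = finsum G (\<lambda>p. b \<odot>\<^bsub>G\<^esub> c p) A"
      unfolding c(4) using eigen_closed[OF c(1)] by (intro vlin_finsum[OF G G lin])
    show "\<exists>c A. (\<forall>p. c p \<in> gr p) \<and> finite A \<and> {p. c p \<noteq> \<zero>\<^bsub>G\<^esub>} \<subseteq> A \<and> b \<odot>\<^bsub>G\<^esub> y = finsum G c A"
    proof (intro exI[of _ "\<lambda>p. b \<odot>\<^bsub>G\<^esub> c p"] exI[of _ A] conjI allI)
      show "b \<odot>\<^bsub>G\<^esub> y = finsum G (\<lambda>p. b \<odot>\<^bsub>G\<^esub> c p) A" by (rule s)
      show "finite A" by (rule c(2))
      show "b \<odot>\<^bsub>G\<^esub> c p \<in> gr p" for p by (rule eigen_smult[OF c(1)])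
      show "{p. b \<odot>\<^bsub>G\<^esub> c p \<noteq> \<zero>\<^bsub>G\<^esub>} \<subseteq> A" using c(3) smult_zero[OF G] by auto
    qed
  qed
  then obtain c A where c: "\<And>p. c p \<in> gr p" "finite A" "{p. c p \<noteq> \<zero>\<^bsub>G\<^esub>} \<subseteq> A" "x = finsum G c A" by blast
  then show "\<exists>c. (\<forall>p. c p \<in> gr p) \<and> finite {p. c p \<noteq> \<zero>\<^bsub>G\<^esub>} \<and> x = (\<Oplus>\<^bsub>G\<^esub>p\<in>{p. c p \<noteq> \<zero>\<^bsub>G\<^esub>}. c p)"
    using finsum_support[of A c] eigen_closed[OF c(1)] finite_subset[OF c(3,2)] by (intro exI[of _ c]) simp
next
  fix c d
  assume c: "(\<forall>p. c p \<in> gr p) \<and> finite {p. c p \<noteq> \<zero>\<^bsub>G\<^esub>} \<and> x = (\<Oplus>\<^bsub>G\<^esub>p\<in>{p. c p \<noteq> \<zero>\<^bsub>G\<^esub>}. c p)"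
    and d: "(\<forall>p. d p \<in> gr p) \<and> finite {p. d p \<noteq> \<zero>\<^bsub>G\<^esub>} \<and> x = (\<Oplus>\<^bsub>G\<^esub>p\<in>{p. d p \<noteq> \<zero>\<^bsub>G\<^esub>}. d p)"
  define A where "A = {p. c p \<noteq> \<zero>\<^bsub>G\<^esub>} \<union> {p. d p \<noteq> \<zero>\<^bsub>G\<^esub>}"
  have A: "finite A" using c d by (simp add: A_def)
  have cC: "c p \<in> carrier G" and dC: "d p \<in> carrier G" and mC: "(- 1) \<odot>\<^bsub>G\<^esub> d p \<in> carrier G" for p
    using c d eigen_closed smult_closed_class[OF G] by blast+
  have xc: "x = finsum G c A" using finsum_support[OF A _ cC] c by (auto simp: A_def)
  have xd: "x = finsum G d A" using finsum_support[OF A _ dC] d by (auto simp: A_def)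
  have lin: "vlin G G (\<lambda>x. (- 1) \<odot>\<^bsub>G\<^esub> x)"
    by (auto simp: vlin_iff smult_closed_class[OF G] smult_distrib_class[OF G] smult_assoc_class[OF G] mult.commute)
  have "finsum G (\<lambda>p. c p \<oplus>\<^bsub>G\<^esub> (- 1) \<odot>\<^bsub>G\<^esub> d p) A = finsum G c A \<oplus>\<^bsub>G\<^esub> finsum G (\<lambda>p. (- 1) \<odot>\<^bsub>G\<^esub> d p) A"
    using cC mC by (intro G.finsum_addf) auto
  also have "finsum G (\<lambda>p. (- 1) \<odot>\<^bsub>G\<^esub> d p) A = (- 1) \<odot>\<^bsub>G\<^esub> finsum G d A"
    using dC by (intro vlin_finsum[OF G G lin, symmetric])
  finally have "finsum G (\<lambda>p. c p \<oplus>\<^bsub>G\<^esub> (- 1) \<odot>\<^bsub>G\<^esub> d p) A = \<zero>\<^bsub>G\<^esub>"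
    unfolding xc[symmetric] xd[symmetric] using add_neg[OF G x] by simp
  moreover have "c p \<oplus>\<^bsub>G\<^esub> (- 1) \<odot>\<^bsub>G\<^esub> d p \<in> gr p" for p
    using c d eigen_smult by (intro submodule.m_closed[OF gr]) auto
  ultimately have z: "\<forall>p\<in>A. c p \<oplus>\<^bsub>G\<^esub> (- 1) \<odot>\<^bsub>G\<^esub> d p = \<zero>\<^bsub>G\<^esub>" using A by (intro eigen_independent)
  show "c = d"
  proof
    fix p
    show "c p = d p"
    proof (cases "p \<in> A")
      case True then show ?thesis using z by (intro eq_if_diff_zero[OF G cC dC]) blast
    next
      case False then show ?thesis by (simp add: A_def)
    qed
  qed
qed

end

text \<open>A linear relation between the \<open>x k\<close> is a decomposition of zero into
  homogeneous components, and uniqueness makes every term zero. So the \<open>x k\<close> are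
  infinitely many independent vectors.\<close>

lemma graded_infinite:
  fixes G :: "('k::field, 'a, 'm) lie_scheme"
  assumes G: "graded_lie_algebra G gr" and fin: "vectorspace.fin_dim class_ring G"
    and x: "\<And>k::nat. x k \<in> gr (int k)" "\<And>k. x k \<noteq> \<zero>\<^bsub>G\<^esub>"
  shows False
proof -
  interpret G: lie_algebra G using G by (simp add: graded_lie_algebra_def)
  note Gvs = G.is_vs
  have gr: "submodule class_ring (gr p) G" for p using G by (simp add: graded_lie_algebra_def VectorSpace.subspace_def)
  have xC: "x k \<in> carrier G" for k using submodule.subset[OF gr] x(1) by blast
  have dec: "\<exists>!c. (\<forall>p. c p \<in> gr p) \<and> finite {p. c p \<noteq> \<zero>\<^bsub>G\<^esub>} \<and> y = (\<Oplus>\<^bsub>G\<^esub>p\<in>{p. c p \<noteq> \<zero>\<^bsub>G\<^esub>}. c p)" if "y \<in> carrier G" for y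
    using G that unfolding graded_lie_algebra_def by blast
  have ind: "a k = 0" if A: "finite A" "k \<in> A" and s: "finsum G (\<lambda>k. a k \<odot>\<^bsub>G\<^esub> x k) A = \<zero>\<^bsub>G\<^esub>" for a A k
  proof -
    let ?P = "\<lambda>c. (\<forall>p. c p \<in> gr p) \<and> finite {p. c p \<noteq> \<zero>\<^bsub>G\<^esub>} \<and> \<zero>\<^bsub>G\<^esub> = (\<Oplus>\<^bsub>G\<^esub>p\<in>{p. c p \<noteq> \<zero>\<^bsub>G\<^esub>}. c p)"
    define c where "c = (\<lambda>p. if p \<in> int ` A then a (nat p) \<odot>\<^bsub>G\<^esub> x (nat p) else \<zero>\<^bsub>G\<^esub>)"
    have cgr: "c p \<in> gr p" for p
    proof (cases "p \<in> int ` A")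
      case True
      then show ?thesis using x(1)[of "nat p"] submodule.smult_closed[OF gr, of "a (nat p)" "x (nat p)" p] by (auto simp: c_def)
    next
      case False then show ?thesis using submodule.zero_closed[OF gr] by (simp add: c_def)
    qed
    have cC: "c p \<in> carrier G" for p using submodule.subset[OF gr] cgr by blast
    have sub: "{p. c p \<noteq> \<zero>\<^bsub>G\<^esub>} \<subseteq> int ` A" by (auto simp: c_def)
    have fin: "finite (int ` A)" using A by simp
    have "(\<Oplus>\<^bsub>G\<^esub>p\<in>{p. c p \<noteq> \<zero>\<^bsub>G\<^esub>}. c p) = finsum G c (int ` A)"
      using cC by (intro G.add.finprod_mono_neutral_cong_right[OF fin sub, symmetric]) auto
    also have "\<dots> = finsum G (\<lambda>k. c (int k)) A" using cC by (intro G.add.finprod_reindex) auto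
    also have "\<dots> = finsum G (\<lambda>k. a k \<odot>\<^bsub>G\<^esub> x k) A"
      using xC smult_closed_class[OF Gvs] by (intro G.finsum_cong') (auto simp: c_def)
    finally have Pc: "?P c" using s cgr finite_subset[OF sub fin] by simp
    have Pz: "?P (\<lambda>p. \<zero>\<^bsub>G\<^esub>)" using submodule.zero_closed[OF gr] by simp
    from dec[OF G.zero_closed] obtain d where d: "\<forall>c. ?P c \<longrightarrow> c = d" by (rule ex1E)
    have "c = d" by (rule mp[OF spec[OF d] Pc])
    also have "\<dots> = (\<lambda>p. \<zero>\<^bsub>G\<^esub>)" by (rule mp[OF spec[OF d] Pz, symmetric])
    finally have "c = (\<lambda>p. \<zero>\<^bsub>G\<^esub>)" .
    then have "c (int k) = \<zero>\<^bsub>G\<^esub>" by simp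
    then have z: "a k \<odot>\<^bsub>G\<^esub> x k = \<zero>\<^bsub>G\<^esub>" using A by (simp add: c_def)
    show "a k = 0"
    proof (rule ccontr)
      assume "a k \<noteq> 0"
      then have "inverse (a k) \<odot>\<^bsub>G\<^esub> (a k \<odot>\<^bsub>G\<^esub> x k) = x k"
        using smult_assoc_class[OF Gvs xC] one_smult[OF Gvs xC] by simp
      then show False using z x(2)[of k] smult_zero[OF Gvs] by simp
    qed
  qed
  have "inj x"
  proof (rule injI, rule ccontr)
    fix k l assume kl: "x k = x l" "k \<noteq> l"
    define a where "a = (\<lambda>i. if i = k then 1 else - 1 :: 'k)"
    have "finsum G (\<lambda>i. a i \<odot>\<^bsub>G\<^esub> x i) {k, l} = x k \<oplus>\<^bsub>G\<^esub> (- 1) \<odot>\<^bsub>G\<^esub> x l"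
      using kl(2) xC smult_closed_class[OF Gvs] one_smult[OF Gvs xC] by (simp add: a_def)
    also have "\<dots> = \<zero>\<^bsub>G\<^esub>" unfolding kl(1) by (rule add_neg[OF Gvs xC])
    finally show False using ind[of "{k, l}" k a] by (simp add: a_def)
  qed
  have "G.lin_indpt (range x)"
  proof
    assume "G.lin_dep (range x)"
    then obtain A a v where A: "finite A" "A \<subseteq> range x" "G.lincomb a A = \<zero>\<^bsub>G\<^esub>" "v \<in> A" "a v \<noteq> 0"
      unfolding G.lin_dep_def by auto
    obtain B where B: "A = x ` B" using A(2) by (meson subset_imageE)
    have finB: "finite B" using A(1) B \<open>inj x\<close> by (simp add: finite_image_iff inj_on_subset)
    have "G.lincomb a A = finsum G (\<lambda>k. a (x k) \<odot>\<^bsub>G\<^esub> x k) B"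
      unfolding G.lincomb_def B using xC smult_closed_class[OF Gvs] \<open>inj x\<close>
      by (intro G.add.finprod_reindex) (auto intro: inj_on_subset)
    then have "a (x k) = 0" if "k \<in> B" for k using ind[OF finB that, of "\<lambda>k. a (x k)"] A(3) by simp
    then show False using A B by auto
  qed
  then have "finite (range x)" using fin xC by (intro G.fin_dim_li_fin) auto
  then show False using \<open>inj x\<close> by (simp add: finite_image_iff)
qed

section \<open>An effective prolongation realised by polynomial vector fields\<close>

locale tanaka_lie = tanaka V e n \<LL> \<K> m \<mu>
  for V :: "('k::field_char_0, 'v, 'w) module_scheme" and e n \<LL> \<K> m \<mu> +
  assumes LL: "lie_subalgebra \<LL> (gl V)"
begin

text \<open>Polynomial vector fields, given by their derivatives at the origin, whose Jacobian
  matrix and all its derivatives solve the linear system. The constant term is free: the constant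
  fields stand for V itself.\<close>

definition vf_space :: "'k tensor set" where
  "vf_space = {X. (\<forall>js j. X js j \<noteq> 0 \<longrightarrow> set js \<subseteq> {..<n} \<and> j < n) \<and> (\<exists>N. \<forall>js. N \<le> length js \<longrightarrow> X js = 0) \<and>
     swap_sym X \<and> (\<forall>js. slice_eqs R n (\<lambda>j l. X (l # js) j))}"

lemma vf_spaceD:
  assumes "X \<in> vf_space"
  shows "X js j \<noteq> 0 \<Longrightarrow> set js \<subseteq> {..<n} \<and> j < n" "swap_sym X" "slice_eqs R n (\<lambda>j l. X (l # js) j)"
    "\<exists>N. \<forall>js. N \<le> length js \<longrightarrow> X js = 0"
  using assms unfolding vf_space_def by blast+

lemma vf_space_zero: "0 \<in> vf_space"
  by (auto simp: vf_space_def swap_sym_def slice_eqs_zero)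

lemma vf_space_add:
  assumes X: "X \<in> vf_space" and Y: "Y \<in> vf_space"
  shows "X + Y \<in> vf_space"
  unfolding vf_space_def
proof (intro CollectI conjI allI impI)
  fix js j assume "(X + Y) js j \<noteq> 0"
  then have "X js j \<noteq> 0 \<or> Y js j \<noteq> 0" by auto
  then show "set js \<subseteq> {..<n}" "j < n" using vf_spaceD(1)[OF X] vf_spaceD(1)[OF Y] by blast+
next
  obtain N M where "\<And>js. N \<le> length js \<Longrightarrow> X js = 0" "\<And>js. M \<le> length js \<Longrightarrow> Y js = 0"
    using vf_spaceD(4)[OF X] vf_spaceD(4)[OF Y] by blast
  then show "\<exists>N. \<forall>js. N \<le> length js \<longrightarrow> (X + Y) js = 0" by (intro exI[of _ "max N M"]) simp
next
  show "swap_sym (X + Y)" using vf_spaceD(2)[OF X] vf_spaceD(2)[OF Y] unfolding swap_sym_def plus_fun_apply by metis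
  show "slice_eqs R n (\<lambda>j l. (X + Y) (l # js) j)" for js
    using slice_eqs_add[OF vf_spaceD(3)[OF X, of js] vf_spaceD(3)[OF Y, of js]] by simp
qed

text \<open>Rescales each homogeneous part by its own factor. This is the source both of homogeneous
  components and of the operator that defines the grading.\<close>

lemma vf_space_weighted:
  assumes X: "X \<in> vf_space"
  shows "(\<lambda>js j. w (length js) * X js j) \<in> vf_space"
  unfolding vf_space_def
proof (intro CollectI conjI allI impI)
  fix js j assume "w (length js) * X js j \<noteq> 0"
  then show "set js \<subseteq> {..<n}" "j < n" using vf_spaceD(1)[OF X, of js j] by auto
next
  obtain N where "\<And>js. N \<le> length js \<Longrightarrow> X js = 0" using vf_spaceD(4)[OF X] by blast
  then show "\<exists>N. \<forall>js. N \<le> length js \<longrightarrow> (\<lambda>j. w (length js) * X js j) = 0"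
    by (intro exI[of _ N]) (simp add: zero_fun_def)
next
  show "swap_sym (\<lambda>js j. w (length js) * X js j)"
    unfolding swap_sym_def
  proof (intro allI)
    fix us i j js
    have "X (us @ i # j # js) = X (us @ j # i # js)" using vf_spaceD(2)[OF X] unfolding swap_sym_def by blast
    then show "(\<lambda>k. w (length (us @ i # j # js)) * X (us @ i # j # js) k) = (\<lambda>k. w (length (us @ j # i # js)) * X (us @ j # i # js) k)"
      by (simp only: length_append length_Cons)
  qed
  show "slice_eqs R n (\<lambda>j l. w (length (l # js)) * X (l # js) j)" for js
    using slice_eqs_scale[OF vf_spaceD(3)[OF X, of js], of "w (Suc (length js))"] by simp
qed

lemma vf_space_scale: "X \<in> vf_space \<Longrightarrow> tscale c X \<in> vf_space"
  using vf_space_weighted[of X "\<lambda>_. c"] by (simp add: tscale_def)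

lemma vf_space_br:
  assumes X: "X \<in> vf_space" and Y: "Y \<in> vf_space"
  shows "vf_br n X Y \<in> vf_space"
  unfolding vf_space_def
proof (intro CollectI conjI allI impI)
  fix js j assume nz: "vf_br n X Y js j \<noteq> 0"
  have "set js \<subseteq> {..<n} \<and> j < n"
    using vf_br_support[OF _ _ nz] vf_spaceD(1)[OF X] vf_spaceD(1)[OF Y] by blast
  then show "set js \<subseteq> {..<n}" "j < n" by blast+
next
  obtain N M where "\<And>js. N \<le> length js \<Longrightarrow> X js = 0" "\<And>js. M \<le> length js \<Longrightarrow> Y js = 0"
    using vf_spaceD(4)[OF X] vf_spaceD(4)[OF Y] by blast
  then show "\<exists>N. \<forall>js. N \<le> length js \<longrightarrow> vf_br n X Y js = 0"
    using vf_br_bounded[of N X M Y] by blast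
next
  show "swap_sym (vf_br n X Y)" by (rule swap_sym_vf_br[OF vf_spaceD(2)[OF X] vf_spaceD(2)[OF Y]])
  show "slice_eqs R n (\<lambda>j l. vf_br n X Y (l # js) j)" for js
    by (rule vf_br_slice_eqs[OF slice_eqs_commutator[OF LL] vf_spaceD(2)[OF X] vf_spaceD(2)[OF Y] vf_spaceD(3)[OF X] vf_spaceD(3)[OF Y]])
qed

definition const_vf :: "(nat \<Rightarrow> 'k) \<Rightarrow> 'k tensor" where
  "const_vf c = (\<lambda>js. if js = [] then c else 0)"

lemma const_vf_space: "(\<And>j. c j \<noteq> 0 \<Longrightarrow> j < n) \<Longrightarrow> const_vf c \<in> vf_space"
  unfolding vf_space_def
proof (intro CollectI conjI allI impI)
  fix js j assume c: "\<And>j. c j \<noteq> 0 \<Longrightarrow> j < n" and "const_vf c js j \<noteq> 0"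
  then show "set js \<subseteq> {..<n}" "j < n" by (auto simp: const_vf_def split: if_splits)
next
  show "\<exists>N. \<forall>js. N \<le> length js \<longrightarrow> const_vf c js = 0" by (intro exI[of _ 1]) (auto simp: const_vf_def)
qed (auto simp: swap_sym_def const_vf_def slice_eqs_zero)

lemma const_vf_br: "vf_br n (const_vf c) (const_vf d) = 0"
proof
  fix js
  have "length js + 1 = 0 + 0" if "vf_br n (const_vf c) (const_vf d) js \<noteq> 0"
    using that by (rule vf_br_homogeneous[rotated 2]) (auto simp: const_vf_def split: if_splits)
  then show "vf_br n (const_vf c) (const_vf d) js = 0 js" by auto
qed

text \<open>Bracketing with a constant field is a directional derivative: one index is added at the
  end of the list and contracted with \<open>c\<close>.\<close>

lemma vf_br_const: "vf_br n X (const_vf c) js = (\<lambda>j. \<Sum>i<n. X (js @ [i]) j * c i)"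
proof (induction js arbitrary: X)
  case Nil show ?case by (simp add: vf_br_Nil const_vf_def)
next
  case (Cons i js)
  have "(\<lambda>js. const_vf c (i # js)) = 0" by (auto simp: const_vf_def)
  then have "vf_br n X (\<lambda>js. const_vf c (i # js)) = 0" by (simp only: vf_br_zero)
  then have "vf_br n X (const_vf c) (i # js) = vf_br n (\<lambda>js. X (i # js)) (const_vf c) js"
    unfolding vf_br_Cons by simp
  then show ?case using Cons.IH by simp
qed

lemma \<beta>_plus: "\<beta> (c + d) = \<beta> c \<oplus>\<^bsub>MM\<^esub> \<beta> d"
  using \<beta>_add[of c d] by (simp add: plus_fun_def)

lemma \<beta>_zero_fun: "\<beta> 0 = \<zero>\<^bsub>MM\<^esub>"
  using \<beta>_zero by (simp add: zero_fun_def)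

lemma \<beta>_tscale: "\<beta> (tscale a X js) = a \<odot>\<^bsub>MM\<^esub> \<beta> (X js)"
  using \<beta>_smult[of a "X js"] by (simp add: tscale_def)

text \<open>The quotient m and the polynomial fields glued along V: the constant term of the field
  repeats the V-component of \<open>u\<close>. A field without constant term brackets with m only
  through that component, so it acts by zero on degree at most -2. The summand with
  \<open>\<beta>\<close> returns to m the value at the origin of the bracket of fields.\<close>

definition HH :: "('k, ('k, 'v) fundamental \<times> 'k tensor) lie" where
  "HH = \<lparr>carrier = {(u, X). u \<in> carrier MM \<and> X \<in> vf_space \<and> X [] = lin_part u}, mult = undefined, one = undefined,
     zero = (\<zero>\<^bsub>MM\<^esub>, 0), add = (\<lambda>x y. (fst x \<oplus>\<^bsub>MM\<^esub> fst y, snd x + snd y)),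
     smult = (\<lambda>a x. (a \<odot>\<^bsub>MM\<^esub> fst x, tscale a (snd x))),
     bracket = (\<lambda>x y. (bracket MM (fst x) (fst y) \<oplus>\<^bsub>MM\<^esub> \<beta> (vf_br n (snd x) (snd y) []), vf_br n (snd x) (snd y)))\<rparr>"

lemma HH_carrier: "(u, X) \<in> carrier HH \<longleftrightarrow> u \<in> carrier MM \<and> X \<in> vf_space \<and> X [] = lin_part u"
  and HH_zero: "\<zero>\<^bsub>HH\<^esub> = (\<zero>\<^bsub>MM\<^esub>, 0)"
  and HH_add: "(u, X) \<oplus>\<^bsub>HH\<^esub> (v, Y) = (u \<oplus>\<^bsub>MM\<^esub> v, X + Y)"
  and HH_smult: "a \<odot>\<^bsub>HH\<^esub> (u, X) = (a \<odot>\<^bsub>MM\<^esub> u, tscale a X)"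
  and HH_bracket: "bracket HH (u, X) (v, Y) = (bracket MM u v \<oplus>\<^bsub>MM\<^esub> \<beta> (vf_br n X Y []), vf_br n X Y)"
  by (simp_all add: HH_def)

lemmas HH_ops = HH_zero HH_add HH_smult HH_bracket

lemma HH_add_closed: "(u, X) \<in> carrier HH \<Longrightarrow> (v, Y) \<in> carrier HH \<Longrightarrow> (u \<oplus>\<^bsub>MM\<^esub> v, X + Y) \<in> carrier HH"
  by (simp add: HH_carrier vf_space_add lin_part_add)

lemma HH_smult_closed: "(u, X) \<in> carrier HH \<Longrightarrow> (a \<odot>\<^bsub>MM\<^esub> u, tscale a X) \<in> carrier HH"
  using smult_closed_class[OF Mvs] by (simp add: HH_carrier vf_space_scale lin_part_smult) (simp add: tscale_def)

lemma HH_vectorspace: "vectorspace class_ring HH"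
proof (rule vs_criteria)
  show "field (class_ring :: 'k ring)" by (rule class_field.field_axioms)
  show "\<zero>\<^bsub>HH\<^esub> \<in> carrier HH" unfolding HH_zero HH_carrier lin_part_zero using vf_space_zero by (auto simp: fun_eq_iff)
  show "\<forall>v w. v \<in> carrier HH \<and> w \<in> carrier HH \<longrightarrow> v \<oplus>\<^bsub>HH\<^esub> w \<in> carrier HH"
    using HH_add_closed by (auto simp: HH_ops)
  show "\<forall>v\<in>carrier HH. \<exists>neg_v\<in>carrier HH. v \<oplus>\<^bsub>HH\<^esub> neg_v = \<zero>\<^bsub>HH\<^esub>"
  proof
    fix x assume x: "x \<in> carrier HH"
    obtain u X where uX: "x = (u, X)" by (cases x)
    have "X + tscale (- 1) X = 0" by (auto simp: tscale_def fun_eq_iff)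
    moreover have "u \<oplus>\<^bsub>MM\<^esub> (- 1) \<odot>\<^bsub>MM\<^esub> u = \<zero>\<^bsub>MM\<^esub>" using x uX add_neg[OF Mvs] by (simp add: HH_carrier)
    ultimately have "x \<oplus>\<^bsub>HH\<^esub> ((- 1) \<odot>\<^bsub>MM\<^esub> u, tscale (- 1) X) = \<zero>\<^bsub>HH\<^esub>" by (simp add: uX HH_ops)
    then show "\<exists>y\<in>carrier HH. x \<oplus>\<^bsub>HH\<^esub> y = \<zero>\<^bsub>HH\<^esub>" using HH_smult_closed x uX by blast
  qed
  show "\<forall>c v. c \<in> carrier (class_ring :: 'k ring) \<and> v \<in> carrier HH \<longrightarrow> c \<odot>\<^bsub>HH\<^esub> v \<in> carrier HH"
    using HH_smult_closed by (auto simp: HH_ops)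
  show "\<forall>v w. v \<in> carrier HH \<and> w \<in> carrier HH \<longrightarrow> v \<oplus>\<^bsub>HH\<^esub> w = w \<oplus>\<^bsub>HH\<^esub> v"
    by (auto simp: HH_ops HH_carrier M.a_comm add.commute)
  show "\<forall>v w x. v \<in> carrier HH \<and> w \<in> carrier HH \<and> x \<in> carrier HH
      \<longrightarrow> v \<oplus>\<^bsub>HH\<^esub> w \<oplus>\<^bsub>HH\<^esub> x = v \<oplus>\<^bsub>HH\<^esub> (w \<oplus>\<^bsub>HH\<^esub> x)"
    by (auto simp: HH_ops HH_carrier M.a_assoc add.assoc)
  show "\<forall>v\<in>carrier HH. v \<oplus>\<^bsub>HH\<^esub> \<zero>\<^bsub>HH\<^esub> = v" by (auto simp: HH_ops HH_carrier)
  show "\<forall>a b v. a \<in> carrier (class_ring :: 'k ring) \<and> b \<in> carrier (class_ring :: 'k ring) \<and> v \<in> carrier HH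
      \<longrightarrow> (a \<otimes>\<^bsub>class_ring\<^esub> b) \<odot>\<^bsub>HH\<^esub> v = a \<odot>\<^bsub>HH\<^esub> (b \<odot>\<^bsub>HH\<^esub> v)"
    using smult_assoc_class[OF Mvs] by (auto simp: HH_ops HH_carrier tscale_def mult.assoc)
  show "\<forall>v\<in>carrier HH. \<one>\<^bsub>class_ring\<^esub> \<odot>\<^bsub>HH\<^esub> v = v"
    using one_smult[OF Mvs] by (auto simp: HH_ops HH_carrier tscale_def)
  show "\<forall>a b v. a \<in> carrier (class_ring :: 'k ring) \<and> b \<in> carrier (class_ring :: 'k ring) \<and> v \<in> carrier HH
      \<longrightarrow> (a \<oplus>\<^bsub>class_ring\<^esub> b) \<odot>\<^bsub>HH\<^esub> v = a \<odot>\<^bsub>HH\<^esub> v \<oplus>\<^bsub>HH\<^esub> b \<odot>\<^bsub>HH\<^esub> v"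
    using smult_add_class[OF Mvs] by (auto simp: HH_ops HH_carrier tscale_def fun_eq_iff distrib_right)
  show "\<forall>a v w. a \<in> carrier (class_ring :: 'k ring) \<and> v \<in> carrier HH \<and> w \<in> carrier HH
      \<longrightarrow> a \<odot>\<^bsub>HH\<^esub> (v \<oplus>\<^bsub>HH\<^esub> w) = a \<odot>\<^bsub>HH\<^esub> v \<oplus>\<^bsub>HH\<^esub> a \<odot>\<^bsub>HH\<^esub> w"
    using smult_distrib_class[OF Mvs] by (auto simp: HH_ops HH_carrier tscale_def fun_eq_iff distrib_left)
qed

definition act1 :: "'k tensor \<Rightarrow> (nat \<Rightarrow> 'k) \<Rightarrow> nat \<Rightarrow> 'k" where
  "act1 X c = (\<lambda>j. \<Sum>l<n. X [l] j * c l)"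

lemma vf_br_Nil_act1: "vf_br n X Y [] = (\<lambda>j. act1 X (Y []) j + (- 1) * act1 Y (X []) j)"
  by (simp add: vf_br_Nil act1_def sum_subtractf)

lemma act1_W: "X \<in> vf_space \<Longrightarrow> j < n \<Longrightarrow> m \<le> j \<Longrightarrow> act1 X c j = 0"
  using vf_spaceD(3)[of X "[]"] unfolding slice_eqs_iff act1_def by (intro sum.neutral) auto

text \<open>The value at the origin of a bracket of fields lies in W, as slices have their image in
  W. Therefore \<open>u\<close> may be replaced by its V-component, and the bracket splits in
  two.\<close>

lemma bracket_\<beta>_vf_br:
  assumes u: "u \<in> carrier MM" and Y: "Y \<in> vf_space" and Z: "Z \<in> vf_space"
  shows "bracket MM u (\<beta> (vf_br n Y Z [])) =
    bracket MM (\<beta> (lin_part u)) (\<beta> (act1 Y (Z []))) \<oplus>\<^bsub>MM\<^esub> (- 1) \<odot>\<^bsub>MM\<^esub> bracket MM (\<beta> (lin_part u)) (\<beta> (act1 Z (Y [])))"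
proof -
  have 1: "bracket MM u (\<beta> (vf_br n Y Z [])) = bracket MM (\<beta> (lin_part u)) (\<beta> (vf_br n Y Z []))"
    using act1_W[OF Y] act1_W[OF Z] by (intro bracket_W[OF u]) (simp add: vf_br_Nil_act1)
  have d: "\<beta> (vf_br n Y Z []) = \<beta> (act1 Y (Z [])) \<oplus>\<^bsub>MM\<^esub> (- 1) \<odot>\<^bsub>MM\<^esub> \<beta> (act1 Z (Y []))"
    unfolding vf_br_Nil_act1 \<beta>_add \<beta>_smult ..
  show ?thesis
    unfolding 1 unfolding d using \<beta>_closed smult_closed_class[OF Mvs] by (simp add: M.bracket_add_right M.bracket_smult_right)
qed

lemma act1_swap: "X \<in> vf_space \<Longrightarrow> bracket MM (\<beta> c) (\<beta> (act1 X d)) = bracket MM (\<beta> d) (\<beta> (act1 X c))"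
  using bracket_swap_slices[OF vf_spaceD(3)[of X "[]"], of c d] by (simp add: act1_def)

text \<open>The field component is \<open>vf_jacobi\<close>. In the component in m three sums vanish
  separately: the Jacobi expression of m, the value at the origin of the Jacobi expression of the
  fields, and the mixed terms, which cancel in pairs.\<close>

lemma HH_jacobi:
  assumes "(u, X) \<in> carrier HH" "(v, Y) \<in> carrier HH" "(w, Z) \<in> carrier HH"
  shows "bracket HH (u, X) (bracket HH (v, Y) (w, Z)) \<oplus>\<^bsub>HH\<^esub> bracket HH (v, Y) (bracket HH (w, Z) (u, X))
    \<oplus>\<^bsub>HH\<^esub> bracket HH (w, Z) (bracket HH (u, X) (v, Y)) = \<zero>\<^bsub>HH\<^esub>"
proof -
  have u: "u \<in> carrier MM" "X \<in> vf_space" "X [] = lin_part u" and v: "v \<in> carrier MM" "Y \<in> vf_space" "Y [] = lin_part v"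
    and w: "w \<in> carrier MM" "Z \<in> vf_space" "Z [] = lin_part w" using assms by (simp_all add: HH_carrier)
  note C = M.bracket_closed \<beta>_closed smult_closed_class[OF Mvs] u(1) v(1) w(1)
  have J: "vf_br n X (vf_br n Y Z) + vf_br n Y (vf_br n Z X) + vf_br n Z (vf_br n X Y) = 0"
    by (rule vf_jacobi[OF vf_spaceD(2)[OF u(2)] vf_spaceD(2)[OF v(2)] vf_spaceD(2)[OF w(2)]])
  let ?x = "lin_part u" and ?y = "lin_part v" and ?z = "lin_part w"
  \<comment> \<open>The mixed terms are six brackets, equal in pairs by \<open>act1_swap\<close> and
    of opposite signs; \<open>p\<close>, \<open>q\<close> and \<open>r\<close> represent the
    pairs.\<close>
  define p q r where "p = bracket MM (\<beta> ?x) (\<beta> (act1 Y ?z))" and "q = bracket MM (\<beta> ?x) (\<beta> (act1 Z ?y))"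
    and "r = bracket MM (\<beta> ?y) (\<beta> (act1 X ?z))"
  have pqr: "p \<in> carrier MM" "q \<in> carrier MM" "r \<in> carrier MM" unfolding p_def q_def r_def by (intro C)+
  define s1 s2 s3 where "s1 = bracket MM u (\<beta> (vf_br n Y Z []))" and "s2 = bracket MM v (\<beta> (vf_br n Z X []))"
    and "s3 = bracket MM w (\<beta> (vf_br n X Y []))"
  have s: "s1 = p \<oplus>\<^bsub>MM\<^esub> (- 1) \<odot>\<^bsub>MM\<^esub> q" "s2 = q \<oplus>\<^bsub>MM\<^esub> (- 1) \<odot>\<^bsub>MM\<^esub> r" "s3 = r \<oplus>\<^bsub>MM\<^esub> (- 1) \<odot>\<^bsub>MM\<^esub> p"
    unfolding s1_def s2_def s3_def bracket_\<beta>_vf_br[OF u(1) v(2) w(2)] bracket_\<beta>_vf_br[OF v(1) w(2) u(2)]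
      bracket_\<beta>_vf_br[OF w(1) u(2) v(2)] u(3) v(3) w(3) p_def q_def r_def
    using act1_swap[OF w(2), of ?x ?y] act1_swap[OF u(2), of ?y ?z] act1_swap[OF v(2), of ?x ?z] by simp_all
  have sC: "s1 \<in> carrier MM" "s2 \<in> carrier MM" "s3 \<in> carrier MM" unfolding s1_def s2_def s3_def by (intro C)+
  have "s1 \<oplus>\<^bsub>MM\<^esub> s2 \<oplus>\<^bsub>MM\<^esub> s3 = (p \<oplus>\<^bsub>MM\<^esub> (- 1) \<odot>\<^bsub>MM\<^esub> p) \<oplus>\<^bsub>MM\<^esub> ((q \<oplus>\<^bsub>MM\<^esub> (- 1) \<odot>\<^bsub>MM\<^esub> q) \<oplus>\<^bsub>MM\<^esub> (r \<oplus>\<^bsub>MM\<^esub> (- 1) \<odot>\<^bsub>MM\<^esub> r))"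
    unfolding s using pqr C(3) by (simp only: M.a_ac M.a_closed)
  then have S: "s1 \<oplus>\<^bsub>MM\<^esub> s2 \<oplus>\<^bsub>MM\<^esub> s3 = \<zero>\<^bsub>MM\<^esub>" using pqr by (simp add: add_neg[OF Mvs])
  define t1 t2 t3 where "t1 = bracket MM u (bracket MM v w)" and "t2 = bracket MM v (bracket MM w u)"
    and "t3 = bracket MM w (bracket MM u v)"
  have tC: "t1 \<in> carrier MM" "t2 \<in> carrier MM" "t3 \<in> carrier MM" unfolding t1_def t2_def t3_def by (intro C)+
  have T: "t1 \<oplus>\<^bsub>MM\<^esub> t2 \<oplus>\<^bsub>MM\<^esub> t3 = \<zero>\<^bsub>MM\<^esub>" unfolding t1_def t2_def t3_def by (rule M.jacobi[OF u(1) v(1) w(1)])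
  define r1 r2 r3 where "r1 = \<beta> (vf_br n X (vf_br n Y Z) [])" and "r2 = \<beta> (vf_br n Y (vf_br n Z X) [])"
    and "r3 = \<beta> (vf_br n Z (vf_br n X Y) [])"
  have rC: "r1 \<in> carrier MM" "r2 \<in> carrier MM" "r3 \<in> carrier MM" unfolding r1_def r2_def r3_def by (intro C)+
  have "r1 \<oplus>\<^bsub>MM\<^esub> r2 \<oplus>\<^bsub>MM\<^esub> r3 = \<beta> ((vf_br n X (vf_br n Y Z) + vf_br n Y (vf_br n Z X) + vf_br n Z (vf_br n X Y)) [])"
    unfolding r1_def r2_def r3_def by (simp only: \<beta>_plus plus_fun_apply)
  then have RR: "r1 \<oplus>\<^bsub>MM\<^esub> r2 \<oplus>\<^bsub>MM\<^esub> r3 = \<zero>\<^bsub>MM\<^esub>" unfolding J by (simp only: zero_fun_apply \<beta>_zero_fun)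
  have "(t1 \<oplus>\<^bsub>MM\<^esub> s1 \<oplus>\<^bsub>MM\<^esub> r1) \<oplus>\<^bsub>MM\<^esub> (t2 \<oplus>\<^bsub>MM\<^esub> s2 \<oplus>\<^bsub>MM\<^esub> r2) \<oplus>\<^bsub>MM\<^esub> (t3 \<oplus>\<^bsub>MM\<^esub> s3 \<oplus>\<^bsub>MM\<^esub> r3)
      = (t1 \<oplus>\<^bsub>MM\<^esub> t2 \<oplus>\<^bsub>MM\<^esub> t3) \<oplus>\<^bsub>MM\<^esub> ((s1 \<oplus>\<^bsub>MM\<^esub> s2 \<oplus>\<^bsub>MM\<^esub> s3) \<oplus>\<^bsub>MM\<^esub> (r1 \<oplus>\<^bsub>MM\<^esub> r2 \<oplus>\<^bsub>MM\<^esub> r3))"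
    using tC sC rC by (simp only: M.a_ac M.a_closed)
  also have "\<dots> = \<zero>\<^bsub>MM\<^esub>" unfolding T S RR by simp
  finally have first: "(t1 \<oplus>\<^bsub>MM\<^esub> s1 \<oplus>\<^bsub>MM\<^esub> r1) \<oplus>\<^bsub>MM\<^esub> (t2 \<oplus>\<^bsub>MM\<^esub> s2 \<oplus>\<^bsub>MM\<^esub> r2) \<oplus>\<^bsub>MM\<^esub> (t3 \<oplus>\<^bsub>MM\<^esub> s3 \<oplus>\<^bsub>MM\<^esub> r3) = \<zero>\<^bsub>MM\<^esub>" .
  have e1: "bracket MM u (bracket MM v w \<oplus>\<^bsub>MM\<^esub> \<beta> (vf_br n Y Z [])) = t1 \<oplus>\<^bsub>MM\<^esub> s1"
    and e2: "bracket MM v (bracket MM w u \<oplus>\<^bsub>MM\<^esub> \<beta> (vf_br n Z X [])) = t2 \<oplus>\<^bsub>MM\<^esub> s2"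
    and e3: "bracket MM w (bracket MM u v \<oplus>\<^bsub>MM\<^esub> \<beta> (vf_br n X Y [])) = t3 \<oplus>\<^bsub>MM\<^esub> s3"
    unfolding t1_def t2_def t3_def s1_def s2_def s3_def by (intro M.bracket_add_right C)+
  show ?thesis
    unfolding HH_ops e1 e2 e3 r1_def[symmetric] r2_def[symmetric] r3_def[symmetric] first J ..
qed

lemma vf_br_self: "vf_br n X X = (0 :: 'k tensor)"
proof (intro ext)
  fix js j
  have "vf_br n X X js j = - vf_br n X X js j" using fun_cong[OF fun_cong[OF vf_br_antisym[of n X X], of js], of j] by simp
  then show "vf_br n X X js j = 0 js j" by simp
qed

lemma HH_bracket_closed:
  assumes "(u, X) \<in> carrier HH" "(v, Y) \<in> carrier HH"
  shows "bracket HH (u, X) (v, Y) \<in> carrier HH"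
proof -
  have C: "u \<in> carrier MM" "v \<in> carrier MM" "X \<in> vf_space" "Y \<in> vf_space" using assms by (simp_all add: HH_carrier)
  have br: "vf_br n X Y \<in> vf_space" by (rule vf_space_br[OF C(3,4)])
  have "lin_part (bracket MM u v \<oplus>\<^bsub>MM\<^esub> \<beta> (vf_br n X Y [])) j = vf_br n X Y [] j" for j
    using vf_spaceD(1)[OF br, of "[]" j] C
    by (simp add: lin_part_add M.bracket_closed \<beta>_closed lin_part_bracket lin_part_\<beta>) blast
  then have "vf_br n X Y [] = lin_part (bracket MM u v \<oplus>\<^bsub>MM\<^esub> \<beta> (vf_br n X Y []))" by (intro ext) simp
  then show ?thesis unfolding HH_bracket HH_carrier
    using br C by (intro conjI M.a_closed M.bracket_closed \<beta>_closed)
qed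

lemma HH_lie: "lie_algebra HH"
proof (rule lie_algebra.intro[OF HH_vectorspace])
  show "lie_algebra_axioms HH"
  proof
    fix x y assume x: "x \<in> carrier HH" and y: "y \<in> carrier HH"
    obtain u X v Y where uv: "x = (u, X)" "y = (v, Y)" by (metis surj_pair)
    have C: "u \<in> carrier MM" "v \<in> carrier MM" using x y uv by (simp_all add: HH_carrier)
    note C' = C M.bracket_closed[OF C] \<beta>_closed smult_closed_class[OF Mvs]
    show "bracket HH x y \<in> carrier HH" using HH_bracket_closed x y uv by blast
    show "bracket HH (c \<odot>\<^bsub>HH\<^esub> x) y = c \<odot>\<^bsub>HH\<^esub> bracket HH x y" for c
      using C' by (simp add: uv HH_ops vf_br_scale_left \<beta>_tscale M.bracket_smult_left smult_distrib_class[OF Mvs])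
    show "bracket HH x (c \<odot>\<^bsub>HH\<^esub> y) = c \<odot>\<^bsub>HH\<^esub> bracket HH x y" for c
      using C' by (simp add: uv HH_ops vf_br_scale_right \<beta>_tscale M.bracket_smult_right smult_distrib_class[OF Mvs])
    show "bracket HH x x = \<zero>\<^bsub>HH\<^esub>"
      using C by (simp add: uv HH_ops vf_br_self M.bracket_self \<beta>_zero_fun)
    fix z assume z: "z \<in> carrier HH"
    obtain w Z where w: "z = (w, Z)" by (metis surj_pair)
    have D: "w \<in> carrier MM" using z w by (simp add: HH_carrier)
    note D' = C' D M.bracket_closed[OF C(1) D] M.bracket_closed[OF C(2) D]
    show "bracket HH (x \<oplus>\<^bsub>HH\<^esub> y) z = bracket HH x z \<oplus>\<^bsub>HH\<^esub> bracket HH y z"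
      using D' by (simp add: uv w HH_ops vf_br_add_left \<beta>_plus M.bracket_add_left M.a_ac)
    show "bracket HH x (y \<oplus>\<^bsub>HH\<^esub> z) = bracket HH x y \<oplus>\<^bsub>HH\<^esub> bracket HH x z"
      using D' by (simp add: uv w HH_ops vf_br_add_right \<beta>_plus M.bracket_add_right M.a_ac)
    show "bracket HH x (bracket HH y z) \<oplus>\<^bsub>HH\<^esub> bracket HH y (bracket HH z x) \<oplus>\<^bsub>HH\<^esub> bracket HH z (bracket HH x y) = \<zero>\<^bsub>HH\<^esub>"
      using HH_jacobi x y z unfolding uv w by blast
  qed
qed

end

lemma image_submodule:
  assumes M: "vectorspace class_ring M" and N: "vectorspace class_ring N" and f: "vlin M N f"
    and S: "submodule class_ring S M"
  shows "submodule class_ring (f ` S) N"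
proof (rule submodule_class_ringI[OF N])
  interpret S: submodule class_ring S M by (rule S)
  have SC: "x \<in> carrier M" if "x \<in> S" for x using S.subset that by blast
  show "f ` S \<subseteq> carrier N" using SC vlinD(1)[OF f] by blast
  show "\<zero>\<^bsub>N\<^esub> \<in> f ` S" using vlin_zero[OF M N f] S.zero_closed by (metis image_eqI)
  fix x y assume "x \<in> f ` S" "y \<in> f ` S"
  then obtain a b where ab: "a \<in> S" "b \<in> S" "x = f a" "y = f b" by blast
  have "x \<oplus>\<^bsub>N\<^esub> y = f (a \<oplus>\<^bsub>M\<^esub> b)" using vlinD(2)[OF f] SC ab by simp
  then show "x \<oplus>\<^bsub>N\<^esub> y \<in> f ` S" using S.m_closed ab by blast
next
  interpret S: submodule class_ring S M by (rule S)
  fix c x assume "x \<in> f ` S"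
  then obtain a where a: "a \<in> S" "x = f a" by blast
  have "c \<odot>\<^bsub>N\<^esub> x = f (c \<odot>\<^bsub>M\<^esub> a)" using vlinD(3)[OF f] S.subset a by auto
  moreover have "c \<odot>\<^bsub>M\<^esub> a \<in> S" using S.smult_closed[of c a] a by simp
  ultimately show "c \<odot>\<^bsub>N\<^esub> x \<in> f ` S" by blast
qed

text \<open>These are the eigenvalues of the grading operator; characteristic zero keeps them
  distinct.\<close>

lemma inj_two_power_int: "inj (\<lambda>p::int. (2::'k::field_char_0) powi (- p))"
proof -
  have aux: "a = b" if "(2::'k) powi a = 2 powi b" "a \<le> b" for a b :: int
  proof -
    have "(2::'k) powi b = 2 powi a * 2 powi (b - a)" by (subst power_int_add[symmetric]) auto
    then have "(2::'k) powi (b - a) = 1" using that(1) by simp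
    then have "(2::'k) ^ nat (b - a) = 1" using that(2) by (simp add: power_int_def)
    then have "of_nat (2 ^ nat (b - a)) = (of_nat 1 :: 'k)" by simp
    then have "(2::nat) ^ nat (b - a) = 1" by (simp only: of_nat_eq_iff)
    then have "nat (b - a) = 0" by (simp add: power_eq_1_iff)
    then show ?thesis using that(2) by simp
  qed
  show ?thesis
  proof (rule injI)
    fix p q :: int assume e: "(2::'k) powi (- p) = 2 powi (- q)"
    show "p = q"
    proof (cases "p \<le> q")
      case True then show ?thesis using aux[of "- q" "- p"] e by simp
    next
      case False then show ?thesis using aux[of "- p" "- q"] e by simp
    qed
  qed
qed

section \<open>Grading, effectivity and the degree zero part of \<open>HH\<close>\<close>

context tanaka_lie
begin

sublocale H: lie_algebra HH by (rule HH_lie)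

lemmas Hvs = H.is_vs

definition \<iota>H :: "('k, 'v) fundamental \<Rightarrow> ('k, 'v) fundamental \<times> 'k tensor" where
  "\<iota>H u = (u, const_vf (lin_part u))"

lemma const_lin_part: "const_vf (lin_part u) \<in> vf_space"
  using const_vf_space lin_part_support by blast

lemma \<iota>H_closed: "u \<in> carrier MM \<Longrightarrow> \<iota>H u \<in> carrier HH"
  by (simp add: \<iota>H_def HH_carrier const_lin_part) (simp add: const_vf_def)

lemma const_vf_add: "const_vf (c + d) = const_vf c + const_vf d"
  and const_vf_scale: "const_vf (\<lambda>j. a * c j) = tscale a (const_vf c)"
  and const_vf_zero: "const_vf (\<lambda>j. 0) = 0"
  by (auto simp: const_vf_def tscale_def fun_eq_iff)

lemma \<iota>H_lin: "vlin MM HH \<iota>H"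
  unfolding vlin_iff using \<iota>H_closed
  by (simp add: \<iota>H_def HH_ops lin_part_add lin_part_smult const_vf_add const_vf_scale)

lemma \<iota>H_hom: "lie_hom MM HH \<iota>H"
  unfolding lie_hom_def
proof (intro conjI ballI)
  show "\<iota>H \<in> module_hom class_ring MM HH" using \<iota>H_lin by (simp add: vlin_def)
  fix u v assume uv: "u \<in> carrier MM" "v \<in> carrier MM"
  have "bracket HH (\<iota>H u) (\<iota>H v) = (bracket MM u v \<oplus>\<^bsub>MM\<^esub> \<zero>\<^bsub>MM\<^esub>, 0)"
    unfolding \<iota>H_def HH_bracket const_vf_br zero_fun_apply \<beta>_zero_fun ..
  then show "\<iota>H (bracket MM u v) = bracket HH (\<iota>H u) (\<iota>H v)"
    using uv M.bracket_closed by (simp add: \<iota>H_def lin_part_bracket const_vf_zero)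
qed

text \<open>A homogeneous field of degree \<open>p\<close> has \<open>p + 1\<close> lower indices.
  Degree -1, that is the constant fields, is covered by the image of m.\<close>

definition hgr :: "int \<Rightarrow> (('k, 'v) fundamental \<times> 'k tensor) set" where
  "hgr p = (if p < 0 then \<iota>H ` fund_gr V \<K> p
    else {(\<zero>\<^bsub>MM\<^esub>, X) | X. X \<in> vf_space \<and> X [] = 0 \<and> (\<forall>js. X js \<noteq> 0 \<longrightarrow> int (length js) = p + 1)})"

lemma hgr_neg: "k \<ge> 1 \<Longrightarrow> hgr (- int k) = (\<lambda>x. \<iota>H (qm x)) ` FLG k"
  by (simp add: hgr_def fund_gr_qm image_image)

lemma hgr_nonneg: "x \<in> hgr (int k) \<longleftrightarrow> (\<exists>X. x = (\<zero>\<^bsub>MM\<^esub>, X) \<and> X \<in> vf_space \<and> X [] = 0 \<and> (\<forall>js. X js \<noteq> 0 \<longrightarrow> length js = k + 1))"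
proof -
  have "int (length js) = int k + 1 \<longleftrightarrow> length js = k + 1" for js :: "nat list" by linarith
  then show ?thesis by (auto simp: hgr_def)
qed

lemma int_sign_cases:
  obtains k :: nat where "p = int k" | k :: nat where "k \<ge> 1" "p = - int k"
proof (cases "p \<ge> 0")
  case True
  then show thesis using that(1)[of "nat p"] by simp
next
  case False
  then show thesis using that(2)[of "nat (- p)"] by simp
qed

lemma \<iota>H_qm_lin: "vlin FL HH (\<lambda>x. \<iota>H (qm x))"
  by (rule vlin_comp[OF qm_lin \<iota>H_lin])

lemma hgr_submodule: "submodule class_ring (hgr p) HH"
proof (cases p rule: int_sign_cases)
  case (1 k)
  show ?thesis
  proof (rule submodule_class_ringI[OF Hvs])
    show "hgr p \<subseteq> carrier HH"
    proof
      fix x assume "x \<in> hgr p"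
      then obtain X where "x = (\<zero>\<^bsub>MM\<^esub>, X)" "X \<in> vf_space" "X [] = 0" unfolding 1 hgr_nonneg by blast
      then show "x \<in> carrier HH" by (simp add: HH_carrier lin_part_zero zero_fun_def)
    qed
    show "\<zero>\<^bsub>HH\<^esub> \<in> hgr p" unfolding 1 hgr_nonneg HH_zero using vf_space_zero by auto
    fix x y assume "x \<in> hgr p" "y \<in> hgr p"
    then obtain X Y where X: "x = (\<zero>\<^bsub>MM\<^esub>, X)" "X \<in> vf_space" "X [] = 0" "\<And>js. X js \<noteq> 0 \<Longrightarrow> length js = k + 1"
      and Y: "y = (\<zero>\<^bsub>MM\<^esub>, Y)" "Y \<in> vf_space" "Y [] = 0" "\<And>js. Y js \<noteq> 0 \<Longrightarrow> length js = k + 1"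
      unfolding 1 hgr_nonneg by blast
    have "length js = k + 1" if nz: "(X + Y) js \<noteq> 0" for js
    proof -
      have "X js \<noteq> 0 \<or> Y js \<noteq> 0" using nz by auto
      then show ?thesis using X(4) Y(4) by blast
    qed
    moreover have "(X + Y) [] = 0" using X(3) Y(3) by simp
    moreover have "x \<oplus>\<^bsub>HH\<^esub> y = (\<zero>\<^bsub>MM\<^esub>, X + Y)" using X(1) Y(1) by (simp add: HH_ops)
    ultimately show "x \<oplus>\<^bsub>HH\<^esub> y \<in> hgr p" unfolding 1 hgr_nonneg using vf_space_add[OF X(2) Y(2)] by blast
  next
    fix c x assume "x \<in> hgr p"
    then obtain X where X: "x = (\<zero>\<^bsub>MM\<^esub>, X)" "X \<in> vf_space" "X [] = 0" "\<And>js. X js \<noteq> 0 \<Longrightarrow> length js = k + 1"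
      unfolding 1 hgr_nonneg by blast
    have "length js = k + 1" if nz: "tscale c X js \<noteq> 0" for js
    proof -
      have "X js \<noteq> 0" using nz by (auto simp: tscale_def fun_eq_iff)
      then show ?thesis by (rule X(4))
    qed
    moreover have "tscale c X [] = 0" using X(3) by (simp add: tscale_def fun_eq_iff)
    moreover have "c \<odot>\<^bsub>HH\<^esub> x = (\<zero>\<^bsub>MM\<^esub>, tscale c X)" using X(1) smult_zero[OF Mvs] by (simp add: HH_ops)
    ultimately show "c \<odot>\<^bsub>HH\<^esub> x \<in> hgr p" unfolding 1 hgr_nonneg using vf_space_scale[OF X(2)] by blast
  qed
next
  case (2 k)
  then show ?thesis using image_submodule[OF F.is_vs Hvs \<iota>H_qm_lin FG_submodule[OF V]] hgr_neg by simp
qed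

lemma hgr_closed: "x \<in> hgr p \<Longrightarrow> x \<in> carrier HH"
  using submodule.subset[OF hgr_submodule] by blast

lemma lin_part_FLG: "x \<in> FLG k \<Longrightarrow> k \<ge> 2 \<Longrightarrow> lin_part (qm x) = (\<lambda>j. 0)"
  by (intro lin_part_from_2 FG_free_lie_from[OF V])

lemma FLG_closed: "x \<in> FLG k \<Longrightarrow> x \<in> carrier FL"
  by (rule FG_closed[OF V])

lemma \<beta>_FLG: "\<iota>H (\<beta> c) \<in> hgr (- 1)"
proof -
  have "gen (comb c) \<in> FLG 1" unfolding FG_1[OF V] using comb_closed by blast
  then show ?thesis using hgr_neg[of 1] unfolding \<beta>_def by auto
qed

lemma bracket_degree_zero:
  assumes X: "X \<in> vf_space" "\<And>js. X js \<noteq> 0 \<Longrightarrow> length js = 1" and u: "u \<in> carrier MM"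
  shows "bracket HH (\<zero>\<^bsub>MM\<^esub>, X) (\<iota>H u) = \<iota>H (\<beta> (\<lambda>j. \<Sum>l<n. X [l] j * lin_part u l))"
proof -
  let ?w = "\<lambda>j. \<Sum>l<n. X [l] j * lin_part u l"
  have v: "vf_br n X (const_vf (lin_part u)) = const_vf ?w"
  proof
    fix js
    show "vf_br n X (const_vf (lin_part u)) js = const_vf ?w js"
    proof (cases "js = []")
      case True then show ?thesis unfolding vf_br_const by (simp add: const_vf_def)
    next
      case False
      have "X (js @ [i]) = 0" for i using X(2)[of "js @ [i]"] False by auto
      then show ?thesis using False unfolding vf_br_const by (simp add: const_vf_def zero_fun_def)
    qed
  qed
  have w: "lin_part (\<beta> ?w) = ?w"
  proof
    fix j
    have "?w j = 0" if "\<not> j < n" using vf_spaceD(1)[OF X(1)] that by (intro sum.neutral) auto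
    then show "lin_part (\<beta> ?w) j = ?w j" by (simp add: lin_part_\<beta>)
  qed
  have c: "const_vf ?w [] = ?w" by (simp add: const_vf_def)
  show ?thesis
    unfolding \<iota>H_def HH_bracket v w c using u \<beta>_closed by (simp add: M.bracket_zero)
qed

text \<open>Only degree -1 interacts with the fields: for \<open>k = 1\<close> the bracket is a
  directional derivative, for larger \<open>k\<close> it is zero. A linear field yields a constant
  one, which has to be recognised in the image of m; hence the split on \<open>q\<close>.\<close>

lemma hgr_mixed:
  assumes k: "k \<ge> 1" and x: "x \<in> hgr (- int k)" and y: "y \<in> hgr (int q)"
  shows "bracket HH y x \<in> hgr (int q - int k)"
proof -
  obtain a where a: "a \<in> FLG k" "x = \<iota>H (qm a)" using x hgr_neg[OF k] by auto
  have uC: "qm a \<in> carrier MM" by (rule vlinD(1)[OF qm_lin FLG_closed[OF a(1)]])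
  obtain X where X: "y = (\<zero>\<^bsub>MM\<^esub>, X)" "X \<in> vf_space" "X [] = 0" "\<And>js. X js \<noteq> 0 \<Longrightarrow> length js = q + 1"
    using y unfolding hgr_nonneg by blast
  let ?c = "lin_part (qm a)"
  show ?thesis
  proof (cases "k = 1")
    case False
    then have "?c = (\<lambda>j. 0)" using lin_part_FLG[OF a(1)] k by simp
    then have z: "const_vf ?c = 0" using const_vf_zero by simp
    have "bracket HH y x = \<zero>\<^bsub>HH\<^esub>"
      unfolding X(1) a(2) \<iota>H_def HH_bracket z vf_br_zero zero_fun_apply \<beta>_zero_fun HH_zero
      using uC by (simp add: M.bracket_zero)
    then show ?thesis using submodule.zero_closed[OF hgr_submodule] by simp
  next
    case True
    show ?thesis
    proof (cases q)
      case 0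
      have "bracket HH y x = \<iota>H (\<beta> (\<lambda>j. \<Sum>l<n. X [l] j * ?c l))"
        unfolding X(1) a(2) using X(4) 0 by (intro bracket_degree_zero[OF X(2) _ uC]) simp
      then show ?thesis using \<beta>_FLG True 0 by simp
    next
      case (Suc q')
      let ?Z = "vf_br n X (const_vf ?c)"
      have len: "length js = q' + 1" if "?Z js \<noteq> 0" for js
      proof -
        obtain j where "(\<Sum>i<n. X (js @ [i]) j * ?c i) \<noteq> 0"
          using \<open>?Z js \<noteq> 0\<close> unfolding vf_br_const by (auto simp: fun_eq_iff)
        then obtain i where "X (js @ [i]) j * ?c i \<noteq> 0" by (meson sum.neutral)
        then have "X (js @ [i]) \<noteq> 0" by auto
        then show ?thesis using X(4) Suc by fastforce
      qed
      have Z0: "?Z [] = 0" using len[of "[]"] by auto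
      have "bracket HH y x = (\<zero>\<^bsub>MM\<^esub>, ?Z)"
        unfolding X(1) a(2) \<iota>H_def HH_bracket Z0 \<beta>_zero_fun using uC by (simp add: M.bracket_zero)
      moreover have "?Z \<in> vf_space" by (rule vf_space_br[OF X(2) const_lin_part])
      ultimately have "bracket HH y x \<in> hgr (int q')" unfolding hgr_nonneg using Z0 len by blast
      then show ?thesis using True Suc by simp
    qed
  qed
qed

lemma hgr_bracket:
  assumes x: "x \<in> hgr p" and y: "y \<in> hgr q"
  shows "bracket HH x y \<in> hgr (p + q)"
proof (cases p rule: int_sign_cases)
  case (1 k)
  note p = this
  show ?thesis
  proof (cases q rule: int_sign_cases)
    case (1 l)
    obtain X where X: "x = (\<zero>\<^bsub>MM\<^esub>, X)" "X \<in> vf_space" "X [] = 0" "\<And>js. X js \<noteq> 0 \<Longrightarrow> length js = k + 1"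
      using x unfolding p hgr_nonneg by blast
    obtain Y where Y: "y = (\<zero>\<^bsub>MM\<^esub>, Y)" "Y \<in> vf_space" "Y [] = 0" "\<And>js. Y js \<noteq> 0 \<Longrightarrow> length js = l + 1"
      using y unfolding 1 hgr_nonneg by blast
    have len: "length js = k + l + 1" if "vf_br n X Y js \<noteq> 0" for js
      using vf_br_homogeneous[of X "k + 1" Y "l + 1" n js] X(4) Y(4) that by simp
    have Z0: "vf_br n X Y [] = 0" using len[of "[]"] by auto
    have "bracket HH x y = (\<zero>\<^bsub>MM\<^esub>, vf_br n X Y)"
      unfolding X(1) Y(1) HH_bracket Z0 \<beta>_zero_fun by (simp add: M.bracket_zero)
    then have "bracket HH x y \<in> hgr (int (k + l))"
      unfolding hgr_nonneg using Z0 len vf_space_br[OF X(2) Y(2)] by blast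
    then show ?thesis using p 1 by simp
  next
    case (2 l)
    then show ?thesis using hgr_mixed[of l y x k] x y p by simp
  qed
next
  case (2 k)
  note p = this
  show ?thesis
  proof (cases q rule: int_sign_cases)
    case (1 l)
    have "bracket HH y x \<in> hgr (p + q)" using hgr_mixed[of k x y l] x y p 1 by (simp add: add.commute)
    moreover have "bracket HH x y = (- 1) \<odot>\<^bsub>HH\<^esub> bracket HH y x"
      by (rule H.bracket_anti[OF hgr_closed[OF x] hgr_closed[OF y]])
    ultimately show ?thesis using submodule.smult_closed[OF hgr_submodule, of "- 1"] by simp
  next
    case (2 l)
    obtain a b where ab: "a \<in> FLG k" "x = \<iota>H (qm a)" "b \<in> FLG l" "y = \<iota>H (qm b)"
      using x y hgr_neg[OF p(1)] hgr_neg[OF 2(1)] p 2 by auto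
    have "bracket HH x y = \<iota>H (qm (bracket FL a b))"
      unfolding ab using lie_hom_bracket[OF \<iota>H_hom] lie_hom_bracket[OF qm_hom] FLG_closed ab vlinD(1)[OF qm_lin] by simp
    then have "bracket HH x y \<in> hgr (- int (k + l))"
      using hgr_neg[of "k + l"] FG_bracket[OF V ab(1,3)] p by simp
    then show ?thesis using p 2 by simp
  qed
qed

text \<open>The ideal is spanned by its homogeneous elements, each an eigenvector, so it is stable
  and the doubling map descends to the quotient.\<close>

lemma K_doubling:
  assumes \<theta>: "vlin FL FL \<theta>" "\<And>p x. x \<in> FLG p \<Longrightarrow> \<theta> x = 2 ^ p \<odot>\<^bsub>FL\<^esub> x" and x: "x \<in> \<K>"
  shows "\<theta> x \<in> \<K>"
proof -
  have "\<K> = vspan FL (\<Union>p. \<K> \<inter> free_lie_gr V p)" using K_graded by (simp add: graded_lie_ideal_def)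
  then have "x \<in> vspan FL (\<Union>p. \<K> \<inter> free_lie_gr V p)" using x by simp
  moreover have "(\<Union>p. \<K> \<inter> free_lie_gr V p) \<subseteq> carrier FL" using K.subset by blast
  ultimately show ?thesis
  proof (rule vspan_induct[OF F.is_vs])
    show "\<theta> \<zero>\<^bsub>FL\<^esub> \<in> \<K>" using vlin_zero[OF F.is_vs F.is_vs \<theta>(1)] K.zero_closed by simp
  next
    fix a assume "a \<in> (\<Union>p. \<K> \<inter> free_lie_gr V p)"
    then obtain p where a: "a \<in> \<K>" "a \<in> free_lie_gr V p" by blast
    show "\<theta> a \<in> \<K>"
    proof (cases p rule: int_sign_cases)
      case (1 k)
      then have "a = \<zero>\<^bsub>FL\<^esub>" using a(2) free_lie_gr_nonneg[OF V, of p] by simp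
      then show ?thesis using vlin_zero[OF F.is_vs F.is_vs \<theta>(1)] K.zero_closed by simp
    next
      case (2 k)
      then have "\<theta> a = 2 ^ k \<odot>\<^bsub>FL\<^esub> a" using \<theta>(2) a(2) by simp
      then show ?thesis using K.smult_closed[of "2 ^ k" a] a(1) by simp
    qed
  next
    fix x y assume "x \<in> carrier FL" "y \<in> carrier FL" "\<theta> x \<in> \<K>" "\<theta> y \<in> \<K>"
    then show "\<theta> (x \<oplus>\<^bsub>FL\<^esub> y) \<in> \<K>" using vlinD(2)[OF \<theta>(1)] K.m_closed by simp
  next
    fix c x assume "x \<in> carrier FL" "\<theta> x \<in> \<K>"
    then show "\<theta> (c \<odot>\<^bsub>FL\<^esub> x) \<in> \<K>" using vlinD(3)[OF \<theta>(1)] K.smult_closed[of c] by simp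
  qed
qed

lemma MM_doubling:
  obtains t where "vlin MM MM t" "\<And>k x. x \<in> FLG k \<Longrightarrow> t (qm x) = 2 ^ k \<odot>\<^bsub>MM\<^esub> qm x"
proof -
  obtain \<theta> where \<theta>: "vlin FL FL \<theta>" "\<And>p x. x \<in> FLG p \<Longrightarrow> \<theta> x = 2 ^ p \<odot>\<^bsub>FL\<^esub> x"
    by (rule free_lie_doubling[OF V]) blast
  \<comment> \<open>Defined through chosen representatives; that the choice does not matter is
    \<open>K_doubling\<close>.\<close>
  define t where "t = (\<lambda>u. qm (\<theta> (SOME x. x \<in> carrier FL \<and> qm x = u)))"
  note sC = smult_closed_class[OF F.is_vs]
  have t: "t (qm x) = qm (\<theta> x)" if x: "x \<in> carrier FL" for x
  proof -
    define y where "y = (SOME y. y \<in> carrier FL \<and> qm y = qm x)"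
    have y: "y \<in> carrier FL" "qm y = qm x"
      using someI[of "\<lambda>y. y \<in> carrier FL \<and> qm y = qm x" x] x by (auto simp: y_def)
    have d: "y \<oplus>\<^bsub>FL\<^esub> (- 1) \<odot>\<^bsub>FL\<^esub> x \<in> carrier FL" using x y(1) sC by simp
    have "qm (y \<oplus>\<^bsub>FL\<^esub> (- 1) \<odot>\<^bsub>FL\<^esub> x) = qm x \<oplus>\<^bsub>MM\<^esub> (- 1) \<odot>\<^bsub>MM\<^esub> qm x"
      using vlinD(2)[OF qm_lin y(1) sC[OF x]] vlinD(3)[OF qm_lin x] y(2) by simp
    also have "\<dots> = \<zero>\<^bsub>MM\<^esub>" by (rule add_neg[OF Mvs vlinD(1)[OF qm_lin x]])
    finally have "\<theta> (y \<oplus>\<^bsub>FL\<^esub> (- 1) \<odot>\<^bsub>FL\<^esub> x) \<in> \<K>" using K_doubling[OF \<theta>] qm_zero_iff[OF d] by blast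
    then have z1: "qm (\<theta> (y \<oplus>\<^bsub>FL\<^esub> (- 1) \<odot>\<^bsub>FL\<^esub> x)) = \<zero>\<^bsub>MM\<^esub>" using qm_zero_iff K_closed by blast
    have z2: "qm (\<theta> (y \<oplus>\<^bsub>FL\<^esub> (- 1) \<odot>\<^bsub>FL\<^esub> x)) = qm (\<theta> y) \<oplus>\<^bsub>MM\<^esub> (- 1) \<odot>\<^bsub>MM\<^esub> qm (\<theta> x)"
      unfolding vlinD(2)[OF \<theta>(1) y(1) sC[OF x]] vlinD(3)[OF \<theta>(1) x]
        vlinD(2)[OF qm_lin vlinD(1)[OF \<theta>(1) y(1)] sC[OF vlinD(1)[OF \<theta>(1) x]]] vlinD(3)[OF qm_lin vlinD(1)[OF \<theta>(1) x]] ..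
    have "qm (\<theta> y) = qm (\<theta> x)"
      by (rule eq_if_diff_zero[OF Mvs vlinD(1)[OF qm_lin vlinD(1)[OF \<theta>(1) y(1)]]
            vlinD(1)[OF qm_lin vlinD(1)[OF \<theta>(1) x]] HOL.trans[OF z2[symmetric] z1]])
    then show ?thesis by (simp add: t_def y_def)
  qed
  have "vlin MM MM t"
    unfolding vlin_iff
  proof (intro conjI ballI allI)
    fix u v assume "u \<in> carrier MM" "v \<in> carrier MM"
    then obtain x y where xy: "x \<in> carrier FL" "u = qm x" "y \<in> carrier FL" "v = qm y" by (metis MM_cases)
    note C = vlinD(1)[OF \<theta>(1) xy(1)] vlinD(1)[OF \<theta>(1) xy(3)]
    show "t u \<in> carrier MM" unfolding xy t[OF xy(1)] by (rule vlinD(1)[OF qm_lin C(1)])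
    have "t (u \<oplus>\<^bsub>MM\<^esub> v) = t (qm (x \<oplus>\<^bsub>FL\<^esub> y))" using vlinD(2)[OF qm_lin xy(1,3)] xy by simp
    also have "\<dots> = qm (\<theta> x) \<oplus>\<^bsub>MM\<^esub> qm (\<theta> y)"
      using t xy vlinD(2)[OF \<theta>(1) xy(1,3)] vlinD(2)[OF qm_lin C] by simp
    finally show "t (u \<oplus>\<^bsub>MM\<^esub> v) = t u \<oplus>\<^bsub>MM\<^esub> t v" using t xy by simp
  next
    fix c u assume "u \<in> carrier MM"
    then obtain x where x: "x \<in> carrier FL" "u = qm x" by (metis MM_cases)
    have "t (c \<odot>\<^bsub>MM\<^esub> u) = t (qm (c \<odot>\<^bsub>FL\<^esub> x))" using vlinD(3)[OF qm_lin x(1)] x by simp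
    also have "\<dots> = c \<odot>\<^bsub>MM\<^esub> qm (\<theta> x)"
      using t sC[OF x(1)] vlinD(3)[OF \<theta>(1) x(1)] vlinD(3)[OF qm_lin vlinD(1)[OF \<theta>(1) x(1)]] by simp
    finally show "t (c \<odot>\<^bsub>MM\<^esub> u) = c \<odot>\<^bsub>MM\<^esub> t u" using t x by simp
  qed
  moreover have "t (qm x) = 2 ^ k \<odot>\<^bsub>MM\<^esub> qm x" if "x \<in> FLG k" for k x
    using t[OF FLG_closed[OF that]] \<theta>(2)[OF that] vlinD(3)[OF qm_lin FLG_closed[OF that]] by simp
  ultimately show thesis by (rule that)
qed

lemma from_1_induct:
  assumes "x \<in> carrier FL" "P \<zero>\<^bsub>FL\<^esub>" "\<And>k a. k \<ge> 1 \<Longrightarrow> a \<in> FLG k \<Longrightarrow> P a"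
    and "\<And>x y. x \<in> carrier FL \<Longrightarrow> y \<in> carrier FL \<Longrightarrow> P x \<Longrightarrow> P y \<Longrightarrow> P (x \<oplus>\<^bsub>FL\<^esub> y)"
    and "\<And>c x. x \<in> carrier FL \<Longrightarrow> P x \<Longrightarrow> P (c \<odot>\<^bsub>FL\<^esub> x)"
  shows "P x"
proof (rule vspan_induct[OF F.is_vs])
  show "x \<in> vspan FL (\<Union>p\<in>{1..}. FLG p)" using assms(1) free_lie_from_1[OF V] by (simp only: free_lie_from_def)
  show "(\<Union>p\<in>{1..}. FLG p) \<subseteq> carrier FL" by (rule FG_union_closed[OF V])
  fix a assume "a \<in> (\<Union>p\<in>{1..}. FLG p)"
  then show "P a" using assms(3) by auto
qed (use assms in blast)+

lemma hgr_span: "vspan HH (\<Union>p. hgr p) = carrier HH"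
proof
  have sub: "(\<Union>p. hgr p) \<subseteq> carrier HH" using hgr_closed by blast
  show "vspan HH (\<Union>p. hgr p) \<subseteq> carrier HH" using vspan_closed[OF Hvs sub] by blast
  interpret S: submodule class_ring "vspan HH (\<Union>p. hgr p)" HH by (rule vspan_submodule[OF Hvs sub])
  have base: "x \<in> vspan HH (\<Union>p. hgr p)" if "x \<in> hgr p" for x p using that vspan_base[OF Hvs sub] by blast
  have neg: "\<iota>H (qm x) \<in> vspan HH (\<Union>p. hgr p)" if "x \<in> carrier FL" for x
    using that
  proof (rule from_1_induct)
    show "\<iota>H (qm \<zero>\<^bsub>FL\<^esub>) \<in> vspan HH (\<Union>p. hgr p)"
      using vlin_zero[OF F.is_vs Hvs \<iota>H_qm_lin] S.zero_closed by simp
    show "\<iota>H (qm a) \<in> vspan HH (\<Union>p. hgr p)" if "k \<ge> 1" "a \<in> FLG k" for k a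
      using base[of "\<iota>H (qm a)" "- int k"] hgr_neg that by auto
    show "\<iota>H (qm (x \<oplus>\<^bsub>FL\<^esub> y)) \<in> vspan HH (\<Union>p. hgr p)"
      if "x \<in> carrier FL" "y \<in> carrier FL" "\<iota>H (qm x) \<in> vspan HH (\<Union>p. hgr p)" "\<iota>H (qm y) \<in> vspan HH (\<Union>p. hgr p)" for x y
      using vlinD(2)[OF \<iota>H_qm_lin that(1,2)] S.m_closed[OF that(3,4)] by simp
    show "\<iota>H (qm (c \<odot>\<^bsub>FL\<^esub> x)) \<in> vspan HH (\<Union>p. hgr p)"
      if "x \<in> carrier FL" "\<iota>H (qm x) \<in> vspan HH (\<Union>p. hgr p)" for c x
      using vlinD(3)[OF \<iota>H_qm_lin that(1)] S.smult_closed[of c, OF _ that(2)] by simp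
  qed
  \<comment> \<open>Peels off the part with exactly \<open>N\<close> indices, which is homogeneous;
    the remainder has fewer than \<open>N\<close> indices.\<close>
  have nonneg: "(\<zero>\<^bsub>MM\<^esub>, X) \<in> vspan HH (\<Union>p. hgr p)"
    if "X \<in> vf_space" "X [] = 0" "\<And>js. N \<le> length js \<Longrightarrow> X js = 0" for X N
    using that
  proof (induction N arbitrary: X)
    case 0
    then have X0: "X = 0" by (auto simp: fun_eq_iff)
    show ?case unfolding X0 HH_zero[symmetric] by (rule S.zero_closed)
  next
    case (Suc N)
    define Y where "Y = (\<lambda>js j. (if length js = N then 1 else 0) * X js j)"
    define Z where "Z = (\<lambda>js j. (if length js = N then 0 else 1) * X js j)"
    have Y: "Y \<in> vf_space" and Z: "Z \<in> vf_space"
      unfolding Y_def Z_def by (rule vf_space_weighted[OF Suc.prems(1)])+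
    have sum: "X = Y + Z" by (auto simp: Y_def Z_def fun_eq_iff)
    have z: "Z [] = 0" "Y [] = 0" using Suc.prems(2) by (auto simp: Z_def Y_def fun_eq_iff)
    have "Z js = 0" if "N \<le> length js" for js
      using Suc.prems(3)[of js] that by (cases "length js = N") (auto simp: Z_def fun_eq_iff)
    then have "(\<zero>\<^bsub>MM\<^esub>, Z) \<in> vspan HH (\<Union>p. hgr p)" by (intro Suc.IH Z z)
    moreover have "(\<zero>\<^bsub>MM\<^esub>, Y) \<in> vspan HH (\<Union>p. hgr p)"
    proof (cases N)
      case 0
      then have Y0: "Y = 0" using Suc.prems(2) by (auto simp: Y_def fun_eq_iff)
      show ?thesis unfolding Y0 HH_zero[symmetric] by (rule S.zero_closed)
    next
      case (Suc k)
      have "length js = k + 1" if "Y js \<noteq> 0" for js using that Suc by (auto simp: Y_def fun_eq_iff split: if_splits)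
      then have "(\<zero>\<^bsub>MM\<^esub>, Y) \<in> hgr (int k)" unfolding hgr_nonneg using Y z by blast
      then show ?thesis by (rule base)
    qed
    ultimately have "(\<zero>\<^bsub>MM\<^esub>, Y) \<oplus>\<^bsub>HH\<^esub> (\<zero>\<^bsub>MM\<^esub>, Z) \<in> vspan HH (\<Union>p. hgr p)" by (intro S.m_closed)
    moreover have "(\<zero>\<^bsub>MM\<^esub>, Y) \<oplus>\<^bsub>HH\<^esub> (\<zero>\<^bsub>MM\<^esub>, Z) = (\<zero>\<^bsub>MM\<^esub>, X)" unfolding HH_add sum by simp
    ultimately show ?case by (simp only:)
  qed
  show "carrier HH \<subseteq> vspan HH (\<Union>p. hgr p)"
  proof
    fix x assume x: "x \<in> carrier HH"
    obtain u X where uX: "x = (u, X)" by (cases x)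
    have u: "u \<in> carrier MM" "X \<in> vf_space" "X [] = lin_part u" using x uX by (simp_all add: HH_carrier)
    define Z where "Z = X + tscale (- 1) (const_vf (lin_part u))"
    have Z: "Z \<in> vf_space" unfolding Z_def by (intro vf_space_add u vf_space_scale const_lin_part)
    have "Z [] = 0" by (auto simp: Z_def u tscale_def const_vf_def fun_eq_iff)
    moreover obtain N where "\<And>js. N \<le> length js \<Longrightarrow> Z js = 0" using vf_spaceD(4)[OF Z] by blast
    ultimately have "(\<zero>\<^bsub>MM\<^esub>, Z) \<in> vspan HH (\<Union>p. hgr p)" using nonneg[OF Z] by blast
    moreover obtain a where "a \<in> carrier FL" "u = qm a" using MM_cases[OF u(1)] by blast
    then have "\<iota>H u \<in> vspan HH (\<Union>p. hgr p)" using neg by simp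
    ultimately have "\<iota>H u \<oplus>\<^bsub>HH\<^esub> (\<zero>\<^bsub>MM\<^esub>, Z) \<in> vspan HH (\<Union>p. hgr p)" by (intro S.m_closed)
    moreover have "const_vf (lin_part u) + Z = X" by (auto simp: Z_def tscale_def fun_eq_iff)
    then have "\<iota>H u \<oplus>\<^bsub>HH\<^esub> (\<zero>\<^bsub>MM\<^esub>, Z) = x" unfolding \<iota>H_def HH_add uX using u(1) by simp
    ultimately show "x \<in> vspan HH (\<Union>p. hgr p)" by simp
  qed
qed

text \<open>The decomposition is obtained from the operator \<open>\<Theta>\<close>, which has the
  eigenvalue 2^(-p) on degree \<open>p\<close>: doubling on m, and a weight depending on the number
  of indices on fields.\<close>

lemma HH_graded: "graded_lie_algebra HH hgr"
proof -
  obtain t where t: "vlin MM MM t" "\<And>k x. x \<in> FLG k \<Longrightarrow> t (qm x) = 2 ^ k \<odot>\<^bsub>MM\<^esub> qm x"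
    by (rule MM_doubling) blast
  have t_lin_part: "lin_part (t u) = (\<lambda>j. 2 * lin_part u j)" if u: "u \<in> carrier MM" for u
  proof -
    obtain x where x: "x \<in> carrier FL" "u = qm x" using MM_cases[OF u] by blast
    note C = vlinD(1)[OF qm_lin] vlinD(1)[OF t(1)]
    have "lin_part (t (qm x)) = (\<lambda>j. 2 * lin_part (qm x) j)" using x(1)
    proof (rule from_1_induct)
      show "lin_part (t (qm \<zero>\<^bsub>FL\<^esub>)) = (\<lambda>j. 2 * lin_part (qm \<zero>\<^bsub>FL\<^esub>) j)"
        using vlin_zero[OF F.is_vs Mvs qm_lin] vlin_zero[OF Mvs Mvs t(1)] lin_part_zero by simp
      show "lin_part (t (qm a)) = (\<lambda>j. 2 * lin_part (qm a) j)" if a: "k \<ge> 1" "a \<in> FLG k" for k a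
      proof -
        have e: "lin_part (t (qm a)) = (\<lambda>j. 2 ^ k * lin_part (qm a) j)"
          unfolding t(2)[OF a(2)] by (rule lin_part_smult[OF C(1)[OF FLG_closed[OF a(2)]]])
        show ?thesis
        proof (cases "k = 1")
          case True then show ?thesis using e by simp
        next
          case False then show ?thesis using e lin_part_FLG[OF a(2)] a(1) by simp
        qed
      qed
      show "lin_part (t (qm (x \<oplus>\<^bsub>FL\<^esub> y))) = (\<lambda>j. 2 * lin_part (qm (x \<oplus>\<^bsub>FL\<^esub> y)) j)"
        if xy: "x \<in> carrier FL" "y \<in> carrier FL" and IH: "lin_part (t (qm x)) = (\<lambda>j. 2 * lin_part (qm x) j)"
          "lin_part (t (qm y)) = (\<lambda>j. 2 * lin_part (qm y) j)" for x y
        unfolding vlinD(2)[OF qm_lin xy] vlinD(2)[OF t(1) C(1)[OF xy(1)] C(1)[OF xy(2)]]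
          lin_part_add[OF C(2)[OF C(1)[OF xy(1)]] C(2)[OF C(1)[OF xy(2)]]] lin_part_add[OF C(1)[OF xy(1)] C(1)[OF xy(2)]] IH
        by (simp add: fun_eq_iff distrib_left)
      show "lin_part (t (qm (c \<odot>\<^bsub>FL\<^esub> x))) = (\<lambda>j. 2 * lin_part (qm (c \<odot>\<^bsub>FL\<^esub> x)) j)"
        if x: "x \<in> carrier FL" and IH: "lin_part (t (qm x)) = (\<lambda>j. 2 * lin_part (qm x) j)" for c x
        unfolding vlinD(3)[OF qm_lin x] vlinD(3)[OF t(1) C(1)[OF x]] lin_part_smult[OF C(2)[OF C(1)[OF x]]]
          lin_part_smult[OF C(1)[OF x]] IH
        by (simp add: mult.left_commute)
    qed
    then show ?thesis using x(2) by simp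
  qed
  \<comment> \<open>A field with \<open>k\<close> indices has degree \<open>k - 1\<close> and gets
    the eigenvalue 2^(1-k). For \<open>k = 0\<close> this is 2, the eigenvalue of \<open>t\<close>
    on V, so the constant term keeps agreeing with the V-component.\<close>
  define w where "w = (\<lambda>k::nat. (2::'k) powi (1 - int k))"
  define \<Theta> where "\<Theta> = (\<lambda>(u, X). (t u, (\<lambda>js j. w (length js) * X js j) :: 'k tensor))"
  have w0: "w 0 = 2" by (simp add: w_def)
  have \<Theta>: "vlin HH HH \<Theta>"
    unfolding vlin_iff
  proof (intro conjI ballI allI)
    fix x assume x: "x \<in> carrier HH"
    obtain u X where uX: "x = (u, X)" by (cases x)
    have u: "u \<in> carrier MM" "X \<in> vf_space" "X [] = lin_part u" using x uX by (simp_all add: HH_carrier)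
    show "\<Theta> x \<in> carrier HH"
      unfolding uX \<Theta>_def prod.case HH_carrier
      using vlinD(1)[OF t(1) u(1)] vf_space_weighted[OF u(2), of w] t_lin_part[OF u(1)] u(3) w0 by simp
    fix c
    show "\<Theta> (c \<odot>\<^bsub>HH\<^esub> x) = c \<odot>\<^bsub>HH\<^esub> \<Theta> x"
      unfolding uX HH_ops \<Theta>_def prod.case using vlinD(3)[OF t(1) u(1)]
      by (simp add: tscale_def mult.left_commute)
  next
    fix x y assume xy: "x \<in> carrier HH" "y \<in> carrier HH"
    obtain u X v Y where uX: "x = (u, X)" "y = (v, Y)" by (metis surj_pair)
    have "u \<in> carrier MM" "v \<in> carrier MM" using xy uX by (simp_all add: HH_carrier)
    then show "\<Theta> (x \<oplus>\<^bsub>HH\<^esub> y) = \<Theta> x \<oplus>\<^bsub>HH\<^esub> \<Theta> y"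
      unfolding uX HH_ops \<Theta>_def prod.case using vlinD(2)[OF t(1)]
      by (simp add: fun_eq_iff distrib_left)
  qed
  have eig: "\<Theta> x = 2 powi (- p) \<odot>\<^bsub>HH\<^esub> x" if x: "x \<in> hgr p" for p x
  proof (cases p rule: int_sign_cases)
    case (1 k)
    obtain X where X: "x = (\<zero>\<^bsub>MM\<^esub>, X)" "\<And>js. X js \<noteq> 0 \<Longrightarrow> length js = k + 1"
      using x unfolding 1 hgr_nonneg by blast
    have "(\<lambda>js j. w (length js) * X js j) = tscale (2 powi (- int k)) X"
    proof (intro ext)
      fix js j
      show "w (length js) * X js j = tscale (2 powi (- int k)) X js j"
        by (cases "X js = 0") (use X(2)[of js] in \<open>auto simp: w_def tscale_def\<close>)
    qed
    then show ?thesis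
      unfolding X(1) \<Theta>_def prod.case HH_smult 1 using vlin_zero[OF Mvs Mvs t(1)] smult_zero[OF Mvs] by simp
  next
    case (2 k)
    obtain a where a: "a \<in> FLG k" "x = \<iota>H (qm a)" using x hgr_neg[OF 2(1)] 2(2) by auto
    have uC: "qm a \<in> carrier MM" by (rule vlinD(1)[OF qm_lin FLG_closed[OF a(1)]])
    have ta: "t (qm a) = 2 ^ k \<odot>\<^bsub>MM\<^esub> qm a" by (rule t(2)[OF a(1)])
    have "(\<lambda>j. 2 * lin_part (qm a) j) = (\<lambda>j. 2 ^ k * lin_part (qm a) j)"
      using t_lin_part[OF uC] lin_part_smult[OF uC, of "2 ^ k"] ta by simp
    then have l: "2 * lin_part (qm a) j = 2 ^ k * lin_part (qm a) j" for j by (rule fun_cong)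
    have "(\<lambda>js j. w (length js) * const_vf (lin_part (qm a)) js j) = tscale (2 ^ k) (const_vf (lin_part (qm a)))"
      using l w0 by (auto simp: const_vf_def tscale_def fun_eq_iff)
    then show ?thesis
      unfolding a(2) \<iota>H_def \<Theta>_def prod.case HH_smult ta 2(2) by (simp add: power_int_of_nat)
  qed
  have "\<exists>!c. (\<forall>p. c p \<in> hgr p) \<and> finite {p. c p \<noteq> \<zero>\<^bsub>HH\<^esub>} \<and> x = (\<Oplus>\<^bsub>HH\<^esub>p\<in>{p. c p \<noteq> \<zero>\<^bsub>HH\<^esub>}. c p)"
    if "x \<in> carrier HH" for x
    by (rule eigen_decomposition[OF Hvs \<Theta> hgr_submodule eig inj_two_power_int hgr_span that])
  then show ?thesis
    unfolding graded_lie_algebra_def VectorSpace.subspace_def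
    using HH_lie hgr_submodule hgr_bracket Hvs by blast
qed

text \<open>Bracketing with the constant fields of the basis strips the last index of every
  coefficient. So a field that commutes with all of them has only a constant term, and that is zero
  here.\<close>

lemma HH_effective: "{X \<in> vspan HH (\<Union>p\<in>{0..}. hgr p). \<forall>Y\<in>hgr (- 1). bracket HH X Y = \<zero>\<^bsub>HH\<^esub>} = {\<zero>\<^bsub>HH\<^esub>}"
proof (intro equalityI subsetI)
  define S where "S = {(\<zero>\<^bsub>MM\<^esub>, X) | X. X \<in> vf_space \<and> X [] = 0}"
  have S: "submodule class_ring S HH"
  proof (rule submodule_class_ringI[OF Hvs])
    show "S \<subseteq> carrier HH" by (auto simp: S_def HH_carrier lin_part_zero zero_fun_def)
    show "\<zero>\<^bsub>HH\<^esub> \<in> S" unfolding S_def HH_zero using vf_space_zero by auto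
    fix x y assume "x \<in> S" "y \<in> S"
    then obtain X Y where "x = (\<zero>\<^bsub>MM\<^esub>, X)" "X \<in> vf_space" "X [] = 0" "y = (\<zero>\<^bsub>MM\<^esub>, Y)" "Y \<in> vf_space" "Y [] = 0"
      unfolding S_def by blast
    moreover from this have "(X + Y) [] = 0" by simp
    ultimately show "x \<oplus>\<^bsub>HH\<^esub> y \<in> S" using vf_space_add unfolding S_def by (auto simp: HH_ops)
  next
    fix c x assume "x \<in> S"
    then obtain X where "x = (\<zero>\<^bsub>MM\<^esub>, X)" "X \<in> vf_space" "X [] = 0" unfolding S_def by blast
    moreover from this have "tscale c X [] = 0" by (simp add: tscale_def fun_eq_iff)
    ultimately show "c \<odot>\<^bsub>HH\<^esub> x \<in> S" using vf_space_scale smult_zero[OF Mvs] unfolding S_def by (auto simp: HH_ops)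
  qed
  fix x assume x: "x \<in> {X \<in> vspan HH (\<Union>p\<in>{0..}. hgr p). \<forall>Y\<in>hgr (- 1). bracket HH X Y = \<zero>\<^bsub>HH\<^esub>}"
  have "hgr p \<subseteq> S" if p: "p \<ge> 0" for p
  proof
    fix y assume "y \<in> hgr p"
    then have "y \<in> hgr (int (nat p))" using p by simp
    then show "y \<in> S" unfolding hgr_nonneg S_def by blast
  qed
  then have "(\<Union>p\<in>{0..}. hgr p) \<subseteq> S" by auto
  then have "x \<in> S" using vspan_minimal[OF Hvs _ S] x by blast
  then obtain X where X: "x = (\<zero>\<^bsub>MM\<^esub>, X)" "X \<in> vf_space" "X [] = 0" unfolding S_def by blast
  have last: "X (js @ [i]) = 0" if i: "i < n" for js i
  proof
    fix j
    let ?d = "\<lambda>l. if l = i then 1 else 0 :: 'k"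
    have "bracket HH x (\<iota>H (\<beta> ?d)) = \<zero>\<^bsub>HH\<^esub>" using x \<beta>_FLG by blast
    then have "vf_br n X (const_vf (lin_part (\<beta> ?d))) = 0" unfolding X(1) \<iota>H_def HH_bracket HH_zero by simp
    then have "(\<lambda>j. \<Sum>l<n. X (js @ [l]) j * lin_part (\<beta> ?d) l) = 0" unfolding vf_br_const[symmetric] by (simp only: zero_fun_apply)
    then have "(\<Sum>l<n. X (js @ [l]) j * lin_part (\<beta> ?d) l) = 0" by (simp add: fun_eq_iff)
    moreover have "(\<Sum>l<n. X (js @ [l]) j * lin_part (\<beta> ?d) l) = (\<Sum>l<n. if l = i then X (js @ [l]) j else 0)"
      by (intro sum.cong) (auto simp: lin_part_\<beta>)
    ultimately show "X (js @ [i]) j = 0 j" using i by simp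
  qed
  have "X js j = 0" for js j
  proof (cases js rule: rev_cases)
    case Nil then show ?thesis using X(3) by simp
  next
    case (snoc us i)
    then show ?thesis using last[of i us] vf_spaceD(1)[OF X(2), of js j] by (cases "i < n") auto
  qed
  then have "X = 0" by (auto simp: fun_eq_iff)
  then show "x \<in> {\<zero>\<^bsub>HH\<^esub>}" by (simp add: X HH_zero)
next
  fix x assume x: "x \<in> {\<zero>\<^bsub>HH\<^esub>}"
  have sub: "(\<Union>p\<in>{0..}. hgr p) \<subseteq> carrier HH" using hgr_closed by blast
  show "x \<in> {X \<in> vspan HH (\<Union>p\<in>{0..}. hgr p). \<forall>Y\<in>hgr (- 1). bracket HH X Y = \<zero>\<^bsub>HH\<^esub>}"
    using x vspan_zero[OF Hvs sub] H.bracket_zero hgr_closed by auto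
qed

theorem HH_prolongation: "effective_prolongation V \<LL> \<K> HH hgr \<iota>H"
  unfolding effective_prolongation_def
proof (intro conjI HH_graded \<iota>H_hom HH_effective allI impI ballI)
  show "inj_on \<iota>H (carrier MM)" by (auto simp: inj_on_def \<iota>H_def)
  show "\<iota>H ` fund_gr V \<K> p = hgr p" if "p < 0" for p using that by (simp add: hgr_def)
  fix A assume "A \<in> hgr 0"
  then have "A \<in> hgr (int 0)" by simp
  then obtain X where X: "A = (\<zero>\<^bsub>MM\<^esub>, X)" "X \<in> vf_space" "\<And>js. X js \<noteq> 0 \<Longrightarrow> length js = 0 + 1"
    unfolding hgr_nonneg by blast
  \<comment> \<open>The coefficients of a field of degree zero form a slice, so they are the matrix
    of an element of L.\<close>
  obtain T where T: "T \<in> \<LL>" "\<And>v. v \<in> carrier V \<Longrightarrow> T v = comb (\<lambda>j. \<Sum>l<n. X [l] j * co v l)"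
    by (rule LL_member[OF LL vf_spaceD(3)[OF X(2), of "[]"]]) blast
  show "\<exists>T\<in>\<LL>. \<forall>v\<in>carrier V. bracket HH A (\<iota>H (fund_gen V \<K> v)) = \<iota>H (fund_gen V \<K> (T v))"
  proof (intro bexI[OF _ T(1)] ballI)
    fix v assume v: "v \<in> carrier V"
    have C: "qm (gen v) \<in> carrier MM" by (rule vlinD(1)[OF qm_gen_lin v])
    have "bracket HH A (\<iota>H (qm (gen v))) = \<iota>H (\<beta> (\<lambda>j. \<Sum>l<n. X [l] j * lin_part (qm (gen v)) l))"
      unfolding X(1) using X(3) by (intro bracket_degree_zero[OF X(2) _ C]) simp
    also have "(\<lambda>j. \<Sum>l<n. X [l] j * lin_part (qm (gen v)) l) = (\<lambda>j. \<Sum>l<n. X [l] j * co v l)"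
      using lin_part_qm[OF gen_closed[OF v]] pr(2)[OF v] by simp
    also have "\<beta> (\<lambda>j. \<Sum>l<n. X [l] j * co v l) = qm (gen (T v))" unfolding T(2)[OF v] \<beta>_def ..
    finally show "bracket HH A (\<iota>H (fund_gen V \<K> v)) = \<iota>H (fund_gen V \<K> (T v))" by (simp add: fund_gen_qm)
  qed
qed

theorem rank_one_imp_infinite_dim:
  fixes G :: "('k, 'g) lie" and z \<eta> :: "nat \<Rightarrow> 'k alg_closure"
  assumes V_eq: "maximal_effective_prolongation V \<LL> \<K> G gr \<iota>"
    and z: "j0 < n" "z j0 \<noteq> 0" and \<eta>: "l0 < n" "\<eta> l0 \<noteq> 0"
    and sl: "slice_eqs ((\<lambda>r j l. to_ac (r j l)) ` R) n (\<lambda>j l. z j * \<eta> l)"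
  shows "\<not> vectorspace.fin_dim class_ring G"
proof
  assume fin: "vectorspace.fin_dim class_ring G"
  have "\<exists>X. (\<zero>\<^bsub>MM\<^esub>, X) \<in> hgr (int k) \<and> X \<noteq> 0" for k
  proof -
    \<comment> \<open>The value of the form over the closure at the upper index \<open>j0\<close>
      and the lower index \<open>l0\<close> repeated \<open>k + 1\<close> times. The functional must
      not kill it, so it is chosen anew for each \<open>k\<close>.\<close>
    define c where "c = z j0 * \<eta> l0 ^ (k + 1)"
    have "c \<noteq> 0" using z \<eta> by (simp add: c_def)
    then obtain \<phi> where \<phi>: "\<And>x y. \<phi> (x + y) = \<phi> x + \<phi> y" "\<And>a x. \<phi> (to_ac a * x) = a * (\<phi> x :: 'k)" "\<phi> c \<noteq> 0"
      by (rule closure_functional) blast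
    have \<phi>0: "\<phi> 0 = 0" using \<phi>(2)[of 0 0] by simp
    have \<phi>sum: "\<phi> (sum f A) = (\<Sum>i\<in>A. \<phi> (f i))" for f and A :: "nat set"
      by (induction A rule: infinite_finite_induct) (simp_all add: \<phi> \<phi>0)
    define X where "X = (\<lambda>js j. if length js = k + 1 \<and> set js \<subseteq> {..<n} \<and> j < n then \<phi> (z j * prod_list (map \<eta> js)) else 0)"
    have slice: "slice_eqs R n (\<lambda>j l. X (l # js) j)" for js
    proof (cases "length js = k \<and> set js \<subseteq> {..<n}")
      case True
      show ?thesis
        unfolding slice_eqs_def
      proof
        fix r assume r: "r \<in> R"
        have "(\<Sum>j<n. \<Sum>l<n. r j l * X (l # js) j) = (\<Sum>j<n. \<Sum>l<n. \<phi> (to_ac (r j l) * (z j * (\<eta> l * prod_list (map \<eta> js)))))"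
          using True by (intro sum.cong) (auto simp: X_def \<phi>(2))
        also have "\<dots> = \<phi> ((\<Sum>j<n. \<Sum>l<n. to_ac (r j l) * (z j * \<eta> l)) * prod_list (map \<eta> js))"
          by (simp add: \<phi>sum sum_distrib_right mult.assoc)
        also have "(\<Sum>j<n. \<Sum>l<n. to_ac (r j l) * (z j * \<eta> l)) = 0" using sl r unfolding slice_eqs_def by auto
        finally show "(\<Sum>j<n. \<Sum>l<n. r j l * X (l # js) j) = 0" using \<phi>0 by simp
      qed
    next
      case False
      then have "(\<lambda>j l. X (l # js) j) = (\<lambda>j l. 0)" by (auto simp: X_def fun_eq_iff)
      then show ?thesis using slice_eqs_zero by simp
    qed
    have "swap_sym X"
      unfolding swap_sym_def X_def by (auto simp: fun_eq_iff mult.left_commute insert_commute)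
    then have "X \<in> vf_space"
      unfolding vf_space_def using slice
      by (intro CollectI conjI allI exI[of _ "k + 2"]) (auto simp: X_def fun_eq_iff split: if_splits)
    moreover have "X [] = 0" by (simp add: X_def fun_eq_iff)
    moreover have "length js = k + 1" if "X js \<noteq> 0" for js using that by (auto simp: X_def fun_eq_iff split: if_splits)
    ultimately have "(\<zero>\<^bsub>MM\<^esub>, X) \<in> hgr (int k)" unfolding hgr_nonneg by blast
    moreover have "X (replicate (k + 1) l0) j0 = \<phi> c"
      using z \<eta> by (auto simp: X_def c_def prod_list_replicate)
    then have "X \<noteq> 0" using \<phi>(3) by auto
    ultimately show ?thesis by blast
  qed
  then obtain X where X: "\<And>k. (\<zero>\<^bsub>MM\<^esub>, X k) \<in> hgr (int k)" "\<And>k. X k \<noteq> 0" by metis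
  \<comment> \<open>Maximality quantifies over algebras carried by one fixed type, so
    \<open>HH\<close> is first moved to that type.\<close>
  obtain H' :: "('k, ('k, 'v) fundamental list \<Rightarrow> int \<Rightarrow> ('k, 'v) fundamental) lie" and gr' \<kappa> \<phi> where
    H': "effective_prolongation V \<LL> \<K> H' gr' \<kappa>" "lie_hom HH H' \<phi>" "bij_betw \<phi> (carrier HH) (carrier H')" "\<forall>p. \<phi> ` hgr p = gr' p"
    using effective_prolongation_realized[OF HH_prolongation] by blast
  obtain \<psi> where \<psi>: "lie_hom H' G \<psi>" "inj_on \<psi> (carrier H')" "\<forall>p. \<psi> ` gr' p \<subseteq> gr p"
    using V_eq H'(1) unfolding maximal_effective_prolongation_def by blast
  have G: "graded_lie_algebra G gr"
    using V_eq unfolding maximal_effective_prolongation_def effective_prolongation_def by blast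
  interpret G: lie_algebra G using G by (simp add: graded_lie_algebra_def)
  interpret H': lie_algebra H' by (rule effective_prolongationD(1)[OF H'(1)])
  define x where "x = (\<lambda>k. \<psi> (\<phi> (\<zero>\<^bsub>MM\<^esub>, X k)))"
  have x: "x k \<in> gr (int k)" for k unfolding x_def using \<psi>(3) H'(4) X(1)[of k] by blast
  have "x k \<noteq> \<zero>\<^bsub>G\<^esub>" for k
  proof
    assume z: "x k = \<zero>\<^bsub>G\<^esub>"
    have C: "(\<zero>\<^bsub>MM\<^esub>, X k) \<in> carrier HH" by (rule hgr_closed[OF X(1)])
    have C': "\<phi> (\<zero>\<^bsub>MM\<^esub>, X k) \<in> carrier H'" by (rule vlinD(1)[OF lie_hom_vlin[OF H'(2)] C])
    have "\<psi> \<zero>\<^bsub>H'\<^esub> = \<zero>\<^bsub>G\<^esub>" by (rule vlin_zero[OF H'.is_vs G.is_vs lie_hom_vlin[OF \<psi>(1)]])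
    then have "\<psi> (\<phi> (\<zero>\<^bsub>MM\<^esub>, X k)) = \<psi> \<zero>\<^bsub>H'\<^esub>" using z by (simp only: x_def)
    then have "\<phi> (\<zero>\<^bsub>MM\<^esub>, X k) = \<zero>\<^bsub>H'\<^esub>" by (rule inj_onD[OF \<psi>(2) _ C' H'.zero_closed])
    also have "\<dots> = \<phi> \<zero>\<^bsub>HH\<^esub>" by (rule vlin_zero[OF Hvs H'.is_vs lie_hom_vlin[OF H'(2)], symmetric])
    finally have "(\<zero>\<^bsub>MM\<^esub>, X k) = \<zero>\<^bsub>HH\<^esub>"
      by (rule inj_onD[OF bij_betw_imp_inj_on[OF H'(3)] _ C H.zero_closed])
    then have "X k = 0" unfolding HH_zero by (rule Pair_inject)
    then show False using X(2)[of k] by blast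
  qed
  then show False using graded_infinite[OF G fin x] by blast
qed

end

section \<open>The rank condition\<close>

lemma rank_full_iff_span:
  fixes A :: "'f::field mat"
  assumes A: "A \<in> carrier_mat n nc"
  shows "vec_space.rank n A = n \<longleftrightarrow> vspan (module_vec TYPE('f) n) (set (cols A)) = carrier_vec n"
proof -
  interpret vec_space "TYPE('f)" n .
  have cC: "set (cols A) \<subseteq> carrier_vec n" using cols_dim A by blast
  show ?thesis
  proof
    assume r: "rank A = n"
    obtain S where S: "maximal S (\<lambda>T. T \<subseteq> set (cols A) \<and> lin_indpt T)"
      using maximal_exists_superset[of "set (cols A)" "\<lambda>T. T \<subseteq> set (cols A) \<and> lin_indpt T" "{}"]
      by (auto simp: lin_dep_def)
    have Sp: "S \<subseteq> set (cols A)" "lin_indpt S" using S unfolding maximal_def by blast+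
    have "card S = n" using rank_card_indpt[OF A S] r by simp
    then have "basis S"
      using Sp cC by (intro dim_li_is_basis[OF fin_dim]) (auto simp: dim_is_n intro: finite_subset)
    then have "carrier_vec n = span S" by (simp add: basis_def)
    also have "\<dots> \<subseteq> span (set (cols A))" by (rule vspan_mono[OF vec_vs Sp(1)])
    finally show "span (set (cols A)) = carrier_vec n" using vspan_closed[OF vec_vs] cC by auto
  next
    assume "span (set (cols A)) = carrier_vec n"
    then have "rank A = dim" unfolding rank_def by (simp add: module_vec_def)
    then show "rank A = n" by (simp add: dim_is_n)
  qed
qed

text \<open>A proper subspace of the coordinate space is killed by some nonzero covector.\<close>

lemma span_full_iff_annihilator:
  fixes C :: "'f::field vec set"
  assumes C: "C \<subseteq> carrier_vec n"
  shows "vspan (module_vec TYPE('f) n) C = carrier_vec n \<longleftrightarrow>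
    (\<forall>\<eta>. (\<forall>c\<in>C. (\<Sum>l<n. \<eta> l * c $ l) = 0) \<longrightarrow> (\<forall>l<n. \<eta> l = 0))"
proof -
  let ?V = "module_vec TYPE('f) n"
  have vs: "vectorspace class_ring ?V" by (rule vec_vs)
  have C': "C \<subseteq> carrier ?V" using C by (simp add: module_vec_simps)
  note simps = module_vec_simps
  show ?thesis
  proof (intro iffI allI impI)
    fix \<eta> l assume sp: "vspan ?V C = carrier_vec n" and ann: "\<forall>c\<in>C. (\<Sum>l<n. \<eta> l * c $ l) = 0" and l: "l < n"
    have "(\<Sum>l<n. \<eta> l * v $ l) = 0" if v: "v \<in> vspan ?V C" for v
      using v C'
    proof (rule vspan_induct[OF vs])
      show "(\<Sum>l<n. \<eta> l * \<zero>\<^bsub>?V\<^esub> $ l) = 0" by (simp add: simps)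
      show "(\<Sum>l<n. \<eta> l * a $ l) = 0" if "a \<in> C" for a using ann that by blast
      show "(\<Sum>l<n. \<eta> l * (x \<oplus>\<^bsub>?V\<^esub> y) $ l) = 0" if "x \<in> carrier ?V" "y \<in> carrier ?V"
        "(\<Sum>l<n. \<eta> l * x $ l) = 0" "(\<Sum>l<n. \<eta> l * y $ l) = 0" for x y
      proof -
        have "(\<Sum>l<n. \<eta> l * (x \<oplus>\<^bsub>?V\<^esub> y) $ l) = (\<Sum>l<n. \<eta> l * x $ l + \<eta> l * y $ l)"
          using that(1,2) by (intro sum.cong) (auto simp: simps distrib_left)
        then show ?thesis using that by (simp add: sum.distrib)
      qed
      show "(\<Sum>l<n. \<eta> l * (c \<odot>\<^bsub>?V\<^esub> x) $ l) = 0" if "x \<in> carrier ?V" "(\<Sum>l<n. \<eta> l * x $ l) = 0" for c x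
      proof -
        have "(\<Sum>l<n. \<eta> l * (c \<odot>\<^bsub>?V\<^esub> x) $ l) = (\<Sum>l<n. c * (\<eta> l * x $ l))"
          using that(1) by (intro sum.cong) (auto simp: simps)
        then show ?thesis using that by (simp add: sum_distrib_left[symmetric])
      qed
    qed
    then have "(\<Sum>i<n. \<eta> i * unit_vec n l $ i) = 0" using sp by simp
    moreover have "(\<Sum>i<n. \<eta> i * unit_vec n l $ i) = (\<Sum>i<n. if i = l then \<eta> l else 0)"
      using l by (intro sum.cong) auto
    ultimately show "\<eta> l = 0" using l by simp
  next
    assume ann: "\<forall>\<eta>. (\<forall>c\<in>C. (\<Sum>l<n. \<eta> l * c $ l) = 0) \<longrightarrow> (\<forall>l<n. \<eta> l = 0)"
    have sub: "vspan ?V C \<subseteq> carrier_vec n" using vspan_closed[OF vs C'] by (auto simp: simps)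
    interpret s: submodule class_ring "vspan ?V C" ?V by (rule vspan_submodule[OF vs C'])
    interpret k: vector_space "(*) :: 'f \<Rightarrow> 'f \<Rightarrow> 'f" by unfold_locales (auto simp: algebra_simps)
    interpret w: vector_space "\<lambda>c (f :: nat \<Rightarrow> 'f) i. c * f i" by (rule k.vector_space_fun)
    define fc where "fc = (\<lambda>v::'f vec. \<lambda>i. if i < n then v $ i else 0)"
    have ss: "w.subspace (fc ` vspan ?V C)"
    proof (rule w.subspaceI)
      have "fc (0\<^sub>v n) = 0" by (auto simp: fc_def)
      then show "0 \<in> fc ` vspan ?V C" using s.zero_closed by (metis image_eqI simps(2))
    next
      fix x y assume "x \<in> fc ` vspan ?V C" "y \<in> fc ` vspan ?V C"
      then obtain u v where uv: "u \<in> vspan ?V C" "v \<in> vspan ?V C" "x = fc u" "y = fc v" by blast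
      then have "u \<in> carrier_vec n" "v \<in> carrier_vec n" using sub by blast+
      then have "x + y = fc (u + v)" using uv by (auto simp: fc_def fun_eq_iff)
      moreover have "u + v \<in> vspan ?V C" using vspan_add[OF vs C' uv(1,2)] by (simp add: simps)
      ultimately show "x + y \<in> fc ` vspan ?V C" by blast
    next
      fix c x assume "x \<in> fc ` vspan ?V C"
      then obtain u where u: "u \<in> vspan ?V C" "x = fc u" by blast
      then have "u \<in> carrier_vec n" using sub by blast
      then have "(\<lambda>i. c * x i) = fc (c \<cdot>\<^sub>v u)" using u by (auto simp: fc_def fun_eq_iff)
      moreover have "c \<cdot>\<^sub>v u \<in> vspan ?V C" using vspan_smult[OF vs C' u(1), of c] by (simp add: simps)
      ultimately show "(\<lambda>i. c * x i) \<in> fc ` vspan ?V C" by blast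
    qed
    have "v \<in> vspan ?V C" if v: "v \<in> carrier_vec n" for v
    proof (rule ccontr)
      assume n: "v \<notin> vspan ?V C"
      have nfc: "fc v \<notin> fc ` vspan ?V C"
      proof
        assume "fc v \<in> fc ` vspan ?V C"
        then obtain u where u: "u \<in> vspan ?V C" "fc v = fc u" by blast
        have "v = u"
        proof (rule eq_vecI)
          show "dim_vec v = dim_vec u" using u sub v by auto
          fix i assume "i < dim_vec u"
          then have "i < n" using u sub by auto
          then show "v $ i = u $ i" using fun_cong[OF u(2), of i] by (simp add: fc_def)
        qed
        then show False using n u by simp
      qed
      have supp: "\<forall>f\<in>insert (fc v) (fc ` vspan ?V C). \<forall>i. i \<notin> {..<n} \<longrightarrow> f i = 0" by (auto simp: fc_def)
      obtain r where r: "\<And>f. f \<in> fc ` vspan ?V C \<Longrightarrow> (\<Sum>i<n. r i * f i) = 0" "(\<Sum>i<n. r i * fc v i) \<noteq> 0"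
        using separating_functional_ex[OF finite_lessThan ss supp nfc] by blast
      have "(\<Sum>l<n. r l * c $ l) = 0" if "c \<in> C" for c
        using r(1)[of "fc c"] vspan_base[OF vs C' that] by (simp add: fc_def)
      then have "\<forall>l<n. r l = 0" using ann by blast
      then show False using r(2) by simp
    qed
    then show "vspan ?V C = carrier_vec n" using sub by blast
  qed
qed

text \<open>Passes a linear condition from generators to the whole space, which frees the rank
  condition from the choice of \<open>As\<close>, \<open>Xs\<close> and \<open>Ys\<close>. The
  values of \<open>f\<close> will lie in the algebraic closure, so scalars pass through a map
  \<open>h\<close>, which is \<open>to_ac\<close> in the applications.\<close>

lemma generates_mats_linear_zero:
  assumes gen: "generates_mats n As S" and zero: "f (0\<^sub>m n n) = (0 :: 'f::field)"
    and add: "\<And>A B. A \<in> carrier_mat n n \<Longrightarrow> B \<in> carrier_mat n n \<Longrightarrow> f (A + B) = f A + f B"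
    and smult: "\<And>c A. A \<in> carrier_mat n n \<Longrightarrow> f (c \<cdot>\<^sub>m A) = h c * f A"
  shows "(\<forall>A\<in>S. f A = 0) \<longleftrightarrow> (\<forall>A\<in>set As. f A = 0)"
proof -
  let ?M = "module_mat TYPE('a) n n"
  have vs: "vectorspace class_ring ?M" by (rule matrix_vs)
  have C: "set As \<subseteq> carrier ?M" and S: "vspan ?M (set As) = S" using gen by (auto simp: generates_mats_def module_mat_simps)
  have "f A = 0" if A: "A \<in> vspan ?M (set As)" and z: "\<forall>A\<in>set As. f A = 0" for A
    using A C
    by (rule vspan_induct[OF vs]) (use z zero add smult in \<open>auto simp: module_mat_simps\<close>)
  moreover have "A \<in> S" if "A \<in> set As" for A using vspan_base[OF vs C that] S by simp
  ultimately show ?thesis using S by blast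
qed

definition mulv :: "nat \<Rightarrow> 'k::field mat \<Rightarrow> (nat \<Rightarrow> 'k alg_closure) \<Rightarrow> nat \<Rightarrow> 'k alg_closure" where
  "mulv n A y = (\<lambda>l. \<Sum>j<n. to_ac (A $$ (l, j)) * y j)"

lemma mat_ac_mult_vec: "A \<in> carrier_mat n n \<Longrightarrow> z \<in> carrier_vec n \<Longrightarrow> l < n \<Longrightarrow> (mat_ac A *\<^sub>v z) $ l = mulv n A (($) z) l"
  by (auto simp: mulv_def scalar_prod_def lessThan_atLeast0 intro!: sum.cong)

lemma mulv_cong: "(\<And>j. j < n \<Longrightarrow> y j = y' j) \<Longrightarrow> mulv n A y = mulv n A y'"
  by (simp add: mulv_def)

text \<open>The pairing of eta with X y is the trace of X y eta^T, and the matrices orthogonal to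
  all antisymmetric ones are the symmetric ones.\<close>

lemma antisym_annihilator_iff:
  fixes y \<eta> :: "nat \<Rightarrow> 'k::field_char_0 alg_closure"
  shows "(\<forall>X\<in>antisym_mats n :: 'k mat set. (\<Sum>l<n. \<eta> l * mulv n X y l) = 0) \<longleftrightarrow> (\<forall>p<n. \<forall>q<n. y p * \<eta> q = y q * \<eta> p)"
proof (intro iffI ballI allI impI)
  fix X :: "'k mat" assume sym: "\<forall>p<n. \<forall>q<n. y p * \<eta> q = y q * \<eta> p" and X: "X \<in> antisym_mats n"
  have "(\<Sum>l<n. \<eta> l * mulv n X y l) = (\<Sum>l<n. \<Sum>j<n. to_ac (X $$ (l, j)) * (y j * \<eta> l))"
    by (simp add: mulv_def sum_distrib_left ac_simps)
  also have "\<dots> = (\<Sum>l<n. \<Sum>j<n. - (to_ac (X $$ (j, l)) * (y l * \<eta> j)))"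
  proof (intro sum.cong HOL.refl)
    fix l j assume lj: "l \<in> {..<n}" "j \<in> {..<n}"
    have "X $$ (l, j) = - X $$ (j, l)" using antisym_index[OF X, of j l] lj by simp
    moreover have "y j * \<eta> l = y l * \<eta> j" using sym lj by blast
    ultimately show "to_ac (X $$ (l, j)) * (y j * \<eta> l) = - (to_ac (X $$ (j, l)) * (y l * \<eta> j))"
      by (simp only: to_ac_minus mult_minus_left)
  qed
  also have "\<dots> = - (\<Sum>l<n. \<Sum>j<n. to_ac (X $$ (j, l)) * (y l * \<eta> j))" by (simp only: sum_negf)
  also have "(\<Sum>l<n. \<Sum>j<n. to_ac (X $$ (j, l)) * (y l * \<eta> j)) = (\<Sum>j<n. \<Sum>l<n. to_ac (X $$ (j, l)) * (y l * \<eta> j))"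
    by (rule sum.swap)
  also have "\<dots> = (\<Sum>l<n. \<eta> l * mulv n X y l)" by (simp add: mulv_def sum_distrib_left ac_simps)
  finally have "to_ac 2 * (\<Sum>l<n. \<eta> l * mulv n X y l) = 0" by simp
  then show "(\<Sum>l<n. \<eta> l * mulv n X y l) = 0" by simp
next
  fix p q assume ann: "\<forall>X\<in>antisym_mats n :: 'k mat set. (\<Sum>l<n. \<eta> l * mulv n X y l) = 0" and p: "p < n" and q: "q < n"
  \<comment> \<open>The elementary antisymmetric matrix whose pairing with \<open>y\<close> and
    \<open>\<eta>\<close> is the difference of the two sides.\<close>
  define X :: "'k mat" where "X = mat n n (\<lambda>(i, j). (if i = q \<and> j = p then 1 else 0) - (if i = p \<and> j = q then 1 else 0))"
  have "X \<in> antisym_mats n"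
    unfolding antisym_mats_def
  proof (intro CollectI conjI)
    show "X \<in> carrier_mat n n" by (simp add: X_def)
    show "transpose_mat X = - X"
    proof (rule eq_matI)
      fix i j assume "i < dim_row (- X)" "j < dim_col (- X)"
      then have ij: "i < n" "j < n" by (simp_all add: X_def)
      then have "transpose_mat X $$ (i, j) = (if j = q \<and> i = p then 1 else 0) - (if j = p \<and> i = q then 1 else 0)"
        by (simp add: X_def)
      also have "\<dots> = - ((if i = q \<and> j = p then 1 else 0) - (if i = p \<and> j = q then 1 else 0))"
        by (simp only: conj_commute minus_diff_eq)
      also have "\<dots> = (- X) $$ (i, j)" using ij by (simp add: X_def)
      finally show "transpose_mat X $$ (i, j) = (- X) $$ (i, j)" .
    qed (simp_all add: X_def)
  qed
  then have "(\<Sum>l<n. \<eta> l * mulv n X y l) = 0" using ann by blast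
  moreover have "mulv n X y l = (if l = q then y p else 0) - (if l = p then y q else 0)" if l: "l < n" for l
  proof -
    have "mulv n X y l = (\<Sum>j<n. (if j = p then (if l = q then y j else 0) else 0) - (if j = q then (if l = p then y j else 0) else 0))"
      unfolding mulv_def using l by (intro sum.cong) (auto simp: X_def)
    then show ?thesis using p q by (simp add: sum_subtractf)
  qed
  then have "(\<Sum>l<n. \<eta> l * mulv n X y l) = (\<Sum>l<n. (if l = q then \<eta> l * y p else 0) - (if l = p then \<eta> l * y q else 0))"
    by (intro sum.cong) (auto simp: right_diff_distrib)
  ultimately show "y p * \<eta> q = y q * \<eta> p" using p q by (simp add: sum_subtractf mult.commute)
qed

lemma mulv_linear:
  shows "mulv n (0\<^sub>m n n) y l = 0 \<or> \<not> l < n"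
    and "A \<in> carrier_mat n n \<Longrightarrow> B \<in> carrier_mat n n \<Longrightarrow> l < n \<Longrightarrow> mulv n (A + B) y l = mulv n A y l + mulv n B y l"
    and "A \<in> carrier_mat n n \<Longrightarrow> l < n \<Longrightarrow> mulv n (c \<cdot>\<^sub>m A) y l = to_ac c * mulv n A y l"
  by (auto simp: mulv_def distrib_right sum.distrib sum_distrib_left mult.assoc)

lemma mulv_add_right: "mulv n A (\<lambda>j. y j + y' j) l = mulv n A y l + mulv n A y' l"
  and mulv_scale_right: "mulv n A (\<lambda>j. c * y j) l = c * mulv n A y l"
  and mulv_zero_right: "mulv n A (\<lambda>j. 0) l = 0"
  by (simp_all add: mulv_def distrib_left sum.distrib sum_distrib_left mult.left_commute)

text \<open>With z eta^T in place of A: the columns of M_1 give the equations of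
  \<open>L_perp\<close>; those of M_2 say that (Y z) eta^T, the product of Y with z eta^T, is
  symmetric; and the third family holds because z lies in W.\<close>

lemma columns_annihilated_iff:
  fixes z :: "'k::field_char_0 alg_closure vec"
  assumes As: "generates_mats n As (L_perp V e n \<LL>)" and Xs: "generates_mats n Xs (antisym_mats n)"
    and Ys: "generates_mats n Ys (K2_perp V e n \<K>)" and z: "z \<in> carrier_vec n" "\<And>i. i < n \<Longrightarrow> m \<le> i \<Longrightarrow> z $ i = 0"
  shows "(\<forall>c\<in>set (M1_cols As z @ M2_cols Xs Ys z). (\<Sum>l<n. \<eta> l * c $ l) = 0) \<longleftrightarrow>
    slice_eqs ((\<lambda>r j l. to_ac (r j l)) ` der_eqs V e n \<LL> \<K> m) n (\<lambda>j l. z $ j * \<eta> l)"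
proof -
  have AC: "A \<in> carrier_mat n n" if "A \<in> set As" for A using As that by (auto simp: generates_mats_def)
  have XC: "A \<in> carrier_mat n n" if "A \<in> set Xs" for A using Xs that by (auto simp: generates_mats_def)
  have YC: "A \<in> carrier_mat n n" if "A \<in> set Ys" for A using Ys that by (auto simp: generates_mats_def)
  have 1: "(\<forall>c\<in>set (M1_cols As z). (\<Sum>l<n. \<eta> l * c $ l) = 0) \<longleftrightarrow> (\<forall>A\<in>set As. (\<Sum>l<n. \<eta> l * mulv n A (($) z) l) = 0)"
  proof -
    have "(\<Sum>l<n. \<eta> l * (mat_ac A *\<^sub>v z) $ l) = (\<Sum>l<n. \<eta> l * mulv n A (($) z) l)" if "A \<in> set As" for A
    proof (intro sum.cong HOL.refl)
      fix l assume "l \<in> {..<n}"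
      then have "(mat_ac A *\<^sub>v z) $ l = mulv n A (($) z) l" by (intro mat_ac_mult_vec[OF AC[OF that] z(1)]) simp
      then show "\<eta> l * (mat_ac A *\<^sub>v z) $ l = \<eta> l * mulv n A (($) z) l" by (rule arg_cong)
    qed
    then show ?thesis unfolding M1_cols_def set_map ball_simps(9) by (rule ball_cong[OF HOL.refl arg_cong[where f = "\<lambda>x. x = 0"]])
  qed
  also have "\<dots> \<longleftrightarrow> (\<forall>A\<in>L_perp V e n \<LL>. (\<Sum>l<n. \<eta> l * mulv n A (($) z) l) = 0)"
  proof (rule generates_mats_linear_zero[OF As, symmetric, where h = to_ac])
    show "(\<Sum>l<n. \<eta> l * mulv n (0\<^sub>m n n) (($) z) l) = 0" using mulv_linear(1) by (intro sum.neutral) auto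
    show "(\<Sum>l<n. \<eta> l * mulv n (A + B) (($) z) l) = (\<Sum>l<n. \<eta> l * mulv n A (($) z) l) + (\<Sum>l<n. \<eta> l * mulv n B (($) z) l)"
      if "A \<in> carrier_mat n n" "B \<in> carrier_mat n n" for A B
      using that by (simp add: mulv_linear(2) distrib_left sum.distrib)
    show "(\<Sum>l<n. \<eta> l * mulv n (c \<cdot>\<^sub>m A) (($) z) l) = to_ac c * (\<Sum>l<n. \<eta> l * mulv n A (($) z) l)"
      if "A \<in> carrier_mat n n" for c A
      using that by (simp add: mulv_linear(3) sum_distrib_left mult.left_commute)
  qed
  also have "\<dots> \<longleftrightarrow> (\<forall>B\<in>L_perp V e n \<LL>. (\<Sum>j<n. \<Sum>l<n. to_ac (B $$ (l, j)) * (z $ j * \<eta> l)) = 0)"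
  proof -
    have "(\<Sum>l<n. \<eta> l * mulv n B (($) z) l) = (\<Sum>j<n. \<Sum>l<n. to_ac (B $$ (l, j)) * (z $ j * \<eta> l))" for B
    proof -
      have "(\<Sum>l<n. \<eta> l * mulv n B (($) z) l) = (\<Sum>l<n. \<Sum>j<n. to_ac (B $$ (l, j)) * (z $ j * \<eta> l))"
        by (simp add: mulv_def sum_distrib_left ac_simps)
      also have "\<dots> = (\<Sum>j<n. \<Sum>l<n. to_ac (B $$ (l, j)) * (z $ j * \<eta> l))" by (rule sum.swap)
      finally show ?thesis .
    qed
    then show ?thesis by (simp only:)
  qed
  finally have M1: "(\<forall>c\<in>set (M1_cols As z). (\<Sum>l<n. \<eta> l * c $ l) = 0) \<longleftrightarrow>
    (\<forall>B\<in>L_perp V e n \<LL>. (\<Sum>j<n. \<Sum>l<n. to_ac (B $$ (l, j)) * (z $ j * \<eta> l)) = 0)" .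
  define f where "f = (\<lambda>X Y. \<Sum>l<n. \<eta> l * mulv n X (mulv n Y (($) z)) l)"
  have col: "(mat_ac X *\<^sub>v (mat_ac Y *\<^sub>v z)) $ l = mulv n X (mulv n Y (($) z)) l"
    if "X \<in> carrier_mat n n" "Y \<in> carrier_mat n n" "l < n" for X Y :: "'k mat" and l
  proof -
    have "mat_ac Y *\<^sub>v z \<in> carrier_vec n" using that by (intro mult_mat_vec_carrier[OF _ z(1)]) auto
    then have "(mat_ac X *\<^sub>v (mat_ac Y *\<^sub>v z)) $ l = mulv n X (($) (mat_ac Y *\<^sub>v z)) l"
      using that by (intro mat_ac_mult_vec)
    also have "mulv n X (($) (mat_ac Y *\<^sub>v z)) = mulv n X (mulv n Y (($) z))"
      using mat_ac_mult_vec[OF that(2) z(1)] by (intro mulv_cong)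
    finally show ?thesis .
  qed
  have "(\<forall>c\<in>set (M2_cols Xs Ys z). (\<Sum>l<n. \<eta> l * c $ l) = 0) \<longleftrightarrow> (\<forall>Y\<in>set Ys. \<forall>X\<in>set Xs. f X Y = 0)"
  proof -
    have "(\<Sum>l<n. \<eta> l * (mat_ac X *\<^sub>v (mat_ac Y *\<^sub>v z)) $ l) = f X Y" if "X \<in> set Xs" "Y \<in> set Ys" for X Y
      unfolding f_def
    proof (intro sum.cong HOL.refl)
      fix l assume "l \<in> {..<n}"
      then have "(mat_ac X *\<^sub>v (mat_ac Y *\<^sub>v z)) $ l = mulv n X (mulv n Y (($) z)) l"
        by (intro col XC YC that) simp
      then show "\<eta> l * (mat_ac X *\<^sub>v (mat_ac Y *\<^sub>v z)) $ l = \<eta> l * mulv n X (mulv n Y (($) z)) l" by (rule arg_cong)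
    qed
    moreover have "set (M2_cols Xs Ys z) = (\<Union>Y\<in>set Ys. (\<lambda>X. mat_ac X *\<^sub>v (mat_ac Y *\<^sub>v z)) ` set Xs)"
      by (auto simp: M2_cols_def)
    ultimately show ?thesis by (simp only: ball_UN ball_simps(9) cong: ball_cong)
  qed
  also have "\<dots> \<longleftrightarrow> (\<forall>Y\<in>set Ys. \<forall>X\<in>antisym_mats n. f X Y = 0)"
  proof (rule ball_cong[OF HOL.refl])
    fix Y
    show "(\<forall>X\<in>set Xs. f X Y = 0) \<longleftrightarrow> (\<forall>X\<in>antisym_mats n. f X Y = 0)"
    proof (rule generates_mats_linear_zero[OF Xs, symmetric, where h = to_ac])
      show "f (0\<^sub>m n n) Y = 0" unfolding f_def using mulv_linear(1) by (intro sum.neutral) auto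
      show "f (A + B) Y = f A Y + f B Y" if "A \<in> carrier_mat n n" "B \<in> carrier_mat n n" for A B
        unfolding f_def using that by (simp add: mulv_linear(2) distrib_left sum.distrib)
      show "f (c \<cdot>\<^sub>m A) Y = to_ac c * f A Y" if "A \<in> carrier_mat n n" for c A
        unfolding f_def using that by (simp add: mulv_linear(3) sum_distrib_left mult.left_commute)
    qed
  qed
  also have "\<dots> \<longleftrightarrow> (\<forall>X\<in>antisym_mats n. \<forall>Y\<in>set Ys. f X Y = 0)" by blast
  also have "\<dots> \<longleftrightarrow> (\<forall>X\<in>antisym_mats n. \<forall>Y\<in>K2_perp V e n \<K>. f X Y = 0)"
  proof (rule ball_cong[OF HOL.refl])
    fix X
    have c: "f X Y = (\<Sum>l<n. \<eta> l * mulv n X y l)" if "\<And>j. j < n \<Longrightarrow> mulv n Y (($) z) j = y j" for Y y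
      unfolding f_def using mulv_cong[of n "mulv n Y (($) z)" y X] that by simp
    show "(\<forall>Y\<in>set Ys. f X Y = 0) \<longleftrightarrow> (\<forall>Y\<in>K2_perp V e n \<K>. f X Y = 0)"
    proof (rule generates_mats_linear_zero[OF Ys, symmetric, where h = to_ac])
      have "mulv n (0\<^sub>m n n) (($) z) j = 0" if "j < n" for j using mulv_linear(1)[of n "($) z" j] that by blast
      then have "f X (0\<^sub>m n n) = (\<Sum>l<n. \<eta> l * mulv n X (\<lambda>j. 0) l)" by (rule c)
      then show "f X (0\<^sub>m n n) = 0" by (simp add: mulv_zero_right)
      show "f X (A + B) = f X A + f X B" if AB: "A \<in> carrier_mat n n" "B \<in> carrier_mat n n" for A B
      proof -
        have "f X (A + B) = (\<Sum>l<n. \<eta> l * mulv n X (\<lambda>j. mulv n A (($) z) j + mulv n B (($) z) j) l)"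
          by (rule c) (rule mulv_linear(2)[OF AB])
        then show ?thesis unfolding f_def mulv_add_right by (simp add: distrib_left sum.distrib)
      qed
      show "f X (b \<cdot>\<^sub>m A) = to_ac b * f X A" if A: "A \<in> carrier_mat n n" for b A
      proof -
        have "f X (b \<cdot>\<^sub>m A) = (\<Sum>l<n. \<eta> l * mulv n X (\<lambda>j. to_ac b * mulv n A (($) z) j) l)"
          by (rule c) (rule mulv_linear(3)[OF A])
        then show ?thesis unfolding f_def mulv_scale_right by (simp add: sum_distrib_left mult.left_commute)
      qed
    qed
  qed
  also have "\<dots> \<longleftrightarrow> (\<forall>Y\<in>K2_perp V e n \<K>. \<forall>X\<in>antisym_mats n. f X Y = 0)" by blast
  also have "\<dots> \<longleftrightarrow> (\<forall>Y\<in>K2_perp V e n \<K>. \<forall>p<n. \<forall>q<n. mulv n Y (($) z) p * \<eta> q = mulv n Y (($) z) q * \<eta> p)"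
    unfolding f_def antisym_annihilator_iff ..
  also have "\<dots> \<longleftrightarrow> (\<forall>Y\<in>K2_perp V e n \<K>. \<forall>p<n. \<forall>q<n. (\<Sum>j<n. to_ac (Y $$ (p, j)) * (z $ j * \<eta> q)) = (\<Sum>j<n. to_ac (Y $$ (q, j)) * (z $ j * \<eta> p)))"
    by (simp add: mulv_def sum_distrib_right mult.assoc)
  finally have M2: "(\<forall>c\<in>set (M2_cols Xs Ys z). (\<Sum>l<n. \<eta> l * c $ l) = 0) \<longleftrightarrow>
    (\<forall>Y\<in>K2_perp V e n \<K>. \<forall>p<n. \<forall>q<n. (\<Sum>j<n. to_ac (Y $$ (p, j)) * (z $ j * \<eta> q)) = (\<Sum>j<n. to_ac (Y $$ (q, j)) * (z $ j * \<eta> p)))" .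
  have W: "\<forall>a<n. \<forall>b<n. m \<le> a \<longrightarrow> z $ a * \<eta> b = 0" using z(2) by simp
  show ?thesis
    unfolding der_eqs_iff[of to_ac, OF to_ac_0 to_ac_1 to_ac_diff] set_append ball_Un M1 M2 using W by blast
qed

text \<open>Forms over the ground field embed into forms over the closure, coefficient by
  coefficient.\<close>

lemma finite_type_descent:
  fixes R :: "(nat \<Rightarrow> nat \<Rightarrow> 'k::field) set"
  assumes "sym_tensors ((\<lambda>r j l. to_ac (r j l)) ` R) n 0 k = {0}"
  shows "sym_tensors R n 0 k = {0}"
proof -
  have "X = 0" if X: "X \<in> sym_tensors R n 0 k" for X
  proof -
    define Y where "Y = (\<lambda>js j. to_ac (X js j))"
    have "Y \<in> sym_tensors ((\<lambda>r j l. to_ac (r j l)) ` R) n 0 k"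
      unfolding sym_tensors_def
    proof (intro CollectI conjI allI impI)
      fix js j assume "Y js j \<noteq> 0"
      then have "X js j \<noteq> 0" by (auto simp: Y_def)
      then show "length js = k" "set js \<subseteq> {0..<n}" "j < n" using sym_tensorsD(1)[OF X] by blast+
    next
      fix js js' :: "nat list" assume "mset js = mset js'"
      then have e: "X js = X js'" by (rule sym_tensorsD(2)[OF X])
      show "Y js = Y js'" unfolding Y_def e ..
    next
      fix js
      show "slice_eqs ((\<lambda>r j l. to_ac (r j l)) ` R) n (\<lambda>j l. Y (l # js) j)"
        unfolding slice_eqs_def
      proof (intro ballI, elim imageE)
        fix s r assume r: "r \<in> R" and s: "s = (\<lambda>j l. to_ac (r j l))"
        have "(\<Sum>j<n. \<Sum>l<n. s j l * Y (l # js) j) = to_ac (\<Sum>j<n. \<Sum>l<n. r j l * X (l # js) j)"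
          by (simp add: s Y_def to_ac_sum to_ac_mult)
        also have "\<dots> = 0" using sym_tensorsD(3)[OF X, of js] r by (simp add: slice_eqs_def)
        finally show "(\<Sum>j<n. \<Sum>l<n. s j l * Y (l # js) j) = 0" .
      qed
    qed
    then have "Y = 0" using assms by blast
    then have "Y js j = 0" for js j by simp
    then have "X js j = 0" for js j by (simp add: Y_def)
    then show "X = 0" by (auto simp: fun_eq_iff)
  qed
  moreover have "0 \<in> sym_tensors R n 0 k" by (rule ts.subspace_0[OF subspace_sym_tensors])
  ultimately show ?thesis by blast
qed

lemma slice_eqs_cong: "(\<And>j l. j < n \<Longrightarrow> l < n \<Longrightarrow> A j l = B j l) \<Longrightarrow> slice_eqs R n A = slice_eqs R n B"
  unfolding slice_eqs_def by (intro ball_cong HOL.refl arg_cong[where f = "\<lambda>x. x = 0"] sum.cong) auto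

theorem theorem6p1:
  fixes V :: "('k::field_char_0, 'v) module"
    and \<LL> :: "('v \<Rightarrow> 'v) set"
    and \<K> :: "('k, 'v) lie_term set set"
    and e :: "nat \<Rightarrow> 'v" and n m \<mu> :: nat
    and As Xs Ys :: "'k mat list"
    and G :: "('k, 'g) lie" and gr :: "int \<Rightarrow> 'g set" and \<iota> :: "('k, 'v) fundamental \<Rightarrow> 'g"
  assumes "vectorspace class_ring V"
    and "vectorspace.fin_dim class_ring V"
    and "vectorspace.dim class_ring V = n" and "n \<ge> 2"
    and "lie_subalgebra \<LL> (gl V)"
    and "graded_lie_ideal \<K> (free_lie V) (free_lie_gr V)"
    and "\<mu> \<ge> 1" and "free_lie_from V (\<mu> + 1) \<subseteq> \<K>" and "\<K> \<subseteq> free_lie_from V 2"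
    and "inj_on e {..<n}" and "vectorspace.basis class_ring V (e ` {..<n})"
    and "m \<le> n"
    and "vectorspace.basis class_ring (V\<lparr>carrier := W_space V \<K>\<rparr>) (e ` {..<m})"
    and "generates_mats n As (L_perp V e n \<LL>)"
    and "generates_mats n Xs (antisym_mats n)"
    and "generates_mats n Ys (K2_perp V e n \<K>)"
    and "maximal_effective_prolongation V \<LL> \<K> G gr \<iota>"
  shows "vectorspace.fin_dim class_ring G \<longleftrightarrow>
    (\<forall>z \<in> {z \<in> carrier_vec n. z \<noteq> 0\<^sub>v n \<and> (\<forall>i<n. m \<le> i \<longrightarrow> z $ i = 0)}.
       vec_space.rank n (mat_of_cols n (M1_cols As z @ M2_cols Xs Ys z)) = n)"
proof -
  let ?R = "der_eqs V e n \<LL> \<K> m"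
  let ?RF = "(\<lambda>r j l. to_ac (r j l)) ` ?R"
  note max = assms(17)
  have lie: "tanaka_lie V e n \<LL> \<K> m \<mu>"
    by (intro tanaka_lie.intro tanaka.intro based_space.intro tanaka_axioms.intro tanaka_lie_axioms.intro assms)
  interpret tanaka_lie V e n \<LL> \<K> m \<mu> by (rule lie)
  have "effective_prolongation V \<LL> \<K> G gr \<iota>" using max by (simp add: maximal_effective_prolongation_def)
  then have prolongation: "tanaka_prolongation V e n \<LL> \<K> m \<mu> G gr \<iota>"
    by (intro tanaka_prolongation.intro tanaka_prolongation_axioms.intro tanaka_axioms LL)
  \<comment> \<open>Full row rank fails exactly when some nonzero covector kills all columns, that
    is when z eta^T solves the equations over the closure for some nonzero eta.\<close>
  have full: "vec_space.rank n (mat_of_cols n (M1_cols As z @ M2_cols Xs Ys z)) = n \<longleftrightarrow>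
      (\<forall>\<eta>. slice_eqs ?RF n (\<lambda>j l. z $ j * \<eta> l) \<longrightarrow> (\<forall>l<n. \<eta> l = 0))"
    if z: "z \<in> carrier_vec n" "\<And>i. i < n \<Longrightarrow> m \<le> i \<Longrightarrow> z $ i = 0" for z
  proof -
    let ?cs = "M1_cols As z @ M2_cols Xs Ys z"
    have "set As \<subseteq> carrier_mat n n" "set Xs \<subseteq> carrier_mat n n"
      using assms(14,15) by (auto simp: generates_mats_def)
    then have cs: "set ?cs \<subseteq> carrier_vec n"
      by (auto simp: M1_cols_def M2_cols_def intro!: carrier_vecI)
    have "mat_of_cols n ?cs \<in> carrier_mat n (length ?cs)" by (rule mat_of_cols_carrier(1))
    from rank_full_iff_span[OF this]
    have span: "vec_space.rank n (mat_of_cols n ?cs) = n \<longleftrightarrow>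
        (\<forall>\<eta>. (\<forall>c\<in>set ?cs. (\<Sum>l<n. \<eta> l * c $ l) = 0) \<longrightarrow> (\<forall>l<n. \<eta> l = 0))"
      unfolding cols_mat_of_cols[OF cs] span_full_iff_annihilator[OF cs] .
    have link: "(\<forall>c\<in>set ?cs. (\<Sum>l<n. \<eta> l * c $ l) = 0) \<longleftrightarrow> slice_eqs ?RF n (\<lambda>j l. z $ j * \<eta> l)" for \<eta>
      by (rule columns_annihilated_iff[OF assms(14-16) z])
    show ?thesis
      unfolding span
    proof (intro iffI allI impI)
      fix \<eta> l
      assume a: "\<forall>\<eta>. (\<forall>c\<in>set ?cs. (\<Sum>l<n. \<eta> l * c $ l) = 0) \<longrightarrow> (\<forall>l<n. \<eta> l = 0)"
        "slice_eqs ?RF n (\<lambda>j l. z $ j * \<eta> l)" "l < n"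
      from spec[OF a(1), of \<eta>] iffD2[OF link a(2)] a(3) show "\<eta> l = 0" by blast
    next
      fix \<eta> l
      assume a: "\<forall>\<eta>. slice_eqs ?RF n (\<lambda>j l. z $ j * \<eta> l) \<longrightarrow> (\<forall>l<n. \<eta> l = 0)"
        "\<forall>c\<in>set ?cs. (\<Sum>l<n. \<eta> l * c $ l) = 0" "l < n"
      from spec[OF a(1), of \<eta>] iffD1[OF link a(2)] a(3) show "\<eta> l = 0" by blast
    qed
  qed
  show ?thesis
  proof (intro iffI ballI)
    fix z :: "'k alg_closure vec" assume fin: "vectorspace.fin_dim class_ring G"
      and "z \<in> {z \<in> carrier_vec n. z \<noteq> 0\<^sub>v n \<and> (\<forall>i<n. m \<le> i \<longrightarrow> z $ i = 0)}"
    then have z: "z \<in> carrier_vec n" "z \<noteq> 0\<^sub>v n" "\<And>i. i < n \<Longrightarrow> m \<le> i \<Longrightarrow> z $ i = 0" by auto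
    obtain j0 where j0: "j0 < n" "z $ j0 \<noteq> 0"
    proof (rule ccontr)
      assume "\<not> thesis"
      then have "z $ j = 0" if "j < n" for j using that \<open>\<And>j0. j0 < n \<Longrightarrow> z $ j0 \<noteq> 0 \<Longrightarrow> thesis\<close> by blast
      then have "z = 0\<^sub>v n" using z(1) by (intro eq_vecI) auto
      then show False using z(2) by simp
    qed
    have eq: "vec_space.rank n (mat_of_cols n (M1_cols As z @ M2_cols Xs Ys z)) = n \<longleftrightarrow>
        (\<forall>\<eta>. slice_eqs ?RF n (\<lambda>j l. z $ j * \<eta> l) \<longrightarrow> (\<forall>l<n. \<eta> l = 0))"
      by (rule full[OF z(1)]) (rule z(3))
    show "vec_space.rank n (mat_of_cols n (M1_cols As z @ M2_cols Xs Ys z)) = n"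
      unfolding eq
    proof (intro allI impI, rule ccontr)
      fix \<eta> l assume sl: "slice_eqs ?RF n (\<lambda>j l. z $ j * \<eta> l)" and l: "l < n" "\<eta> l \<noteq> 0"
      have "\<not> vectorspace.fin_dim class_ring G"
        by (rule rank_one_imp_infinite_dim[where z = "\<lambda>j. z $ j" and \<eta> = \<eta>, OF max j0 l sl])
      then show False using fin by (rule notE)
    qed
  next
    assume rank: "\<forall>z\<in>{z \<in> carrier_vec n. z \<noteq> 0\<^sub>v n \<and> (\<forall>i<n. m \<le> i \<longrightarrow> z $ i = 0)}.
      vec_space.rank n (mat_of_cols n (M1_cols As z @ M2_cols Xs Ys z)) = n"
    have "\<exists>k0. \<forall>k\<ge>k0. sym_tensors ?RF n 0 k = {0}"
    proof (rule no_rank_one_imp_finite_type, rule notI)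
      fix z \<eta> :: "nat \<Rightarrow> 'k alg_closure"
      assume "\<exists>j<n. z j \<noteq> 0" "\<exists>l<n. \<eta> l \<noteq> 0" and sl: "slice_eqs ?RF n (\<lambda>j l. z j * \<eta> l)"
      then obtain j0 l0 where jl: "j0 < n" "z j0 \<noteq> 0" "l0 < n" "\<eta> l0 \<noteq> 0" by blast
      define v where "v = Matrix.vec n z"
      \<comment> \<open>The third family of equations forces \<open>z\<close> into W because
        \<open>\<eta>\<close> is nonzero, so the rank hypothesis covers this
        \<open>z\<close>.\<close>
      have "z a * \<eta> b = 0" if "a < n" "b < n" "m \<le> a" for a b
        using sl that unfolding der_eqs_iff[of to_ac, OF to_ac_0 to_ac_1 to_ac_diff] by blast
      from this[OF _ jl(3)] have W: "v $ a = 0" if "a < n" "m \<le> a" for a using that jl(4) by (simp add: v_def)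
      have v: "v \<in> carrier_vec n" by (simp add: v_def)
      have "v $ j0 \<noteq> 0\<^sub>v n $ j0" using jl by (simp add: v_def)
      then have "v \<noteq> 0\<^sub>v n" by blast
      then have "vec_space.rank n (mat_of_cols n (M1_cols As v @ M2_cols Xs Ys v)) = n" using rank v W by blast
      moreover have "slice_eqs ?RF n (\<lambda>j l. v $ j * \<eta> l)"
        using sl slice_eqs_cong[of n "\<lambda>j l. v $ j * \<eta> l" "\<lambda>j l. z j * \<eta> l" ?RF] by (simp add: v_def)
      moreover have "vec_space.rank n (mat_of_cols n (M1_cols As v @ M2_cols Xs Ys v)) = n \<longleftrightarrow>
          (\<forall>\<eta>. slice_eqs ?RF n (\<lambda>j l. v $ j * \<eta> l) \<longrightarrow> (\<forall>l<n. \<eta> l = 0))"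
        by (rule full[OF v]) (rule W)
      ultimately have "\<eta> l0 = 0" using jl(3) by blast
      then show False using jl(4) by simp
    qed
    then have "\<exists>k0. \<forall>k\<ge>k0. sym_tensors ?R n 0 k = {0}" using finite_type_descent by blast
    then show "vectorspace.fin_dim class_ring G" by (rule tanaka_prolongation.finite_type_imp_fin_dim[OF prolongation])
  qed
qed

end
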